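(* Let $(M,d,\mu)$ be a complete doubling metric measure space which has the cone covering property, and let $X$ be a complex Banach space of type $r\in(1,2]$. Then for $0<\theta<1$, $$[T^1(X),T^r(X)]_\theta = T^p(X), \qquad \text{where}\quad \frac1p = 1-\theta\Big(1-\frac1r\Big),$$ with equivalent norms, where $[\cdot,\cdot]_\theta$ denotes the complex interpolation method.
   Context: Doubling: there is $n>0$ such that $\mu(\alpha B)\lesssim \alpha^n\mu(B)$ for all balls $B\subset M$ and all $\alpha\ge 1$ ($\alpha B$ is the concentric dilate). Write $V(y,t)=\mu(B(y,t))$. Upper half-space and cones: $M^+=M\times(0,\infty)$ carries the measure $d\nu(y,t)=\frac{d\mu(y)\,dt}{tV(y,t)}$, and $L^2(M^+)=L^2(M^+,\nu)$. $L^2_c(M^+)$ is the space of compactly supported functions in $L^2(M^+)$. $\Gamma(x)=\{(y,t)\in M^+: d(x,y)<t\}$. Radonifying norm: a densely defined linear operator $u$ from $L^2(M^+)$ to $X$ has norm $\|u\|_{\gamma(L^2(M^+),X)}=\sup\big(\mathbb E\|\sum_k\gamma_k u h_k\|^2\big)^{1/2}$, the supremum being over finite orthonormal systems $\{h_k\}$ in the domain of $u$, with $\gamma_k$ independent standard Gaussian variables; $\gamma(L^2(M^+),X)$ is the (complete) space of operators that can be approximated by finite rank operators in this norm. The symbol $1_K$ also denotes the projection $h\mapsto 1_Kh$. Tent spaces: for $1\le p<\infty$, $T^p(X)$ consists of the linear operators $u:L^2_c(M^+)\to X$ for which $x\mapsto u1_{\Gamma(x)}$ is strongly measurable from $M$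 to $\gamma(L^2(M^+),X)$ and $\|u\|_{T^p(X)}=\|\mathscr A u\|_{L^p(M)}<\infty$, where $\mathscr A u(x)=\|u1_{\Gamma(x)}\|_{\gamma(L^2(M^+),X)}$. The spaces $T^p(X)$, $1\le p<\infty$, are Banach spaces that embed continuously (via $u\mapsto (x\mapsto u1_{\Gamma(x)})$) into $L^1_{loc}(M;\gamma(L^2(M^+),X))$, which serves as ambient space for interpolation. Type: $X$ has type $r\in[1,2]$ if $\big(\mathbb E\|\sum_k\varepsilon_k\xi_k\|^2\big)^{1/2}\lesssim\big(\sum_k\|\xi_k\|^r\big)^{1/r}$ for all finite collections $\{\xi_k\}\subset X$, with $\varepsilon_k$ independent Rademacher variables. Cone covering property: for an open set $E\subset M$ and $\sigma\in(0,1)$ let $E^\sigma=\{x\in M:\sup_{B\ni x}\mu(B\cap E)/\mu(B)>\sigma\}$ (supremum over balls), and let $T(E)=\{(y,t)\in M^+: B(y,t)\subset E\}=M^+\setminus\bigcup_{x\notin E}\Gamma(x)$. $M$ has the cone covering property if there is $\sigma\in(0,1)$ such that every bounded open set $E\subset M$ satisfies: for every $x\in E$ there are $x_1,\dots,x_N\in M\setminus E$, with $N$ depending only on $M$, such that $\Gamma(x)\setminus T(E^\sigma)\subset\bigcup_{m=1}^N\Gamma(x_m)$. *)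

theory Defs
  imports "HOL-Probability.Probability" "HOL-Library.Function_Algebras"
begin

section \<open>Complex Banach spaces\<close>

class complex_vector = ab_group_add +
  fixes scaleC :: "complex \<Rightarrow> 'a \<Rightarrow> 'a"  (infixr \<open>*\<^sub>C\<close> 75)
  assumes scaleC_add_right: "a *\<^sub>C (x + y) = a *\<^sub>C x + a *\<^sub>C y"
    and scaleC_add_left: "(a + b) *\<^sub>C x = a *\<^sub>C x + b *\<^sub>C x"
    and scaleC_scaleC: "a *\<^sub>C b *\<^sub>C x = (a * b) *\<^sub>C x"
    and scaleC_one: "1 *\<^sub>C x = x"

class complex_banach = banach + complex_vector +
  assumes scaleC_of_real: "of_real a *\<^sub>C x = a *\<^sub>R x"
    and norm_scaleC: "norm (c *\<^sub>C x) = cmod c * norm x"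

instantiation complex :: complex_banach
begin
definition scaleC_complex :: "complex \<Rightarrow> complex \<Rightarrow> complex" where
  "scaleC_complex a x = a * x"
instance
  by standard (auto simp: scaleC_complex_def algebra_simps norm_mult scaleR_conv_of_real)
end

instantiation "fun" :: (type, complex_vector) complex_vector
begin
definition scaleC_fun :: "complex \<Rightarrow> ('a \<Rightarrow> 'b) \<Rightarrow> 'a \<Rightarrow> 'b" where
  "scaleC_fun a f = (\<lambda>x. a *\<^sub>C f x)"
instance
  by standard (auto simp: scaleC_fun_def fun_eq_iff scaleC_add_right scaleC_add_left
      scaleC_scaleC scaleC_one)
end


section \<open>The complex interpolation method\<close>

text \<open>A normed space that lives inside an ambient complex vector space; the value of
  \<open>norm_on\<close> is meaningful only on \<open>points\<close>.\<close>

record 'v normed_subspace =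
  points :: "'v set"
  norm_on :: "'v \<Rightarrow> real"

definition sum_space ::
    "'v::complex_vector normed_subspace \<Rightarrow> 'v normed_subspace \<Rightarrow> 'v normed_subspace" where
  "sum_space A B = \<lparr>
     points = {a + b | a b. a \<in> points A \<and> b \<in> points B},
     norm_on = (\<lambda>v. Inf {norm_on A a + norm_on B b | a b.
                          a \<in> points A \<and> b \<in> points B \<and> v = a + b}) \<rparr>"

definition continuous_in ::
    "'v::complex_vector normed_subspace \<Rightarrow> 't::topological_space set \<Rightarrow> ('t \<Rightarrow> 'v) \<Rightarrow> bool" where
  "continuous_in A S f \<longleftrightarrow> f ` S \<subseteq> points A \<and>
     (\<forall>z\<in>S. ((\<lambda>w. norm_on A (f w - f z)) \<longlongrightarrow> 0) (at z within S))"

definition holomorphic_in ::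
    "'v::complex_vector normed_subspace \<Rightarrow> complex set \<Rightarrow> (complex \<Rightarrow> 'v) \<Rightarrow> bool" where
  "holomorphic_in A S f \<longleftrightarrow> f ` S \<subseteq> points A \<and>
     (\<forall>z\<in>S. \<exists>d\<in>points A.
        ((\<lambda>w. norm_on A (inverse (w - z) *\<^sub>C (f w - f z) - d)) \<longlongrightarrow> 0) (at z within S))"

text \<open>The Calderon space of the couple \<open>(A\<^sub>0, A\<^sub>1)\<close>. The values of the functions on the boundary
  lines tend to zero at infinity, as in Calderon and in Bergh--Loefstroem.\<close>

definition calderon_functions ::
    "'v::complex_vector normed_subspace \<Rightarrow> 'v normed_subspace \<Rightarrow> (complex \<Rightarrow> 'v) set" where
  "calderon_functions A\<^sub>0 A\<^sub>1 = {f.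
     continuous_in (sum_space A\<^sub>0 A\<^sub>1) {z. 0 \<le> Re z \<and> Re z \<le> 1} f \<and>
     (\<exists>C. \<forall>z. 0 \<le> Re z \<and> Re z \<le> 1 \<longrightarrow> norm_on (sum_space A\<^sub>0 A\<^sub>1) (f z) \<le> C) \<and>
     holomorphic_in (sum_space A\<^sub>0 A\<^sub>1) {z. 0 < Re z \<and> Re z < 1} f \<and>
     continuous_in A\<^sub>0 (UNIV :: real set) (\<lambda>t. f (Complex 0 t)) \<and>
     continuous_in A\<^sub>1 (UNIV :: real set) (\<lambda>t. f (Complex 1 t)) \<and>
     ((\<lambda>t. norm_on A\<^sub>0 (f (Complex 0 t))) \<longlongrightarrow> 0) at_infinity \<and>
     ((\<lambda>t. norm_on A\<^sub>1 (f (Complex 1 t))) \<longlongrightarrow> 0) at_infinity}"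

definition calderon_norm ::
    "'v normed_subspace \<Rightarrow> 'v normed_subspace \<Rightarrow> (complex \<Rightarrow> 'v) \<Rightarrow> real" where
  "calderon_norm A\<^sub>0 A\<^sub>1 f =
     max (SUP t. norm_on A\<^sub>0 (f (Complex 0 t))) (SUP t. norm_on A\<^sub>1 (f (Complex 1 t)))"

definition complex_interpolation ::
    "'v::complex_vector normed_subspace \<Rightarrow> 'v normed_subspace \<Rightarrow> real \<Rightarrow> 'v normed_subspace" where
  "complex_interpolation A\<^sub>0 A\<^sub>1 \<theta> = \<lparr>
     points = {f (of_real \<theta>) | f. f \<in> calderon_functions A\<^sub>0 A\<^sub>1},
     norm_on = (\<lambda>v. Inf {calderon_norm A\<^sub>0 A\<^sub>1 f | f.
                          f \<in> calderon_functions A\<^sub>0 A\<^sub>1 \<and> f (of_real \<theta>) = v}) \<rparr>"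

definition equal_with_equivalent_norms ::
    "'v normed_subspace \<Rightarrow> 'v normed_subspace \<Rightarrow> bool" where
  "equal_with_equivalent_norms A B \<longleftrightarrow> points A = points B \<and>
     (\<exists>c>0. \<exists>C>0. \<forall>v\<in>points A. c * norm_on B v \<le> norm_on A v \<and> norm_on A v \<le> C * norm_on B v)"


section \<open>Type and radonifying operators\<close>

text \<open>\<open>P\<close> is the joint law of the random coefficients \<open>\<omega> 0, \<dots>, \<omega> (n - 1)\<close>.\<close>

definition rms_random_sum ::
    "(nat \<Rightarrow> real) measure \<Rightarrow> nat \<Rightarrow> (nat \<Rightarrow> 'x::real_normed_vector) \<Rightarrow> real" where
  "rms_random_sum P n \<xi> = sqrt (\<integral>\<omega>. (norm (\<Sum>k<n. \<omega> k *\<^sub>R \<xi> k))\<^sup>2 \<partial>P)"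

definition gaussian_law :: "nat \<Rightarrow> (nat \<Rightarrow> real) measure" where
  "gaussian_law n = (\<Pi>\<^sub>M k\<in>{..<n}. std_normal_distribution)"

definition rademacher_law :: "nat \<Rightarrow> (nat \<Rightarrow> real) measure" where
  "rademacher_law n = measure_pmf (Pi_pmf {..<n} 0 (\<lambda>_. pmf_of_set {-1, 1}))"

definition has_type :: "'x::real_normed_vector itself \<Rightarrow> real \<Rightarrow> bool" where
  "has_type _ r \<longleftrightarrow> (\<exists>C. \<forall>n. \<forall>\<xi> :: nat \<Rightarrow> 'x.
     rms_random_sum (rademacher_law n) n \<xi> \<le> C * (\<Sum>k<n. norm (\<xi> k) powr r) powr (1 / r))"

text \<open>Elements of \<open>L\<^sup>2(N)\<close> are represented by functions, and operators on a subspace \<open>D\<close> of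
  \<open>L\<^sup>2(N)\<close> by maps on functions that do not distinguish functions equal almost everywhere.
  Below, \<open>D\<close> is always the domain of the operators; their values outside \<open>D\<close> are irrelevant.\<close>

definition L2_functions :: "'a measure \<Rightarrow> ('a \<Rightarrow> complex) set" where
  "L2_functions N = {h \<in> borel_measurable N. integrable N (\<lambda>p. (cmod (h p))\<^sup>2)}"

definition L2_inner :: "'a measure \<Rightarrow> ('a \<Rightarrow> complex) \<Rightarrow> ('a \<Rightarrow> complex) \<Rightarrow> complex" where
  "L2_inner N g h = (\<integral>p. g p * cnj (h p) \<partial>N)"

definition L2_operator ::
    "'a measure \<Rightarrow> ('a \<Rightarrow> complex) set \<Rightarrow> (('a \<Rightarrow> complex) \<Rightarrow> 'x::complex_banach) \<Rightarrow> bool" where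
  "L2_operator N D u \<longleftrightarrow>
     (\<forall>g\<in>D. \<forall>h\<in>D. u (g + h) = u g + u h) \<and>
     (\<forall>c. \<forall>h\<in>D. u (\<lambda>p. c * h p) = c *\<^sub>C u h) \<and>
     (\<forall>g\<in>D. \<forall>h\<in>D. (AE p in N. g p = h p) \<longrightarrow> u g = u h)"

definition orthonormal_system ::
    "'a measure \<Rightarrow> ('a \<Rightarrow> complex) set \<Rightarrow> nat \<Rightarrow> (nat \<Rightarrow> 'a \<Rightarrow> complex) \<Rightarrow> bool" where
  "orthonormal_system N D n h \<longleftrightarrow>
     (\<forall>k<n. h k \<in> D) \<and> (\<forall>j<n. \<forall>k<n. L2_inner N (h j) (h k) = (if j = k then 1 else 0))"

definition gamma_norm ::
    "'a measure \<Rightarrow> ('a \<Rightarrow> complex) set \<Rightarrow> (('a \<Rightarrow> complex) \<Rightarrow> 'x::complex_banach) \<Rightarrow> ennreal" where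
  "gamma_norm N D u =
     (SUP (n, h) \<in> {(n, h). orthonormal_system N D n h}.
        ennreal (rms_random_sum (gaussian_law n) n (\<lambda>k. u (h k))))"

definition finite_rank_operator ::
    "'a measure \<Rightarrow> (('a \<Rightarrow> complex) \<Rightarrow> 'x::complex_banach) \<Rightarrow> bool" where
  "finite_rank_operator N v \<longleftrightarrow> (\<exists>(m::nat) g \<xi>. (\<forall>k<m. g k \<in> L2_functions N) \<and>
     v = (\<lambda>h. \<Sum>k<m. L2_inner N h (g k) *\<^sub>C \<xi> k))"

definition gamma_space ::
    "'a measure \<Rightarrow> ('a \<Rightarrow> complex) set \<Rightarrow> (('a \<Rightarrow> complex) \<Rightarrow> 'x::complex_banach) set" where
  "gamma_space N D = {u. L2_operator N D u \<and>
     (\<forall>\<epsilon>>0. \<exists>v. finite_rank_operator N v \<and> gamma_norm N D (u - v) < ennreal \<epsilon>)}"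

text \<open>Strong measurability is understood almost everywhere: \<open>F\<close> is an almost everywhere limit of
  simple functions with values in the space of radonifying operators.\<close>

definition gamma_strongly_measurable ::
    "'m measure \<Rightarrow> 'a measure \<Rightarrow> ('a \<Rightarrow> complex) set \<Rightarrow>
     ('m \<Rightarrow> ('a \<Rightarrow> complex) \<Rightarrow> 'x::complex_banach) \<Rightarrow> bool" where
  "gamma_strongly_measurable \<mu> N D F \<longleftrightarrow>
     (AE x in \<mu>. F x \<in> gamma_space N D) \<and>
     (\<exists>s :: nat \<Rightarrow> 'm \<Rightarrow> ('a \<Rightarrow> complex) \<Rightarrow> 'x.
        (\<forall>n. simple_function \<mu> (s n) \<and> range (s n) \<subseteq> gamma_space N D) \<and>
        (AE x in \<mu>. (\<lambda>n. gamma_norm N D (s n x - F x)) \<longlonglongrightarrow> 0))"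


section \<open>Metric measure spaces and the upper half-space\<close>

definition metric_measure :: "'m::metric_space measure \<Rightarrow> bool" where
  "metric_measure \<mu> \<longleftrightarrow> sets \<mu> = sets borel \<and>
     (\<forall>x. \<forall>t>0. 0 < emeasure \<mu> (ball x t) \<and> emeasure \<mu> (ball x t) < \<infinity>)"

definition doubling :: "'m::metric_space measure \<Rightarrow> bool" where
  "doubling \<mu> \<longleftrightarrow> (\<exists>n::real. n > 0 \<and> (\<exists>C. \<forall>x t \<alpha>. 0 < t \<and> 1 \<le> \<alpha> \<longrightarrow>
     measure \<mu> (ball x (\<alpha> * t)) \<le> C * \<alpha> powr n * measure \<mu> (ball x t)))"

definition upper_half_space :: "('m \<times> real) set" where
  "upper_half_space = UNIV \<times> {0<..}"

definition half_space_measure :: "'m::metric_space measure \<Rightarrow> ('m \<times> real) measure" where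
  "half_space_measure \<mu> =
     density (restrict_space (\<mu> \<Otimes>\<^sub>M lborel) upper_half_space)
       (\<lambda>(y, t). ennreal (1 / (t * measure \<mu> (ball y t))))"

definition cone_at :: "'m::metric_space \<Rightarrow> ('m \<times> real) set" where
  "cone_at x = {(y, t). 0 < t \<and> dist x y < t}"

definition tent :: "'m::metric_space set \<Rightarrow> ('m \<times> real) set" where
  "tent E = {(y, t). 0 < t \<and> ball y t \<subseteq> E}"

definition density_enlargement ::
    "'m::metric_space measure \<Rightarrow> real \<Rightarrow> 'm set \<Rightarrow> 'm set" where
  "density_enlargement \<mu> \<sigma> E = {x.
     (SUP (y, t) \<in> {(y, t). 0 < t \<and> x \<in> ball y t}.
        measure \<mu> (ball y t \<inter> E) / measure \<mu> (ball y t)) > \<sigma>}"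

text \<open>The vertices of the covering cones form a set of at most \<open>N\<close> points rather than an \<open>N\<close>-tuple:
  if \<open>M\<close> is bounded then \<open>E = M\<close> is allowed, there are no points outside \<open>E\<close>, and nothing has to be
  covered since \<open>T(E\<^sup>\<sigma>) = M\<^sup>+\<close>. For \<open>E \<noteq> M\<close> points may be repeated, so there is no difference.\<close>

definition cone_covering_property :: "'m::metric_space measure \<Rightarrow> bool" where
  "cone_covering_property \<mu> \<longleftrightarrow> (\<exists>\<sigma>::real. 0 < \<sigma> \<and> \<sigma> < 1 \<and> (\<exists>N::nat.
     \<forall>E. open E \<and> bounded E \<longrightarrow> (\<forall>x\<in>E. \<exists>F. finite F \<and> card F \<le> N \<and> F \<subseteq> - E \<and>
        cone_at x - tent (density_enlargement \<mu> \<sigma> E) \<subseteq> (\<Union>z\<in>F. cone_at z))))"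


section \<open>Tent spaces\<close>

definition L2c :: "'m::metric_space measure \<Rightarrow> ('m \<times> real \<Rightarrow> complex) set" where
  "L2c \<mu> = {h \<in> L2_functions (half_space_measure \<mu>).
     \<exists>K. compact K \<and> K \<subseteq> upper_half_space \<and>
         (AE p in half_space_measure \<mu>. p \<notin> K \<longrightarrow> h p = 0)}"

definition restrict_operator ::
    "(('a \<Rightarrow> complex) \<Rightarrow> 'x) \<Rightarrow> 'a set \<Rightarrow> (('a \<Rightarrow> complex) \<Rightarrow> 'x)" where
  "restrict_operator u K = (\<lambda>h. u (\<lambda>p. indicator K p * h p))"

lemma sets_cone_at:
  fixes x :: "'m::metric_space"
  assumes "sets \<mu> = sets borel"
  shows "cone_at x \<in> sets (half_space_measure \<mu>)"
proof -
  have sp: "space \<mu> = UNIV"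
    using sets_eq_imp_space_eq[OF assms] by simp
  have m: "(\<lambda>y. dist x y) \<in> borel_measurable \<mu>"
    unfolding measurable_cong_sets[OF assms refl]
    by (intro borel_measurable_continuous_onI continuous_intros)
  have "{p \<in> space (\<mu> \<Otimes>\<^sub>M lborel). dist x (fst p) < snd p} \<in> sets (\<mu> \<Otimes>\<^sub>M lborel)"
    by (intro borel_measurable_less measurable_compose[OF measurable_fst m]) simp
  moreover have "{p \<in> space (\<mu> \<Otimes>\<^sub>M lborel). dist x (fst p) < snd p} = cone_at x"
    by (auto simp: cone_at_def space_pair_measure sp intro: le_less_trans[OF zero_le_dist])
  moreover have "cone_at x \<subseteq> upper_half_space"
    by (auto simp: cone_at_def upper_half_space_def)
  ultimately show ?thesis
    by (auto simp: half_space_measure_def sets_restrict_space image_iff intro!: exI[of _ "cone_at x"])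
qed

lemma indicator_mult_L2c:
  assumes K: "K \<in> sets (half_space_measure \<mu>)" and h: "h \<in> L2c \<mu>"
  shows "(\<lambda>p. indicator K p * h p) \<in> L2c \<mu>"
proof -
  let ?N = "half_space_measure \<mu>"
  have hm: "h \<in> borel_measurable ?N" and hi: "integrable ?N (\<lambda>p. (cmod (h p))\<^sup>2)"
    using h by (auto simp: L2c_def L2_functions_def)
  obtain L where L: "compact L" "L \<subseteq> upper_half_space"
      "AE p in ?N. p \<notin> L \<longrightarrow> h p = 0"
    using h by (auto simp: L2c_def)
  have m: "(\<lambda>p. indicator K p * h p) \<in> borel_measurable ?N"
    using K hm by (intro borel_measurable_times borel_measurable_indicator)
  have "integrable ?N (\<lambda>p. (cmod (indicator K p * h p))\<^sup>2)"
    by (rule Bochner_Integration.integrable_bound[OF hi])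
       (use borel_measurable_power[OF measurable_compose[OF m borel_measurable_norm], of 2]
        in \<open>auto simp: indicator_def\<close>)
  moreover have "AE p in ?N. p \<notin> L \<longrightarrow> indicator K p * h p = 0"
    using L(3) by eventually_elim auto
  ultimately show ?thesis
    using m L by (auto simp: L2c_def L2_functions_def)
qed

lemma L2_operator_cong_AE:
  assumes "L2_operator N D u" and "g \<in> D" and "h \<in> D" and "AE p in N. g p = h p"
  shows "u g = u h"
  using assms unfolding L2_operator_def by blast

lemma restrict_operator_cone_inject:
  fixes u v :: "('m::metric_space \<times> real \<Rightarrow> complex) \<Rightarrow> 'x::complex_banach"
  assumes \<mu>: "metric_measure \<mu>"
    and u: "L2_operator (half_space_measure \<mu>) (L2c \<mu>) u" "\<And>h. h \<notin> L2c \<mu> \<Longrightarrow> u h = 0"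
    and v: "L2_operator (half_space_measure \<mu>) (L2c \<mu>) v" "\<And>h. h \<notin> L2c \<mu> \<Longrightarrow> v h = 0"
    and eq: "AE x in \<mu>. \<forall>h\<in>L2c \<mu>.
               restrict_operator u (cone_at x) h = restrict_operator v (cone_at x) h"
  shows "u = v"
proof
  fix h
  let ?N = "half_space_measure \<mu>"
  have sets\<mu>: "sets \<mu> = sets borel"
    using \<mu> by (simp add: metric_measure_def)
  obtain Z where Z: "Z \<in> sets \<mu>" "emeasure \<mu> Z = 0"
      "\<And>x k. x \<notin> Z \<Longrightarrow> k \<in> L2c \<mu> \<Longrightarrow>
        restrict_operator u (cone_at x) k = restrict_operator v (cone_at x) k"
    using eq sets_eq_imp_space_eq[OF sets\<mu>] by (auto elim!: AE_E)
  have fin: "u (\<lambda>p. indicator (\<Union>x\<in>F. cone_at x) p * k p) =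
      v (\<lambda>p. indicator (\<Union>x\<in>F. cone_at x) p * k p)"
    if "finite F" "F \<inter> Z = {}" "k \<in> L2c \<mu>" for F k
    using that
  proof (induction F arbitrary: k)
    case empty
    have "w (\<lambda>p. 0) = 0" if "L2_operator ?N (L2c \<mu>) w" for w :: "_ \<Rightarrow> 'x"
    proof -
      have z: "(\<lambda>p. 0) \<in> L2c \<mu>"
        using indicator_mult_L2c[OF sets.empty_sets empty(2)] by simp
      have "w ((\<lambda>p. 0) + (\<lambda>p. 0)) = w (\<lambda>p. 0) + w (\<lambda>p. 0)"
        using that z unfolding L2_operator_def by blast
      then show ?thesis by (simp add: plus_fun_def)
    qed
    from this[OF u(1)] this[OF v(1)] show ?case by simp
  next
    case (insert x F)
    let ?C = "cone_at x" and ?U = "\<Union>x\<in>F. cone_at x"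
    let ?k = "\<lambda>p. indicator (space ?N - ?C) p * k p"
    have C: "?C \<in> sets ?N" by (rule sets_cone_at[OF sets\<mu>])
    have U: "?U \<in> sets ?N"
      using insert.hyps(1) by (intro sets.finite_UN) (auto intro: sets_cone_at[OF sets\<mu>])
    have k: "?k \<in> L2c \<mu>"
      by (intro indicator_mult_L2c sets.compl_sets C insert.prems)
    have a: "(\<lambda>p. indicator ?C p * k p) \<in> L2c \<mu>"
      by (intro indicator_mult_L2c C insert.prems)
    have b: "(\<lambda>p. indicator ?U p * ?k p) \<in> L2c \<mu>"
      by (intro indicator_mult_L2c U k)
    have split: "(\<lambda>p. indicator (\<Union>x\<in>insert x F. cone_at x) p * k p) =
        (\<lambda>p. indicator ?C p * k p) + (\<lambda>p. indicator ?U p * ?k p)"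
      using sets.sets_into_space[OF U] by (auto simp: fun_eq_iff indicator_def)
    have "u (\<lambda>p. indicator ?C p * k p) = v (\<lambda>p. indicator ?C p * k p)"
      using Z(3)[of x k] insert.prems by (auto simp: restrict_operator_def)
    moreover have "u (\<lambda>p. indicator ?U p * ?k p) = v (\<lambda>p. indicator ?U p * ?k p)"
      using insert.prems k by (intro insert.IH) auto
    moreover have "w ((\<lambda>p. indicator ?C p * k p) + (\<lambda>p. indicator ?U p * ?k p)) =
        w (\<lambda>p. indicator ?C p * k p) + w (\<lambda>p. indicator ?U p * ?k p)"
      if "L2_operator ?N (L2c \<mu>) w" for w :: "_ \<Rightarrow> 'x"
      using that a b unfolding L2_operator_def by blast
    from this[OF u(1)] this[OF v(1)]
    have "u ((\<lambda>p. indicator ?C p * k p) + (\<lambda>p. indicator ?U p * ?k p)) =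
        u (\<lambda>p. indicator ?C p * k p) + u (\<lambda>p. indicator ?U p * ?k p)"
      "v ((\<lambda>p. indicator ?C p * k p) + (\<lambda>p. indicator ?U p * ?k p)) =
        v (\<lambda>p. indicator ?C p * k p) + v (\<lambda>p. indicator ?U p * ?k p)" .
    ultimately show ?case
      unfolding split by (simp only:)
  qed
  show "u h = v h"
  proof (cases "h \<in> L2c \<mu>")
    case True
    then obtain K where K: "compact K" "K \<subseteq> upper_half_space"
        "AE p in ?N. p \<notin> K \<longrightarrow> h p = 0"
      by (auto simp: L2c_def)
    have op: "open (cone_at x)" for x :: 'm
      unfolding cone_at_def case_prod_unfold
      by (intro open_Collect_conj open_Collect_less continuous_intros)
    have cov: "K \<subseteq> (\<Union>x\<in>-Z. cone_at x)"
    proof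
      fix q assume "q \<in> K"
      then obtain y t where q: "q = (y, t)" "t > 0"
        using K(2) by (auto simp: upper_half_space_def)
      have "\<not> ball y t \<subseteq> Z"
      proof
        assume "ball y t \<subseteq> Z"
        then have "emeasure \<mu> (ball y t) = 0"
          using emeasure_mono[OF _ Z(1), of "ball y t"] Z(2) by simp
        moreover have "0 < emeasure \<mu> (ball y t)"
          using \<mu> q(2) unfolding metric_measure_def by blast
        ultimately show False by simp
      qed
      then obtain x where x: "x \<notin> Z" "dist y x < t"
        unfolding subset_iff mem_ball by blast
      with q have "q \<in> cone_at x"
        by (simp add: cone_at_def dist_commute)
      with x(1) show "q \<in> (\<Union>x\<in>-Z. cone_at x)"
        by blast
    qed
    obtain F where F: "F \<subseteq> -Z" "finite F" "K \<subseteq> (\<Union>x\<in>F. cone_at x)"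
      using compactE_image[OF K(1) op cov] by blast
    let ?h = "\<lambda>p. indicator (\<Union>x\<in>F. cone_at x) p * h p"
    have hL: "?h \<in> L2c \<mu>"
      using F(2) True
      by (intro indicator_mult_L2c sets.finite_UN) (auto intro: sets_cone_at[OF sets\<mu>])
    have ae: "AE p in ?N. h p = ?h p"
      using K(3) by eventually_elim (use F(3) in \<open>auto simp: indicator_def\<close>)
    have ext: "w h = w ?h" if "L2_operator ?N (L2c \<mu>) w" for w :: "_ \<Rightarrow> 'x"
      by (rule L2_operator_cong_AE[OF that True hL ae])
    have "u ?h = v ?h"
      by (rule fin[OF F(2) _ True]) (use F(1) in blast)
    with ext[OF u(1)] ext[OF v(1)] show ?thesis
      by metis
  qed (use u(2) v(2) in simp)
qed

definition square_function ::
    "'m::metric_space measure \<Rightarrow> (('m \<times> real \<Rightarrow> complex) \<Rightarrow> 'x::complex_banach) \<Rightarrow> 'm \<Rightarrow> ennreal" where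
  "square_function \<mu> u x =
     gamma_norm (half_space_measure \<mu>) (L2c \<mu>) (restrict_operator u (cone_at x))"

definition ennreal_powr :: "ennreal \<Rightarrow> real \<Rightarrow> ennreal" where
  "ennreal_powr a s = (if a = \<top> then \<top> else ennreal (enn2real a powr s))"

definition Lp_norm :: "'m measure \<Rightarrow> real \<Rightarrow> ('m \<Rightarrow> ennreal) \<Rightarrow> ennreal" where
  "Lp_norm \<mu> p f = ennreal_powr (\<integral>\<^sup>+x. ennreal_powr (f x) p \<partial>\<mu>) (1 / p)"

text \<open>An operator on \<open>L\<^sup>2\<^sub>c(M\<^sup>+)\<close> is extended by zero to all functions, so that equal operators are
  equal as maps and the pointwise vector space operations are those of operators.

  The ambient space for interpolation is the space of all these operators. It is used only to form
  \<open>T\<^sup>1 + T\<^sup>r\<close>. Passing to \<open>x \<mapsto> u 1\<^bsub>\<Gamma>(x)\<^esub>\<close> modulo almost everywhere equality is linear and, by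
  \<open>restrict_operator_cone_inject\<close>, injective on the whole ambient space, so the sum formed
  here is the one formed in \<open>L\<^sup>1\<^sub>l\<^sub>o\<^sub>c(M; \<gamma>(L\<^sup>2(M\<^sup>+), X))\<close>, with the same norm.\<close>

definition tent_space ::
    "'m::metric_space measure \<Rightarrow> real \<Rightarrow>
     (('m \<times> real \<Rightarrow> complex) \<Rightarrow> 'x::complex_banach) normed_subspace" where
  "tent_space \<mu> p = \<lparr>
     points = {u. L2_operator (half_space_measure \<mu>) (L2c \<mu>) u \<and> (\<forall>h. h \<notin> L2c \<mu> \<longrightarrow> u h = 0) \<and>
       gamma_strongly_measurable \<mu> (half_space_measure \<mu>) (L2c \<mu>)
         (\<lambda>x. restrict_operator u (cone_at x)) \<and>
       Lp_norm \<mu> p (square_function \<mu> u) < \<top>},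
     norm_on = (\<lambda>u. enn2real (Lp_norm \<mu> p (square_function \<mu> u))) \<rparr>"

end

theory Submission
  imports Defs "HOL-Complex_Analysis.Complex_Analysis"
begin

text \<open>For the inclusion \<open>T\<^sup>p \<subseteq> [T\<^sup>1, T\<^sup>r]\<^sub>\<theta>\<close>, the cone covering property cuts \<open>M\<^sup>+\<close> into pieces \<open>A\<^sub>k\<close>,
  differences of tents over the enlarged level sets of the square function of \<open>u\<close>, such that the square
  function of the restriction of \<open>u\<close> to \<open>A\<^sub>k\<close> is at most a constant times \<open>2^k\<close>. Multiplying \<open>u\<close> on \<open>A\<^sub>k\<close> by
  \<open>2^(k (p (1 - z + z / r) - 1))\<close> gives a function of the Calderon space; on the line \<open>Re z = 1\<close> the
  type of \<open>X\<close>, through a contraction principle for Gaussian sums, bounds its square function in \<open>L\<^sup>r\<close>.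
  For the other inclusion, the restrictions of \<open>f \<theta>\<close> to the cones are paired with norming functionals
  of \<open>\<gamma>(L\<^sup>2(M\<^sup>+), X)\<close>, and the maximum principle on the strip is applied as in the scalar case.\<close>

section \<open>Gaussian random sums\<close>

text \<open>The multiplier is constant on pieces because the square function of a piece is then
  merely rescaled, and recombining disjoint pieces costs only the triangle inequality at one
  endpoint and type at the other. Type is about random signs; they come from an orthonormal system
  adapted to the pieces, and passing to it needs a comparison of Gaussian sums, derived here from
  rotation invariance of the plane Gaussian law. The cone covering property speaks of bounded open
  sets. Hence level sets must be open, which is lower semicontinuity of the square function, and
  \<open>u\<close> is cut into shells of an exhaustion whose norms decay like 2^(-j). A function in
  \<open>L2c\<close> meets finitely many shells, so sums over shells are defined function by
  function. In the other direction no integrability of the p-th power is known in advance; finite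
  level sums over sets of finite measure are reals by which one may divide. A functional chosen
  separately at each vertex need not depend measurably on it, so functionals are attached to simple
  functions that approximate the cone restrictions.\<close>

abbreviation gaussian_rms :: "nat => (nat => 'x::real_normed_vector) => real" where
  "gaussian_rms n \<equiv> rms_random_sum (gaussian_law n) n"

lemma floor_approx_tendsto:
  "(%m. of_int \<lfloor>real (Suc m) * t\<rfloor> / real (Suc m)) \<longlonglongrightarrow> t"
proof (rule real_tendsto_sandwich)
  have "(%m. inverse (real (Suc m))) \<longlonglongrightarrow> 0" by (rule LIMSEQ_inverse_real_of_nat)
  from tendsto_diff[OF tendsto_const[of t] this]
  show "(%m. t - inverse (real (Suc m))) \<longlonglongrightarrow> t" by simp
  show "\<forall>\<^sub>F m in sequentially. t - inverse (real (Suc m)) <= of_int \<lfloor>real (Suc m) * t\<rfloor> / real (Suc m)"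
  proof (intro always_eventually allI)
    fix m
    have "real (Suc m) * t - 1 <= of_int \<lfloor>real (Suc m) * t\<rfloor>" by linarith
    then have "(real (Suc m) * t - 1) / real (Suc m) <= of_int \<lfloor>real (Suc m) * t\<rfloor> / real (Suc m)"
      by (intro divide_right_mono) auto
    moreover have "(real (Suc m) * t - 1) / real (Suc m) = t - inverse (real (Suc m))"
      by (simp add: diff_divide_distrib inverse_eq_divide del: of_nat_Suc)
    ultimately show "t - inverse (real (Suc m)) <= of_int \<lfloor>real (Suc m) * t\<rfloor> / real (Suc m)" by simp
  qed
  show "\<forall>\<^sub>F m in sequentially. of_int \<lfloor>real (Suc m) * t\<rfloor> / real (Suc m) <= t"
  proof (intro always_eventually allI)
    fix m
    have "of_int \<lfloor>real (Suc m) * t\<rfloor> <= real (Suc m) * t" by linarith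
    then show "of_int \<lfloor>real (Suc m) * t\<rfloor> / real (Suc m) <= t"
      by (subst pos_divide_le_eq) (auto simp: mult.commute)
  qed
qed simp

text \<open>The range space need not be separable, so the coefficients are rounded to countably many
  values.\<close>

lemma norm_sum_measurable:
  fixes \<xi> :: "nat => 'x::real_normed_vector"
  assumes "!!k. k < n ==> a k \<in> borel_measurable M"
  shows "(%\<omega>. norm (x0 + (\<Sum>k<n. a k \<omega> *\<^sub>R \<xi> k))) \<in> borel_measurable M"
  using assms
proof (induction n arbitrary: x0)
  case 0
  then show ?case by simp
next
  case (Suc n)
  have [measurable]: "a n \<in> borel_measurable M" using Suc.prems by simp
  \<comment> \<open>The rounded last term takes countably many values and is absorbed into the base
    point \<open>x0\<close>, which is why \<open>x0\<close> is arbitrary in the induction.\<close>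
  define g where "g m \<omega> = norm ((x0 + (of_int \<lfloor>real (Suc m) * a n \<omega>\<rfloor> / real (Suc m)) *\<^sub>R \<xi> n)
      + (\<Sum>k<n. a k \<omega> *\<^sub>R \<xi> k))" for m \<omega>
  have "g m \<in> borel_measurable M" for m
  proof -
    have *: "(%\<omega>. norm ((x0 + (of_int i / real (Suc m)) *\<^sub>R \<xi> n)
      + (\<Sum>k<n. a k \<omega> *\<^sub>R \<xi> k))) \<in> borel_measurable M" for i :: int
      by (rule Suc.IH) (use Suc.prems in auto)
    have **: "(%\<omega>. \<lfloor>real (Suc m) * a n \<omega>\<rfloor>) \<in> measurable M (count_space UNIV)" by measurable
    show ?thesis
      unfolding g_def using measurable_compose_countable[OF * **] .
  qed
  moreover have "(%m. g m \<omega>) \<longlonglongrightarrow> norm (x0 + (\<Sum>k<Suc n. a k \<omega> *\<^sub>R \<xi> k))" for \<omega>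
  proof -
    have "(%m. g m \<omega>) \<longlonglongrightarrow> norm ((x0 + a n \<omega> *\<^sub>R \<xi> n) + (\<Sum>k<n. a k \<omega> *\<^sub>R \<xi> k))"
      unfolding g_def by (intro tendsto_intros floor_approx_tendsto)
    then show ?thesis by (simp add: algebra_simps)
  qed
  ultimately show ?case by (rule borel_measurable_LIMSEQ_real[rotated])
qed

text \<open>The base point \<open>x\<close> carries the terms whose Gaussian variable is integrated
  outside, so that \<open>gauss_sq_Suc\<close> becomes a recursion. Values in \<open>ennreal\<close>
  let Tonelli's theorem apply before any integrability is known.\<close>

definition gauss_sq :: "nat => (nat => 'x::real_normed_vector) => 'x => ennreal" where
  "gauss_sq n y x = (\<integral>\<^sup>+\<omega>. ennreal ((norm (x + (\<Sum>k<n. \<omega> k *\<^sub>R y k)))\<^sup>2) \<partial>gaussian_law n)"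

interpretation std_normal: prob_space std_normal_distribution
  using real_dist_normal_dist by (simp add: real_distribution_def)

interpretation std_normal_prod: product_prob_space "%_::nat. std_normal_distribution" UNIV
  by (simp add: product_prob_space_def product_sigma_finite_def product_prob_space_axioms_def
    std_normal.prob_space_axioms std_normal.sigma_finite_measure_axioms)

interpretation std_normal_pair: pair_sigma_finite std_normal_distribution std_normal_distribution
  by standard

lemma prob_space_gaussian_law: "prob_space (gaussian_law n)"
  unfolding gaussian_law_def by (intro prob_space_PiM std_normal.prob_space_axioms)

lemma gaussian_law_coord:
  "k < n ==> (%\<omega>. \<omega> k) \<in> borel_measurable (gaussian_law n)"
proof -
  assume "k < n"
  then have "(%\<omega>. \<omega> k) \<in> measurable (gaussian_law n) std_normal_distribution"
    unfolding gaussian_law_def by (intro measurable_component_singleton) simp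
  then show ?thesis by simp
qed

lemma gauss_sq_cong: "(!!k. k < n ==> y k = z k) ==> gauss_sq n y x = gauss_sq n z x"
  unfolding gauss_sq_def by (intro nn_integral_cong) simp

text \<open>The two additional terms are appended to the finite sum as numbers \<open>n\<close> and
  \<open>n + 1\<close> on a product space, where \<open>norm_sum_measurable\<close> applies. Two
  directions are what a rotation in one coordinate plane needs.\<close>

lemma gauss_sq_measurable:
  assumes a: "a \<in> borel_measurable M" and b: "b \<in> borel_measurable M"
  shows "(%\<omega>. gauss_sq n y (x + a \<omega> *\<^sub>R p + b \<omega> *\<^sub>R q)) \<in> borel_measurable M"
proof -
  interpret P: prob_space "gaussian_law n" by (rule prob_space_gaussian_law)
  define c where "c k z = (if k < n then snd z k else if k = n then a (fst z) else b (fst z))"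
    for k :: nat and z :: "_ \<times> (nat => real)"
  define \<xi> where "\<xi> k = (if k < n then y k else if k = n then p else q)" for k :: nat
  have "(%z. norm (x + (\<Sum>k<Suc (Suc n). c k z *\<^sub>R \<xi> k))) \<in> borel_measurable (M \<Otimes>\<^sub>M gaussian_law n)"
  proof (rule norm_sum_measurable)
    fix k
    consider "k < n" | "k = n" | "k > n" by linarith
    then show "c k \<in> borel_measurable (M \<Otimes>\<^sub>M gaussian_law n)"
    proof cases
      case 1
      then have "c k = (%z. snd z k)" by (simp add: c_def fun_eq_iff)
      moreover have "(%z. snd z k) \<in> borel_measurable (M \<Otimes>\<^sub>M gaussian_law n)"
        using measurable_compose[OF measurable_snd gaussian_law_coord[OF 1]] .
      ultimately show ?thesis by simp
    next
      case 2
      then have "c k = (%z. a (fst z))" by (simp add: c_def fun_eq_iff)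
      then show ?thesis using measurable_compose[OF measurable_fst a] by simp
    next
      case 3
      then have "c k = (%z. b (fst z))" by (simp add: c_def fun_eq_iff)
      then show ?thesis using measurable_compose[OF measurable_fst b] by simp
    qed
  qed
  also have "(%z. norm (x + (\<Sum>k<Suc (Suc n). c k z *\<^sub>R \<xi> k))) =
      (%(w, \<omega>). norm ((x + a w *\<^sub>R p + b w *\<^sub>R q) + (\<Sum>k<n. \<omega> k *\<^sub>R y k)))"
    by (auto simp: fun_eq_iff c_def \<xi>_def algebra_simps intro!: arg_cong[where f=norm])
  finally have [measurable]: "(%(w, \<omega>). norm ((x + a w *\<^sub>R p + b w *\<^sub>R q) + (\<Sum>k<n. \<omega> k *\<^sub>R y k)))
      \<in> borel_measurable (M \<Otimes>\<^sub>M gaussian_law n)" .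
  show ?thesis
    unfolding gauss_sq_def
    by (rule P.borel_measurable_nn_integral) (simp add: case_prod_unfold)
qed

lemma gauss_sq_measurable1:
  assumes a: "a \<in> borel_measurable M"
  shows "(%\<omega>. gauss_sq n y (x + a \<omega> *\<^sub>R p)) \<in> borel_measurable M"
  using gauss_sq_measurable[OF a a, of n y x p 0] by simp

lemma gauss_sq_0 [simp]: "gauss_sq 0 y x = ennreal ((norm x)\<^sup>2)"
  by (simp add: gauss_sq_def gaussian_law_def PiM_empty nn_integral_count_space_finite)

lemma gauss_sq_Suc:
  "gauss_sq (Suc n) y x = (\<integral>\<^sup>+t. gauss_sq n y (x + t *\<^sub>R y n) \<partial>std_normal_distribution)"
proof -
  have m: "(%\<omega>. ennreal ((norm (x + (\<Sum>k<Suc n. \<omega> k *\<^sub>R y k)))\<^sup>2)) \<in> borel_measurable (gaussian_law (Suc n))"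
    by (intro measurable_compose[OF _ measurable_ennreal] borel_measurable_power norm_sum_measurable
        gaussian_law_coord)
  have "gauss_sq (Suc n) y x = (\<integral>\<^sup>+t. \<integral>\<^sup>+\<omega>. ennreal ((norm (x + (\<Sum>k<Suc n. fun_upd \<omega> n t k *\<^sub>R y k)))\<^sup>2)
    \<partial>Pi\<^sub>M {..<n} (%_. std_normal_distribution) \<partial>std_normal_distribution)"
    unfolding gauss_sq_def gaussian_law_def
    using m[unfolded gaussian_law_def]
    by (subst lessThan_Suc, subst std_normal_prod.product_nn_integral_insert_rev)
      (simp_all add: lessThan_Suc[symmetric] del: sum.lessThan_Suc)
  also have "... = (\<integral>\<^sup>+t. gauss_sq n y (x + t *\<^sub>R y n) \<partial>std_normal_distribution)"
    unfolding gauss_sq_def gaussian_law_def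
    by (intro nn_integral_cong arg_cong[where f=ennreal] arg_cong[where f="%x. x\<^sup>2"]
        arg_cong[where f=norm]) (simp add: algebra_simps)
  finally show ?thesis .
qed

lemma std_normal_reflect:
  assumes [measurable]: "f \<in> borel_measurable borel"
  shows "(\<integral>\<^sup>+t. f (- t) \<partial>std_normal_distribution) = (\<integral>\<^sup>+t. f t \<partial>std_normal_distribution)"
proof -
  have "(\<integral>\<^sup>+t. f t \<partial>std_normal_distribution) = (\<integral>\<^sup>+t. ennreal (std_normal_density t) * f t \<partial>lborel)"
    by (subst nn_integral_density) auto
  also have "... = (\<integral>\<^sup>+t. ennreal (std_normal_density (-t)) * f (-t) \<partial>lborel)"
    by (subst nn_integral_real_affine[of _ "-1" 0]) auto
  also have "... = (\<integral>\<^sup>+t. f (- t) \<partial>std_normal_distribution)"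
    by (subst nn_integral_density) (auto simp: normal_density_def)
  finally show ?thesis ..
qed

lemma std_normal_second_moment: "(\<integral>\<^sup>+t. ennreal (t\<^sup>2) \<partial>std_normal_distribution) = 1"
  using std_normal_distribution_even_moments[of 1]
  by (subst nn_integral_eq_integral) (auto simp: fact_numeral numeral_2_eq_2)

text \<open>A plane rotation is a product of three shears, and a shear is a translation in one
  variable with the other one fixed. Invariance of Lebesgue measure thus follows from translation
  invariance on the line and Tonelli's theorem.\<close>

lemma lborel_shear_rotation:
  fixes G :: "real => real => ennreal"
  assumes G [measurable]: "case_prod G \<in> borel_measurable (borel \<Otimes>\<^sub>M borel)"
    and cs: "c\<^sup>2 + s\<^sup>2 = 1" "s \<noteq> 0"
  shows "(\<integral>\<^sup>+v. \<integral>\<^sup>+u. G (c * u + s * v) (c * v - s * u) \<partial>lborel \<partial>lborel) =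
    (\<integral>\<^sup>+v. \<integral>\<^sup>+u. G u v \<partial>lborel \<partial>lborel)"
proof -
  \<comment> \<open>With \<open>c\<close> and \<open>s\<close> the cosine and sine of the angle,
    this is the tangent of half the angle, the factor of the first and the third shear.\<close>
  define \<tau> where "\<tau> = (1 - c) / s"
  have shear1: "(\<integral>\<^sup>+v. \<integral>\<^sup>+u. G (u + a * v) v \<partial>lborel \<partial>lborel) = (\<integral>\<^sup>+v. \<integral>\<^sup>+u. G u v \<partial>lborel \<partial>lborel)"
    if [measurable]: "case_prod G \<in> borel_measurable (borel \<Otimes>\<^sub>M borel)" for G :: "real => real => ennreal" and a
  proof (rule nn_integral_cong)
    fix v :: real
    show "(\<integral>\<^sup>+u. G (u + a * v) v \<partial>lborel) = (\<integral>\<^sup>+u. G u v \<partial>lborel)"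
      by (subst (2) nn_integral_real_affine[of _ 1 "a * v"]) (auto simp: add.commute)
  qed
  have swap: "(\<integral>\<^sup>+v. \<integral>\<^sup>+u. G u v \<partial>lborel \<partial>lborel) = (\<integral>\<^sup>+u. \<integral>\<^sup>+v. G u v \<partial>lborel \<partial>lborel)"
    if "case_prod G \<in> borel_measurable (borel \<Otimes>\<^sub>M borel)" for G :: "real => real => ennreal"
    by (rule lborel_pair.Fubini') (use that in \<open>simp add: measurable_cong_sets[OF sets_pair_measure_cong[OF sets_lborel sets_lborel] refl]\<close>)
  have shear2: "(\<integral>\<^sup>+v. \<integral>\<^sup>+u. G u (v + a * u) \<partial>lborel \<partial>lborel) = (\<integral>\<^sup>+v. \<integral>\<^sup>+u. G u v \<partial>lborel \<partial>lborel)"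
    if [measurable]: "case_prod G \<in> borel_measurable (borel \<Otimes>\<^sub>M borel)" for G :: "real => real => ennreal" and a
  proof -
    have "(\<integral>\<^sup>+v. \<integral>\<^sup>+u. G u (v + a * u) \<partial>lborel \<partial>lborel) = (\<integral>\<^sup>+u. \<integral>\<^sup>+v. G u (v + a * u) \<partial>lborel \<partial>lborel)"
      by (rule swap) measurable
    also have "... = (\<integral>\<^sup>+u. \<integral>\<^sup>+v. G u v \<partial>lborel \<partial>lborel)"
    proof (rule nn_integral_cong)
      fix u :: real
      show "(\<integral>\<^sup>+v. G u (v + a * u) \<partial>lborel) = (\<integral>\<^sup>+v. G u v \<partial>lborel)"
        by (subst (2) nn_integral_real_affine[of _ 1 "a * u"]) (auto simp: add.commute)
    qed
    also have "... = (\<integral>\<^sup>+v. \<integral>\<^sup>+u. G u v \<partial>lborel \<partial>lborel)"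
      by (rule swap[symmetric]) measurable
    finally show ?thesis .
  qed
  have s2: "s * s = 1 - c * c" using cs by (simp add: power2_eq_square algebra_simps)
  have \<tau>s: "s * \<tau> = 1 - c" using cs(2) by (simp add: \<tau>_def)
  have e1: "(v + (-s) * (u + \<tau> * v)) = c * v - s * u" for u v
    using \<tau>s by (simp add: algebra_simps) (metis (no_types, opaque_lifting) add.commute add_diff_cancel_left' diff_add_cancel mult.assoc mult.commute mult_1 ring_class.ring_distribs(2))
  have \<tau>c: "\<tau> * (1 + c) = s"
    using cs(2) s2 by (simp add: \<tau>_def field_simps)
  have e2: "(u + \<tau> * v) + \<tau> * (c * v - s * u) = c * u + s * v" for u v
  proof -
    have "(u + \<tau> * v) + \<tau> * (c * v - s * u) = u * (1 - s * \<tau>) + (\<tau> * (1 + c)) * v"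
      by (simp add: algebra_simps)
    then show ?thesis by (simp add: \<tau>s \<tau>c)
  qed
  have "(\<integral>\<^sup>+v. \<integral>\<^sup>+u. G (c * u + s * v) (c * v - s * u) \<partial>lborel \<partial>lborel) =
    (\<integral>\<^sup>+v. \<integral>\<^sup>+u. G ((u + \<tau> * v) + \<tau> * (v + (-s) * (u + \<tau> * v))) (v + (-s) * (u + \<tau> * v)) \<partial>lborel \<partial>lborel)"
    by (simp only: e1 e2)
  also have "... = (\<integral>\<^sup>+v. \<integral>\<^sup>+u. G (u + \<tau> * (v + (-s) * u)) (v + (-s) * u) \<partial>lborel \<partial>lborel)"
    by (rule shear1[where G="%u v. G (u + \<tau> * (v + (-s) * u)) (v + (-s) * u)"]) measurable
  also have "... = (\<integral>\<^sup>+v. \<integral>\<^sup>+u. G (u + \<tau> * v) v \<partial>lborel \<partial>lborel)"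
    by (rule shear2[where G="%u v. G (u + \<tau> * v) v"]) measurable
  also have "... = (\<integral>\<^sup>+v. \<integral>\<^sup>+u. G u v \<partial>lborel \<partial>lborel)" by (rule shear1) measurable
  finally show ?thesis .
qed

text \<open>The product of the two densities depends on \<open>u\<close> and \<open>v\<close> only
  through u^2 + v^2, which a rotation preserves; the Lebesgue part is
  \<open>lborel_shear_rotation\<close>.\<close>

lemma std_normal_rotation:
  fixes F :: "real => real => ennreal"
  assumes F [measurable]: "case_prod F \<in> borel_measurable (borel \<Otimes>\<^sub>M borel)"
    and cs: "c\<^sup>2 + s\<^sup>2 = 1" "s \<noteq> 0"
  shows "(\<integral>\<^sup>+v. \<integral>\<^sup>+u. F (c * u + s * v) (c * v - s * u) \<partial>std_normal_distribution \<partial>std_normal_distribution) =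
    (\<integral>\<^sup>+v. \<integral>\<^sup>+u. F u v \<partial>std_normal_distribution \<partial>std_normal_distribution)"
proof -
  have nn: "(\<integral>\<^sup>+v. \<integral>\<^sup>+u. F u v \<partial>std_normal_distribution \<partial>std_normal_distribution)
     = (\<integral>\<^sup>+v. \<integral>\<^sup>+u. ennreal (std_normal_density u * std_normal_density v) * F u v \<partial>lborel \<partial>lborel)"
    if [measurable]: "case_prod F \<in> borel_measurable (borel \<Otimes>\<^sub>M borel)" for F :: "real => real => ennreal"
  proof -
    have "(\<integral>\<^sup>+v. \<integral>\<^sup>+u. F u v \<partial>std_normal_distribution \<partial>std_normal_distribution) =
      (\<integral>\<^sup>+v. ennreal (std_normal_density v) * (\<integral>\<^sup>+u. ennreal (std_normal_density u) * F u v \<partial>lborel) \<partial>lborel)"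
      by (subst nn_integral_density; (subst nn_integral_density)?; measurable)
    also have "... = (\<integral>\<^sup>+v. \<integral>\<^sup>+u. ennreal (std_normal_density u * std_normal_density v) * F u v \<partial>lborel \<partial>lborel)"
      by (intro nn_integral_cong, subst nn_integral_cmult[symmetric])
        (auto simp: ennreal_mult mult_ac)
    finally show ?thesis .
  qed
  have rot: "std_normal_density (c * u + s * v) * std_normal_density (c * v - s * u) =
     std_normal_density u * std_normal_density v" for u v
  proof -
    have "(c * u + s * v)\<^sup>2 + (c * v - s * u)\<^sup>2 = (c\<^sup>2 + s\<^sup>2) * (u\<^sup>2 + v\<^sup>2)"
      by (simp add: power2_eq_square algebra_simps)
    then have "- (c * u + s * v)\<^sup>2 / 2 + - (c * v - s * u)\<^sup>2 / 2 = - u\<^sup>2 / 2 + - v\<^sup>2 / 2"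
      using cs(1) by (simp add: field_simps)
    then show ?thesis
      unfolding std_normal_density_def by (simp add: mult_exp_exp)
  qed
  have "(\<integral>\<^sup>+v. \<integral>\<^sup>+u. F (c * u + s * v) (c * v - s * u) \<partial>std_normal_distribution \<partial>std_normal_distribution) =
    (\<integral>\<^sup>+v. \<integral>\<^sup>+u. ennreal (std_normal_density (c * u + s * v) * std_normal_density (c * v - s * u)) *
       F (c * u + s * v) (c * v - s * u) \<partial>lborel \<partial>lborel)"
    unfolding rot by (rule nn) measurable
  also have "... = (\<integral>\<^sup>+v. \<integral>\<^sup>+u. ennreal (std_normal_density u * std_normal_density v) * F u v \<partial>lborel \<partial>lborel)"
    by (rule lborel_shear_rotation[OF _ cs, where G="%u v. ennreal (std_normal_density u * std_normal_density v) * F u v"]) measurable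
  finally show ?thesis using nn[OF F] by simp
qed

text \<open>Rotating the vectors at positions \<open>n\<close> and \<open>Suc n\<close> amounts to
  rotating the last two Gaussian variables, whose joint law is rotation invariant.\<close>

lemma gauss_sq_rotate:
  assumes cs: "c\<^sup>2 + s\<^sup>2 = 1" "s \<noteq> 0"
    and z: "!!k. k < n ==> z k = y k" "z n = c *\<^sub>R y n - s *\<^sub>R y (Suc n)"
      "z (Suc n) = s *\<^sub>R y n + c *\<^sub>R y (Suc n)"
  shows "gauss_sq (Suc (Suc n)) z x = gauss_sq (Suc (Suc n)) y x"
proof -
  have e: "gauss_sq (Suc (Suc n)) y x =
    (\<integral>\<^sup>+v. \<integral>\<^sup>+u. gauss_sq n y (x + u *\<^sub>R y n + v *\<^sub>R y (Suc n)) \<partial>std_normal_distribution \<partial>std_normal_distribution)" for y :: "nat => 'a"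
    by (simp add: gauss_sq_Suc algebra_simps)
  have "gauss_sq (Suc (Suc n)) z x = (\<integral>\<^sup>+v. \<integral>\<^sup>+u. gauss_sq n y (x + (c * u + s * v) *\<^sub>R y n + (c * v - s * u) *\<^sub>R y (Suc n)) \<partial>std_normal_distribution \<partial>std_normal_distribution)"
    unfolding e z(2,3) using gauss_sq_cong[of n z y, OF z(1)] by (simp add: algebra_simps)
  also have "... = gauss_sq (Suc (Suc n)) y x"
    unfolding e
  proof (rule std_normal_rotation[OF _ cs, where F="%u v. gauss_sq n y (x + u *\<^sub>R y n + v *\<^sub>R y (Suc n))"])
    show "(%(u, v). gauss_sq n y (x + u *\<^sub>R y n + v *\<^sub>R y (Suc n))) \<in> borel_measurable (borel \<Otimes>\<^sub>M borel)"
      unfolding case_prod_unfold by (rule gauss_sq_measurable) measurable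
  qed
  finally show ?thesis .
qed

lemma gauss_sq_reflect_integral:
  "(\<integral>\<^sup>+t. gauss_sq n y (x + t *\<^sub>R a) \<partial>std_normal_distribution) =
   (\<integral>\<^sup>+t. gauss_sq n y (x - t *\<^sub>R a) \<partial>std_normal_distribution)"
  using std_normal_reflect[of "%t. gauss_sq n y (x - t *\<^sub>R a)"] gauss_sq_measurable1[of "%t. - t" borel n y x a]
  by simp

lemma two_norm_sq_le:
  fixes x :: "'x::real_normed_vector"
  shows "2 * (norm x)\<^sup>2 <= (norm (x + a))\<^sup>2 + (norm (x - a))\<^sup>2"
proof -
  have "norm (2 *\<^sub>R x) <= norm (x + a) + norm (x - a)"
    using norm_triangle_ineq[of "x + a" "x - a"] by (simp add: scaleR_2 algebra_simps)
  then have "norm x <= (norm (x + a) + norm (x - a)) / 2" by simp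
  then have "(norm x)\<^sup>2 <= ((norm (x + a) + norm (x - a)) / 2)\<^sup>2" by (intro power_mono) auto
  moreover have "2 * ((p + q) / 2)\<^sup>2 <= p\<^sup>2 + q\<^sup>2" for p q :: real
    using sum_squares_bound[of p q] by (simp add: power2_eq_square field_simps)
  ultimately show ?thesis by (smt (verit, best))
qed

lemma gauss_sq_two_le: "2 * gauss_sq n y x <= gauss_sq n y (x + a) + gauss_sq n y (x - a)"
proof -
  have m: "(%\<omega>. ennreal ((norm (x + (\<Sum>k<n. \<omega> k *\<^sub>R y k)))\<^sup>2)) \<in> borel_measurable (gaussian_law n)" for x
    by (intro measurable_compose[OF _ measurable_ennreal] borel_measurable_power norm_sum_measurable
        gaussian_law_coord)
  have "2 * ennreal ((norm (x + s))\<^sup>2) <= ennreal ((norm (x + a + s))\<^sup>2) + ennreal ((norm (x - a + s))\<^sup>2)" for s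
    using two_norm_sq_le[of "x + s" a]
    by (simp add: ennreal_plus[symmetric] algebra_simps ennreal_numeral[symmetric] ennreal_mult[symmetric] ennreal_leI
        del: ennreal_plus ennreal_numeral)
  then have "(\<integral>\<^sup>+\<omega>. 2 * ennreal ((norm (x + (\<Sum>k<n. \<omega> k *\<^sub>R y k)))\<^sup>2) \<partial>gaussian_law n) \<le>
    (\<integral>\<^sup>+\<omega>. ennreal ((norm (x + a + (\<Sum>k<n. \<omega> k *\<^sub>R y k)))\<^sup>2) + ennreal ((norm (x - a + (\<Sum>k<n. \<omega> k *\<^sub>R y k)))\<^sup>2) \<partial>gaussian_law n)"
    by (intro nn_integral_mono) simp
  then show ?thesis
    unfolding gauss_sq_def nn_integral_cmult[OF m] nn_integral_add[OF m m] .
qed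

text \<open>An additional independent symmetric term cannot lower the second moment:
  \<open>t\<close> and \<open>- t\<close> have the same law, and the mean of the values at both
  dominates the value at 0 by convexity of the squared norm.\<close>

lemma gauss_sq_le_Suc: "gauss_sq n y x <= gauss_sq (Suc n) y x"
proof -
  let ?N = std_normal_distribution
  have "2 * gauss_sq n y x = (\<integral>\<^sup>+t. 2 * gauss_sq n y x \<partial>?N)"
    using std_normal.emeasure_space_1 by simp
  also have "... <= (\<integral>\<^sup>+t. gauss_sq n y (x + t *\<^sub>R y n) + gauss_sq n y (x - t *\<^sub>R y n) \<partial>?N)"
    by (intro nn_integral_mono gauss_sq_two_le)
  also have "... = (\<integral>\<^sup>+t. gauss_sq n y (x + t *\<^sub>R y n) \<partial>?N) + (\<integral>\<^sup>+t. gauss_sq n y (x - t *\<^sub>R y n) \<partial>?N)"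
    using gauss_sq_measurable1[of "%t. t" ?N n y x "y n"] gauss_sq_measurable1[of "%t. - t" ?N n y x "y n"]
    by (intro nn_integral_add) simp_all
  also have "... = 2 * gauss_sq (Suc n) y x"
    by (simp add: gauss_sq_reflect_integral[symmetric] gauss_sq_Suc mult_2)
  finally show ?thesis by (simp add: ennreal_mult_le_mult_iff)
qed

lemma gauss_sq_sign:
  assumes "!!k. k < n ==> \<epsilon> k \<in> {1, -1 :: real}"
  shows "gauss_sq n (%k. \<epsilon> k *\<^sub>R y k) x = gauss_sq n y x"
  using assms
proof (induction n arbitrary: x)
  case (Suc n)
  have IH: "gauss_sq n (%k. \<epsilon> k *\<^sub>R y k) x = gauss_sq n y x" for x
    using Suc by simp
  have "\<epsilon> n = 1 \<or> \<epsilon> n = -1" using Suc.prems[of n] by simp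
  then show ?case
  proof
    assume "\<epsilon> n = -1"
    then show ?thesis
      using gauss_sq_reflect_integral[of n y x "y n"] by (simp add: gauss_sq_Suc IH)
  qed (simp add: gauss_sq_Suc IH)
qed simp

section \<open>Real coordinate rows and the contraction principle for Gaussian sums\<close>

definition coord_inner :: "nat => (nat => real) => (nat => real) => real" where
  "coord_inner m v w = (\<Sum>l<m. v l * w l)"

definition coord_comb :: "nat => (nat => 'x::real_vector) => (nat => real) => 'x" where
  "coord_comb m y w = (\<Sum>l<m. w l *\<^sub>R y l)"

definition coord_orthonormal :: "nat => nat => (nat => nat => real) => bool" where
  "coord_orthonormal m n w \<longleftrightarrow> (\<forall>i<n. \<forall>j<n. coord_inner m (w i) (w j) = (if i = j then 1 else 0))"

lemma coord_inner_comb: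
  "coord_inner m (%l. a * v l + b * w l) z = a * coord_inner m v z + b * coord_inner m w z"
  "coord_inner m z (%l. a * v l + b * w l) = a * coord_inner m z v + b * coord_inner m z w"
  "coord_inner m (%l. a * v l - b * w l) z = a * coord_inner m v z - b * coord_inner m w z"
  "coord_inner m z (%l. a * v l - b * w l) = a * coord_inner m z v - b * coord_inner m z w"
  "coord_inner m (%l. v l / b) z = coord_inner m v z / b"
  "coord_inner m z (%l. v l / b) = coord_inner m z v / b"
  by (simp_all add: coord_inner_def sum.distrib sum_distrib_left algebra_simps sum_subtractf
      sum_divide_distrib)

lemma coord_inner_commute: "coord_inner m v w = coord_inner m w v"
  by (simp add: coord_inner_def mult.commute)

lemma coord_comb_comb:
  "coord_comb m y (%l. a * v l + b * w l) = a *\<^sub>R coord_comb m y v + b *\<^sub>R coord_comb m y w"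
  "coord_comb m y (%l. a * v l - b * w l) = a *\<^sub>R coord_comb m y v - b *\<^sub>R coord_comb m y w"
  "coord_comb m y (%l. v l / b) = (1 / b) *\<^sub>R coord_comb m y v"
  by (simp_all add: coord_comb_def sum.distrib scaleR_right.sum algebra_simps sum_subtractf)

text \<open>Givens rotations of neighbouring rows move the entries of one column into the last row.\<close>

lemma gauss_sq_eliminate:
  fixes y :: "nat => 'x::real_normed_vector"
  assumes "coord_orthonormal m (Suc n) w"
  shows "\<exists>w'. coord_orthonormal m (Suc n) w' \<and> (\<forall>j<n. w' j l = 0) \<and>
    (\<forall>v. (\<forall>j<Suc n. coord_inner m v (w j) = 0) --> (\<forall>j<Suc n. coord_inner m v (w' j) = 0)) \<and>
    (\<forall>x. gauss_sq (Suc n) (%j. coord_comb m y (w' j)) x = gauss_sq (Suc n) (%j. coord_comb m y (w j)) x)"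
  using assms
proof (induction n)
  case 0
  then show ?case by (intro exI[of _ w]) auto
next
  case (Suc n)
  have ON: "coord_inner m (w i) (w j) = (if i = j then 1 else 0)" if "i <= Suc n" "j <= Suc n" for i j
    using Suc.prems that by (simp add: coord_orthonormal_def)
  then have "coord_orthonormal m (Suc n) w" by (simp add: coord_orthonormal_def)
  from Suc.IH[OF this] obtain w' where
    w'ON: "coord_orthonormal m (Suc n) w'" and w'0: "\<forall>j<n. w' j l = 0" and
    w'perp: "!!v. (\<forall>j<Suc n. coord_inner m v (w j) = 0) ==> (\<forall>j<Suc n. coord_inner m v (w' j) = 0)" and
    w'G: "!!x. gauss_sq (Suc n) (%j. coord_comb m y (w' j)) x = gauss_sq (Suc n) (%j. coord_comb m y (w j)) x"
    by blast
  \<comment> \<open>The rows 0 to \<open>n\<close> come from the induction hypothesis and the last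
    row is untouched; the clause on orthogonal vectors \<open>v\<close>, applied to that row, keeps
    the system orthonormal.\<close>
  define z where "z j = (if j = Suc n then w (Suc n) else w' j)" for j
  have zperp: "\<forall>j<Suc (Suc n). coord_inner m v (z j) = 0" if "\<forall>j<Suc (Suc n). coord_inner m v (w j) = 0" for v
    using that w'perp[of v] by (auto simp: z_def less_Suc_eq)
  have *: "coord_inner m (w (Suc n)) (w' j) = 0" "coord_inner m (w' j) (w (Suc n)) = 0" if "j < Suc n" for j
    using w'perp[of "w (Suc n)"] ON that coord_inner_commute[of m "w (Suc n)" "w' j"] by auto
  then have zON: "coord_orthonormal m (Suc (Suc n)) z"
    using w'ON ON[of "Suc n" "Suc n"]
    by (auto simp: coord_orthonormal_def z_def less_Suc_eq)
  have zG: "gauss_sq (Suc (Suc n)) (%j. coord_comb m y (z j)) x = gauss_sq (Suc (Suc n)) (%j. coord_comb m y (w j)) x" for x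
  proof -
    have "gauss_sq (Suc n) (%j. coord_comb m y (z j)) x = gauss_sq (Suc n) (%j. coord_comb m y (w j)) x" for x
      using w'G[of x] gauss_sq_cong[of "Suc n" "%j. coord_comb m y (z j)" "%j. coord_comb m y (w' j)" x]
      by (simp add: z_def)
    then show ?thesis
      by (subst (1 2) gauss_sq_Suc) (simp add: z_def)
  qed
  have z0: "z j l = 0" if "j < n" for j using that w'0 by (simp add: z_def)
  show ?case
  proof (cases "z n l = 0")
    case True
    then have "\<forall>j<Suc n. z j l = 0" using z0 by (auto simp: less_Suc_eq)
    then show ?thesis using zON zperp zG by (intro exI[of _ z]) auto
  next
    case False
    \<comment> \<open>The two entries of column \<open>l\<close> that may remain, divided by their
      Euclidean length, are the sine and cosine of the Givens rotation that clears row
      \<open>n\<close>.\<close>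
    define \<rho> where "\<rho> = sqrt ((z n l)\<^sup>2 + (z (Suc n) l)\<^sup>2)"
    have \<rho>0: "\<rho> > 0" using False by (simp add: \<rho>_def sum_power2_gt_zero_iff)
    have \<rho>2: "\<rho>\<^sup>2 = (z n l)\<^sup>2 + (z (Suc n) l)\<^sup>2" by (simp add: \<rho>_def)
    define c where "c = z (Suc n) l / \<rho>"
    define s where "s = z n l / \<rho>"
    have cs: "c\<^sup>2 + s\<^sup>2 = 1" "s \<noteq> 0"
      using \<rho>0 \<rho>2 False by (auto simp: c_def s_def power_divide add_divide_distrib[symmetric])
    define w'' where "w'' j = (if j = n then (%l. c * z n l - s * z (Suc n) l)
      else if j = Suc n then (%l. s * z n l + c * z (Suc n) l) else z j)" for j
    have zz: "coord_inner m (z i) (z j) = (if i = j then 1 else 0)" if "i <= Suc n" "j <= Suc n" for i j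
      using zON that by (simp add: coord_orthonormal_def)
    have ccss: "c * c + s * s = 1" using cs(1) by (simp add: power2_eq_square)
    have "coord_orthonormal m (Suc (Suc n)) w''"
      unfolding coord_orthonormal_def w''_def
      using ccss by (auto simp: coord_inner_comb zz algebra_simps)
    moreover have "w'' j l = 0" if "j < Suc n" for j
    proof (cases "j = n")
      case True
      then show ?thesis by (simp add: w''_def c_def s_def)
    next
      case False
      then show ?thesis using z0 that by (simp add: w''_def)
    qed
    moreover have "\<forall>j<Suc (Suc n). coord_inner m v (w'' j) = 0" if "\<forall>j<Suc (Suc n). coord_inner m v (w j) = 0" for v
      using zperp[OF that] by (auto simp: w''_def coord_inner_comb)
    moreover have "gauss_sq (Suc (Suc n)) (%j. coord_comb m y (w'' j)) x = gauss_sq (Suc (Suc n)) (%j. coord_comb m y (z j)) x" for x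
      by (rule gauss_sq_rotate[OF cs]) (simp_all add: w''_def coord_comb_comb)
    ultimately show ?thesis using zG by (intro exI[of _ w'']) auto
  qed
qed

text \<open>Induction on the number of columns. After elimination only the last row meets the last
  column; it is s times a unit vector of the first \<open>m\<close> coordinates plus c times the
  last coordinate vector. Adjoining the complementary combination with coefficients -c and s does
  not lower the second moment, and a rotation turns the pair into the unit vector and the coordinate
  vector. Conditionally on the last Gaussian variable, the induction hypothesis applies to the rows
  cut to \<open>m\<close> columns.\<close>

theorem gauss_sq_contraction:
  fixes y :: "nat => 'x::real_normed_vector"
  assumes "coord_orthonormal m n w"
  shows "gauss_sq n (%j. coord_comb m y (w j)) x <= gauss_sq m y x"
  using assms
proof (induction m arbitrary: n w x)
  case 0
  have "n = 0"
  proof (rule ccontr)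
    assume "n \<noteq> 0"
    then have "coord_inner 0 (w 0) (w 0) = 1" using 0 unfolding coord_orthonormal_def by (metis gr0I)
    then show False by (simp add: coord_inner_def)
  qed
  then show ?case by simp
next
  case (Suc m)
  show ?case
  proof (cases n)
    case 0
    have "gauss_sq 0 y x <= gauss_sq k y x" for k
      by (induction k) (auto intro: order_trans gauss_sq_le_Suc simp del: gauss_sq_0)
    moreover have "gauss_sq n (%j. coord_comb (Suc m) y (w j)) x = gauss_sq 0 y x"
      unfolding 0 by (rule gauss_sq_cong) simp
    ultimately show ?thesis by simp
  next
    case (Suc n')
    let ?g = "%n w x. gauss_sq n (%j. coord_comb (Suc m) y (w j)) x"
    obtain w' where
      ON: "coord_orthonormal (Suc m) (Suc n') w'" and w0: "\<forall>j<n'. w' j m = 0" and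
      G: "!!x. ?g (Suc n') w' x = ?g (Suc n') w x"
      using gauss_sq_eliminate[of "Suc m" n' w m y] Suc.prems unfolding Suc by blast
    have inner: "coord_inner (Suc m) v u = coord_inner m v u + v m * u m" for u v
      by (simp add: coord_inner_def)
    have comb: "coord_comb (Suc m) y v = coord_comb m y v + v m *\<^sub>R y m" for v
      by (simp add: coord_comb_def)
    have ip: "coord_inner m (w' i) (w' j) = (if i = j then 1 else 0)" if "i < n'" "j <= n'" for i j
    proof -
      have "coord_inner (Suc m) (w' i) (w' j) = (if i = j then 1 else 0)"
        using ON that unfolding coord_orthonormal_def by (meson le_imp_less_Suc less_SucI)
      then show ?thesis using w0 that by (simp add: inner)
    qed
    define c where "c = w' n' m"
    have ipc: "coord_inner m (w' n') (w' n') = 1 - c\<^sup>2"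
      using ON by (simp add: coord_orthonormal_def inner c_def power2_eq_square eq_diff_eq)
    have "0 <= coord_inner m (w' n') (w' n')" by (simp add: coord_inner_def sum_nonneg)
    then have c1: "c\<^sup>2 <= 1" using ipc by simp
    define s where "s = sqrt (1 - c\<^sup>2)"
    have cs: "c\<^sup>2 + s\<^sup>2 = 1" using c1 by (simp add: s_def)
    define b where "b = coord_comb m y (w' n')"
    have IH: "gauss_sq k (%j. coord_comb m y (v j)) x <= gauss_sq m y x" if "coord_orthonormal m k v" for k v x
      using Suc.IH[OF that] .
    have "?g (Suc n') w' x <= gauss_sq (Suc m) y x"
    proof (cases "s = 0")
      \<comment> \<open>Here the last row is plus or minus the last coordinate vector and cannot be
        normalised in the first \<open>m\<close> columns; reflecting one Gaussian variable takes
        care of the sign.\<close>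
      case True
      have "\<forall>l<m. w' n' l = 0"
      proof -
        have "(\<Sum>l<m. (w' n' l)\<^sup>2) = 0"
          using ipc cs True by (simp add: coord_inner_def power2_eq_square)
        then show ?thesis by (subst (asm) sum_nonneg_eq_0_iff) auto
      qed
      then have b0: "b = 0" by (simp add: b_def coord_comb_def)
      have "c\<^sup>2 = 1" using cs True by simp
      then have "c = 1 \<or> c = -1" by (simp add: power2_eq_1_iff)
      have "?g (Suc n') w' x = (\<integral>\<^sup>+t. gauss_sq n' (%j. coord_comb m y (w' j)) (x + t *\<^sub>R c *\<^sub>R y m) \<partial>std_normal_distribution)"
      proof -
        have e: "coord_comb (Suc m) y (w' n') = c *\<^sub>R y m"
          using b0 by (simp add: comb b_def c_def)
        have "gauss_sq n' (%j. coord_comb (Suc m) y (w' j)) x' = gauss_sq n' (%j. coord_comb m y (w' j)) x'" for x'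
          by (rule gauss_sq_cong) (use w0 in \<open>simp add: comb\<close>)
        then show ?thesis by (simp add: gauss_sq_Suc e)
      qed
      also have "... <= (\<integral>\<^sup>+t. gauss_sq m y (x + t *\<^sub>R c *\<^sub>R y m) \<partial>std_normal_distribution)"
        by (intro nn_integral_mono IH) (use ip in \<open>simp add: coord_orthonormal_def\<close>)
      also have "... = (\<integral>\<^sup>+t. gauss_sq m y (x + t *\<^sub>R y m) \<partial>std_normal_distribution)"
        using \<open>c = 1 \<or> c = -1\<close> gauss_sq_reflect_integral[of m y x "y m"] by auto
      also have "... = gauss_sq (Suc m) y x" by (simp add: gauss_sq_Suc)
      finally show ?thesis .
    next
      case False
      then have s0: "s > 0" using c1 by (simp add: s_def)
      define v where "v j = (if j = n' then (%l. w' n' l / s) else w' j)" for j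
      have ip': "coord_inner m (w' n') (w' i) = 0" if "i < n'" for i
        using ip[of i n'] that by (simp add: coord_inner_commute)
      have ipc': "coord_inner m (w' n') (w' n') = s * s"
        using ipc cs by (simp add: power2_eq_square)
      have vON: "coord_orthonormal m (Suc n') v"
        unfolding coord_orthonormal_def v_def
        using ip ip' ipc' s0 by (auto simp: less_Suc_eq coord_inner_comb)
      \<comment> \<open>\<open>z\<close> ends with the normalised row and \<open>y m\<close>. Its
        rotation \<open>z'\<close> has the original last row at position \<open>n'\<close> and the
        adjoined complement at position \<open>Suc n'\<close>.\<close>
      define z where "z j = (if j < n' then coord_comb m y (w' j) else if j = n' then (1/s) *\<^sub>R b else y m)" for j
      define z' where "z' j = (if j < n' then coord_comb m y (w' j)
        else if j = n' then s *\<^sub>R z n' + c *\<^sub>R z (Suc n')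
        else (- c) *\<^sub>R z n' + s *\<^sub>R z (Suc n'))" for j
      have "?g (Suc n') w' x = gauss_sq (Suc n') z' x"
        by (rule gauss_sq_cong) (use w0 s0 in \<open>auto simp: z'_def z_def comb b_def c_def less_Suc_eq\<close>)
      also have "... <= gauss_sq (Suc (Suc n')) z' x" by (rule gauss_sq_le_Suc)
      also have "... = gauss_sq (Suc (Suc n')) z x"
      proof (cases "c = 0")
        \<comment> \<open>\<open>gauss_sq_rotate\<close> requires a nonzero sine, which is
          \<open>- c\<close> here.\<close>
        case True
        then have "s = 1" using cs s0 by (simp add: power2_eq_1_iff)
        then show ?thesis using True
          by (intro gauss_sq_cong) (auto simp: z'_def z_def less_Suc_eq)
      next
        case False
        show ?thesis
          by (rule gauss_sq_rotate[of s "- c"])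
            (use cs False in \<open>auto simp: z'_def z_def add.commute\<close>)
      qed
      also have "... = (\<integral>\<^sup>+t. gauss_sq (Suc n') (%j. coord_comb m y (v j)) (x + t *\<^sub>R y m) \<partial>std_normal_distribution)"
      proof -
        have "gauss_sq (Suc n') z x' = gauss_sq (Suc n') (%j. coord_comb m y (v j)) x'" for x'
          by (rule gauss_sq_cong) (auto simp: z_def v_def b_def coord_comb_comb less_Suc_eq)
        then show ?thesis by (subst gauss_sq_Suc) (simp add: z_def)
      qed
      also have "... <= (\<integral>\<^sup>+t. gauss_sq m y (x + t *\<^sub>R y m) \<partial>std_normal_distribution)"
        by (intro nn_integral_mono IH vON)
      also have "... = gauss_sq (Suc m) y x" by (simp add: gauss_sq_Suc)
      finally show ?thesis .
    qed
    then show ?thesis using G[of x] Suc by simp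
  qed
qed

text \<open>Quadratic growth in the base point, with one constant for all base points, is the form
  of finiteness that survives the integration of one more variable.\<close>

lemma gauss_sq_bounded: "\<exists>C\<ge>0. \<forall>x. gauss_sq n y x <= ennreal (C * (1 + (norm x)\<^sup>2))"
proof (induction n)
  case 0
  show ?case by (intro exI[of _ 1]) (auto intro: ennreal_leI)
next
  case (Suc n)
  then obtain C where C: "C \<ge> 0" "!!x. gauss_sq n y x <= ennreal (C * (1 + (norm x)\<^sup>2))" by blast
  let ?N = std_normal_distribution
  have "gauss_sq (Suc n) y x <= ennreal (C * (2 + 2 * (norm (y n))\<^sup>2) * (1 + (norm x)\<^sup>2))" for x
  proof -
    have b: "(norm (x + t *\<^sub>R y n))\<^sup>2 <= 2 * (norm x)\<^sup>2 + 2 * (norm (y n))\<^sup>2 * t\<^sup>2" for t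
    proof -
      have "norm (x + t *\<^sub>R y n) <= norm x + \<bar>t\<bar> * norm (y n)" by (metis norm_scaleR norm_triangle_ineq)
      then have "(norm (x + t *\<^sub>R y n))\<^sup>2 <= (norm x + \<bar>t\<bar> * norm (y n))\<^sup>2" by (intro power_mono) auto
      also have "... <= 2 * (norm x)\<^sup>2 + 2 * (\<bar>t\<bar> * norm (y n))\<^sup>2"
        by (rule order_trans[OF eq_refl[OF power2_sum]]) (use sum_squares_bound[of "norm x" "\<bar>t\<bar> * norm (y n)"] in simp)
      finally show ?thesis by (simp add: power_mult_distrib mult.commute)
    qed
    have "gauss_sq (Suc n) y x <= (\<integral>\<^sup>+t. ennreal (C * (1 + 2 * (norm x)\<^sup>2) + C * 2 * (norm (y n))\<^sup>2 * t\<^sup>2) \<partial>?N)"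
      unfolding gauss_sq_Suc
    proof (intro nn_integral_mono order_trans[OF C(2)] ennreal_leI)
      fix t
      have "C * (1 + (norm (x + t *\<^sub>R y n))\<^sup>2) <= C * (1 + (2 * (norm x)\<^sup>2 + 2 * (norm (y n))\<^sup>2 * t\<^sup>2))"
        using b[of t] C(1) by (intro mult_left_mono) auto
      then show "C * (1 + (norm (x + t *\<^sub>R y n))\<^sup>2) <= C * (1 + 2 * (norm x)\<^sup>2) + C * 2 * (norm (y n))\<^sup>2 * t\<^sup>2"
        by (simp add: algebra_simps)
    qed
    also have "... = (\<integral>\<^sup>+t. ennreal (C * (1 + 2 * (norm x)\<^sup>2)) + ennreal (C * 2 * (norm (y n))\<^sup>2) * ennreal (t\<^sup>2) \<partial>?N)"
      using C(1) by (intro nn_integral_cong) (simp add: ennreal_plus ennreal_mult)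
    also have "... = ennreal (C * (1 + 2 * (norm x)\<^sup>2)) + ennreal (C * 2 * (norm (y n))\<^sup>2) * 1"
      using std_normal_second_moment std_normal.emeasure_space_1
      by (subst nn_integral_add) (simp_all add: nn_integral_cmult)
    also have "... = ennreal (C * (1 + 2 * (norm x)\<^sup>2) + C * 2 * (norm (y n))\<^sup>2)"
      using C(1) by (simp add: ennreal_plus)
    also have "... <= ennreal (C * (2 + 2 * (norm (y n))\<^sup>2) * (1 + (norm x)\<^sup>2))"
    proof (intro ennreal_leI)
      have "C * (1 + 2 * (norm x)\<^sup>2 + 2 * (norm (y n))\<^sup>2) <= C * ((2 + 2 * (norm (y n))\<^sup>2) * (1 + (norm x)\<^sup>2))"
        using C(1) by (intro mult_left_mono) (auto simp: algebra_simps)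
      then show "C * (1 + 2 * (norm x)\<^sup>2) + C * 2 * (norm (y n))\<^sup>2 <= C * (2 + 2 * (norm (y n))\<^sup>2) * (1 + (norm x)\<^sup>2)"
        by (simp add: algebra_simps)
    qed
    finally show ?thesis .
  qed
  then show ?case using C(1) by (intro exI[of _ "C * (2 + 2 * (norm (y n))\<^sup>2)"]) auto
qed

lemma gauss_sq_finite: "gauss_sq n y x < \<top>"
  using gauss_sq_bounded[of n y] by (metis ennreal_less_top order_le_less_trans)

lemma gauss_integrable:
  "integrable (gaussian_law n) (%\<omega>. (norm (x + (\<Sum>k<n. \<omega> k *\<^sub>R y k)))\<^sup>2)"
proof (rule integrableI_nonneg)
  show "(%\<omega>. (norm (x + (\<Sum>k<n. \<omega> k *\<^sub>R y k)))\<^sup>2) \<in> borel_measurable (gaussian_law n)"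
    by (intro borel_measurable_power norm_sum_measurable gaussian_law_coord)
  show "(\<integral>\<^sup>+\<omega>. ennreal ((norm (x + (\<Sum>k<n. \<omega> k *\<^sub>R y k)))\<^sup>2) \<partial>gaussian_law n) < \<infinity>"
    using gauss_sq_finite[of n y x] by (simp add: gauss_sq_def)
qed simp

lemma rms_gaussian_nonneg [simp]: "0 <= rms_random_sum P n y"
  by (simp add: rms_random_sum_def)

lemma rms_gaussian_sq: "ennreal ((gaussian_rms n y)\<^sup>2) = gauss_sq n y 0"
  using gauss_integrable[of n 0 y]
  by (simp add: gauss_sq_def rms_random_sum_def nn_integral_eq_integral)

lemma rms_gaussian_le_iff:
  assumes "0 <= c"
  shows "gaussian_rms n y <= c \<longleftrightarrow> gauss_sq n y 0 <= ennreal (c\<^sup>2)"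
  using assms by (simp add: rms_gaussian_sq[symmetric] power2_le_iff_abs_le)

lemma rms_gaussian_mono_iff:
  "gaussian_rms n y <= gaussian_rms m z \<longleftrightarrow> gauss_sq n y 0 <= gauss_sq m z 0"
  by (simp add: rms_gaussian_sq[symmetric] power2_le_iff_abs_le)

section \<open>Powers of extended nonnegative reals and the Minkowski inequality\<close>

lemma ennreal_powr_ennreal: "a \<ge> 0 ==> ennreal_powr (ennreal a) s = ennreal (a powr s)"
  by (simp add: ennreal_powr_def)

lemma ennreal_powr_top [simp]: "ennreal_powr \<top> s = \<top>"
  by (simp add: ennreal_powr_def)

lemma ennreal_powr_zero [simp]: "ennreal_powr 0 s = 0"
  by (simp add: ennreal_powr_def)

lemma ennreal_powr_mono: "s \<ge> 0 ==> a <= b ==> ennreal_powr a s <= ennreal_powr b s"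
  by (cases a rule: ennreal_cases; cases b rule: ennreal_cases)
    (auto simp: ennreal_powr_ennreal top_unique intro!: ennreal_leI powr_mono2)

lemma ennreal_powr_powr: "s \<noteq> 0 ==> ennreal_powr (ennreal_powr a s) t = ennreal_powr a (s * t)"
  by (cases a rule: ennreal_cases) (auto simp: ennreal_powr_ennreal powr_powr)

lemma ennreal_powr_1 [simp]: "ennreal_powr a 1 = a"
  by (cases a rule: ennreal_cases) (auto simp: ennreal_powr_ennreal)

lemma ennreal_powr_le_iff:
  assumes "s > 0" shows "ennreal_powr a s <= b \<longleftrightarrow> a <= ennreal_powr b (1 / s)"
proof
  assume "ennreal_powr a s <= b"
  then have "ennreal_powr (ennreal_powr a s) (1 / s) <= ennreal_powr b (1 / s)"
    using assms by (intro ennreal_powr_mono) auto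
  then show "a <= ennreal_powr b (1 / s)" using assms by (simp add: ennreal_powr_powr)
next
  assume "a <= ennreal_powr b (1 / s)"
  then have "ennreal_powr a s <= ennreal_powr (ennreal_powr b (1 / s)) s"
    using assms by (intro ennreal_powr_mono) auto
  then show "ennreal_powr a s <= b" using assms by (simp add: ennreal_powr_powr)
qed

lemma ennreal_powr_mult:
  "c \<ge> 0 ==> s > 0 ==> ennreal_powr (ennreal c * a) s = ennreal (c powr s) * ennreal_powr a s"
  by (cases a rule: ennreal_cases; cases "c = 0")
    (auto simp: ennreal_powr_ennreal ennreal_mult[symmetric] powr_mult ennreal_mult_top)

lemma ennreal_powr_2: "a \<ge> 0 ==> ennreal_powr (ennreal a) 2 = ennreal (a\<^sup>2)"
  by (simp add: ennreal_powr_ennreal)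

lemma ennreal_powr_eq_0_iff: "ennreal_powr a s = 0 \<longleftrightarrow> a = 0"
  by (cases a rule: ennreal_cases) (auto simp: ennreal_powr_ennreal)

lemma ennreal_powr_measurable [measurable (raw)]:
  assumes [measurable]: "f \<in> borel_measurable M"
  shows "(%x. ennreal_powr (f x) s) \<in> borel_measurable M"
  unfolding ennreal_powr_def by measurable

lemma ennreal_powr_SUP:
  assumes "s > 0" "incseq f"
  shows "ennreal_powr (SUP n. f n) s = (SUP n. ennreal_powr (f n) s)"
proof (rule antisym)
  have "(SUP n. f n) <= ennreal_powr (SUP n. ennreal_powr (f n) s) (1 / s)"
    using assms(1) by (intro SUP_least) (auto simp: ennreal_powr_le_iff[symmetric] intro: SUP_upper2)
  then show "ennreal_powr (SUP n. f n) s <= (SUP n. ennreal_powr (f n) s)"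
    using assms(1) by (simp add: ennreal_powr_le_iff)
  show "(SUP n. ennreal_powr (f n) s) <= ennreal_powr (SUP n. f n) s"
    using assms(1) by (intro SUP_least ennreal_powr_mono SUP_upper) auto
qed

text \<open>The tangent line of the convex function t^q at \<open>a\<close>. Scaling reduces it to
  Bernoulli's inequality, which is Young's inequality with the weights 1/q and 1 - 1/q.\<close>

lemma powr_tangent_le:
  fixes a t q :: real
  assumes "a > 0" "t \<ge> 0" "q \<ge> 1"
  shows "a powr q + q * a powr (q - 1) * (t - a) <= t powr q"
proof -
  have *: "1 + q * (s - 1) <= s powr q" if "s \<ge> 0" for s :: real
  proof (cases "s = 0")
    case True
    then show ?thesis using assms by simp
  next
    case False
    have "(s powr q) powr (1/q) * 1 powr (1 - 1/q) <= (1/q) * s powr q + (1 - 1/q) * 1"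
      using assms False that by (intro Youngs_inequality_0) (auto simp: field_simps)
    then have "s <= (1/q) * s powr q + (1 - 1/q)"
      using assms that by (simp add: powr_powr)
    then have "q * s <= q * ((1/q) * s powr q + (1 - 1/q))"
      using assms by (intro mult_left_mono) auto
    then show ?thesis using assms by (simp add: algebra_simps)
  qed
  have "a powr q * (1 + q * (t / a - 1)) <= a powr q * (t / a) powr q"
    using assms by (intro mult_left_mono *) auto
  moreover have "a powr q * (t / a) powr q = t powr q"
    using assms by (simp add: powr_divide)
  moreover have "a powr q * (1 + q * (t / a - 1)) = a powr q + q * a powr (q - 1) * (t - a)"
    using assms by (simp add: powr_diff field_simps)
  ultimately show ?thesis by simp
qed

text \<open>Jensen's inequality, obtained by averaging the tangent inequality at the mean
  \<open>a\<close>, where the linear terms cancel.\<close>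

lemma powr_sum_le:
  fixes w t :: "'i => real"
  assumes "finite K" "!!k. k \<in> K ==> w k > 0" "!!k. k \<in> K ==> t k \<ge> 0" "(\<Sum>k\<in>K. w k) = 1" "q \<ge> 1"
  shows "(\<Sum>k\<in>K. w k * t k) powr q <= (\<Sum>k\<in>K. w k * t k powr q)"
proof -
  define a where "a = (\<Sum>k\<in>K. w k * t k)"
  have "a \<ge> 0" unfolding a_def using assms by (intro sum_nonneg) (auto intro: mult_nonneg_nonneg less_imp_le)
  show ?thesis
  proof (cases "a = 0")
    case True
    then show ?thesis using assms(2)
      by (auto simp: a_def[symmetric] intro!: sum_nonneg mult_nonneg_nonneg less_imp_le[OF assms(2)])
  next
    case False
    then have "a > 0" using \<open>a \<ge> 0\<close> by simp
    have "a powr q = (\<Sum>k\<in>K. w k * (a powr q + q * a powr (q - 1) * (t k - a)))"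
    proof -
      have "(\<Sum>k\<in>K. w k * (a powr q + q * a powr (q - 1) * (t k - a))) =
        a powr q * (\<Sum>k\<in>K. w k) + q * a powr (q - 1) * ((\<Sum>k\<in>K. w k * t k) - a * (\<Sum>k\<in>K. w k))"
        by (simp add: sum.distrib sum_distrib_left sum_distrib_right sum_subtractf algebra_simps)
      then show ?thesis using assms(4) by (simp add: a_def)
    qed
    also have "... <= (\<Sum>k\<in>K. w k * t k powr q)"
      using assms \<open>a > 0\<close> by (intro sum_mono mult_left_mono powr_tangent_le) (auto intro: less_imp_le)
    finally show ?thesis by (simp add: a_def)
  qed
qed

text \<open>Jensen's inequality with the weights \<open>G k / S\<close> applied to the quotients of
  \<open>f k\<close> by \<open>G k\<close>. If the integral of the q-th power of each
  \<open>f k\<close> is at most \<open>G k powr q\<close>, the right side integrates to at most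
  \<open>S powr q\<close>, which is Minkowski's inequality.\<close>

lemma ennreal_powr_sum_le:
  assumes K: "finite K" "K \<noteq> {}" and G: "!!k. k \<in> K ==> G k > 0" and q: "q \<ge> 1"
  defines "S \<equiv> (\<Sum>k\<in>K. G k)"
  shows "ennreal_powr (\<Sum>k\<in>K. f k) q \<le>
    (\<Sum>k\<in>K. ennreal (S powr q * (G k / S) / G k powr q) * ennreal_powr (f k) q)"
proof (cases "\<exists>k\<in>K. f k = \<top>")
  case True
  then obtain k where k: "k \<in> K" "f k = \<top>" by blast
  have "S > 0" unfolding S_def using K G by (intro sum_pos) auto
  then have "ennreal (S powr q * (G k / S) / G k powr q) * ennreal_powr (f k) q = \<top>"
    using k G[OF k(1)] by (simp add: ennreal_mult_top)
  then have "(\<Sum>k\<in>K. ennreal (S powr q * (G k / S) / G k powr q) * ennreal_powr (f k) q) = \<top>"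
    using K k by (subst sum.remove[of _ k]) auto
  then show ?thesis by simp
next
  case False
  have S: "S > 0" unfolding S_def using K G by (intro sum_pos) auto
  define g where "g k = enn2real (f k)" for k
  have fg: "f k = ennreal (g k)" "g k \<ge> 0" if "k \<in> K" for k
    using False that by (auto simp: g_def ennreal_enn2real_if)
  have "(\<Sum>k\<in>K. (G k / S) * (g k / G k)) powr q <= (\<Sum>k\<in>K. (G k / S) * (g k / G k) powr q)"
    using K G S q fg by (intro powr_sum_le)
      (auto simp: S_def sum_divide_distrib[symmetric] less_imp_le)
  also have "(\<Sum>k\<in>K. (G k / S) * (g k / G k)) = (\<Sum>k\<in>K. g k) / S"
    using G by (simp add: sum_divide_distrib) (intro sum.cong refl, force)
  finally have "S powr q * ((\<Sum>k\<in>K. g k) / S) powr q <= S powr q * (\<Sum>k\<in>K. (G k / S) * (g k / G k) powr q)"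
    by (intro mult_left_mono) auto
  moreover have "S powr q * ((\<Sum>k\<in>K. g k) / S) powr q = (\<Sum>k\<in>K. g k) powr q"
    using S fg by (subst powr_divide) (auto intro: sum_nonneg)
  moreover have "S powr q * (\<Sum>k\<in>K. (G k / S) * (g k / G k) powr q) =
      (\<Sum>k\<in>K. (S powr q * (G k / S) / G k powr q) * g k powr q)"
    unfolding sum_distrib_left using fg G by (intro sum.cong refl) (simp add: powr_divide less_imp_le)
  ultimately have *: "(\<Sum>k\<in>K. g k) powr q <= (\<Sum>k\<in>K. (S powr q * (G k / S) / G k powr q) * g k powr q)"
    by simp
  have "ennreal_powr (\<Sum>k\<in>K. f k) q = ennreal ((\<Sum>k\<in>K. g k) powr q)"
    using fg by (simp add: ennreal_powr_ennreal sum_nonneg)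
  also have "... <= ennreal (\<Sum>k\<in>K. (S powr q * (G k / S) / G k powr q) * g k powr q)"
    using * by (rule ennreal_leI)
  also have "... = (\<Sum>k\<in>K. ennreal ((S powr q * (G k / S) / G k powr q) * g k powr q))"
    using S by (subst sum_ennreal) (auto intro!: mult_nonneg_nonneg divide_nonneg_nonneg less_imp_le[OF G])
  also have "... = (\<Sum>k\<in>K. ennreal (S powr q * (G k / S) / G k powr q) * ennreal_powr (f k) q)"
    using fg S G by (intro sum.cong refl) (auto simp: ennreal_powr_ennreal ennreal_mult[symmetric] less_imp_le)
  finally show ?thesis .
qed

lemma Minkowski_sum_pos:
  assumes K: "finite K" and f [measurable]: "!!k. k \<in> K ==> f k \<in> borel_measurable M"
    and G: "!!k. k \<in> K ==> G k > 0" and q: "q \<ge> 1"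
    and le: "!!k. k \<in> K ==> (\<integral>\<^sup>+x. ennreal_powr (f k x) q \<partial>M) <= ennreal (G k powr q)"
  shows "(\<integral>\<^sup>+x. ennreal_powr (\<Sum>k\<in>K. f k x) q \<partial>M) <= ennreal ((\<Sum>k\<in>K. G k) powr q)"
proof (cases "K = {}")
  case False
  define S where "S = (\<Sum>k\<in>K. G k)"
  have S: "S > 0" unfolding S_def using K False G by (intro sum_pos) auto
  have "(\<integral>\<^sup>+x. ennreal_powr (\<Sum>k\<in>K. f k x) q \<partial>M) \<le>
    (\<integral>\<^sup>+x. (\<Sum>k\<in>K. ennreal (S powr q * (G k / S) / G k powr q) * ennreal_powr (f k x) q) \<partial>M)"
    unfolding S_def using K False G q by (intro nn_integral_mono ennreal_powr_sum_le)
  also have "... = (\<Sum>k\<in>K. ennreal (S powr q * (G k / S) / G k powr q) * (\<integral>\<^sup>+x. ennreal_powr (f k x) q \<partial>M))"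
    by (subst nn_integral_sum) (auto simp: nn_integral_cmult)
  also have "... <= (\<Sum>k\<in>K. ennreal (S powr q * (G k / S) / G k powr q) * ennreal (G k powr q))"
    by (intro sum_mono mult_left_mono le) auto
  also have "... = (\<Sum>k\<in>K. ennreal (S powr q * (G k / S)))"
    using S G by (intro sum.cong refl) (auto simp: ennreal_mult[symmetric] less_imp_le)
  also have "... = ennreal (\<Sum>k\<in>K. S powr q * (G k / S))"
    using S G by (subst sum_ennreal) (auto simp: less_imp_le)
  also have "(\<Sum>k\<in>K. S powr q * (G k / S)) = S powr q"
    using S by (simp add: sum_distrib_left[symmetric] sum_divide_distrib[symmetric] S_def[symmetric])
  finally show ?thesis by (simp add: S_def)
qed simp

text \<open>Serves to pass from the positive bounds \<open>G k + e\<close> to \<open>G k\<close> in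
  Minkowski's inequality; a vanishing \<open>G k\<close> could not be a denominator in the Jensen
  weights.\<close>

lemma ennreal_le_powr_epsilon:
  assumes "c \<ge> 0" "d \<ge> 0" "q > 0" "!!e. e > 0 ==> X <= ennreal ((c + e * d) powr q)"
  shows "X <= ennreal (c powr q)"
proof -
  have *: "ennreal_powr X (1 / q) <= ennreal (c + e * d)" if "e > 0" for e
  proof -
    have "X <= ennreal_powr (ennreal (c + e * d)) q"
      using assms(1,2) assms(4)[OF that] that ennreal_powr_ennreal[of "c + e * d" q]
      by (simp del: ennreal_plus)
    then show ?thesis using assms(3) by (subst ennreal_powr_le_iff) auto
  qed
  have "ennreal_powr X (1 / q) <= ennreal c"
  proof (rule ennreal_le_epsilon)
    fix e :: real assume "e > 0"
    have "e / (d + 1) * d <= e" using \<open>e > 0\<close> assms(2) by (simp add: field_simps)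
    then have "ennreal (c + e / (d + 1) * d) <= ennreal (c + e)" by (intro ennreal_leI) simp
    moreover have "ennreal_powr X (1 / q) <= ennreal (c + e / (d + 1) * d)"
      using \<open>e > 0\<close> assms(2) by (intro *) (auto intro: divide_pos_pos)
    ultimately have "ennreal_powr X (1 / q) <= ennreal (c + e)" by (rule order_trans[rotated])
    then show "ennreal_powr X (1 / q) <= ennreal c + ennreal e"
      using \<open>e > 0\<close> assms(1) by (simp add: ennreal_plus)
  qed
  then have "X <= ennreal_powr (ennreal c) q" using assms(3) by (subst (asm) ennreal_powr_le_iff) auto
  then show ?thesis using assms(1) by (simp add: ennreal_powr_ennreal)
qed

lemma Minkowski_sum:
  assumes K: "finite K" and f [measurable]: "!!k. k \<in> K ==> f k \<in> borel_measurable M"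
    and G: "!!k. k \<in> K ==> G k \<ge> 0" and q: "q \<ge> 1"
    and le: "!!k. k \<in> K ==> (\<integral>\<^sup>+x. ennreal_powr (f k x) q \<partial>M) <= ennreal (G k powr q)"
  shows "(\<integral>\<^sup>+x. ennreal_powr (\<Sum>k\<in>K. f k x) q \<partial>M) <= ennreal ((\<Sum>k\<in>K. G k) powr q)"
proof (rule ennreal_le_powr_epsilon)
  fix e :: real assume e: "e > 0"
  have "(\<integral>\<^sup>+x. ennreal_powr (\<Sum>k\<in>K. f k x) q \<partial>M) <= ennreal ((\<Sum>k\<in>K. G k + e) powr q)"
  proof (rule Minkowski_sum_pos[OF K f _ q])
    fix k assume k: "k \<in> K"
    show "0 < G k + e" using G[OF k] e by simp
    have "ennreal (G k powr q) <= ennreal ((G k + e) powr q)"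
      using G[OF k] e q by (intro ennreal_leI powr_mono2) auto
    then show "(\<integral>\<^sup>+x. ennreal_powr (f k x) q \<partial>M) <= ennreal ((G k + e) powr q)"
      using order_trans[OF le[OF k]] by blast
  qed
  then show "(\<integral>\<^sup>+x. ennreal_powr (\<Sum>k\<in>K. f k x) q \<partial>M) <= ennreal (((\<Sum>k\<in>K. G k) + e * real (card K)) powr q)"
    by (simp add: sum.distrib mult.commute)
qed (use G q in \<open>auto intro: sum_nonneg\<close>)

lemma Minkowski_suminf:
  fixes f :: "nat => 'a => ennreal"
  assumes f [measurable]: "!!k. f k \<in> borel_measurable M"
    and G: "!!k. G k \<ge> 0" "summable G" and q: "q \<ge> 1"
    and le: "!!k. (\<integral>\<^sup>+x. ennreal_powr (f k x) q \<partial>M) <= ennreal (G k powr q)"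
  shows "(\<integral>\<^sup>+x. ennreal_powr (\<Sum>k. f k x) q \<partial>M) <= ennreal ((\<Sum>k. G k) powr q)"
proof -
  have "(\<integral>\<^sup>+x. ennreal_powr (\<Sum>k. f k x) q \<partial>M) = (\<integral>\<^sup>+x. (SUP n. ennreal_powr (\<Sum>k<n. f k x) q) \<partial>M)"
    using q by (intro nn_integral_cong) (simp add: suminf_eq_SUP ennreal_powr_SUP incseq_sumI)
  also have "... = (SUP n. \<integral>\<^sup>+x. ennreal_powr (\<Sum>k<n. f k x) q \<partial>M)"
    using q by (intro nn_integral_monotone_convergence_SUP)
      (auto simp: incseq_def le_fun_def intro!: ennreal_powr_mono sum_mono2)
  also have "... <= ennreal ((\<Sum>k. G k) powr q)"
  proof (rule SUP_least)
    fix n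
    have "(\<integral>\<^sup>+x. ennreal_powr (\<Sum>k<n. f k x) q \<partial>M) <= ennreal ((\<Sum>k<n. G k) powr q)"
      using assms by (intro Minkowski_sum) auto
    also have "... <= ennreal ((\<Sum>k. G k) powr q)"
      using G q by (intro ennreal_leI powr_mono2 sum_le_suminf) (auto intro: sum_nonneg)
    finally show "(\<integral>\<^sup>+x. ennreal_powr (\<Sum>k<n. f k x) q \<partial>M) <= ennreal ((\<Sum>k. G k) powr q)" .
  qed
  finally show ?thesis .
qed

section \<open>Radonifying norms\<close>

text \<open>Minkowski's inequality in L2 of the Gaussian law, with \<open>bool\<close> as
  two-element index set. It is applied to the norms of the two sums, which are scalar and measurable
  even if the range space is not separable; the halves of \<open>e\<close> make both bounds
  positive.\<close>

lemma rms_gaussian_triangle: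
  "gaussian_rms n (%k. y k + z k) \<le>
   gaussian_rms n y + gaussian_rms n z"
proof (rule field_le_epsilon)
  fix e :: real assume "e > 0"
  let ?P = "gaussian_law n"
  define A where "A = rms_random_sum ?P n y + e / 2"
  define B where "B = rms_random_sum ?P n z + e / 2"
  have AB: "A > 0" "B > 0" using \<open>e > 0\<close> by (auto simp: A_def B_def add_nonneg_pos)
  define f where "f b \<omega> = ennreal (norm (\<Sum>k<n. \<omega> k *\<^sub>R (if b then y k else z k)))" for b \<omega>
  have m: "(%\<omega>. norm (\<Sum>k<n. \<omega> k *\<^sub>R w k)) \<in> borel_measurable ?P" for w :: "nat => 'a"
    using norm_sum_measurable[of n "%k \<omega>. \<omega> k" ?P 0 w] gaussian_law_coord by simp
  have rA: "gauss_sq n y 0 <= ennreal (A\<^sup>2)" "gauss_sq n z 0 <= ennreal (B\<^sup>2)"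
    using AB \<open>e > 0\<close> by (auto simp: rms_gaussian_le_iff[symmetric] A_def B_def)
  have "(\<integral>\<^sup>+\<omega>. ennreal_powr (\<Sum>b\<in>UNIV. f b \<omega>) 2 \<partial>?P) <= ennreal ((\<Sum>b\<in>UNIV. if b then A else B) powr 2)"
    using AB rA m by (intro Minkowski_sum_pos)
      (auto simp: f_def ennreal_powr_2 gauss_sq_def[symmetric] gauss_sq_def)
  also have "... = ennreal ((A + B)\<^sup>2)" using AB by (simp add: UNIV_bool)
  finally have 1: "(\<integral>\<^sup>+\<omega>. ennreal_powr (\<Sum>b\<in>UNIV. f b \<omega>) 2 \<partial>?P) <= ennreal ((A + B)\<^sup>2)" .
  have "gauss_sq n (%k. y k + z k) 0 <= (\<integral>\<^sup>+\<omega>. ennreal_powr (\<Sum>b\<in>UNIV. f b \<omega>) 2 \<partial>?P)"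
    unfolding gauss_sq_def
  proof (intro nn_integral_mono)
    fix \<omega>
    have "norm (\<Sum>k<n. \<omega> k *\<^sub>R (y k + z k)) <= norm (\<Sum>k<n. \<omega> k *\<^sub>R y k) + norm (\<Sum>k<n. \<omega> k *\<^sub>R z k)"
      by (simp add: scaleR_add_right sum.distrib norm_triangle_ineq)
    then have "(norm (\<Sum>k<n. \<omega> k *\<^sub>R (y k + z k)))\<^sup>2 <= (norm (\<Sum>k<n. \<omega> k *\<^sub>R y k) + norm (\<Sum>k<n. \<omega> k *\<^sub>R z k))\<^sup>2"
      by (intro power_mono) auto
    then show "ennreal ((norm (0 + (\<Sum>k<n. \<omega> k *\<^sub>R (y k + z k))))\<^sup>2) <= ennreal_powr (\<Sum>b\<in>UNIV. f b \<omega>) 2"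
      by (simp add: f_def UNIV_bool ennreal_plus[symmetric] ennreal_powr_2 ennreal_leI add.commute del: ennreal_plus)
  qed
  with 1 have "gauss_sq n (%k. y k + z k) 0 <= ennreal ((A + B)\<^sup>2)" by simp
  then have "rms_random_sum ?P n (%k. y k + z k) <= A + B"
    using AB by (simp add: rms_gaussian_le_iff)
  then show "rms_random_sum ?P n (%k. y k + z k) <= rms_random_sum ?P n y + rms_random_sum ?P n z + e"
    by (simp add: A_def B_def)
qed

lemma rms_gaussian_zero [simp]: "rms_random_sum P n (%k. 0) = 0"
  by (simp add: rms_random_sum_def)

lemma rms_gaussian_sum:
  "finite J ==> gaussian_rms n (%k. \<Sum>j\<in>J. y j k) \<le>
    (\<Sum>j\<in>J. gaussian_rms n (y j))"
proof (induction J rule: finite_induct)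
  case (insert j J)
  have "gaussian_rms n (%k. \<Sum>i\<in>insert j J. y i k) =
     gaussian_rms n (%k. y j k + (\<Sum>i\<in>J. y i k))"
    using insert by (simp add: rms_random_sum_def)
  also have "... <= gaussian_rms n (y j) + (\<Sum>i\<in>J. gaussian_rms n (y i))"
    using insert by (intro order_trans[OF rms_gaussian_triangle]) auto
  finally show ?case using insert by simp
qed simp

section \<open>Complex scalars in random sums\<close>

lemma scaleR_scaleC_commute: "a *\<^sub>R (c *\<^sub>C x) = c *\<^sub>C (a *\<^sub>R (x::'x::complex_banach))"
  by (simp add: scaleC_of_real[symmetric] scaleC_scaleC mult.commute)

lemma scaleC_zero [simp]: "c *\<^sub>C (0::'x::complex_vector) = 0" "0 *\<^sub>C (x::'x) = 0"
  using scaleC_add_right[of c "0::'x" 0] scaleC_add_left[of 0 0 x] by auto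

lemma scaleC_minus: "c *\<^sub>C (- (x::'x::complex_vector)) = - (c *\<^sub>C x)" "(- c) *\<^sub>C x = - (c *\<^sub>C x)"
proof -
  have "c *\<^sub>C (- x) + c *\<^sub>C x = 0" by (simp add: scaleC_add_right[symmetric])
  then show "c *\<^sub>C (- x) = - (c *\<^sub>C x)" by (simp add: eq_neg_iff_add_eq_0)
  have "(- c) *\<^sub>C x + c *\<^sub>C x = 0" by (simp add: scaleC_add_left[symmetric])
  then show "(- c) *\<^sub>C x = - (c *\<^sub>C x)" by (simp add: eq_neg_iff_add_eq_0)
qed

lemma scaleC_diff_right: "c *\<^sub>C (x - y :: 'x::complex_vector) = c *\<^sub>C x - c *\<^sub>C y"
  using scaleC_add_right[of c x "- y"] by (simp add: scaleC_minus)

lemma scaleC_sum_right: "c *\<^sub>C (\<Sum>k\<in>K. f k :: 'x::complex_vector) = (\<Sum>k\<in>K. c *\<^sub>C f k)"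
  by (induction K rule: infinite_finite_induct) (auto simp: scaleC_add_right)

lemma scaleC_sum_left: "(\<Sum>k\<in>K. c k) *\<^sub>C (x :: 'x::complex_vector) = (\<Sum>k\<in>K. c k *\<^sub>C x)"
  by (induction K rule: infinite_finite_induct) (auto simp: scaleC_add_left)

lemma rms_random_sum_scaleC:
  fixes y :: "nat => 'x::complex_banach"
  shows "rms_random_sum P n (%k. c *\<^sub>C y k) = cmod c * rms_random_sum P n y"
proof -
  have "norm (\<Sum>k<n. \<omega> k *\<^sub>R c *\<^sub>C y k) = cmod c * norm (\<Sum>k<n. \<omega> k *\<^sub>R y k)" for \<omega> :: "nat => real"
    by (simp add: scaleR_scaleC_commute scaleC_sum_right[symmetric] norm_scaleC)
  then show ?thesis
    by (simp add: rms_random_sum_def power_mult_distrib real_sqrt_mult)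
qed

lemma rms_random_sum_scaleC_left:
  fixes x :: "'x::complex_banach"
  shows "rms_random_sum P n (%k. c k *\<^sub>C x) = rms_random_sum P n c * norm x"
proof -
  have "norm (\<Sum>k<n. \<omega> k *\<^sub>R c k *\<^sub>C x) = norm (\<Sum>k<n. \<omega> k *\<^sub>R c k) * norm x" for \<omega> :: "nat => real"
  proof -
    have "(\<Sum>k<n. \<omega> k *\<^sub>R c k *\<^sub>C x) = (\<Sum>k<n. \<omega> k *\<^sub>R c k) *\<^sub>C x"
      unfolding scaleC_sum_left
      by (intro sum.cong refl) (simp add: scaleC_of_real[symmetric, where 'a='x] scaleC_scaleC scaleR_conv_of_real)
    then show ?thesis by (simp add: norm_scaleC)
  qed
  then show ?thesis
    by (simp add: rms_random_sum_def power_mult_distrib real_sqrt_mult)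
qed

lemma gauss_sq_const_zero: "gauss_sq n (%k. 0) x = ennreal ((norm x)\<^sup>2)"
  using prob_space.emeasure_space_1[OF prob_space_gaussian_law[of n]] by (simp add: gauss_sq_def)

lemma gauss_sq_single:
  "gauss_sq (Suc n) (%k. if k = n then y else 0) 0 = ennreal ((norm y)\<^sup>2)"
proof -
  have e: "gauss_sq n (%k. if k = n then y else 0) x = ennreal ((norm x)\<^sup>2)" for x
    using gauss_sq_cong[of n "%k. if k = n then y else 0" "%k. 0" x] by (simp add: gauss_sq_const_zero)
  have "gauss_sq (Suc n) (%k. if k = n then y else 0) 0 = (\<integral>\<^sup>+t. ennreal ((norm y)\<^sup>2) * ennreal (t\<^sup>2) \<partial>std_normal_distribution)"
    by (simp add: gauss_sq_Suc e power_mult_distrib ennreal_mult[symmetric] mult.commute)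
  also have "... = ennreal ((norm y)\<^sup>2)"
    using std_normal_second_moment by (simp add: nn_integral_cmult)
  finally show ?thesis .
qed

lemma rms_gaussian_1: "gaussian_rms 1 y = norm (y 0)"
proof -
  have "gauss_sq 1 y 0 = ennreal ((norm (y 0))\<^sup>2)"
    using gauss_sq_single[of 0 "y 0"] gauss_sq_cong[of 1 y "%k. if k = 0 then y 0 else 0" 0] by simp
  then have "ennreal ((gaussian_rms 1 y)\<^sup>2) = ennreal ((norm (y 0))\<^sup>2)"
    by (simp add: rms_gaussian_sq)
  then show ?thesis by (simp add: power2_eq_iff_nonneg)
qed

lemma rms_gaussian_le_sum: "gaussian_rms n y <= (\<Sum>k<n. norm (y k))"
proof (induction n)
  case (Suc n)
  let ?y = "%k. if k = n then 0 else y k" and ?z = "%k. if k = n then y n else 0"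
  have "rms_random_sum (gaussian_law (Suc n)) (Suc n) y =
      rms_random_sum (gaussian_law (Suc n)) (Suc n) (%k. ?y k + ?z k)"
    by (intro arg_cong[where f="rms_random_sum _ _"]) auto
  also have "... <= rms_random_sum (gaussian_law (Suc n)) (Suc n) ?y + rms_random_sum (gaussian_law (Suc n)) (Suc n) ?z"
    by (rule rms_gaussian_triangle)
  also have "rms_random_sum (gaussian_law (Suc n)) (Suc n) ?z = norm (y n)"
    using rms_gaussian_sq[of "Suc n" ?z] gauss_sq_single[of n "y n"] by (simp add: power2_eq_iff_nonneg)
  also have "rms_random_sum (gaussian_law (Suc n)) (Suc n) ?y <= gaussian_rms n y"
    unfolding rms_gaussian_mono_iff
    using gauss_sq_cong[of n ?y y] std_normal.emeasure_space_1 by (simp add: gauss_sq_Suc)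
  finally show ?case using Suc by simp
qed (simp add: rms_random_sum_def)

text \<open>In the complex plane the parallelogram identity cancels the cross terms when
  \<open>t\<close> and \<open>- t\<close> are averaged, so each coefficient adds the square of its
  modulus.\<close>

lemma gauss_sq_complex_le: "gauss_sq n c x <= ennreal ((cmod x)\<^sup>2 + (\<Sum>k<n. (cmod (c k))\<^sup>2))"
proof (induction n arbitrary: x)
  case (Suc n)
  let ?N = std_normal_distribution
  let ?b = "\<Sum>k<n. (cmod (c k))\<^sup>2"
  have "2 * gauss_sq (Suc n) c x = (\<integral>\<^sup>+t. gauss_sq n c (x + t *\<^sub>R c n) \<partial>?N) + (\<integral>\<^sup>+t. gauss_sq n c (x - t *\<^sub>R c n) \<partial>?N)"
    by (simp add: gauss_sq_reflect_integral[symmetric] gauss_sq_Suc mult_2)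
  also have "... = (\<integral>\<^sup>+t. gauss_sq n c (x + t *\<^sub>R c n) + gauss_sq n c (x - t *\<^sub>R c n) \<partial>?N)"
    using gauss_sq_measurable1[of "%t. t" ?N n c x "c n"] gauss_sq_measurable1[of "%t. - t" ?N n c x "c n"]
    by (intro nn_integral_add[symmetric]) simp_all
  also have "... <= (\<integral>\<^sup>+t. 2 * (ennreal ((cmod x)\<^sup>2 + ?b) + ennreal ((cmod (c n))\<^sup>2) * ennreal (t\<^sup>2)) \<partial>?N)"
  proof (intro nn_integral_mono order_trans[OF add_mono[OF Suc.IH Suc.IH]])
    fix t
    have "(cmod (x + t *\<^sub>R c n))\<^sup>2 + (cmod (x - t *\<^sub>R c n))\<^sup>2 = 2 * ((cmod x)\<^sup>2 + (cmod (c n))\<^sup>2 * t\<^sup>2)"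
      unfolding cmod_power2 by (simp add: power2_eq_square algebra_simps)
    then show "ennreal ((cmod (x + t *\<^sub>R c n))\<^sup>2 + ?b) + ennreal ((cmod (x - t *\<^sub>R c n))\<^sup>2 + ?b)
       <= 2 * (ennreal ((cmod x)\<^sup>2 + ?b) + ennreal ((cmod (c n))\<^sup>2) * ennreal (t\<^sup>2))"
      by (simp add: ennreal_plus[symmetric] ennreal_mult[symmetric] ennreal_numeral[symmetric] sum_nonneg
          del: ennreal_plus ennreal_numeral)
  qed
  also have "... = 2 * (ennreal ((cmod x)\<^sup>2 + ?b) + ennreal ((cmod (c n))\<^sup>2))"
    using std_normal_second_moment std_normal.emeasure_space_1
    by (simp add: nn_integral_cmult nn_integral_add)
  also have "... = 2 * ennreal ((cmod x)\<^sup>2 + (\<Sum>k<Suc n. (cmod (c k))\<^sup>2))"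
    by (simp add: ennreal_plus[symmetric] sum_nonneg add.assoc del: ennreal_plus)
  finally show ?case by (simp add: ennreal_mult_le_mult_iff)
qed simp

lemma rms_gaussian_complex_le: "gaussian_rms n c <= sqrt (\<Sum>k<n. (cmod (c k))\<^sup>2)"
  using gauss_sq_complex_le[of n c 0] by (simp add: rms_gaussian_le_iff sum_nonneg)

section \<open>Square-integrable functions and Bessel's inequality\<close>

lemma borel_measurable_cnj [measurable (raw)]:
  "f \<in> borel_measurable M ==> (%x. cnj (f x)) \<in> borel_measurable M"
  by (rule borel_measurable_continuous_on[where f=cnj]) (auto intro: continuous_intros)

lemma cmod_sq_add_le: "(cmod (a + b))\<^sup>2 <= 2 * (cmod a)\<^sup>2 + 2 * (cmod b)\<^sup>2"
proof -
  have "(cmod (a + b))\<^sup>2 <= (cmod a + cmod b)\<^sup>2" by (intro power_mono norm_triangle_ineq) auto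
  then show ?thesis using sum_squares_bound[of "cmod a" "cmod b"] by (simp add: power2_sum)
qed

lemma L2_functions_add:
  assumes "g \<in> L2_functions N" "h \<in> L2_functions N"
  shows "(%p. g p + h p) \<in> L2_functions N"
proof -
  have [measurable]: "g \<in> borel_measurable N" "h \<in> borel_measurable N"
    and i: "integrable N (%p. (cmod (g p))\<^sup>2)" "integrable N (%p. (cmod (h p))\<^sup>2)"
    using assms by (auto simp: L2_functions_def)
  have "integrable N (%p. (cmod (g p + h p))\<^sup>2)"
    by (rule Bochner_Integration.integrable_bound[where f="%p. 2 * (cmod (g p))\<^sup>2 + 2 * (cmod (h p))\<^sup>2"])
      (use i cmod_sq_add_le in auto)
  then show ?thesis by (auto simp: L2_functions_def)
qed

lemma L2_functions_scale: "g \<in> L2_functions N ==> (%p. c * g p) \<in> L2_functions N"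
  by (auto simp: L2_functions_def norm_mult power_mult_distrib)

lemma L2_functions_zero: "(%p. 0) \<in> L2_functions N"
  by (auto simp: L2_functions_def)

lemma L2_functions_bound:
  assumes "h \<in> L2_functions N" and [measurable]: "g \<in> borel_measurable N" and le: "!!p. cmod (g p) <= cmod (h p)"
  shows "g \<in> L2_functions N"
proof -
  have "integrable N (%p. (cmod (g p))\<^sup>2)"
    by (rule Bochner_Integration.integrable_bound[where f="%p. (cmod (h p))\<^sup>2"])
      (use assms in \<open>auto simp: L2_functions_def intro!: power_mono\<close>)
  then show ?thesis by (simp add: L2_functions_def)
qed

lemma L2_functions_indicator:
  assumes "h \<in> L2_functions N" "K \<in> sets N"
  shows "(%p. indicator K p * h p) \<in> L2_functions N"
  by (rule L2_functions_bound[OF assms(1)]) (use assms in \<open>auto simp: L2_functions_def indicator_def\<close>)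

lemma L2_functions_sum:
  "(!!k. k \<in> K ==> f k \<in> L2_functions N) ==> (%p. \<Sum>k\<in>K. f k p) \<in> L2_functions N"
  by (induction K rule: infinite_finite_induct) (auto simp: L2_functions_zero intro: L2_functions_add)

lemma L2_inner_integrable:
  assumes "g \<in> L2_functions N" "h \<in> L2_functions N"
  shows "integrable N (%p. g p * cnj (h p))"
proof -
  have [measurable]: "g \<in> borel_measurable N" "h \<in> borel_measurable N"
    using assms by (auto simp: L2_functions_def)
  show ?thesis
  proof (rule Bochner_Integration.integrable_bound[where f="%p. (cmod (g p))\<^sup>2 + (cmod (h p))\<^sup>2"])
    show "AE p in N. norm (g p * cnj (h p)) <= norm ((cmod (g p))\<^sup>2 + (cmod (h p))\<^sup>2)"
    proof (intro AE_I2)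
      fix p
      have "cmod (g p) * cmod (h p) <= (cmod (g p))\<^sup>2 + (cmod (h p))\<^sup>2"
        using sum_squares_bound[of "cmod (g p)" "cmod (h p)"] mult_nonneg_nonneg[OF norm_ge_zero[of "g p"] norm_ge_zero[of "h p"]]
        by linarith
      then show "norm (g p * cnj (h p)) <= norm ((cmod (g p))\<^sup>2 + (cmod (h p))\<^sup>2)"
        by (simp add: norm_mult)
    qed
  qed (use assms in \<open>auto simp: L2_functions_def\<close>)
qed

lemma L2_inner_add_left:
  "\<lbrakk>f \<in> L2_functions N; g \<in> L2_functions N; h \<in> L2_functions N\<rbrakk> \<Longrightarrow>
    L2_inner N (%p. f p + g p) h = L2_inner N f h + L2_inner N g h"
  by (simp add: L2_inner_def distrib_right L2_inner_integrable)

lemma L2_inner_scale_left: "L2_inner N (%p. c * f p) h = c * L2_inner N f h"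
  by (simp add: L2_inner_def mult.assoc)

lemma L2_inner_sum_left:
  assumes "h \<in> L2_functions N" "!!k. k \<in> K ==> f k \<in> L2_functions N"
  shows "L2_inner N (%p. \<Sum>k\<in>K. f k p) h = (\<Sum>k\<in>K. L2_inner N (f k) h)"
  using assms by (simp add: L2_inner_def sum_distrib_right L2_inner_integrable)

lemma L2_inner_commute: "L2_inner N g h = cnj (L2_inner N h g)"
proof -
  have "cnj (L2_inner N h g) = (\<integral>p. cnj (h p * cnj (g p)) \<partial>N)"
    unfolding L2_inner_def by (rule Bochner_Integration.integral_cnj[symmetric])
  then show ?thesis by (simp add: L2_inner_def mult.commute del: Bochner_Integration.integral_cnj)
qed

lemma L2_inner_scale_right: "L2_inner N f (%p. c * h p) = cnj c * L2_inner N f h"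
  by (subst (1 2) L2_inner_commute) (simp add: L2_inner_scale_left)

lemma L2_inner_sum_right:
  assumes "h \<in> L2_functions N" "!!k. k \<in> K ==> f k \<in> L2_functions N"
  shows "L2_inner N h (%p. \<Sum>k\<in>K. f k p) = (\<Sum>k\<in>K. L2_inner N h (f k))"
  by (subst (1 2) L2_inner_commute) (simp add: L2_inner_sum_left assms cnj_sum)

definition L2_norm :: "'a measure => ('a => complex) => real" where
  "L2_norm N h = sqrt (\<integral>p. (cmod (h p))\<^sup>2 \<partial>N)"

lemma L2_norm_nonneg [simp]: "0 <= L2_norm N h"
  by (simp add: L2_norm_def)

lemma L2_inner_self: "L2_inner N h h = of_real ((L2_norm N h)\<^sup>2)"
proof -
  have "L2_inner N h h = (\<integral>p. of_real ((cmod (h p))\<^sup>2) \<partial>N)"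
    unfolding L2_inner_def complex_norm_square ..
  also have "... = of_real (\<integral>p. (cmod (h p))\<^sup>2 \<partial>N)" by (rule integral_complex_of_real)
  finally show ?thesis by (simp add: L2_norm_def)
qed

lemma L2_norm_scale: "L2_norm N (%p. c * h p) = cmod c * L2_norm N h"
  by (simp add: L2_norm_def norm_mult power_mult_distrib real_sqrt_mult)

lemma L2_norm_zero_AE:
  assumes "h \<in> L2_functions N" "L2_norm N h = 0"
  shows "AE p in N. h p = 0"
proof -
  have "integrable N (%p. (cmod (h p))\<^sup>2)" "(\<integral>p. (cmod (h p))\<^sup>2 \<partial>N) = 0"
    using assms by (auto simp: L2_functions_def L2_norm_def)
  then have "AE p in N. (cmod (h p))\<^sup>2 = 0" by (subst (asm) integral_nonneg_eq_0_iff_AE) auto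
  then show ?thesis by auto
qed

lemma Bessel_inequality:
  assumes on: "orthonormal_system N D n h" and D: "D \<subseteq> L2_functions N" and g: "g \<in> L2_functions N"
  shows "(\<Sum>k<n. (cmod (L2_inner N (h k) g))\<^sup>2) <= (L2_norm N g)\<^sup>2"
proof -
  have h: "h k \<in> L2_functions N" if "k < n" for k using on D that by (auto simp: orthonormal_system_def)
  have hh: "L2_inner N (h j) (h k) = (if j = k then 1 else 0)" if "j < n" "k < n" for j k
    using on that by (auto simp: orthonormal_system_def)
  \<comment> \<open>The minus sign makes \<open>d\<close> the residual of the orthogonal projection
    of \<open>g\<close> while only additivity of the inner product is invoked.\<close>
  define c where "c k = - L2_inner N g (h k)" for k
  define s where "s = (%p. \<Sum>k<n. c k * h k p)"
  have s: "s \<in> L2_functions N" unfolding s_def by (intro L2_functions_sum L2_functions_scale h) auto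
  define d where "d p = g p + s p" for p
  have d: "d \<in> L2_functions N" unfolding d_def by (intro L2_functions_add g s)
  have sh: "L2_inner N s (h j) = c j" if "j < n" for j
  proof -
    have "L2_inner N s (h j) = (\<Sum>k<n. c k * L2_inner N (h k) (h j))"
      unfolding s_def by (subst L2_inner_sum_left) (auto simp: h that L2_inner_scale_left intro!: L2_functions_scale h)
    also have "... = (\<Sum>k<n. if k = j then c j else 0)"
      using that by (intro sum.cong refl) (auto simp: hh)
    finally show ?thesis using that by simp
  qed
  have dh: "L2_inner N d (h j) = 0" if "j < n" for j
    using sh[OF that] unfolding d_def by (subst L2_inner_add_left) (auto simp: g s h that c_def)
  have ds: "L2_inner N d s = 0"
  proof -
    have "L2_inner N d s = (\<Sum>k<n. cnj (c k) * L2_inner N d (h k))"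
      unfolding s_def by (subst L2_inner_sum_right) (auto simp: d L2_inner_scale_right intro!: L2_functions_scale h)
    then show ?thesis by (simp add: dh)
  qed
  have "of_real ((L2_norm N d)\<^sup>2) = L2_inner N d g"
  proof -
    have "L2_inner N (%p. g p + s p) d = L2_inner N g d + L2_inner N s d"
      by (rule L2_inner_add_left[OF g s d])
    then have "L2_inner N d d = cnj (L2_inner N d g) + cnj (L2_inner N d s)"
      unfolding d_def[symmetric] using L2_inner_commute[of N g d] L2_inner_commute[of N s d] by simp
    then have "L2_inner N d d = cnj (L2_inner N d g)" using ds by simp
    then have "cnj (L2_inner N d d) = L2_inner N d g" by simp
    then show ?thesis by (simp add: L2_inner_self)
  qed
  also have "... = L2_inner N g g + L2_inner N s g"
    unfolding d_def by (rule L2_inner_add_left) (auto simp: g s)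
  also have "L2_inner N s g = - (\<Sum>k<n. of_real ((cmod (L2_inner N (h k) g))\<^sup>2))"
  proof -
    have "L2_inner N s g = (\<Sum>k<n. c k * L2_inner N (h k) g)"
      unfolding s_def by (subst L2_inner_sum_left) (auto simp: g L2_inner_scale_left intro!: L2_functions_scale h)
    also have "... = (\<Sum>k<n. - of_real ((cmod (L2_inner N (h k) g))\<^sup>2))"
      by (intro sum.cong refl) (simp only: c_def L2_inner_commute[of N g] complex_norm_square, simp)
    finally show ?thesis by (simp add: sum_negf)
  qed
  finally have "of_real ((L2_norm N d)\<^sup>2) = complex_of_real ((L2_norm N g)\<^sup>2 - (\<Sum>k<n. (cmod (L2_inner N (h k) g))\<^sup>2))"
    by (simp add: L2_inner_self)
  then have "(L2_norm N d)\<^sup>2 = (L2_norm N g)\<^sup>2 - (\<Sum>k<n. (cmod (L2_inner N (h k) g))\<^sup>2)"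
    by (simp only: of_real_eq_iff)
  then show ?thesis using zero_le_power2[of "L2_norm N d"] by linarith
qed

text \<open>The estimates for the radonifying norm use only that the domain is linear and stable
  under multiplication by indicators. The domain stays a parameter because the supremum in
  \<open>gamma_norm\<close> runs over orthonormal systems inside it; it is later instantiated with
  the compactly supported functions.\<close>

locale L2_domain =
  fixes N :: "'a measure" and D :: "('a => complex) set"
  assumes D_L2: "D \<subseteq> L2_functions N"
    and D_zero: "(%p. 0) \<in> D"
    and D_add: "g \<in> D ==> h \<in> D ==> g + h \<in> D"
    and D_scale: "h \<in> D ==> (%p. c * h p) \<in> D"
    and D_indicator: "K \<in> sets N ==> h \<in> D ==> (%p. indicator K p * h p) \<in> D"
begin

lemma D_add': "g \<in> D ==> h \<in> D ==> (%p. g p + h p) \<in> D"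
  using D_add[of g h] by (simp add: plus_fun_def)

lemma D_sum: "(!!k. k \<in> K ==> f k \<in> D) ==> (%p. \<Sum>k\<in>K. f k p) \<in> D"
  by (induction K rule: infinite_finite_induct) (auto simp: D_zero intro: D_add')

lemma operator_add: "L2_operator N D u ==> g \<in> D ==> h \<in> D ==> u (%p. g p + h p) = u g + u h"
proof -
  assume "L2_operator N D u" "g \<in> D" "h \<in> D"
  then have "u (g + h) = u g + u h" unfolding L2_operator_def by blast
  then show ?thesis unfolding plus_fun_def[of g h] .
qed

lemma operator_scale: "L2_operator N D u ==> h \<in> D ==> u (%p. c * h p) = c *\<^sub>C u h"
  unfolding L2_operator_def by blast

lemma operator_zero: "L2_operator N D u ==> u (%p. 0) = 0"
  using operator_scale[of u "%p. 0" 0] D_zero by simp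

lemma operator_sum:
  "L2_operator N D u ==> (!!k. k \<in> K ==> f k \<in> D) ==> u (%p. \<Sum>k\<in>K. f k p) = (\<Sum>k\<in>K. u (f k))"
  by (induction K rule: infinite_finite_induct) (auto simp: operator_zero operator_add[OF _ _ D_sum])

lemma operator_cong:
  "L2_operator N D u ==> g \<in> D ==> h \<in> D ==> (AE p in N. g p = h p) ==> u g = u h"
  unfolding L2_operator_def by blast

lemma operator_plus: "L2_operator N D u ==> g \<in> D ==> h \<in> D ==> u (g + h) = u g + u h"
  unfolding L2_operator_def by blast

lemma L2_operatorI:
  assumes "!!g h. g \<in> D ==> h \<in> D ==> u (g + h) = u g + u h"
    and "!!c h. h \<in> D ==> u (%p. c * h p) = c *\<^sub>C u h"
    and "!!g h. g \<in> D ==> h \<in> D ==> AE p in N. g p = h p ==> u g = u h"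
  shows "L2_operator N D u"
  using assms unfolding L2_operator_def by blast

lemma L2_operator_add:
  assumes "L2_operator N D u" "L2_operator N D v" shows "L2_operator N D (u + v)"
proof (rule L2_operatorI)
  fix g h assume "g \<in> D" "h \<in> D"
  then show "(u + v) (g + h) = (u + v) g + (u + v) h"
    unfolding plus_fun_apply[of u v] operator_plus[OF assms(1) \<open>g \<in> D\<close> \<open>h \<in> D\<close>] operator_plus[OF assms(2) \<open>g \<in> D\<close> \<open>h \<in> D\<close>]
    by (simp only: ac_simps)
next
  fix c h assume "h \<in> D"
  then show "(u + v) (%p. c * h p) = c *\<^sub>C (u + v) h"
    unfolding plus_fun_apply[of u v] operator_scale[OF assms(1) \<open>h \<in> D\<close>] operator_scale[OF assms(2) \<open>h \<in> D\<close>]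
    by (simp only: scaleC_add_right)
next
  fix g h assume *: "g \<in> D" "h \<in> D" "AE p in N. g p = h p"
  show "(u + v) g = (u + v) h"
    unfolding plus_fun_apply[of u v] operator_cong[OF assms(1) *] operator_cong[OF assms(2) *] by (rule refl)
qed

lemma L2_operator_scaleC:
  assumes "L2_operator N D u" shows "L2_operator N D (c *\<^sub>C u)"
proof (rule L2_operatorI)
  fix g h assume "g \<in> D" "h \<in> D"
  show "(c *\<^sub>C u) (g + h) = (c *\<^sub>C u) g + (c *\<^sub>C u) h"
    unfolding scaleC_fun_def operator_plus[OF assms(1) \<open>g \<in> D\<close> \<open>h \<in> D\<close>] by (rule scaleC_add_right)
next
  fix a h assume "h \<in> D"
  then show "(c *\<^sub>C u) (%p. a * h p) = a *\<^sub>C (c *\<^sub>C u) h"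
    unfolding scaleC_fun_def operator_scale[OF assms(1) \<open>h \<in> D\<close>] by (simp only: scaleC_scaleC mult.commute)
next
  fix g h assume *: "g \<in> D" "h \<in> D" "AE p in N. g p = h p"
  show "(c *\<^sub>C u) g = (c *\<^sub>C u) h"
    unfolding scaleC_fun_def operator_cong[OF assms(1) *] by (rule refl)
qed

lemma L2_operator_restrict:
  assumes "L2_operator N D u" "K \<in> sets N" shows "L2_operator N D (restrict_operator u K)"
  unfolding restrict_operator_def
proof (rule L2_operatorI)
  fix g h assume *: "g \<in> D" "h \<in> D"
  show "u (%p. indicator K p * (g + h) p) = u (%p. indicator K p * g p) + u (%p. indicator K p * h p)"
    using operator_add[OF assms(1) D_indicator[OF assms(2) *(1)] D_indicator[OF assms(2) *(2)]]
    by (simp add: distrib_left)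
next
  fix g h assume *: "g \<in> D" "h \<in> D" and "AE p in N. g p = h p"
  then have "AE p in N. indicator K p * g p = indicator K p * h p" by auto
  then show "u (%p. indicator K p * g p) = u (%p. indicator K p * h p)"
    by (intro operator_cong[OF assms(1)] D_indicator assms *)
next
  fix c h assume *: "h \<in> D"
  show "u (%p. indicator K p * (c * h p)) = c *\<^sub>C u (%p. indicator K p * h p)"
    using operator_scale[OF assms(1) D_indicator[OF assms(2) *], of c] by (simp only: mult.left_commute)
qed

lemma gamma_norm_le_iff:
  "gamma_norm N D u <= c \<longleftrightarrow> (\<forall>n h. orthonormal_system N D n h \<longrightarrow>
     ennreal (gaussian_rms n (%k. u (h k))) <= c)"
  by (auto simp: gamma_norm_def SUP_le_iff)

lemma gamma_norm_upper:
  "orthonormal_system N D n h ==> ennreal (gaussian_rms n (%k. u (h k))) <= gamma_norm N D u"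
  using gamma_norm_le_iff by blast

lemma gamma_norm_cong: "(!!h. h \<in> D ==> u h = v h) ==> gamma_norm N D u = gamma_norm N D v"
  unfolding gamma_norm_def
proof (intro SUP_cong refl)
  fix z assume eq: "!!h. h \<in> D ==> u h = v h" and z: "z \<in> {(n, h). orthonormal_system N D n h}"
  obtain n h where zh: "z = (n, h)" by (cases z)
  have "u (h k) = v (h k)" if "k < n" for k using z that eq by (auto simp: zh orthonormal_system_def)
  then have "(\<Sum>k<n. \<omega> k *\<^sub>R u (h k)) = (\<Sum>k<n. \<omega> k *\<^sub>R v (h k))" for \<omega> :: "nat => real" by simp
  then show "(case z of (n, h) => ennreal (gaussian_rms n (%k. u (h k)))) =
      (case z of (n, h) => ennreal (gaussian_rms n (%k. v (h k))))"
    by (simp add: zh rms_random_sum_def)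
qed

lemma gamma_norm_add: "gamma_norm N D (u + v) <= gamma_norm N D u + gamma_norm N D v"
  unfolding gamma_norm_le_iff
proof (intro allI impI)
  fix n h assume on: "orthonormal_system N D n h"
  have "ennreal (gaussian_rms n (%k. (u + v) (h k))) \<le>
    ennreal (gaussian_rms n (%k. u (h k))) + ennreal (gaussian_rms n (%k. v (h k)))"
    by (simp add: ennreal_plus[symmetric] rms_gaussian_triangle ennreal_leI del: ennreal_plus)
  also have "... <= gamma_norm N D u + gamma_norm N D v" by (intro add_mono gamma_norm_upper on)
  finally show "ennreal (gaussian_rms n (%k. (u + v) (h k))) <= ..." .
qed

lemma gamma_norm_zero [simp]: "gamma_norm N D 0 = 0"
  using gamma_norm_le_iff[of 0 0] by (simp add: rms_random_sum_def)

lemma gamma_norm_scaleC_le: "gamma_norm N D (c *\<^sub>C u) <= ennreal (cmod c) * gamma_norm N D u"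
  unfolding gamma_norm_le_iff
proof (intro allI impI)
  fix n h assume on: "orthonormal_system N D n h"
  have "ennreal (gaussian_rms n (%k. (c *\<^sub>C u) (h k))) =
    ennreal (cmod c) * ennreal (gaussian_rms n (%k. u (h k)))"
    by (simp add: scaleC_fun_def rms_random_sum_scaleC ennreal_mult)
  also have "... <= ennreal (cmod c) * gamma_norm N D u" by (intro mult_left_mono gamma_norm_upper on) auto
  finally show "ennreal (gaussian_rms n (%k. (c *\<^sub>C u) (h k))) <= ..." .
qed

lemma gamma_norm_scaleC: "gamma_norm N D (c *\<^sub>C u) = ennreal (cmod c) * gamma_norm N D u"
proof (cases "c = 0")
  case True
  then show ?thesis using gamma_norm_scaleC_le[of 0 u] by simp
next
  case False
  have "u = inverse c *\<^sub>C c *\<^sub>C u" using False by (simp add: scaleC_scaleC scaleC_one)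
  then have "gamma_norm N D u <= ennreal (cmod (inverse c)) * gamma_norm N D (c *\<^sub>C u)"
    using gamma_norm_scaleC_le[of "inverse c" "c *\<^sub>C u"] by simp
  then have "ennreal (cmod c) * gamma_norm N D u <= ennreal (cmod c) * (ennreal (cmod (inverse c)) * gamma_norm N D (c *\<^sub>C u))"
    by (intro mult_left_mono) auto
  also have "... = gamma_norm N D (c *\<^sub>C u)"
    using False by (simp add: mult.assoc[symmetric] ennreal_mult[symmetric] norm_inverse)
  finally show ?thesis using gamma_norm_scaleC_le[of c u] by (intro antisym)
qed

lemma gamma_norm_minus: "gamma_norm N D (- u) = gamma_norm N D u"
  using gamma_norm_scaleC[of "-1" u] by (simp add: scaleC_minus scaleC_one)

lemma gamma_norm_diff: "gamma_norm N D (u - v) <= gamma_norm N D u + gamma_norm N D v"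
  using gamma_norm_add[of u "- v"] by (simp add: gamma_norm_minus)

lemma gamma_norm_diff_commute: "gamma_norm N D (u - v) = gamma_norm N D (v - u)"
  using gamma_norm_minus[of "u - v"] by simp

lemma gamma_norm_sum: "gamma_norm N D (\<Sum>k\<in>K. u k) <= (\<Sum>k\<in>K. gamma_norm N D (u k))"
proof (induction K rule: infinite_finite_induct)
  case (insert k K)
  have "gamma_norm N D (\<Sum>j\<in>insert k K. u j) <= gamma_norm N D (u k) + gamma_norm N D (\<Sum>j\<in>K. u j)"
    unfolding sum.insert[OF insert.hyps] by (rule gamma_norm_add)
  also have "... <= gamma_norm N D (u k) + (\<Sum>j\<in>K. gamma_norm N D (u j))"
    by (intro add_left_mono insert.IH)
  finally show ?case unfolding sum.insert[OF insert.hyps] .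
next
  case (infinite K)
  then show ?case by (metis gamma_norm_zero sum.infinite zero_le)
next
  case empty
  show ?case by (simp only: sum.empty gamma_norm_zero order_refl)
qed

text \<open>Multiplication by \<open>1\<^sub>K\<close> is the average of the identity and the reflection
  \<open>2 1\<^sub>K - 1\<close>, which maps orthonormal systems to orthonormal systems.\<close>

lemma gamma_norm_restrict_le:
  assumes u: "L2_operator N D u" and K: "K \<in> sets N"
  shows "gamma_norm N D (restrict_operator u K) <= gamma_norm N D u"
  unfolding gamma_norm_le_iff
proof (intro allI impI)
  fix n h assume on: "orthonormal_system N D n h"
  define h' where "h' k p = (2 * indicator K p - 1) * h k p" for k p
  have hD: "h k \<in> D" if "k < n" for k using on that by (auto simp: orthonormal_system_def)
  have h'_alt: "h' k = (%p. 2 * (indicator K p * h k p) + (- 1) * h k p)" for k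
    by (auto simp: h'_def algebra_simps)
  have h'D: "h' k \<in> D" if "k < n" for k
    unfolding h'_alt by (intro D_add' D_scale D_indicator K hD that)
  have "L2_inner N (h' j) (h' k) = L2_inner N (h j) (h k)" for j k
    unfolding L2_inner_def h'_def by (intro Bochner_Integration.integral_cong refl) (auto simp: indicator_def)
  then have on': "orthonormal_system N D n h'" using on h'D by (simp add: orthonormal_system_def)
  have half: "restrict_operator u K (h k) = (1/2) *\<^sub>C (u (h k) + u (h' k))" if "k < n" for k
  proof -
    have "u (h' k) = 2 *\<^sub>C restrict_operator u K (h k) + (-1) *\<^sub>C u (h k)"
      unfolding h'_alt restrict_operator_def
      using operator_add[OF u D_scale[OF D_indicator[OF K hD[OF that]]] D_scale[OF hD[OF that]], of 2 "-1"]
      by (simp only: operator_scale[OF u D_indicator[OF K hD[OF that]]] operator_scale[OF u hD[OF that]])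
    then show ?thesis by (simp add: scaleC_scaleC scaleC_minus scaleC_one)
  qed
  have "gaussian_rms n (%k. restrict_operator u K (h k)) =
      gaussian_rms n (%k. (1/2) *\<^sub>C (u (h k) + u (h' k)))"
    unfolding rms_random_sum_def using half by (auto intro!: arg_cong[where f=sqrt] Bochner_Integration.integral_cong)
  also have "... <= (1/2) * (gaussian_rms n (%k. u (h k)) + gaussian_rms n (%k. u (h' k)))"
    unfolding rms_random_sum_scaleC using rms_gaussian_triangle by simp
  finally have "ennreal (gaussian_rms n (%k. restrict_operator u K (h k))) \<le>
    ennreal (1/2) * (ennreal (gaussian_rms n (%k. u (h k))) + ennreal (gaussian_rms n (%k. u (h' k))))"
    by (simp only: ennreal_plus[symmetric] ennreal_mult[symmetric] ennreal_leI rms_gaussian_nonneg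
        add_nonneg_nonneg zero_le_divide_1_iff zero_le_numeral)
  also have "... <= ennreal (1/2) * (gamma_norm N D u + gamma_norm N D u)"
    by (intro mult_left_mono add_mono gamma_norm_upper on on') auto
  also have "... = gamma_norm N D u"
  proof -
    have "ennreal (1/2) * 2 = ennreal (1/2) * ennreal 2" by simp
    also have "... = 1" by (subst ennreal_mult[symmetric]) auto
    finally show ?thesis by (simp only: mult_2[symmetric] mult.assoc[symmetric] mult_1)
  qed
  finally show "ennreal (gaussian_rms n (%k. restrict_operator u K (h k))) <= gamma_norm N D u" .
qed

text \<open>The normalised function alone is an orthonormal system of length one, and a Gaussian sum
  of one term has the norm of its vector. A function of norm zero is sent to 0 because operators
  respect equality almost everywhere.\<close>

lemma gamma_norm_dominates:
  assumes u: "L2_operator N D u" and h: "h \<in> D"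
  shows "ennreal (norm (u h)) <= gamma_norm N D u * ennreal (L2_norm N h)"
proof (cases "L2_norm N h = 0")
  case True
  then have "AE p in N. h p = 0" using L2_norm_zero_AE h D_L2 by blast
  then have "u h = 0" using operator_cong[OF u h D_zero] operator_zero[OF u] by simp
  then show ?thesis by simp
next
  case False
  then have pos: "L2_norm N h > 0" using L2_norm_nonneg[of N h] by linarith
  define e where "e p = complex_of_real (1 / L2_norm N h) * h p" for p
  have eD: "e \<in> D" unfolding e_def by (intro D_scale h)
  have "L2_norm N e = 1" unfolding e_def L2_norm_scale using pos by (simp add: norm_divide)
  then have "orthonormal_system N D 1 (%_. e)" using eD by (simp add: orthonormal_system_def L2_inner_self)
  then have "ennreal (norm (u e)) <= gamma_norm N D u"
    using gamma_norm_upper[of 1 "%_. e" u] unfolding rms_gaussian_1 by simp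
  then have "ennreal (norm (u e)) * ennreal (L2_norm N h) <= gamma_norm N D u * ennreal (L2_norm N h)"
    by (intro mult_right_mono) auto
  moreover have "norm (u e) * L2_norm N h = norm (u h)"
  proof -
    have "u e = complex_of_real (1 / L2_norm N h) *\<^sub>C u h"
      unfolding e_def by (rule operator_scale[OF u h])
    then show ?thesis using pos by (simp only: norm_scaleC norm_of_real) simp
  qed
  ultimately show ?thesis by (simp add: ennreal_mult[symmetric])
qed

text \<open>By Bessel's inequality the coefficients of a rank one operator along an orthonormal
  system are square-summable with bound \<open>L2_norm N (g k)\<close>. The explicit dependence on
  the \<open>g k\<close> makes the bound tend to 0 when they are cut to shrinking sets.\<close>

lemma gamma_norm_finite_rank:
  fixes m :: nat
  assumes "!!k. k < m ==> g k \<in> L2_functions N"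
  shows "gamma_norm N D (%h. \<Sum>k<m. L2_inner N h (g k) *\<^sub>C \<xi> k) <= ennreal (\<Sum>k<m. L2_norm N (g k) * norm (\<xi> k))"
  unfolding gamma_norm_le_iff
proof (intro allI impI ennreal_leI)
  fix n h assume on: "orthonormal_system N D n h"
  have "gaussian_rms n (%k. L2_inner N (h k) (g j) *\<^sub>C \<xi> j) <= L2_norm N (g j) * norm (\<xi> j)" if "j < m" for j
  proof -
    have "gaussian_rms n (%k. L2_inner N (h k) (g j)) <= sqrt (\<Sum>k<n. (cmod (L2_inner N (h k) (g j)))\<^sup>2)"
      by (rule rms_gaussian_complex_le)
    also have "... <= L2_norm N (g j)"
      using Bessel_inequality[OF on D_L2 assms[OF that]] real_le_lsqrt by simp
    finally show ?thesis unfolding rms_random_sum_scaleC_left by (intro mult_right_mono) auto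
  qed
  then have "(\<Sum>j<m. gaussian_rms n (%k. L2_inner N (h k) (g j) *\<^sub>C \<xi> j)) \<le>
     (\<Sum>k<m. L2_norm N (g k) * norm (\<xi> k))" by (intro sum_mono) auto
  then show "gaussian_rms n (%k. \<Sum>j<m. L2_inner N (h k) (g j) *\<^sub>C \<xi> j) \<le>
     (\<Sum>k<m. L2_norm N (g k) * norm (\<xi> k))"
    using rms_gaussian_sum[of "{..<m}" n "%j k. L2_inner N (h k) (g j) *\<^sub>C \<xi> j"]
    by (meson finite_lessThan order_trans)
qed

end

section \<open>Finite rank operators and their closure in the radonifying norm\<close>

lemma finite_rank_operatorI:
  "(!!k. k < m ==> g k \<in> L2_functions N) ==> finite_rank_operator N (%h. \<Sum>k<(m::nat). L2_inner N h (g k) *\<^sub>C \<xi> k)"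
  unfolding finite_rank_operator_def by blast

lemma finite_rank_operator_zero: "finite_rank_operator N 0"
  using finite_rank_operatorI[of 0 undefined N undefined] by (simp add: zero_fun_def)

lemma finite_rank_operator_add:
  assumes "finite_rank_operator N v" "finite_rank_operator N w"
  shows "finite_rank_operator N (v + w)"
proof -
  from assms obtain m :: nat and g \<xi> n g' \<xi>' where
    v: "!!k. k < m ==> g k \<in> L2_functions N" "v = (%h. \<Sum>k<m. L2_inner N h (g k) *\<^sub>C \<xi> k)" and
    w: "!!k. k < n ==> g' k \<in> L2_functions N" "w = (%h. \<Sum>k<(n::nat). L2_inner N h (g' k) *\<^sub>C \<xi>' k)"
    unfolding finite_rank_operator_def by blast
  let ?g = "%k. if k < m then g k else g' (k - m)" and ?x = "%k. if k < m then \<xi> k else \<xi>' (k - m)"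
  have "(\<Sum>k<m + n. L2_inner N h (?g k) *\<^sub>C ?x k) = v h + w h" for h
  proof -
    have "(\<Sum>k<m + n. L2_inner N h (?g k) *\<^sub>C ?x k) =
      (\<Sum>k<m. L2_inner N h (?g k) *\<^sub>C ?x k) + (\<Sum>k=m..<m + n. L2_inner N h (?g k) *\<^sub>C ?x k)"
      unfolding lessThan_atLeast0 by (rule sum.atLeastLessThan_concat[symmetric]) auto
    also have "(\<Sum>k=m..<m + n. L2_inner N h (?g k) *\<^sub>C ?x k) = (\<Sum>k<n. L2_inner N h (g' k) *\<^sub>C \<xi>' k)"
      using sum.shift_bounds_nat_ivl[of "%k. L2_inner N h (?g k) *\<^sub>C ?x k" 0 m n]
      by (simp add: lessThan_atLeast0 add.commute)
    finally show ?thesis by (simp add: v w)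
  qed
  then have "v + w = (%h. \<Sum>k<m + n. L2_inner N h (?g k) *\<^sub>C ?x k)" by auto
  moreover have "finite_rank_operator N (%h. \<Sum>k<m + n. L2_inner N h (?g k) *\<^sub>C ?x k)"
    by (rule finite_rank_operatorI) (use v w in auto)
  ultimately show ?thesis by simp
qed

lemma finite_rank_operator_scaleC:
  assumes "finite_rank_operator N v" shows "finite_rank_operator N (c *\<^sub>C v)"
proof -
  from assms obtain m :: nat and g \<xi> where
    v: "!!k. k < m ==> g k \<in> L2_functions N" "v = (%h. \<Sum>k<m. L2_inner N h (g k) *\<^sub>C \<xi> k)"
    unfolding finite_rank_operator_def by blast
  have "c *\<^sub>C v = (%h. \<Sum>k<m. L2_inner N h (g k) *\<^sub>C c *\<^sub>C \<xi> k)"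
    by (simp add: v scaleC_fun_def scaleC_sum_right scaleC_scaleC mult.commute)
  then show ?thesis using finite_rank_operatorI[of m g N "%k. c *\<^sub>C \<xi> k"] v by simp
qed

lemma finite_rank_operator_restrict_alt:
  "restrict_operator (%h. \<Sum>k<m. L2_inner N h (g k) *\<^sub>C \<xi> k) K =
   (%h. \<Sum>k<m. L2_inner N h (%p. indicator K p * g k p) *\<^sub>C \<xi> k)"
  by (intro ext) (auto simp: restrict_operator_def L2_inner_def intro!: sum.cong
      arg_cong2[where f=scaleC] Bochner_Integration.integral_cong split: split_indicator)

lemma finite_rank_operator_restrict:
  assumes "finite_rank_operator N v" "K \<in> sets N" shows "finite_rank_operator N (restrict_operator v K)"
proof -
  from assms obtain m :: nat and g \<xi> where
    v: "!!k. k < m ==> g k \<in> L2_functions N" "v = (%h. \<Sum>k<m. L2_inner N h (g k) *\<^sub>C \<xi> k)"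
    unfolding finite_rank_operator_def by blast
  then show ?thesis
    unfolding v(2) finite_rank_operator_restrict_alt
    by (intro finite_rank_operatorI L2_functions_indicator assms) auto
qed

context L2_domain begin

lemma L2_operator_finite_rank:
  assumes "finite_rank_operator N v" shows "L2_operator N D v"
proof -
  from assms obtain m :: nat and g \<xi> where
    v: "!!k. k < m ==> g k \<in> L2_functions N" "v = (%h. \<Sum>k<m. L2_inner N h (g k) *\<^sub>C \<xi> k)"
    unfolding finite_rank_operator_def by blast
  show ?thesis
    unfolding v
  proof (rule L2_operatorI)
    fix f h assume *: "f \<in> D" "h \<in> D"
    then show "(\<Sum>k<m. L2_inner N (f + h) (g k) *\<^sub>C \<xi> k) = (\<Sum>k<m. L2_inner N f (g k) *\<^sub>C \<xi> k) + (\<Sum>k<m. L2_inner N h (g k) *\<^sub>C \<xi> k)"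
      using v(1) D_L2 by (auto simp: plus_fun_def L2_inner_add_left sum.distrib[symmetric] scaleC_add_left subset_iff intro!: sum.cong)
  next
    fix f h assume *: "f \<in> D" "h \<in> D" and "AE p in N. f p = h p"
    then have "L2_inner N f (g k) = L2_inner N h (g k)" if "k < m" for k
      unfolding L2_inner_def using * v(1)[OF that] D_L2
      by (intro integral_cong_AE borel_measurable_times borel_measurable_cnj) (auto simp: L2_functions_def)
    then show "(\<Sum>k<m. L2_inner N f (g k) *\<^sub>C \<xi> k) = (\<Sum>k<m. L2_inner N h (g k) *\<^sub>C \<xi> k)" by simp
  next
    fix c h
    show "(\<Sum>k<m. L2_inner N (%p. c * h p) (g k) *\<^sub>C \<xi> k) = c *\<^sub>C (\<Sum>k<m. L2_inner N h (g k) *\<^sub>C \<xi> k)"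
      by (simp add: L2_inner_scale_left scaleC_sum_right scaleC_scaleC)
  qed
qed

lemma gamma_norm_finite_rank_finite:
  assumes "finite_rank_operator N v" shows "gamma_norm N D v < \<top>"
proof -
  from assms obtain m :: nat and g \<xi> where
    v: "!!k. k < m ==> g k \<in> L2_functions N" "v = (%h. \<Sum>k<m. L2_inner N h (g k) *\<^sub>C \<xi> k)"
    unfolding finite_rank_operator_def by blast
  show ?thesis unfolding v(2) by (rule order_le_less_trans[OF gamma_norm_finite_rank[OF v(1)]]) auto
qed

lemma gamma_spaceD: "u \<in> gamma_space N D ==> L2_operator N D u"
  unfolding gamma_space_def by blast

lemma gamma_space_approx:
  "u \<in> gamma_space N D ==> 0 < e ==> \<exists>v. finite_rank_operator N v \<and> gamma_norm N D (u - v) < ennreal e"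
  unfolding gamma_space_def by blast

lemma gamma_spaceI:
  "L2_operator N D u ==> (!!e. 0 < e ==> \<exists>v. finite_rank_operator N v \<and> gamma_norm N D (u - v) < ennreal e) ==>
    u \<in> gamma_space N D"
  unfolding gamma_space_def by blast

lemma gamma_space_finite: assumes "u \<in> gamma_space N D" shows "gamma_norm N D u < \<top>"
proof -
  obtain v where v: "finite_rank_operator N v" "gamma_norm N D (u - v) < ennreal 1"
    using gamma_space_approx[OF assms, of 1] by fastforce
  have "gamma_norm N D u <= gamma_norm N D (u - v) + gamma_norm N D v"
    using gamma_norm_add[of "u - v" v] by simp
  also have "... < \<top>" using v(2) gamma_norm_finite_rank_finite[OF v(1)]
    by (simp add: less_top[symmetric]) (metis ennreal_one_neq_top ennreal_1 order.strict_trans top.not_eq_extremum neq_top_trans)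
  finally show ?thesis .
qed

lemma gamma_space_add:
  assumes "u \<in> gamma_space N D" "v \<in> gamma_space N D" shows "u + v \<in> gamma_space N D"
proof -
  have "\<exists>w. finite_rank_operator N w \<and> gamma_norm N D (u + v - w) < ennreal e" if "e > 0" for e
  proof -
    have e2: "e / 2 > 0" using that by simp
    obtain a b where a: "finite_rank_operator N a" "gamma_norm N D (u - a) < ennreal (e/2)"
      and b: "finite_rank_operator N b" "gamma_norm N D (v - b) < ennreal (e/2)"
      using gamma_space_approx[OF assms(1) e2] gamma_space_approx[OF assms(2) e2] by blast
    have "gamma_norm N D (u + v - (a + b)) <= gamma_norm N D (u - a) + gamma_norm N D (v - b)"
      using gamma_norm_add[of "u - a" "v - b"] by (simp add: algebra_simps)
    also have "... < ennreal (e/2) + ennreal (e/2)"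
      using a b by (intro add_strict_mono) auto
    also have "... = ennreal e" using that by (simp add: ennreal_plus[symmetric] del: ennreal_plus)
    finally show ?thesis using finite_rank_operator_add[OF a(1) b(1)] by blast
  qed
  then show ?thesis using L2_operator_add[OF assms[THEN gamma_spaceD]] unfolding gamma_space_def by blast
qed

lemma gamma_space_scaleC:
  assumes "u \<in> gamma_space N D" shows "c *\<^sub>C u \<in> gamma_space N D"
proof -
  have "\<exists>w. finite_rank_operator N w \<and> gamma_norm N D (c *\<^sub>C u - w) < ennreal e" if "e > 0" for e
  proof -
    have "e / (cmod c + 1) > 0" using that by (intro divide_pos_pos add_nonneg_pos) auto
    then obtain a where a: "finite_rank_operator N a" "gamma_norm N D (u - a) < ennreal (e / (cmod c + 1))"
      using gamma_space_approx[OF assms] by blast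
    have "gamma_norm N D (c *\<^sub>C u - c *\<^sub>C a) = ennreal (cmod c) * gamma_norm N D (u - a)"
      by (simp add: scaleC_diff_right[symmetric] gamma_norm_scaleC)
    also have "... <= ennreal (cmod c) * ennreal (e / (cmod c + 1))"
      using a(2) by (intro mult_left_mono) auto
    also have "... < ennreal e"
    proof -
      have "cmod c * e < e * (cmod c + 1)" using that by (simp add: algebra_simps)
      then have "cmod c * (e / (cmod c + 1)) < e" using norm_ge_zero[of c]
        by (simp add: pos_divide_less_eq add_nonneg_pos)
      then show ?thesis using that by (simp add: ennreal_mult[symmetric] ennreal_less_iff)
    qed
    finally show ?thesis using finite_rank_operator_scaleC[OF a(1)] by blast
  qed
  then show ?thesis using L2_operator_scaleC[OF assms[THEN gamma_spaceD]] unfolding gamma_space_def by blast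
qed

lemma gamma_space_diff:
  assumes "u \<in> gamma_space N D" "v \<in> gamma_space N D" shows "u - v \<in> gamma_space N D"
  using gamma_space_add[OF assms(1) gamma_space_scaleC[OF assms(2), of "-1"]]
  by (simp add: scaleC_minus scaleC_one)

lemma gamma_space_zero: "0 \<in> gamma_space N D"
proof -
  have "gamma_norm N D (0 - 0) < ennreal e" if "e > 0" for e using that by simp
  then show ?thesis
    using finite_rank_operator_zero L2_operator_finite_rank[OF finite_rank_operator_zero]
    unfolding gamma_space_def by blast
qed

lemma restrict_operator_diff: "restrict_operator (u - v) K = restrict_operator u K - restrict_operator v K"
  by (simp add: restrict_operator_def fun_eq_iff)

lemma gamma_space_restrict:
  assumes "u \<in> gamma_space N D" "K \<in> sets N" shows "restrict_operator u K \<in> gamma_space N D"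
proof -
  have "\<exists>w. finite_rank_operator N w \<and> gamma_norm N D (restrict_operator u K - w) < ennreal e" if e: "e > 0" for e
  proof -
    obtain a where a: "finite_rank_operator N a" "gamma_norm N D (u - a) < ennreal e"
      using gamma_space_approx[OF assms(1) e] by blast
    have "L2_operator N D (u - a)"
      using L2_operator_add[OF gamma_spaceD[OF assms(1)] L2_operator_scaleC[OF L2_operator_finite_rank[OF a(1)], of "-1"]]
      by (simp add: scaleC_minus scaleC_one)
    then have "gamma_norm N D (restrict_operator u K - restrict_operator a K) < ennreal e"
      using order_le_less_trans[OF gamma_norm_restrict_le a(2)] assms(2) by (simp add: restrict_operator_diff)
    then show ?thesis using finite_rank_operator_restrict[OF a(1) assms(2)] by blast
  qed
  then show ?thesis using L2_operator_restrict[OF assms(1)[THEN gamma_spaceD] assms(2)] unfolding gamma_space_def by blast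
qed

text \<open>For a finite rank operator this is dominated convergence for the representing functions.
  Approximation in the radonifying norm carries it over because restriction does not increase that
  norm; membership in \<open>gamma_space\<close>, more than a finite norm, is what is used.\<close>

lemma gamma_norm_restrict_tendsto_0:
  assumes u: "u \<in> gamma_space N D" and K: "!!n. K n \<in> sets N" and lim: "!!p. p \<in> space N ==> eventually (%n. p \<notin> K n) sequentially"
  shows "(%n. gamma_norm N D (restrict_operator u (K n))) \<longlonglongrightarrow> 0"
proof (rule order_tendstoI)
  fix a :: ennreal assume "0 < a"
  then obtain e :: real where e: "0 < e" "ennreal e < a"
    by (metis dense ennreal_cases ennreal_less_zero_iff less_top top.not_eq_extremum order.strict_trans not_less_iff_gr_or_eq)
  obtain v where v: "finite_rank_operator N v" "gamma_norm N D (u - v) < ennreal (e/2)"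
    using gamma_space_approx[OF u, of "e/2"] e by fastforce
  from v(1) obtain m :: nat and g \<xi> where
    g: "!!k. k < m ==> g k \<in> L2_functions N" and v_eq: "v = (%h. \<Sum>k<m. L2_inner N h (g k) *\<^sub>C \<xi> k)"
    unfolding finite_rank_operator_def by blast
  have gt: "(%n. L2_norm N (%p. indicator (K n) p * g k p)) \<longlonglongrightarrow> 0" if "k < m" for k
  proof -
    have [measurable]: "g k \<in> borel_measurable N" and i: "integrable N (%p. (cmod (g k p))\<^sup>2)"
      using g[OF that] by (auto simp: L2_functions_def)
    have "(%n. \<integral>p. (cmod (indicator (K n) p * g k p))\<^sup>2 \<partial>N) \<longlonglongrightarrow> (\<integral>p. 0 \<partial>N)"
    proof (rule integral_dominated_convergence[OF _ _ i])
      show "AE p in N. (%n. (cmod (indicator (K n) p * g k p))\<^sup>2) \<longlonglongrightarrow> 0"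
      proof (intro AE_I2)
        fix p assume "p \<in> space N"
        from lim[OF this] show "(%n. (cmod (indicator (K n) p * g k p))\<^sup>2) \<longlonglongrightarrow> 0"
          by (intro tendsto_eventually) (auto elim!: eventually_mono)
      qed
      show "AE p in N. norm ((cmod (indicator (K n) p * g k p))\<^sup>2) <= (cmod (g k p))\<^sup>2" for n
        by (auto simp: indicator_def)
      show "(%p. (cmod (indicator (K n) p * g k p))\<^sup>2) \<in> borel_measurable N" for n
        using K[of n] by measurable
    qed simp
    then show ?thesis unfolding L2_norm_def using tendsto_real_sqrt by fastforce
  qed
  have "(%n. \<Sum>k<m. L2_norm N (%p. indicator (K n) p * g k p) * norm (\<xi> k)) \<longlonglongrightarrow> (\<Sum>k<m. 0 * norm (\<xi> k))"
    by (intro tendsto_sum tendsto_mult gt tendsto_const) auto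
  then have "eventually (%n. (\<Sum>k<m. L2_norm N (%p. indicator (K n) p * g k p) * norm (\<xi> k)) < e / 2) sequentially"
    using e by (intro order_tendstoD(2)) auto
  then show "eventually (%n. gamma_norm N D (restrict_operator u (K n)) < a) sequentially"
  proof eventually_elim
    case (elim n)
    have op: "L2_operator N D (u - v)"
      using L2_operator_add[OF gamma_spaceD[OF u] L2_operator_scaleC[OF L2_operator_finite_rank[OF v(1)], of "-1"]]
      by (simp add: scaleC_minus scaleC_one)
    have "gamma_norm N D (restrict_operator u (K n)) \<le>
      gamma_norm N D (restrict_operator (u - v) (K n)) + gamma_norm N D (restrict_operator v (K n))"
      using gamma_norm_add[of "restrict_operator (u - v) (K n)" "restrict_operator v (K n)"]
      by (simp add: restrict_operator_diff)
    also have "... <= ennreal (e/2) + ennreal (e/2)"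
    proof (intro add_mono)
      show "gamma_norm N D (restrict_operator (u - v) (K n)) <= ennreal (e/2)"
        using gamma_norm_restrict_le[OF op K] v(2) by (meson order.strict_implies_order order_trans)
      have "gamma_norm N D (restrict_operator v (K n)) <= ennreal (\<Sum>k<m. L2_norm N (%p. indicator (K n) p * g k p) * norm (\<xi> k))"
        unfolding v_eq finite_rank_operator_restrict_alt
        by (intro gamma_norm_finite_rank L2_functions_indicator g K)
      also have "... <= ennreal (e/2)" using elim by (intro ennreal_leI) simp
      finally show "gamma_norm N D (restrict_operator v (K n)) <= ennreal (e/2)" .
    qed
    also have "... = ennreal e" using e by (simp add: ennreal_plus[symmetric] del: ennreal_plus)
    finally show ?case using e(2) by (rule order_le_less_trans)
  qed
qed simp

end

section \<open>Type and disjointly supported operators\<close>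

lemma gauss_sq_shift:
  assumes "!!l. l < m ==> y l = 0"
  shows "gauss_sq (m + k) y x = gauss_sq k (%l. y (m + l)) x"
proof (induction k arbitrary: x)
  case 0
  have "gauss_sq m y x = gauss_sq m (%l. 0) x" by (rule gauss_sq_cong) (use assms in auto)
  then show ?case by (simp add: gauss_sq_const_zero)
next
  case (Suc k)
  then show ?case by (simp add: gauss_sq_Suc)
qed

lemma gauss_sq_trailing:
  assumes "!!l. m <= l ==> y l = 0"
  shows "gauss_sq (m + k) y x = gauss_sq m y x"
proof (induction k arbitrary: x)
  case (Suc k)
  then show ?case using assms[of "m + k"] std_normal.emeasure_space_1 by (simp add: gauss_sq_Suc)
qed simp

lemma rms_random_sum_cong:
  "(!!k. k < n ==> y k = z k) ==> rms_random_sum P n y = rms_random_sum P n z"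
  by (simp add: rms_random_sum_def)

lemma L2_inner_cong_AE:
  assumes "f \<in> L2_functions N" "f' \<in> L2_functions N" "g \<in> L2_functions N" "g' \<in> L2_functions N"
    and "AE p in N. f p = f' p" "AE p in N. g p = g' p"
  shows "L2_inner N f g = L2_inner N f' g'"
  unfolding L2_inner_def
proof (rule integral_cong_AE)
  have [measurable]: "f \<in> borel_measurable N" "f' \<in> borel_measurable N" "g \<in> borel_measurable N" "g' \<in> borel_measurable N"
    using assms by (auto simp: L2_functions_def)
  show "(%p. f p * cnj (g p)) \<in> borel_measurable N" "(%p. f' p * cnj (g' p)) \<in> borel_measurable N"
    by measurable
  show "AE p in N. f p * cnj (g p) = f' p * cnj (g' p)"
    using assms(5,6) by eventually_elim simp
qed

context L2_domain begin

text \<open>Gram-Schmidt that respects the blocks: inner products of functions from different blocks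
  vanish, so the residual \<open>g\<close> of \<open>f i\<close> stays supported in its block
  \<open>B (\<tau> i)\<close>. The expansion holds almost everywhere because a residual of norm zero
  contributes no new vector.\<close>

lemma adapted_orthonormal_system:
  fixes f :: "'i => 'a => complex" and B :: "nat => 'a set"
  assumes "finite I" and "!!i. i \<in> I ==> f i \<in> D"
    and "!!i p. i \<in> I ==> p \<notin> B (\<tau> i) ==> f i p = 0"
    and disj: "!!k l. k \<noteq> l ==> B k \<inter> B l = {}"
  shows "\<exists>m e \<kappa> a. orthonormal_system N D m e \<and> (\<forall>l<m. \<forall>p. p \<notin> B (\<kappa> l) --> e l p = 0) \<and>
    (\<forall>i\<in>I. AE p in N. f i p = (\<Sum>l<m. a i l * e l p))"
  using assms(1-3)
proof (induction I rule: finite_induct)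
  case empty
  show ?case by (intro exI[of _ 0]) (auto simp: orthonormal_system_def)
next
  case (insert i I)
  have "\<exists>m e \<kappa> a. orthonormal_system N D m e \<and> (\<forall>l<m. \<forall>p. p \<notin> B (\<kappa> l) --> e l p = 0) \<and>
    (\<forall>i\<in>I. AE p in N. f i p = (\<Sum>l<m. a i l * e l p))"
    using insert by simp
  then obtain m e \<kappa> a where on: "orthonormal_system N D m e"
    and supp: "!!l p. l < m ==> p \<notin> B (\<kappa> l) ==> e l p = 0"
    and exp: "!!j. j \<in> I ==> AE p in N. f j p = (\<Sum>l<m. a j l * e l p)"
    by blast
  have fD: "f i \<in> D" and fs: "!!p. p \<notin> B (\<tau> i) ==> f i p = 0" using insert by auto
  have eD: "e l \<in> D" if "l < m" for l using on that by (auto simp: orthonormal_system_def)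
  have L2: "h \<in> L2_functions N" if "h \<in> D" for h using that D_L2 by blast
  have ee: "L2_inner N (e j) (e k) = (if j = k then 1 else 0)" if "j < m" "k < m" for j k
    using on that by (auto simp: orthonormal_system_def)
  define c where "c l = - L2_inner N (f i) (e l)" for l
  have c0: "c l = 0" if "l < m" "\<kappa> l \<noteq> \<tau> i" for l
  proof -
    have "f i p * cnj (e l p) = 0" for p using disj[OF that(2)] fs[of p] supp[OF that(1), of p] by auto
    then have "(%p. f i p * cnj (e l p)) = (%p. 0)" by (rule ext)
    then show ?thesis unfolding c_def L2_inner_def by simp
  qed
  define s where "s = (%p. \<Sum>l<m. c l * e l p)"
  have sD: "s \<in> D" unfolding s_def by (intro D_sum D_scale eD) auto
  define g where "g = (%p. f i p + s p)"
  have gD: "g \<in> D" unfolding g_def by (intro D_add' fD sD)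
  have gs: "g p = 0" if "p \<notin> B (\<tau> i)" for p
  proof -
    have "c l * e l p = 0" if "l < m" for l
      using c0[OF that] supp[OF that, of p] \<open>p \<notin> B (\<tau> i)\<close> by (cases "\<kappa> l = \<tau> i") auto
    then have "s p = 0" unfolding s_def by (intro sum.neutral) auto
    then show ?thesis using fs[OF that] by (simp add: g_def)
  qed
  have ge: "L2_inner N g (e k) = 0" if "k < m" for k
  proof -
    have "L2_inner N s (e k) = (\<Sum>l<m. c l * L2_inner N (e l) (e k))"
      unfolding s_def using that
      by (subst L2_inner_sum_left) (auto simp del: mult_minus_left simp: L2_inner_scale_left intro!: L2 D_scale eD)
    also have "... = (\<Sum>l<m. if l = k then c k else 0)"
      using that by (intro sum.cong refl) (auto simp: ee)
    also have "... = c k" using that by simp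
    finally show ?thesis
      unfolding g_def using that by (subst L2_inner_add_left) (auto simp: c_def intro!: L2 fD sD eD)
  qed
  have fg: "f i p = (\<Sum>l<m. (- c l) * e l p) + g p" for p
    by (simp add: g_def s_def sum_negf)
  show ?case
  proof (cases "L2_norm N g = 0")
    case True
    have "AE p in N. f i p = (\<Sum>l<m. (- c l) * e l p)"
      using L2_norm_zero_AE[OF L2[OF gD] True] by eventually_elim (simp add: fg)
    then show ?thesis
      using on supp exp insert.hyps
      by (intro exI[of _ m] exI[of _ e] exI[of _ \<kappa>] exI[of _ "%j. if j = i then (%l. - c l) else a j"]) auto
  next
    case False
    define \<gamma> where "\<gamma> = complex_of_real (L2_norm N g)"
    have \<gamma>0: "\<gamma> \<noteq> 0" using False by (simp add: \<gamma>_def)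
    define e' where "e' l = (if l = m then (%p. (1 / \<gamma>) * g p) else e l)" for l
    have e'l: "e' l = e l" if "l < m" for l
      using that unfolding e'_def by simp
    have e'm: "e' m = (%p. (1 / \<gamma>) * g p)" unfolding e'_def by simp
    have gg: "L2_inner N g g = \<gamma> * \<gamma>" by (simp add: L2_inner_self \<gamma>_def power2_eq_square)
    have eg: "L2_inner N (e k) g = 0" if "k < m" for k
      using ge[OF that] by (subst L2_inner_commute) simp
    have "orthonormal_system N D (Suc m) e'"
      unfolding orthonormal_system_def
    proof (intro conjI allI impI)
      fix k assume "k < Suc m"
      then show "e' k \<in> D" unfolding e'_def by (auto intro!: eD D_scale gD simp del: times_divide_eq_left)
    next
      fix j k assume "j < Suc m" "k < Suc m"
      then consider "j < m" "k < m" | "j = m" "k < m" | "j < m" "k = m" | "j = m" "k = m" by linarith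
      then show "L2_inner N (e' j) (e' k) = (if j = k then 1 else 0)"
      proof cases
        case 4
        have "L2_inner N (e' j) (e' k) = (1/\<gamma>) * (cnj (1/\<gamma>) * L2_inner N g g)"
          unfolding 4 e'm by (simp only: L2_inner_scale_left L2_inner_scale_right)
        then show ?thesis using \<gamma>0 4 by (simp add: gg) (simp add: \<gamma>_def)
      next
        case 2
        have "L2_inner N (e' j) (e' k) = (1/\<gamma>) * L2_inner N g (e k)"
          unfolding 2(1) e'm e'l[OF 2(2)] by (rule L2_inner_scale_left)
        then show ?thesis using ge 2 by simp
      next
        case 3
        have "L2_inner N (e' j) (e' k) = cnj (1/\<gamma>) * L2_inner N (e j) g"
          unfolding 3(2) e'm e'l[OF 3(1)] by (rule L2_inner_scale_right)
        then show ?thesis using eg 3 by simp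
      qed (simp add: e'_def ee)
    qed
    moreover have "\<forall>l<Suc m. \<forall>p. p \<notin> B ((\<kappa>(m := \<tau> i)) l) --> e' l p = 0"
      using supp gs by (auto simp: e'_def less_Suc_eq)
    moreover have "\<forall>j\<in>insert i I. AE p in N. f j p =
      (\<Sum>l<Suc m. (if j = i then (if l = m then \<gamma> else - c l) else if l = m then 0 else a j l) * e' l p)"
    proof
      fix j assume "j \<in> insert i I"
      show "AE p in N. f j p = (\<Sum>l<Suc m. (if j = i then (if l = m then \<gamma> else - c l) else if l = m then 0 else a j l) * e' l p)"
      proof (cases "j = i")
        case True
        then show ?thesis using \<gamma>0 by (simp add: e'_def fg)
      next
        case False
        then have "j \<in> I" using \<open>j \<in> insert i I\<close> by simp
        from exp[OF this] show ?thesis using False by (simp add: e'_def)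
      qed
    qed
    ultimately show ?thesis
      by (intro exI[of _ "Suc m"] exI[of _ e'] exI[of _ "\<kappa>(m := \<tau> i)"] conjI
        exI[of _ "%j l. if j = i then (if l = m then \<gamma> else - c l) else if l = m then 0 else a j l"])
  qed
qed

text \<open>The orthonormal system is expanded in one whose members are each supported in a single
  \<open>A k\<close>. Splitting the complex coefficients into real and imaginary parts gives real orthonormal
  rows, so that the contraction principle applies at the expense of the factor 2.\<close>

lemma rms_adapted:
  fixes v :: "('a => complex) => 'x::complex_banach" and A :: "nat => 'a set"
  assumes v: "L2_operator N D v" and h: "orthonormal_system N D n h"
    and A: "!!k. k < K ==> A k \<in> sets N" and disj: "!!k l. k < K ==> l < K ==> k \<noteq> l ==> A k \<inter> A l = {}"
  obtains m e \<kappa> where "orthonormal_system N D m e"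
    and "!!l p. l < m ==> p \<in> space N ==> \<kappa> l < K ==> p \<notin> A (\<kappa> l) ==> e l p = 0"
    and "!!l p k. l < m ==> p \<in> space N ==> \<not> \<kappa> l < K ==> k < K ==> p \<in> A k ==> e l p = 0"
    and "gaussian_rms n (%k. v (h k)) <= 2 * gaussian_rms m (%l. v (e l))"
proof -
  \<comment> \<open>The complement of all \<open>A k\<close> is added as block number
    \<open>K\<close>, so that the blocks partition the space and the cut functions
    \<open>f (j, k)\<close> sum to \<open>h j\<close>.\<close>
  define B where "B k = (if k < K then A k else if k = K then space N - (\<Union>k<K. A k) else {})" for k
  have Bdisj: "B k \<inter> B l = {}" if "k \<noteq> l" for k l
    using that disj[of k l] by (auto simp: B_def)
  have Bs: "B k \<in> sets N" for k
    using A by (auto simp: B_def intro!: sets.Diff sets.finite_UN)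
  define f where "f = (%(j, k) p. indicator (B k) p * h j p)"
  let ?I = "{..<n} \<times> {..K}"
  have hD: "h j \<in> D" if "j < n" for j using h that by (auto simp: orthonormal_system_def)
  have "f i \<in> D" if "i \<in> ?I" for i
    using that by (auto simp: f_def intro!: D_indicator Bs hD)
  moreover have "f i p = 0" if "p \<notin> B (snd i)" for i p using that by (auto simp: f_def split_beta)
  ultimately obtain m e \<kappa> a where on: "orthonormal_system N D m e"
    and supp: "!!l p. l < m ==> p \<notin> B (\<kappa> l) ==> e l p = 0"
    and exp: "!!i. i \<in> ?I ==> AE p in N. f i p = (\<Sum>l<m. a i l * e l p)"
    using adapted_orthonormal_system[of ?I f B snd] Bdisj by blast
  have eD: "e l \<in> D" if "l < m" for l using on that by (auto simp: orthonormal_system_def)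
  have L2: "h \<in> L2_functions N" if "h \<in> D" for h using that D_L2 by blast
  define b where "b j l = (\<Sum>k\<le>K. a (j, k) l)" for j l
  have hexp: "AE p in N. h j p = (\<Sum>l<m. b j l * e l p)" if "j < n" for j
  proof -
    have "AE p in N. \<forall>k\<in>{..K}. f (j, k) p = (\<Sum>l<m. a (j, k) l * e l p)"
      using exp that by (intro AE_finite_allI) auto
    with AE_space show ?thesis
    proof eventually_elim
      case (elim p)
      have "\<exists>k\<le>K. p \<in> B k" using elim(1) by (cases "p \<in> (\<Union>k<K. A k)") (auto simp: B_def intro: less_imp_le)
      then obtain k0 where k0: "k0 <= K" "p \<in> B k0" by blast
      have "(\<Sum>k\<le>K. f (j, k) p) = (\<Sum>k\<le>K. if k = k0 then h j p else 0)"
        using k0 Bdisj by (intro sum.cong refl) (auto simp: f_def indicator_def)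
      also have "... = h j p" using k0 by simp
      finally have "h j p = (\<Sum>k\<le>K. \<Sum>l<m. a (j, k) l * e l p)" using elim(2) by simp
      also have "... = (\<Sum>l<m. b j l * e l p)"
        by (subst sum.swap) (simp add: b_def sum_distrib_right)
      finally show ?case .
    qed
  qed
  have sumD: "(%p. \<Sum>l<m. b j l * e l p) \<in> D" for j by (intro D_sum D_scale eD) auto
  have vh: "v (h j) = (\<Sum>l<m. b j l *\<^sub>C v (e l))" if "j < n" for j
  proof -
    have "v (h j) = v (%p. \<Sum>l<m. b j l * e l p)"
      by (rule operator_cong[OF v hD[OF that] sumD hexp[OF that]])
    also have "... = (\<Sum>l<m. v (%p. b j l * e l p))"
      by (intro operator_sum[OF v] D_scale eD) auto
    also have "... = (\<Sum>l<m. b j l *\<^sub>C v (e l))"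
      by (intro sum.cong refl operator_scale[OF v] eD) auto
    finally show ?thesis .
  qed
  have bb: "(\<Sum>l<m. b i l * cnj (b j l)) = (if i = j then 1 else 0)" if "i < n" "j < n" for i j
  proof -
    have "L2_inner N (h i) (h j) = L2_inner N (%p. \<Sum>l<m. b i l * e l p) (%p. \<Sum>l<m. b j l * e l p)"
      by (intro L2_inner_cong_AE L2 hD sumD hexp that)
    also have "... = (\<Sum>l<m. b i l * L2_inner N (e l) (%p. \<Sum>l<m. b j l * e l p))"
      by (subst L2_inner_sum_left) (auto simp: L2_inner_scale_left intro!: L2 sumD D_scale eD)
    also have "... = (\<Sum>l<m. b i l * (\<Sum>l'<m. cnj (b j l') * L2_inner N (e l) (e l')))"
      by (intro sum.cong refl arg_cong2[where f="(*)"], subst L2_inner_sum_right)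
        (auto simp: L2_inner_scale_right intro!: L2 D_scale eD)
    also have "... = (\<Sum>l<m. b i l * (\<Sum>l'<m. if l' = l then cnj (b j l) else 0))"
      using on by (intro sum.cong refl arg_cong2[where f="(*)"]) (auto simp: orthonormal_system_def)
    also have "... = (\<Sum>l<m. b i l * cnj (b j l))"
      by (intro sum.cong refl arg_cong2[where f="(*)"]) auto
    finally show ?thesis using h that by (simp add: orthonormal_system_def)
  qed
  \<comment> \<open>Real parts of the coefficients are paired with \<open>v (e l)\<close> and
    imaginary parts with \<open>\<i> *\<^sub>C v (e l)\<close>, the second half of
    \<open>y\<close>.\<close>
  define w where "w j l = (if l < m then Re (b j l) else Im (b j (l - m)))" for j l
  define y where "y l = (if l < m then v (e l) else \<i> *\<^sub>C v (e (l - m)))" for l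
  have split_sum: "(\<Sum>l<m + m. F l) = (\<Sum>l<m. F l) + (\<Sum>l<m. F (m + l))" for F :: "nat => 'z::comm_monoid_add"
  proof -
    have "(\<Sum>l<m + m. F l) = (\<Sum>l<m. F l) + (\<Sum>l=m..<m + m. F l)"
      unfolding lessThan_atLeast0 by (rule sum.atLeastLessThan_concat[symmetric]) auto
    also have "(\<Sum>l=m..<m + m. F l) = (\<Sum>l<m. F (m + l))"
      using sum.shift_bounds_nat_ivl[of F 0 m m] by (simp add: lessThan_atLeast0 add.commute)
    finally show ?thesis .
  qed
  have "coord_orthonormal (m + m) n w"
    unfolding coord_orthonormal_def
  proof (intro allI impI)
    fix i j assume *: "i < n" "j < n"
    have "coord_inner (m + m) (w i) (w j) = (\<Sum>l<m. Re (b i l) * Re (b j l)) + (\<Sum>l<m. Im (b i l) * Im (b j l))"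
      by (simp add: coord_inner_def split_sum w_def)
    also have "... = Re (\<Sum>l<m. b i l * cnj (b j l))" by (simp add: sum.distrib)
    finally show "coord_inner (m + m) (w i) (w j) = (if i = j then 1 else 0)" by (simp add: bb[OF *])
  qed
  then have c: "gauss_sq n (%j. coord_comb (m + m) y (w j)) 0 <= gauss_sq (m + m) y 0"
    by (rule gauss_sq_contraction)
  have "coord_comb (m + m) y (w j) = v (h j)" if "j < n" for j
  proof -
    have "Re c *\<^sub>R x + Im c *\<^sub>R \<i> *\<^sub>C x = c *\<^sub>C x" for c and x :: 'x
      by (simp add: scaleC_of_real[symmetric] scaleC_scaleC scaleC_add_left[symmetric])
        (metis complex_eq mult.commute)
    then show ?thesis by (simp add: coord_comb_def split_sum w_def y_def vh[OF that] sum.distrib[symmetric])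
  qed
  then have "gauss_sq n (%j. v (h j)) 0 <= gauss_sq (m + m) y 0"
    using c gauss_sq_cong[of n "%j. coord_comb (m + m) y (w j)" "%j. v (h j)" 0] by simp
  then have "gaussian_rms n (%k. v (h k)) <= rms_random_sum (gaussian_law (m + m)) (m + m) y"
    by (simp add: rms_gaussian_mono_iff)
  also have "... = rms_random_sum (gaussian_law (m + m)) (m + m)
      (%l. (if l < m then v (e l) else 0) + (if l < m then 0 else \<i> *\<^sub>C v (e (l - m))))"
    by (intro rms_random_sum_cong) (auto simp: y_def)
  also have "... <= rms_random_sum (gaussian_law (m + m)) (m + m) (%l. if l < m then v (e l) else 0) +
      rms_random_sum (gaussian_law (m + m)) (m + m) (%l. if l < m then 0 else \<i> *\<^sub>C v (e (l - m)))"
    by (rule rms_gaussian_triangle)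
  also have "... <= gaussian_rms m (%l. v (e l)) + gaussian_rms m (%l. \<i> *\<^sub>C v (e l))"
  proof (intro add_mono)
    show "rms_random_sum (gaussian_law (m + m)) (m + m) (%l. if l < m then v (e l) else 0) <= gaussian_rms m (%l. v (e l))"
      unfolding rms_gaussian_mono_iff
      using gauss_sq_cong[of m "%l. if l < m then v (e l) else 0" "%l. v (e l)" 0] by (subst gauss_sq_trailing) auto
    show "rms_random_sum (gaussian_law (m + m)) (m + m) (%l. if l < m then 0 else \<i> *\<^sub>C v (e (l - m))) <= gaussian_rms m (%l. \<i> *\<^sub>C v (e l))"
      unfolding rms_gaussian_mono_iff by (subst gauss_sq_shift) auto
  qed
  also have "... = 2 * gaussian_rms m (%l. v (e l))"
    by (simp add: rms_random_sum_scaleC)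
  finally have "gaussian_rms n (%k. v (h k)) <= 2 * gaussian_rms m (%l. v (e l))" .
  moreover have "e l p = 0" if "l < m" "p \<in> space N" "\<kappa> l < K" "p \<notin> A (\<kappa> l)" for l p
    using supp[of l p] that by (auto simp: B_def)
  moreover have "e l p = 0" if "l < m" "p \<in> space N" "\<not> \<kappa> l < K" "k < K" "p \<in> A k" for l p k
  proof -
    have "p \<notin> B (\<kappa> l)" using that by (auto simp: B_def split: if_splits)
    then show ?thesis using supp that by blast
  qed
  ultimately show ?thesis using that[OF on, of \<kappa>] by blast
qed

end

lemma rademacher_average:
  fixes F :: "(nat => real) => ennreal"
  assumes "!!s. (\<forall>k<n. s k \<in> {1, -1}) ==> F s = c"
  shows "(\<integral>\<^sup>+s. F s \<partial>rademacher_law n) = c"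
proof -
  have "(\<integral>\<^sup>+s. F s \<partial>rademacher_law n) = (\<integral>\<^sup>+s. c \<partial>rademacher_law n)"
    unfolding rademacher_law_def
  proof (rule nn_integral_cong_AE, rule AE_pmfI)
    fix s :: "nat => real" assume "s \<in> set_pmf (Pi_pmf {..<n} 0 (%_. pmf_of_set {- 1, 1}))"
    then have "\<forall>k<n. s k \<in> {1, -1}" by (auto simp: set_Pi_pmf PiE_dflt_def)
    then show "F s = c" by (rule assms)
  qed
  also have "... = c" by (simp add: rademacher_law_def measure_pmf.emeasure_space_1[simplified])
  finally show ?thesis .
qed

lemma rademacher_rms_sq:
  "(\<integral>\<^sup>+s. ennreal ((norm (\<Sum>k<n. s k *\<^sub>R \<xi> k))\<^sup>2) \<partial>rademacher_law n) = ennreal ((rms_random_sum (rademacher_law n) n \<xi>)\<^sup>2)"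
proof -
  have "finite (set_pmf (Pi_pmf {..<n} (0::real) (%_. pmf_of_set {- 1, 1})))"
    by (auto simp: set_Pi_pmf intro!: finite_PiE_dflt)
  then have "integrable (rademacher_law n) (%s. (norm (\<Sum>k<n. s k *\<^sub>R \<xi> k))\<^sup>2)"
    unfolding rademacher_law_def by (rule integrable_measure_pmf_finite)
  then show ?thesis
    by (simp add: rms_random_sum_def nn_integral_eq_integral)
qed

text \<open>On an orthonormal system whose members each live in one \<open>A k\<close>, changing the
  sign of \<open>v k\<close> amounts to changing signs of Gaussian variables, so the Gaussian sum
  may be averaged over random signs. Type is applied for each fixed \<open>\<omega>\<close>, and
  Minkowski's inequality with exponent 2/r, where \<open>r <= 2\<close> enters, exchanges the sum
  over \<open>k\<close> with the Gaussian integral. The constant precedes all other data, hence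
  serves every family of pieces at once.\<close>

lemma (in L2_domain) gamma_norm_type:
  assumes ty: "has_type TYPE('x::complex_banach) r" and r: "1 <= r" "r <= 2"
  obtains C where "C > 0"
    and "!!K A (v :: nat => ('a => complex) => 'x) G. \<lbrakk>!!k. k < K ==> A k \<in> sets N;
       !!k l. k < K ==> l < K ==> k \<noteq> l ==> A k \<inter> A l = {};
       !!k. k < K ==> L2_operator N D (v k);
       !!k h. k < K ==> h \<in> D ==> v k (%p. indicator (A k) p * h p) = v k h;
       !!k. k < K ==> G k \<ge> 0; !!k. k < K ==> gamma_norm N D (v k) <= ennreal (G k)\<rbrakk>
       \<Longrightarrow> gamma_norm N D (\<Sum>k<K. v k) <= ennreal (C * (\<Sum>k<K. G k powr r) powr (1 / r))"
proof -
  obtain C0 where C0: "!!n (\<xi> :: nat => 'x). rms_random_sum (rademacher_law n) n \<xi> <= C0 * (\<Sum>k<n. norm (\<xi> k) powr r) powr (1 / r)"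
    using ty unfolding has_type_def by blast
  \<comment> \<open>\<open>has_type\<close> says nothing about the sign of its constant; the maximum
    makes it positive.\<close>
  define C where "C = max C0 1"
  have C: "rms_random_sum (rademacher_law n) n \<xi> <= C * (\<Sum>k<n. norm (\<xi> k) powr r) powr (1 / r)" for n and \<xi> :: "nat => 'x"
    by (rule order_trans[OF C0]) (auto simp: C_def intro!: mult_right_mono)
  have C1: "C > 0" by (simp add: C_def)
  have bound: "gamma_norm N D (\<Sum>k<K. v k) <= ennreal ((2 * C) * (\<Sum>k<K. G k powr r) powr (1 / r))"
    if A: "!!k. k < K ==> A k \<in> sets N" and disj: "!!k l. k < K ==> l < K ==> k \<noteq> l ==> A k \<inter> A l = {}"
      and v: "!!k. k < K ==> L2_operator N D (v k)"
      and loc: "!!k h. k < K ==> h \<in> D ==> v k (%p. indicator (A k) p * h p) = v k h"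
      and G: "!!k. k < K ==> G k \<ge> 0" "!!k. k < K ==> gamma_norm N D (v k) <= ennreal (G k)"
    for K A and v :: "nat => ('a => complex) => 'x" and G
    unfolding gamma_norm_le_iff
  proof (intro allI impI ennreal_leI)
    fix n h assume h: "orthonormal_system N D n h"
    define V where "V = (\<Sum>k<K. v k)"
    have V_apply: "V f = (\<Sum>k<K. v k f)" for f
      unfolding V_def by (induction K) auto
    have V: "L2_operator N D V"
    proof (rule L2_operatorI)
      fix g h assume "g \<in> D" "h \<in> D"
      then show "V (g + h) = V g + V h"
        unfolding V_apply sum.distrib[symmetric] by (intro sum.cong refl operator_plus v) auto
    next
      fix c h assume "h \<in> D"
      then show "V (%p. c * h p) = c *\<^sub>C V h"
        unfolding V_apply scaleC_sum_right by (intro sum.cong refl operator_scale v) auto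
    next
      fix g h assume "g \<in> D" "h \<in> D" "AE p in N. g p = h p"
      then show "V g = V h"
        unfolding V_apply by (intro sum.cong refl operator_cong v) auto
    qed
    obtain m e \<kappa> where on: "orthonormal_system N D m e"
      and s1: "!!l p. l < m ==> p \<in> space N ==> \<kappa> l < K ==> p \<notin> A (\<kappa> l) ==> e l p = 0"
      and s2: "!!l p k. l < m ==> p \<in> space N ==> \<not> \<kappa> l < K ==> k < K ==> p \<in> A k ==> e l p = 0"
      and le: "gaussian_rms n (%k. V (h k)) <= 2 * gaussian_rms m (%l. V (e l))"
      using rms_adapted[OF V h, of K A] A disj by blast
    let ?P = "gaussian_law m"
    have eD: "e l \<in> D" if "l < m" for l using on that by (auto simp: orthonormal_system_def)
    have v0: "v k (e l) = 0" if "k < K" "l < m" "\<kappa> l \<noteq> k" for k l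
    proof -
      have "AE p in N. indicator (A k) p * e l p = 0"
      proof (intro AE_I2)
        fix p assume p: "p \<in> space N"
        show "indicator (A k) p * e l p = 0"
        proof (cases "p \<in> A k")
          case True
          then have "e l p = 0"
            using s1[OF that(2) p] s2[OF that(2) p _ that(1)] disj[OF that(1) _ that(3)[symmetric]]
            by (cases "\<kappa> l < K") auto
          then show ?thesis by simp
        qed simp
      qed
      then have "v k (%p. indicator (A k) p * e l p) = v k (%p. 0)"
        by (intro operator_cong v that D_indicator A eD D_zero)
      then show ?thesis using loc[OF that(1) eD[OF that(2)]] operator_zero[OF v[OF that(1)]] by simp
    qed
    define \<xi> where "\<xi> k \<omega> = (\<Sum>l<m. \<omega> l *\<^sub>R v k (e l))" for k and \<omega> :: "nat => real"
    have \<xi>m: "(%\<omega>. norm (\<xi> k \<omega>)) \<in> borel_measurable ?P" for k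
      using norm_sum_measurable[of m "%l \<omega>. \<omega> l" ?P 0 "%l. v k (e l)"] gaussian_law_coord
      by (simp add: \<xi>_def)
    have \<xi>m': "(%\<omega>. ennreal (norm (\<xi> k \<omega>) powr r)) \<in> borel_measurable ?P" for k
      by (rule measurable_compose[OF \<xi>m]) measurable
    have swap: "(\<Sum>k<K. s k *\<^sub>R \<xi> k \<omega>) = (\<Sum>l<m. \<omega> l *\<^sub>R (\<Sum>k<K. s k *\<^sub>R v k (e l)))" for s \<omega>
      unfolding \<xi>_def scaleR_sum_right by (subst sum.swap) (simp add: mult.commute)
    have avg: "gauss_sq m (%l. \<Sum>k<K. s k *\<^sub>R v k (e l)) 0 = gauss_sq m (%l. V (e l)) 0"
      if s: "\<forall>k<K. s k \<in> {1, -1}" for s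
    proof -
      \<comment> \<open>A member \<open>e l\<close> is seen only by \<open>v (\<kappa> l)\<close>,
        so signs of the operators become signs of the Gaussian variables; members outside all
        \<open>A k\<close> get the sign 1.\<close>
      define s' where "s' l = (if \<kappa> l < K then s (\<kappa> l) else 1)" for l
      have "(\<Sum>k<K. s k *\<^sub>R v k (e l)) = s' l *\<^sub>R V (e l)" if "l < m" for l
      proof -
        have "(\<Sum>k<K. s k *\<^sub>R v k (e l)) = (\<Sum>k<K. s' l *\<^sub>R v k (e l))"
          using v0[OF _ that] by (intro sum.cong refl) (auto simp: s'_def)
        then show ?thesis by (simp add: V_apply scaleR_sum_right)
      qed
      then have "gauss_sq m (%l. \<Sum>k<K. s k *\<^sub>R v k (e l)) 0 = gauss_sq m (%l. s' l *\<^sub>R V (e l)) 0"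
        by (rule gauss_sq_cong)
      also have "... = gauss_sq m (%l. V (e l)) 0"
        by (rule gauss_sq_sign) (use s in \<open>auto simp: s'_def\<close>)
      finally show ?thesis .
    qed
    interpret P: prob_space ?P by (rule prob_space_gaussian_law)
    interpret R: prob_space "rademacher_law K" unfolding rademacher_law_def by (rule prob_space_measure_pmf)
    have fin: "finite (set_pmf (Pi_pmf {..<K} (0::real) (%_. pmf_of_set {- 1, 1})))"
      by (auto simp: set_Pi_pmf intro!: finite_PiE_dflt)
    have "gauss_sq m (%l. V (e l)) 0 = (\<integral>\<^sup>+s. gauss_sq m (%l. \<Sum>k<K. s k *\<^sub>R v k (e l)) 0 \<partial>rademacher_law K)"
      by (rule rademacher_average[symmetric]) (rule avg)
    also have "... = (\<integral>\<^sup>+s. \<integral>\<^sup>+\<omega>. ennreal ((norm (\<Sum>k<K. s k *\<^sub>R \<xi> k \<omega>))\<^sup>2) \<partial>?P \<partial>rademacher_law K)"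
      unfolding swap gauss_sq_def by simp
    also have "... = (\<integral>\<^sup>+\<omega>. \<integral>\<^sup>+s. ennreal ((norm (\<Sum>k<K. s k *\<^sub>R \<xi> k \<omega>))\<^sup>2) \<partial>rademacher_law K \<partial>?P)"
    proof -
      have m: "(%\<omega>. ennreal ((norm (\<Sum>k<K. s k *\<^sub>R \<xi> k \<omega>))\<^sup>2)) \<in> borel_measurable ?P" for s
        unfolding swap
        using norm_sum_measurable[of m "%l \<omega>. \<omega> l" ?P 0 "%l. \<Sum>k<K. s k *\<^sub>R v k (e l)"] gaussian_law_coord by simp
      show ?thesis
        unfolding rademacher_law_def
        by (simp add: nn_integral_measure_pmf_finite[OF fin], subst nn_integral_sum) (auto intro!: borel_measurable_times_ennreal m sum.cong nn_integral_multc[symmetric])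
    qed
    also have "... <= (\<integral>\<^sup>+\<omega>. ennreal (C\<^sup>2) * ennreal_powr (\<Sum>k<K. ennreal (norm (\<xi> k \<omega>) powr r)) (2 / r) \<partial>?P)"
    proof (intro nn_integral_mono)
      fix \<omega>
      let ?S = "\<Sum>k<K. norm (\<xi> k \<omega>) powr r"
      have "(rms_random_sum (rademacher_law K) K (%k. \<xi> k \<omega>))\<^sup>2 <= (C * ?S powr (1 / r))\<^sup>2"
        using C by (intro power_mono) auto
      also have "... = C\<^sup>2 * ?S powr (2 / r)"
        by (simp add: power_mult_distrib powr_powr[symmetric] powr_numeral[symmetric] power2_eq_square powr_add[symmetric])
      finally have "ennreal ((rms_random_sum (rademacher_law K) K (%k. \<xi> k \<omega>))\<^sup>2) <= ennreal (C\<^sup>2 * ?S powr (2 / r))"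
        by (rule ennreal_leI)
      then show "(\<integral>\<^sup>+s. ennreal ((norm (\<Sum>k<K. s k *\<^sub>R \<xi> k \<omega>))\<^sup>2) \<partial>rademacher_law K) \<le>
          ennreal (C\<^sup>2) * ennreal_powr (\<Sum>k<K. ennreal (norm (\<xi> k \<omega>) powr r)) (2 / r)"
        unfolding rademacher_rms_sq by (simp add: ennreal_mult ennreal_powr_ennreal sum_nonneg)
    qed
    also have "... = ennreal (C\<^sup>2) * (\<integral>\<^sup>+\<omega>. ennreal_powr (\<Sum>k<K. ennreal (norm (\<xi> k \<omega>) powr r)) (2 / r) \<partial>?P)"
      by (intro nn_integral_cmult ennreal_powr_measurable borel_measurable_sum \<xi>m')
    \<comment> \<open>The integral of the power 2/r of \<open>norm (\<xi> k \<omega>) powr r\<close>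
      is the Gaussian second moment for \<open>v k\<close>, hence at most the square of
      \<open>G k\<close>.\<close>
    also have "... <= ennreal (C\<^sup>2) * ennreal ((\<Sum>k<K. G k powr r) powr (2 / r))"
    proof (intro mult_left_mono Minkowski_sum)
      show "1 <= 2 / r" using r by simp
    next
      fix k assume k: "k \<in> {..<K}"
      show "(%\<omega>. ennreal (norm (\<xi> k \<omega>) powr r)) \<in> borel_measurable ?P" by (rule \<xi>m')
      show "0 <= G k powr r" by simp
      have "(\<integral>\<^sup>+\<omega>. ennreal_powr (ennreal (norm (\<xi> k \<omega>) powr r)) (2 / r) \<partial>?P) = gauss_sq m (%l. v k (e l)) 0"
        using r unfolding gauss_sq_def \<xi>_def by (simp add: ennreal_powr_ennreal powr_powr)
      also have "... <= ennreal ((G k)\<^sup>2)"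
      proof -
        have "ennreal (rms_random_sum ?P m (%l. v k (e l))) <= ennreal (G k)"
          using gamma_norm_upper[OF on, of "v k"] G(2)[of k] k by (auto intro: order_trans)
        then have "rms_random_sum ?P m (%l. v k (e l)) <= G k" using G(1)[of k] k by (simp add: ennreal_le_iff less_imp_le)
        then show ?thesis using G(1)[of k] k by (subst (asm) rms_gaussian_le_iff) (auto simp: less_imp_le)
      qed
      also have "(G k)\<^sup>2 = (G k powr r) powr (2 / r)" using r G(1)[of k] k by (simp add: powr_powr)
      finally show "(\<integral>\<^sup>+\<omega>. ennreal_powr (ennreal (norm (\<xi> k \<omega>) powr r)) (2 / r) \<partial>?P) <= ennreal ((G k powr r) powr (2 / r))" .
    qed auto
    also have "... = ennreal ((C * (\<Sum>k<K. G k powr r) powr (1 / r))\<^sup>2)"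
      by (simp add: ennreal_mult[symmetric] power_mult_distrib power2_eq_square powr_add[symmetric])
    finally have "rms_random_sum ?P m (%l. V (e l)) <= C * (\<Sum>k<K. G k powr r) powr (1 / r)"
      using C1 by (subst rms_gaussian_le_iff) auto
    then show "gaussian_rms n (%k. (\<Sum>k<K. v k) (h k)) <= 2 * C * (\<Sum>k<K. G k powr r) powr (1 / r)"
      using le unfolding V_def by linarith
  qed
  show ?thesis
  proof (rule that[of "2 * C"])
    show "2 * C > 0" using C1 by simp
  qed (rule bound; assumption)
qed

section \<open>A covering lemma and the density enlargement\<close>

text \<open>A maximal family among those satisfying \<open>ok\<close> exists by Zorn's lemma: the
  third clause, that a ball meeting the family meets a member of at least half its radius, passes to
  unions of chains. If some ball of \<open>F\<close> met no member, one of more than half the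
  supremal radius among such balls could be added without leaving \<open>ok\<close>.\<close>

lemma Vitali_covering_metric:
  fixes F :: "('m::metric_space \<times> real) set"
  assumes pos: "!!y t. (y, t) \<in> F ==> 0 < t \<and> t <= R"
  obtains G where "G \<subseteq> F" "!!y t y' t'. (y, t) \<in> G ==> (y', t') \<in> G ==> (y, t) \<noteq> (y', t') ==> ball y t \<inter> ball y' t' = {}"
    "!!y t. (y, t) \<in> F ==> \<exists>(y', t')\<in>G. ball y t \<inter> ball y' t' \<noteq> {} \<and> t <= 2 * t'"
proof -
  define B where "B = (%(y::'m, t). ball y t)"
  define ok where "ok G \<longleftrightarrow> G \<subseteq> F \<and> (\<forall>b\<in>G. \<forall>b'\<in>G. b \<noteq> b' --> B b \<inter> B b' = {}) \<and>
    (\<forall>b\<in>F. (\<exists>b'\<in>G. B b \<inter> B b' \<noteq> {}) --> (\<exists>b'\<in>G. B b \<inter> B b' \<noteq> {} \<and> snd b <= 2 * snd b'))" for G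
  have "\<exists>M\<in>{G. ok G}. \<forall>X\<in>{G. ok G}. M \<subseteq> X --> X = M"
  proof (rule subset_Zorn_nonempty)
    show "{G. ok G} \<noteq> {}" by (auto simp: ok_def intro!: exI[of _ "{}"])
  next
    fix C assume C: "C \<noteq> {}" "subset.chain {G. ok G} C"
    have okC: "ok G" if "G \<in> C" for G using C that by (auto simp: subset.chain_def)
    have tot: "G \<subseteq> G' \<or> G' \<subseteq> G" if "G \<in> C" "G' \<in> C" for G G' using C that by (auto simp: subset.chain_def)
    have "ok (\<Union>C)"
      unfolding ok_def
    proof (intro conjI ballI impI)
      show "\<Union>C \<subseteq> F" using okC unfolding ok_def by (meson Union_least)
    next
      fix b b' assume "b \<in> \<Union>C" "b' \<in> \<Union>C" "b \<noteq> b'"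
      then obtain G where "G \<in> C" "b \<in> G" "b' \<in> G" using tot by blast
      then show "B b \<inter> B b' = {}" using okC[of G] \<open>b \<noteq> b'\<close> unfolding ok_def by blast
    next
      fix b assume "b \<in> F" "\<exists>b'\<in>\<Union>C. B b \<inter> B b' \<noteq> {}"
      then obtain G b' where "G \<in> C" "b' \<in> G" "B b \<inter> B b' \<noteq> {}" by blast
      then show "\<exists>b'\<in>\<Union>C. B b \<inter> B b' \<noteq> {} \<and> snd b <= 2 * snd b'"
        using okC[of G] \<open>b \<in> F\<close> unfolding ok_def by (meson UnionI)
    qed
    then show "\<Union>C \<in> {G. ok G}" by simp
  qed
  then obtain G where G: "ok G" and max: "!!X. ok X ==> G \<subseteq> X ==> X = G" by blast
  have meet: "\<exists>b'\<in>G. B b \<inter> B b' \<noteq> {}" if "b \<in> F" for b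
  proof (rule ccontr)
    define L where "L = {b\<in>F. \<forall>b'\<in>G. B b \<inter> B b' = {}}"
    assume "\<not> ?thesis"
    then have "b \<in> L" using that by (auto simp: L_def)
    have bdd: "bdd_above (snd ` L)" using pos by (force simp: L_def bdd_above_def)
    define s where "s = Sup (snd ` L)"
    have "0 < snd b" using pos[of "fst b" "snd b"] that by simp
    then have "0 < s" using cSup_upper[OF imageI[OF \<open>b \<in> L\<close>] bdd] by (simp add: s_def)
    then have "s / 2 < Sup (snd ` L)" by (simp add: s_def)
    then obtain b0 where b0: "b0 \<in> L" "s / 2 < snd b0"
      using less_cSup_iff[OF _ bdd, of "s / 2"] \<open>b \<in> L\<close> by (metis empty_iff image_iff image_is_empty)
    have "ok (insert b0 G)"
      unfolding ok_def
    proof (intro conjI ballI impI)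
      show "insert b0 G \<subseteq> F" using G b0 by (auto simp: ok_def L_def)
    next
      fix c c' assume "c \<in> insert b0 G" "c' \<in> insert b0 G" "c \<noteq> c'"
      then show "B c \<inter> B c' = {}" using G b0 unfolding ok_def L_def by blast
    next
      fix c assume c: "c \<in> F" "\<exists>c'\<in>insert b0 G. B c \<inter> B c' \<noteq> {}"
      show "\<exists>c'\<in>insert b0 G. B c \<inter> B c' \<noteq> {} \<and> snd c <= 2 * snd c'"
      proof (cases "\<exists>c'\<in>G. B c \<inter> B c' \<noteq> {}")
        case True
        then show ?thesis using G c unfolding ok_def by (meson insertI2)
      next
        case False
        then have "c \<in> L" using c by (auto simp: L_def)
        then have "snd c <= s" using cSup_upper[OF imageI bdd] by (simp add: s_def)
        then show ?thesis using b0 c False by (intro bexI[of _ b0]) auto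
      qed
    qed
    then have "insert b0 G = G" using max by blast
    then have "B b0 \<inter> B b0 = {}" using b0 by (auto simp: L_def)
    moreover have "fst b0 \<in> B b0" using pos[of "fst b0" "snd b0"] b0 by (auto simp: B_def L_def split_beta)
    ultimately show False by blast
  qed
  show ?thesis
  proof (rule that[of G])
    show "G \<subseteq> F" using G by (simp add: ok_def)
    show "ball y t \<inter> ball y' t' = {}" if "(y, t) \<in> G" "(y', t') \<in> G" "(y, t) \<noteq> (y', t')" for y t y' t'
    proof -
      have "B (y, t) \<inter> B (y', t') = {}" using G that unfolding ok_def by blast
      then show ?thesis by (simp add: B_def)
    qed
    show "\<exists>(y', t')\<in>G. ball y t \<inter> ball y' t' \<noteq> {} \<and> t <= 2 * t'" if yt: "(y, t) \<in> F" for y t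
    proof -
      obtain b' where "b' \<in> G" "B (y, t) \<inter> B b' \<noteq> {}" "snd (y, t) <= 2 * snd b'"
        using G meet[OF yt] yt unfolding ok_def by blast
      then show ?thesis by (intro bexI[of _ b']) (auto simp: B_def)
    qed
  qed
qed

section \<open>Metric measure spaces, balls and dense balls\<close>

type_synonym ('m, 'x) tent_operator = "('m \<times> real => complex) => 'x"

locale metric_measure_space =
  fixes \<mu> :: "'m::metric_space measure"
  assumes metric_measure: "metric_measure \<mu>"
begin

abbreviation Tent :: "real => ('m, 'x::complex_banach) tent_operator normed_subspace" where
  "Tent \<equiv> tent_space \<mu>"

abbreviation sqf :: "('m, 'x::complex_banach) tent_operator => 'm => ennreal" where
  "sqf \<equiv> square_function \<mu>"

lemma sets_mu [simp]: "sets \<mu> = sets borel"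
  using metric_measure by (simp add: metric_measure_def)

lemma space_mu [simp]: "space \<mu> = UNIV"
  using sets_eq_imp_space_eq[OF sets_mu] by simp

lemma emeasure_ball: "t > 0 ==> 0 < emeasure \<mu> (ball x t)" "t > 0 ==> emeasure \<mu> (ball x t) < \<infinity>"
  using metric_measure by (auto simp: metric_measure_def)

lemma emeasure_ball_eq: "emeasure \<mu> (ball x t) = ennreal (measure \<mu> (ball x t))"
proof (cases "t > 0")
  case True
  then show ?thesis using emeasure_ball(2)[OF True, of x] by (intro emeasure_eq_ennreal_measure) auto
qed (auto simp: ball_empty)

lemma measure_ball_pos: "t > 0 ==> 0 < measure \<mu> (ball x t)"
  using emeasure_ball(1)[of t x] by (simp add: emeasure_ball_eq)

lemma measure_mono_ball: "A \<subseteq> ball x t ==> A \<in> sets borel ==> measure \<mu> A <= measure \<mu> (ball x t)"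
  by (intro measure_mono_fmeasurable fmeasurableI) (auto simp: emeasure_ball_eq)

lemma emeasure_bounded: "bounded E ==> E \<in> sets borel ==> emeasure \<mu> E < \<infinity>"
proof -
  assume "bounded E" "E \<in> sets borel"
  obtain x e where "E \<subseteq> ball x e" using \<open>bounded E\<close> by (meson bounded_subset_ballD)
  then have "emeasure \<mu> E <= emeasure \<mu> (ball x e)" by (intro emeasure_mono) auto
  then show ?thesis by (simp add: emeasure_ball_eq le_less_trans)
qed

lemma UN_ball_nat: "(\<Union>n::nat. ball x (real n)) = UNIV"
proof -
  have "\<exists>n::nat. dist x y < real n" for y by (rule reals_Archimedean2)
  then show ?thesis by auto
qed

sublocale sigma_finite_measure \<mu>
proof
  show "\<exists>A. countable A \<and> A \<subseteq> sets \<mu> \<and> \<Union>A = space \<mu> \<and> (\<forall>a\<in>A. emeasure \<mu> a \<noteq> \<infinity>)"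
    using UN_ball_nat[of "undefined"]
    by (intro exI[of _ "range (%n::nat. ball undefined (real n))"]) (auto simp: emeasure_ball_eq)
qed

text \<open>A supremum exceeds \<sigma> exactly if one of its terms does, so the enlargement is a
  union of balls. Openness and monotonicity are read off from this form.\<close>

lemma density_enlargement_alt:
  "density_enlargement \<mu> \<sigma> E = \<Union>{ball y t | y t. 0 < t \<and> \<sigma> * measure \<mu> (ball y t) < measure \<mu> (ball y t \<inter> E)}"
  if E: "E \<in> sets borel"
proof (intro set_eqI)
  fix x
  let ?I = "{(y::'m, t). 0 < t \<and> x \<in> ball y t}"
  let ?f = "%(y, t). measure \<mu> (ball y t \<inter> E) / measure \<mu> (ball y t)"
  have "(x, 1) \<in> ?I" by simp
  then have ne: "?I \<noteq> {}" by blast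
  have bdd: "bdd_above (?f ` ?I)"
  proof (rule bdd_aboveI2[of _ _ 1])
    fix z assume z: "z \<in> ?I"
    obtain y t where "z = (y, t)" by (cases z)
    then have "measure \<mu> (ball y t \<inter> E) <= measure \<mu> (ball y t)" "0 < measure \<mu> (ball y t)"
      using z E by (auto intro!: measure_mono_ball measure_ball_pos)
    then show "?f z <= 1" using \<open>z = (y, t)\<close> by (simp add: divide_le_eq_1)
  qed
  have "x \<in> density_enlargement \<mu> \<sigma> E \<longleftrightarrow> (\<exists>z\<in>?I. \<sigma> < ?f z)"
    unfolding density_enlargement_def mem_Collect_eq less_cSUP_iff[OF ne bdd] ..
  also have "... \<longleftrightarrow> (\<exists>y t. 0 < t \<and> x \<in> ball y t \<and> \<sigma> < measure \<mu> (ball y t \<inter> E) / measure \<mu> (ball y t))"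
    by auto
  also have "... \<longleftrightarrow> (\<exists>y t. 0 < t \<and> x \<in> ball y t \<and> \<sigma> * measure \<mu> (ball y t) < measure \<mu> (ball y t \<inter> E))"
    using pos_less_divide_eq[OF measure_ball_pos] by metis
  also have "... \<longleftrightarrow> x \<in> \<Union>{ball y t | y t. 0 < t \<and> \<sigma> * measure \<mu> (ball y t) < measure \<mu> (ball y t \<inter> E)}"
    by blast
  finally show "x \<in> density_enlargement \<mu> \<sigma> E \<longleftrightarrow> x \<in> \<Union>{ball y t | y t. 0 < t \<and> \<sigma> * measure \<mu> (ball y t) < measure \<mu> (ball y t \<inter> E)}" .
qed

lemma open_density_enlargement: "E \<in> sets borel ==> open (density_enlargement \<mu> \<sigma> E)"
  unfolding density_enlargement_alt by (intro open_Union) auto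

lemma density_enlargement_mono:
  assumes "E \<subseteq> E'" "E \<in> sets borel" "E' \<in> sets borel"
  shows "density_enlargement \<mu> \<sigma> E \<subseteq> density_enlargement \<mu> \<sigma> E'"
proof -
  have "measure \<mu> (ball y t \<inter> E) <= measure \<mu> (ball y t \<inter> E')" for y t
  proof (rule measure_mono_fmeasurable)
    show "ball y t \<inter> E' \<in> fmeasurable \<mu>"
      using assms emeasure_bounded[of "ball y t \<inter> E'"] by (intro fmeasurableI) (auto simp: bounded_Int)
  qed (use assms in auto)
  then have "\<sigma> * measure \<mu> (ball y t) < measure \<mu> (ball y t \<inter> E')"
    if "\<sigma> * measure \<mu> (ball y t) < measure \<mu> (ball y t \<inter> E)" for y t
    using that by (rule less_le_trans[rotated])
  then show ?thesis
    unfolding density_enlargement_alt[OF assms(2)] density_enlargement_alt[OF assms(3)]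
    by blast
qed

end

locale doubling_space = metric_measure_space +
  assumes doubling: "doubling \<mu>"
begin

lemma doubling_const: obtains D where "D > 0" "!!x t. t > 0 ==> measure \<mu> (ball x (\<alpha> * t)) <= D * measure \<mu> (ball x t)"
proof -
  obtain n C where "n > 0" and C: "!!x t \<alpha>. 0 < t ==> 1 <= \<alpha> ==> measure \<mu> (ball x (\<alpha> * t)) <= C * \<alpha> powr n * measure \<mu> (ball x t)"
    using doubling unfolding doubling_def by blast
  define a where "a = max \<alpha> 1"
  have "measure \<mu> (ball x (\<alpha> * t)) <= max 1 (C * a powr n) * measure \<mu> (ball x t)" if "t > 0" for x t
  proof -
    have "measure \<mu> (ball x (\<alpha> * t)) <= measure \<mu> (ball x (a * t))"
      using that by (intro measure_mono_ball) (auto simp: a_def subset_ball mult_right_mono)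
    also have "... <= C * a powr n * measure \<mu> (ball x t)" by (rule C) (auto simp: a_def that)
    also have "... <= max 1 (C * a powr n) * measure \<mu> (ball x t)" by (intro mult_right_mono) auto
    finally show ?thesis .
  qed
  then show ?thesis using that[of "max 1 (C * a powr n)"] by simp
qed

text \<open>The weak type (1,1) inequality for the maximal function of an indicator. The dense balls
  are thinned to disjoint ones by the covering lemma; each has measure at most 1/\<sigma> times that
  of its part in \<open>E\<close>, and doubling pays for the fivefold enlargement.\<close>

lemma emeasure_density_enlargement_le:
  assumes \<sigma>: "0 < \<sigma>"
  obtains C where "C \<ge> 0" "!!E. open E ==> bounded E ==> emeasure \<mu> (density_enlargement \<mu> \<sigma> E) <= ennreal C * emeasure \<mu> E"
proof -
  obtain D2 where D2: "D2 > 0" "!!x t. t > 0 ==> measure \<mu> (ball x (2 * t)) <= D2 * measure \<mu> (ball x t)"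
    using doubling_const[of 2] by blast
  obtain D5 where D5: "D5 > 0" "!!x t. t > 0 ==> measure \<mu> (ball x (5 * t)) <= D5 * measure \<mu> (ball x t)"
    using doubling_const[of 5] by blast
  define C where "C = max D2 D5 / \<sigma>"
  have C0: "C \<ge> 0" using \<sigma> D2 by (simp add: C_def)
  have "emeasure \<mu> (density_enlargement \<mu> \<sigma> E) <= ennreal C * emeasure \<mu> E" if E: "open E" "bounded E" for E
  proof -
    have Es: "E \<in> sets borel" using E by simp
    define m where "m = measure \<mu> E"
    have em: "emeasure \<mu> E = ennreal m"
      unfolding m_def using emeasure_bounded[OF E(2) Es] by (intro emeasure_eq_ennreal_measure) auto
    have fE: "E \<in> fmeasurable \<mu>" using em Es by (intro fmeasurableI) auto
    have capE: "measure \<mu> (A \<inter> E) <= m" if "A \<in> sets borel" for A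
      unfolding m_def using that Es by (intro measure_mono_fmeasurable fE) auto
    define F where "F = {(y, t). 0 < t \<and> \<sigma> * measure \<mu> (ball y t) < measure \<mu> (ball y t \<inter> E)}"
    have W: "density_enlargement \<mu> \<sigma> E = \<Union>{ball y t | y t. (y, t) \<in> F}"
      unfolding density_enlargement_alt[OF Es] F_def by simp
    have Fm: "measure \<mu> (ball y t) <= m / \<sigma>" if "(y, t) \<in> F" for y t
      using that capE[of "ball y t"] \<sigma> by (auto simp: F_def field_simps)
    show ?thesis
    proof (cases "\<exists>R. \<forall>(y, t)\<in>F. t <= R")
      case False
      \<comment> \<open>There are dense balls of arbitrarily large radius, each meeting
        \<open>E\<close> and of measure at most \<open>m / \<sigma>\<close>. Doubling the radius of
        a large one captures any given ball about \<open>x0\<close>, so the whole space has measure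
        at most \<open>C * m\<close>.\<close>
      obtain x0 e0 where e0: "E \<subseteq> ball x0 e0" using E(2) by (meson bounded_subset_ballD)
      have b: "measure \<mu> (ball x0 s) <= C * m" for s
      proof -
        obtain y t where yt: "(y, t) \<in> F" "t > max 0 s + e0" "t > 0"
          using False by (force simp: F_def not_le)
        have "measure \<mu> (ball y t \<inter> E) \<noteq> 0" using yt(1) mult_pos_pos[OF \<sigma> measure_ball_pos[OF yt(3), of y]] by (auto simp: F_def)
        then have "ball y t \<inter> E \<noteq> {}" by auto
        then obtain z where z: "dist y z < t" "dist x0 z < e0" using e0 by force
        have "ball x0 s \<subseteq> ball y (2 * t)"
        proof
          fix x assume "x \<in> ball x0 s"
          then have "dist y x < t + e0 + s"
            using z dist_triangle[of y x z] dist_triangle[of z x x0] by (simp add: dist_commute)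
          then show "x \<in> ball y (2 * t)" using yt by simp
        qed
        then have "measure \<mu> (ball x0 s) <= measure \<mu> (ball y (2 * t))" by (intro measure_mono_ball) auto
        also have "... <= D2 * measure \<mu> (ball y t)" by (rule D2) (rule yt)
        also have "... <= D2 * (m / \<sigma>)" using D2 Fm[OF yt(1)] by (intro mult_left_mono) auto
        also have "... <= C * m" using \<sigma> by (simp add: C_def m_def divide_right_mono mult_right_mono)
        finally show ?thesis .
      qed
      have "emeasure \<mu> UNIV = (SUP n. emeasure \<mu> (ball x0 (real n)))"
        unfolding UN_ball_nat[of x0, symmetric] by (intro SUP_emeasure_incseq[symmetric]) (auto simp: incseq_def)
      also have "... <= ennreal (C * m)" by (intro SUP_least) (simp add: emeasure_ball_eq b ennreal_leI)
      finally have "emeasure \<mu> UNIV <= ennreal C * emeasure \<mu> E" using C0 by (simp add: em m_def ennreal_mult)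
      then show ?thesis using emeasure_mono[of "density_enlargement \<mu> \<sigma> E" UNIV \<mu>] by simp
    next
      case True
      then obtain R where R: "!!y t. (y, t) \<in> F ==> 0 < t \<and> t <= R" by (auto simp: F_def)
      obtain G where GF: "G \<subseteq> F"
        and disj: "!!y t y' t'. (y, t) \<in> G ==> (y', t') \<in> G ==> (y, t) \<noteq> (y', t') ==> ball y t \<inter> ball y' t' = {}"
        and cov: "!!y t. (y, t) \<in> F ==> \<exists>(y', t')\<in>G. ball y t \<inter> ball y' t' \<noteq> {} \<and> t <= 2 * t'"
        using Vitali_covering_metric[of F R] R by blast
      define c where "c = (%(y, t). measure \<mu> (ball y t \<inter> E))"
      have cpos: "c b > 0" if "b \<in> G" for b
      proof -
        obtain y t where "b = (y, t)" by (cases b)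
        then have "t > 0" "\<sigma> * measure \<mu> (ball y t) < c b" using that GF by (auto simp: F_def c_def)
        then show ?thesis using \<sigma> measure_ball_pos[of t y] by (meson less_trans mult_pos_pos)
      qed
      have csum: "(\<Sum>b\<in>H. c b) <= m" if "finite H" "H \<subseteq> G" for H
      proof -
        have "(\<Sum>b\<in>H. c b) = measure \<mu> (\<Union>b\<in>H. (%(y, t). ball y t \<inter> E) b)"
        proof (subst measure_finite_Union)
          show "(%b. (%(y, t). ball y t \<inter> E) b) ` H \<subseteq> sets \<mu>" using Es by auto
          show "disjoint_family_on (%b. (%(y, t). ball y t \<inter> E) b) H"
            unfolding disjoint_family_on_def
          proof (intro ballI impI)
            fix b b' assume bb: "b \<in> H" "b' \<in> H" "b \<noteq> b'"
            have "ball (fst b) (snd b) \<inter> ball (fst b') (snd b') = {}"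
              using bb that(2) by (intro disj) auto
            then show "(%(y, t). ball y t \<inter> E) b \<inter> (%(y, t). ball y t \<inter> E) b' = {}"
              by (auto simp: split_beta)
          qed
          show "emeasure \<mu> ((%(y, t). ball y t \<inter> E) b) \<noteq> \<infinity>" for b
            using emeasure_mono[of "(%(y, t). ball y t \<inter> E) b" E \<mu>] Es by (auto simp: em split_beta top_unique)
        qed (use that in \<open>auto simp: c_def split_beta intro!: sum.cong\<close>)
        also have "... <= m" unfolding m_def
          using Es that by (intro measure_mono_fmeasurable fE) (auto intro!: sets.finite_UN)
        finally show ?thesis .
      qed
      \<comment> \<open>The disjoint balls have parts in \<open>E\<close> of positive measure and
        total mass at most \<open>m\<close>. A summable family of positive numbers is countable, so
        \<open>G\<close> can be enumerated.\<close>
      have "c summable_on G"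
        using csum cpos by (intro nonneg_bdd_above_summable_on bdd_aboveI2[of _ _ m]) (auto intro: less_imp_le)
      then have "countable {b\<in>G. c b \<noteq> 0}" by (rule summable_countable_real)
      moreover have "{b\<in>G. c b \<noteq> 0} = G" using cpos by force
      ultimately have cG: "countable G" by simp
      have sub: "density_enlargement \<mu> \<sigma> E \<subseteq> (\<Union>(y, t)\<in>G. ball y (5 * t))"
      proof
        fix x assume "x \<in> density_enlargement \<mu> \<sigma> E"
        then obtain y t where yt: "(y, t) \<in> F" "dist y x < t" unfolding W by auto
        then obtain y' t' z where y': "(y', t') \<in> G" "t <= 2 * t'" "dist y z < t" "dist y' z < t'"
          using cov[OF yt(1)] by force
        \<comment> \<open>The path from \<open>y'\<close> through \<open>z\<close> and
          \<open>y\<close> to \<open>x\<close> is shorter than t' + t + t, and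
          \<open>t <= 2 * t'\<close>.\<close>
        have "dist y' x < 5 * t'"
          using y' yt dist_triangle[of y' x z] dist_triangle[of z x y] by (simp add: dist_commute)
        then show "x \<in> (\<Union>(y, t)\<in>G. ball y (5 * t))" using y'(1) by (intro UN_I[of "(y', t')"]) auto
      qed
      show ?thesis
      proof (cases "G = {}")
        case True
        then show ?thesis using sub by simp
      next
        case False
        define b where "b i = (%(y, t). ball y (5 * t)) (from_nat_into G i)" for i
        have UN: "(\<Union>(y, t)\<in>G. ball y (5 * t)) = (\<Union>n. \<Union>i<n. b i)"
        proof -
          have "(\<Union>(y, t)\<in>G. ball y (5 * t)) = (\<Union>i. b i)"
            unfolding b_def using range_from_nat_into[OF False cG] by (metis (no_types, lifting) SUP_cong image_image)
          also have "... = (\<Union>n. \<Union>i<n. b i)" by auto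
          finally show ?thesis .
        qed
        have "emeasure \<mu> (\<Union>i<n. b i) <= ennreal (C * m)" for n
        proof -
          let ?H = "from_nat_into G ` {..<n}"
          have H: "finite ?H" "?H \<subseteq> G" using from_nat_into[OF False] by auto
          have "(\<Union>i<n. b i) = (\<Union>h\<in>?H. (%(y, t). ball y (5 * t)) h)" by (auto simp: b_def)
          then have "emeasure \<mu> (\<Union>i<n. b i) <= (\<Sum>h\<in>?H. emeasure \<mu> ((%(y, t). ball y (5 * t)) h))"
            by (simp only:) (intro emeasure_subadditive_finite, auto)
          also have "... <= (\<Sum>h\<in>?H. ennreal (C * c h))"
          proof (intro sum_mono)
            fix h assume "h \<in> ?H"
            obtain y t where h: "h = (y, t)" by (cases h)
            then have yt: "(y, t) \<in> F" using H GF \<open>h \<in> ?H\<close> by auto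
            then have t: "t > 0" and l: "\<sigma> * measure \<mu> (ball y t) < c h" by (auto simp: F_def c_def h)
            have "measure \<mu> (ball y (5 * t)) <= D5 * measure \<mu> (ball y t)" by (rule D5) (rule t)
            also have "... <= D5 * (c h / \<sigma>)" using D5 l \<sigma> by (intro mult_left_mono) (auto simp: field_simps)
            also have "... <= C * c h" using \<sigma> cpos[of h] H \<open>h \<in> ?H\<close>
              by (simp add: C_def) (intro divide_right_mono mult_right_mono, auto intro: less_imp_le)
            finally show "emeasure \<mu> ((%(y, t). ball y (5 * t)) h) <= ennreal (C * c h)"
              by (simp add: h emeasure_ball_eq ennreal_leI)
          qed
          also have "... = ennreal (C * (\<Sum>h\<in>?H. c h))"
          proof -
            have "0 <= C * c h" if "h \<in> ?H" for h
              using C0 cpos[of h] H(2) that by (intro mult_nonneg_nonneg) (auto intro: less_imp_le)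
            then show ?thesis unfolding sum_distrib_left by (rule sum_ennreal)
          qed
          also have "... <= ennreal (C * m)" using csum[OF H] C0 by (intro ennreal_leI mult_left_mono)
          finally show ?thesis .
        qed
        then have "(SUP n. emeasure \<mu> (\<Union>i<n. b i)) <= ennreal (C * m)" by (intro SUP_least)
        moreover have "(SUP n. emeasure \<mu> (\<Union>i<n. b i)) = emeasure \<mu> (\<Union>n. \<Union>i<n. b i)"
          by (intro SUP_emeasure_incseq) (auto simp: incseq_def b_def split_beta intro!: sets.finite_UN dest: order_less_le_trans)
        ultimately have "emeasure \<mu> (\<Union>(y, t)\<in>G. ball y (5 * t)) <= ennreal (C * m)" by (simp add: UN)
        moreover have "emeasure \<mu> (density_enlargement \<mu> \<sigma> E) <= emeasure \<mu> (\<Union>(y, t)\<in>G. ball y (5 * t))"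
          using cG by (intro emeasure_mono[OF sub]) (auto intro!: sets.countable_UN'' simp: split_beta)
        ultimately show ?thesis using C0 by (simp add: em m_def ennreal_mult)
      qed
    qed
  qed
  then show ?thesis using that C0 by blast
qed

end

section \<open>Square functions\<close>

lemma restrict_restrict_operator:
  "restrict_operator (restrict_operator u A) B = restrict_operator u (A \<inter> B)"
  by (simp add: restrict_operator_def indicator_inter_arith mult.assoc)

context L2_domain begin

lemma restrict_operator_split:
  assumes u: "L2_operator N D u" and "A \<in> sets N" "B \<in> sets N" "A \<inter> B = {}" and h: "h \<in> D"
  shows "restrict_operator u (A \<union> B) h = restrict_operator u A h + restrict_operator u B h"
proof -
  have "(%p. indicator (A \<union> B) p * h p) = (%p. (indicator A p * h p) + (indicator B p * h p))"
    using assms(4) by (auto simp: indicator_def fun_eq_iff)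
  then show ?thesis
    unfolding restrict_operator_def using operator_add[OF u D_indicator[OF assms(2) h] D_indicator[OF assms(3) h]] by simp
qed

lemma gamma_norm_restrict_mono:
  assumes u: "L2_operator N D u" and A: "A \<in> sets N" "B \<in> sets N" "A \<subseteq> B"
  shows "gamma_norm N D (restrict_operator u A) <= gamma_norm N D (restrict_operator u B)"
proof -
  have "restrict_operator u A = restrict_operator (restrict_operator u B) A"
    using A(3) by (simp add: restrict_restrict_operator Int_absorb1)
  then show ?thesis using gamma_norm_restrict_le[OF L2_operator_restrict[OF u A(2)] A(1)] by simp
qed

lemma gamma_norm_restrict_Un:
  assumes u: "L2_operator N D u" and A: "A \<in> sets N" "B \<in> sets N"
  shows "gamma_norm N D (restrict_operator u (A \<union> B)) \<le>
    gamma_norm N D (restrict_operator u A) + gamma_norm N D (restrict_operator u B)"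
proof -
  have "gamma_norm N D (restrict_operator u (A \<union> (B - A))) =
      gamma_norm N D (restrict_operator u A + restrict_operator u (B - A))"
    by (rule gamma_norm_cong, unfold plus_fun_apply, rule restrict_operator_split[OF u]) (use A in auto)
  also have "... <= gamma_norm N D (restrict_operator u A) + gamma_norm N D (restrict_operator u (B - A))"
    by (rule gamma_norm_add)
  also have "... <= gamma_norm N D (restrict_operator u A) + gamma_norm N D (restrict_operator u B)"
    using A by (intro add_left_mono gamma_norm_restrict_mono u) auto
  finally show ?thesis by simp
qed

text \<open>With cones as the covering sets, this converts the cone covering property into a bound
  of one value of the square function by finitely many others.\<close>

lemma gamma_norm_restrict_cover:
  assumes u: "L2_operator N D u" and "finite F" "!!z. z \<in> F ==> C z \<in> sets N" and "B \<in> sets N" "B \<subseteq> (\<Union>z\<in>F. C z)"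
  shows "gamma_norm N D (restrict_operator u B) <= (\<Sum>z\<in>F. gamma_norm N D (restrict_operator u (C z)))"
proof -
  have "gamma_norm N D (restrict_operator u (\<Union>z\<in>F. C z)) <= (\<Sum>z\<in>F. gamma_norm N D (restrict_operator u (C z)))"
    using assms(2,3)
  proof (induction F rule: finite_induct)
    case empty
    have "restrict_operator u {} = 0"
      by (simp add: fun_eq_iff restrict_operator_def operator_zero[OF u])
    then show ?case using gamma_norm_zero by (metis UN_empty zero_le)
  next
    case (insert z F)
    have "gamma_norm N D (restrict_operator u (C z \<union> (\<Union>z\<in>F. C z))) \<le>
      gamma_norm N D (restrict_operator u (C z)) + gamma_norm N D (restrict_operator u (\<Union>z\<in>F. C z))"
      using insert by (intro gamma_norm_restrict_Un u sets.finite_UN) auto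
    also have "... <= gamma_norm N D (restrict_operator u (C z)) + (\<Sum>z\<in>F. gamma_norm N D (restrict_operator u (C z)))"
      using insert by (intro add_left_mono) auto
    finally show ?case using insert.hyps by simp
  qed
  moreover have "gamma_norm N D (restrict_operator u B) <= gamma_norm N D (restrict_operator u (\<Union>z\<in>F. C z))"
    using assms by (intro gamma_norm_restrict_mono u sets.finite_UN) auto
  ultimately show ?thesis by (rule order_trans[rotated])
qed

end

context metric_measure_space begin

abbreviation nu :: "('m \<times> real) measure" where "nu \<equiv> half_space_measure \<mu>"

abbreviation gam :: "('m, 'x::complex_banach) tent_operator => ennreal" where
  "gam \<equiv> gamma_norm (half_space_measure \<mu>) (L2c \<mu>)"

lemma space_nu: "space nu = upper_half_space"
  by (simp add: half_space_measure_def space_restrict_space space_pair_measure upper_half_space_def)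

lemma sets_nu_iff: "A \<in> sets nu \<longleftrightarrow> A \<in> sets (\<mu> \<Otimes>\<^sub>M lborel) \<and> A \<subseteq> upper_half_space"
proof -
  have "(upper_half_space :: ('m \<times> real) set) \<in> sets (\<mu> \<Otimes>\<^sub>M lborel)"
    unfolding upper_half_space_def by (intro pair_measureI) auto
  then show ?thesis
    unfolding half_space_measure_def sets_density by (subst sets_restrict_space_iff) (auto simp: space_pair_measure)
qed

lemma cone_sets [simp]: "cone_at x \<in> sets nu"
  by (rule sets_cone_at) simp

text \<open>A tent compares \<open>t\<close> with the distance of \<open>y\<close> to the
  complement, a continuous function of \<open>y\<close>. The whole space is a separate case because
  \<open>infdist\<close> to the empty set is 0 rather than infinite.\<close>

lemma tent_sets [simp]:
  assumes "open E" shows "tent E \<in> sets nu"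
proof (cases "E = UNIV")
  case True
  have "tent E = space nu" by (auto simp: True tent_def space_nu upper_half_space_def)
  then show ?thesis by simp
next
  case False
  have "ball y t \<subseteq> E \<longleftrightarrow> t <= infdist y (- E)" for y t
  proof
    assume *: "ball y t \<subseteq> E"
    have ne: "- E \<noteq> {}" using False by auto
    show "t <= infdist y (- E)"
      unfolding infdist_notempty[OF ne]
    proof (rule cINF_greatest[OF ne])
      fix a assume "a \<in> - E"
      then show "t <= dist y a" using * by (meson ComplD mem_ball not_le subset_iff)
    qed
  next
    assume *: "t <= infdist y (- E)"
    show "ball y t \<subseteq> E"
    proof
      fix z assume "z \<in> ball y t"
      show "z \<in> E"
      proof (rule ccontr)
        assume "z \<notin> E"
        then have "infdist y (- E) <= dist y z" by (intro infdist_le) simp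
        then show False using * \<open>z \<in> ball y t\<close> by simp
      qed
    qed
  qed
  then have t: "tent E = {p \<in> space (\<mu> \<Otimes>\<^sub>M lborel). 0 < snd p \<and> snd p <= infdist (fst p) (- E)}"
    by (auto simp: tent_def space_pair_measure)
  have m: "(%y. infdist y (- E)) \<in> borel_measurable \<mu>"
    unfolding measurable_cong_sets[OF sets_mu refl]
    by (intro borel_measurable_continuous_onI continuous_intros)
  have "{p \<in> space (\<mu> \<Otimes>\<^sub>M lborel). 0 < snd p \<and> snd p <= infdist (fst p) (- E)} \<in> sets (\<mu> \<Otimes>\<^sub>M lborel)"
    using measurable_compose[OF measurable_fst m] by measurable
  then show ?thesis by (auto simp: t sets_nu_iff upper_half_space_def)
qed

text \<open>Cylinders exhaust the half-space, and every compact subset lies in one. They keep away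
  from \<open>t = 0\<close>, which bounds the volumes of the balls \<open>B(y,t)\<close> from below,
  and the cones that meet one of them have their vertices in a bounded set.\<close>

definition cylinder :: "'m => real => ('m \<times> real) set" where
  "cylinder x0 R = ball x0 R \<times> {1/R<..<R}"

lemma cylinder_sets [simp]: "0 < R ==> cylinder x0 R \<in> sets nu"
  unfolding sets_nu_iff cylinder_def upper_half_space_def
  by (auto intro!: pair_measureI intro: order_less_trans[rotated])

lemma cylinder_mono: "0 < R ==> R <= R' ==> cylinder x0 R \<subseteq> cylinder x0 R'"
  using divide_left_mono[of R R' 1] by (auto simp: cylinder_def)

lemma compact_subset_cylinder:
  assumes "compact K" "K \<subseteq> upper_half_space"
  shows "\<exists>R0>0. \<forall>R\<ge>R0. K \<subseteq> cylinder x0 R"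
proof -
  let ?U = "%n::nat. cylinder x0 (real (Suc n))"
  have "open (?U n)" for n unfolding cylinder_def by (intro open_Times) auto
  moreover have "K \<subseteq> (\<Union>n. ?U n)"
  proof
    fix p assume "p \<in> K"
    obtain y t where p: "p = (y, t)" by (cases p)
    have t: "t > 0" using assms \<open>p \<in> K\<close> by (auto simp: p upper_half_space_def)
    obtain n :: nat where n: "max (dist x0 y) (max t (1 / t)) < real n" using reals_Archimedean2 by blast
    then have "1 / t < real (Suc n)" by simp
    then have "1 / real (Suc n) < t" using t by (simp add: field_simps del: of_nat_Suc)
    then have "p \<in> ?U n" using n by (simp add: p cylinder_def del: of_nat_Suc)
    then show "p \<in> (\<Union>n. ?U n)" by blast
  qed
  ultimately obtain I where I: "finite I" "K \<subseteq> (\<Union>n\<in>I. ?U n)"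
    using compactE_image[OF assms(1), of UNIV ?U] by metis
  define R0 where "R0 = real (Suc (Max (insert 0 I)))"
  have "K \<subseteq> cylinder x0 R" if "R \<ge> R0" for R
  proof -
    have "?U n \<subseteq> cylinder x0 R" if "n \<in> I" for n
    proof (rule cylinder_mono)
      have "n <= Max (insert 0 I)" using I that by (intro Max_ge) auto
      then show "real (Suc n) <= R" using \<open>R \<ge> R0\<close> by (simp add: R0_def)
    qed simp
    then show ?thesis using I by blast
  qed
  moreover have "R0 > 0" by (simp add: R0_def)
  ultimately show ?thesis by blast
qed

sublocale L2_domain "half_space_measure \<mu>" "L2c \<mu>"
proof
  show "L2c \<mu> \<subseteq> L2_functions nu" by (auto simp: L2c_def)
  show "(%p. 0) \<in> L2c \<mu>" by (auto simp: L2c_def L2_functions_zero intro: exI[of _ "{}"])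
next
  fix g h assume "g \<in> L2c \<mu>" "h \<in> L2c \<mu>"
  then obtain K L where "g \<in> L2_functions nu" "h \<in> L2_functions nu" "compact K" "compact L"
    "K \<subseteq> upper_half_space" "L \<subseteq> upper_half_space"
    and ae: "AE p in nu. p \<notin> K --> g p = 0" "AE p in nu. p \<notin> L --> h p = 0"
    by (auto simp: L2c_def)
  moreover from ae have "AE p in nu. p \<notin> K \<union> L --> (g + h) p = 0" by eventually_elim auto
  moreover have "g + h = (%p. g p + h p)" by (rule plus_fun_def)
  ultimately show "g + h \<in> L2c \<mu>"
    unfolding L2c_def by (auto intro!: exI[of _ "K \<union> L"] compact_Un L2_functions_add)
next
  fix c and h assume "h \<in> L2c \<mu>"
  then obtain K where "h \<in> L2_functions nu" "compact K" "K \<subseteq> upper_half_space"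
    and ae: "AE p in nu. p \<notin> K --> h p = 0" by (auto simp: L2c_def)
  moreover from ae have "AE p in nu. p \<notin> K --> c * h p = 0" by eventually_elim auto
  ultimately show "(%p. c * h p) \<in> L2c \<mu>"
    unfolding L2c_def by (auto intro!: exI[of _ K] L2_functions_scale)
next
  fix K and h assume "K \<in> sets nu" "h \<in> L2c \<mu>"
  then show "(%p. indicator K p * h p) \<in> L2c \<mu>" by (rule indicator_mult_L2c)
qed

abbreviation operator_on :: "('m, 'x::complex_banach) tent_operator => bool" where
  "operator_on \<equiv> L2_operator (half_space_measure \<mu>) (L2c \<mu>)"

text \<open>A compact set is covered by finitely many cones whose vertices have a finite square function.\<close>

lemma local_bound:
  assumes u: "operator_on u" and fin: "AE x in \<mu>. sqf u x < \<top>" and h: "h \<in> L2c \<mu>"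
  obtains C where "C \<ge> 0" "!!A. A \<in> sets nu ==>
    norm (u (%p. indicator A p * h p)) <= C * L2_norm nu (%p. indicator A p * h p)"
proof -
  obtain Z where Z: "Z \<in> sets \<mu>" "emeasure \<mu> Z = 0" "!!x. x \<notin> Z ==> sqf u x < \<top>"
  proof -
    obtain Z where "{x \<in> space \<mu>. \<not> sqf u x < \<top>} \<subseteq> Z" "emeasure \<mu> Z = 0" "Z \<in> sets \<mu>"
      using AE_E[OF fin] by blast
    then show ?thesis using that[of Z] by auto
  qed
  obtain K where K: "compact K" "K \<subseteq> upper_half_space" "AE p in nu. p \<notin> K --> h p = 0"
    using h by (auto simp: L2c_def)
  have op: "open (cone_at x)" for x :: 'm
    unfolding cone_at_def case_prod_unfold
    by (intro open_Collect_conj open_Collect_less continuous_intros)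
  have cov: "K \<subseteq> (\<Union>x\<in>-Z. cone_at x)"
  proof
    fix q assume "q \<in> K"
    then obtain y t where q: "q = (y, t)" "t > 0" using K(2) by (auto simp: upper_half_space_def)
    have "\<not> ball y t \<subseteq> Z"
    proof
      assume "ball y t \<subseteq> Z"
      then have "emeasure \<mu> (ball y t) = 0" using emeasure_mono[OF _ Z(1), of "ball y t"] Z(2) by simp
      then show False using emeasure_ball(1)[OF q(2), of y] by simp
    qed
    then obtain x where x: "x \<notin> Z" "dist y x < t" unfolding subset_iff mem_ball by blast
    then show "q \<in> (\<Union>x\<in>-Z. cone_at x)" using q by (auto simp: cone_at_def dist_commute)
  qed
  obtain F where F: "F \<subseteq> -Z" "finite F" "K \<subseteq> (\<Union>x\<in>F. cone_at x)"
    using compactE_image[OF K(1) op cov] by blast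
  let ?U = "\<Union>x\<in>F. cone_at x"
  have U: "?U \<in> sets nu" using F by (intro sets.finite_UN) auto
  have "gam (restrict_operator u ?U) <= (\<Sum>x\<in>F. gam (restrict_operator u (cone_at x)))"
    using F U by (intro gamma_norm_restrict_cover u) auto
  also have "... < \<top>" using F Z(3) by (auto simp: square_function_def[symmetric] subset_iff)
  finally have fin: "gam (restrict_operator u ?U) < \<top>" .
  define C where "C = enn2real (gam (restrict_operator u ?U))"
  have "norm (u (%p. indicator A p * h p)) <= C * L2_norm nu (%p. indicator A p * h p)" if A: "A \<in> sets nu" for A
  proof -
    let ?g = "%p. indicator A p * h p"
    have g: "?g \<in> L2c \<mu>" by (rule D_indicator[OF A h])
    have "AE p in nu. ?g p = indicator ?U p * ?g p"
      using K(3) by eventually_elim (use F(3) in \<open>auto simp: indicator_def\<close>)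
    then have "u ?g = restrict_operator u ?U ?g"
      unfolding restrict_operator_def by (intro operator_cong[OF u g] D_indicator U g)
    then have "ennreal (norm (u ?g)) <= gam (restrict_operator u ?U) * ennreal (L2_norm nu ?g)"
      using gamma_norm_dominates[OF L2_operator_restrict[OF u U] g] by simp
    also have "... = ennreal (C * L2_norm nu ?g)" using fin by (simp add: C_def ennreal_mult less_top)
    finally show ?thesis by (simp add: C_def)
  qed
  then show ?thesis using that[of C] by (simp add: C_def)
qed

lemma L2_norm_indicator_tendsto_0:
  assumes h: "h \<in> L2_functions nu" and A: "!!n::nat. A n \<in> sets nu"
    and lim: "!!p. p \<in> space nu ==> eventually (%n. p \<notin> A n) sequentially"
  shows "(%n. L2_norm nu (%p. indicator (A n) p * h p)) \<longlonglongrightarrow> 0"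
proof -
  have [measurable]: "h \<in> borel_measurable nu" and i: "integrable nu (%p. (cmod (h p))\<^sup>2)"
    using h by (auto simp: L2_functions_def)
  have "(%n. \<integral>p. (cmod (indicator (A n) p * h p))\<^sup>2 \<partial>nu) \<longlonglongrightarrow> (\<integral>p. 0 \<partial>nu)"
  proof (rule integral_dominated_convergence[OF _ _ i])
    show "AE p in nu. (%n. (cmod (indicator (A n) p * h p))\<^sup>2) \<longlonglongrightarrow> 0"
    proof (intro AE_I2)
      fix p assume "p \<in> space nu"
      from lim[OF this] show "(%n. (cmod (indicator (A n) p * h p))\<^sup>2) \<longlonglongrightarrow> 0"
        by (intro tendsto_eventually) (auto elim!: eventually_mono)
    qed
    show "AE p in nu. norm ((cmod (indicator (A n) p * h p))\<^sup>2) <= (cmod (h p))\<^sup>2" for n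
      by (auto simp: indicator_def)
    show "(%p. (cmod (indicator (A n) p * h p))\<^sup>2) \<in> borel_measurable nu" for n
      using A[of n] by measurable
  qed simp
  then show ?thesis unfolding L2_norm_def using tendsto_real_sqrt by fastforce
qed

text \<open>Lower semicontinuity. If \<open>X\<close> tends to \<open>x\<close>, every point is
  eventually outside \<open>cone_at x - cone_at (X n)\<close>, so the contribution of these sets to
  a given Gaussian sum at \<open>x\<close> tends to 0 by \<open>local_bound\<close> and dominated
  convergence; the rest is bounded by the value at \<open>X n\<close>. Openness makes the level sets
  admissible in the cone covering property and yields measurability.\<close>

lemma open_square_function:
  assumes u: "operator_on u" and fin: "AE x in \<mu>. sqf u x < \<top>"
  shows "open {x. s < sqf u x}"
proof (rule ccontr)
  assume "\<not> ?thesis"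
  then obtain x where x: "s < sqf u x"
    and no': "\<not> (\<exists>e>0. \<forall>y. dist y x < e --> s < sqf u y)"
    unfolding open_dist by blast
  have no: "\<exists>y. dist y x < e \<and> sqf u y <= s" if "e > 0" for e
    using no' that by (metis not_le)
  have "\<exists>y. dist y x < 1 / real (Suc n) \<and> sqf u y <= s" for n by (rule no) simp
  then obtain X where X: "!!n. dist (X n) x < 1 / real (Suc n)" "!!n. sqf u (X n) <= s" by metis
  have "X \<longlonglongrightarrow> x"
    by (subst tendsto_dist_iff, rule real_tendsto_sandwich[OF _ _ tendsto_const LIMSEQ_inverse_real_of_nat])
      (use less_imp_le[OF X(1)] in \<open>auto simp: inverse_eq_divide intro!: always_eventually simp del: of_nat_Suc\<close>)
  let ?u = "restrict_operator u (cone_at x)"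
  let ?A = "%n. cone_at x - cone_at (X n)"
  \<comment> \<open>A supremum larger than \<open>s\<close> is witnessed by one finite orthonormal
    system, which stays fixed in the limit.\<close>
  obtain n h where h: "orthonormal_system nu (L2c \<mu>) n h"
    and gt: "s < ennreal (gaussian_rms n (%k. ?u (h k)))"
    using x unfolding square_function_def gamma_norm_def less_SUP_iff by auto
  have hD: "h k \<in> L2c \<mu>" if "k < n" for k using h that by (auto simp: orthonormal_system_def)
  have lim: "(%i. norm (u (%p. indicator (?A i) p * h k p))) \<longlonglongrightarrow> 0" if kn: "k < n" for k
  proof -
    obtain C where C: "C \<ge> 0" "!!A. A \<in> sets nu ==> norm (u (%p. indicator A p * h k p)) <= C * L2_norm nu (%p. indicator A p * h k p)"
      using local_bound[OF u fin hD[OF kn]] by blast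
    have "(%i. L2_norm nu (%p. indicator (?A i) p * h k p)) \<longlonglongrightarrow> 0"
    proof (rule L2_norm_indicator_tendsto_0)
      show "h k \<in> L2_functions nu" using hD[OF that] D_L2 by blast
      fix p :: "'m \<times> real"
      obtain y t where p: "p = (y, t)" by (cases p)
      show "\<forall>\<^sub>F i in sequentially. p \<notin> ?A i"
      proof (cases "p \<in> cone_at x")
        case True
        have "(%i. dist (X i) y) \<longlonglongrightarrow> dist x y" by (intro tendsto_intros \<open>X \<longlonglongrightarrow> x\<close>)
        then have "\<forall>\<^sub>F i in sequentially. dist (X i) y < t"
          using True by (intro order_tendstoD(2)) (auto simp: p cone_at_def)
        then show ?thesis using True by (elim eventually_mono) (auto simp: p cone_at_def)
      qed simp
    qed auto
    then have "(%i. C * L2_norm nu (%p. indicator (?A i) p * h k p)) \<longlonglongrightarrow> C * 0" by (intro tendsto_intros)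
    then have "(%i. C * L2_norm nu (%p. indicator (?A i) p * h k p)) \<longlonglongrightarrow> 0" by simp
    then show ?thesis
      by (rule Lim_null_comparison[rotated]) (intro always_eventually allI, simp only: real_norm_def abs_norm_cancel, rule C(2), auto)
  qed
  have le: "gaussian_rms n (%k. ?u (h k)) \<le>
     gaussian_rms n (%k. restrict_operator u (cone_at x \<inter> cone_at (X i)) (h k))
     + (\<Sum>k<n. norm (u (%p. indicator (?A i) p * h k p)))" for i
  proof -
    have "gaussian_rms n (%k. ?u (h k)) =
      gaussian_rms n (%k. restrict_operator u (cone_at x \<inter> cone_at (X i)) (h k) + u (%p. indicator (?A i) p * h k p))"
    proof (rule rms_random_sum_cong)
      fix k assume "k < n"
      have "(cone_at x \<inter> cone_at (X i)) \<union> ?A i = cone_at x" by blast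
      then show "?u (h k) = restrict_operator u (cone_at x \<inter> cone_at (X i)) (h k) + u (%p. indicator (?A i) p * h k p)"
        using restrict_operator_split[OF u sets.Int[OF cone_sets cone_sets] sets.Diff[OF cone_sets cone_sets] _ hD[OF \<open>k < n\<close>],
            of x "X i" x "X i"]
        by (simp add: restrict_operator_def Diff_disjoint disjoint_iff)
    qed
    also have "... <= gaussian_rms n (%k. restrict_operator u (cone_at x \<inter> cone_at (X i)) (h k))
      + gaussian_rms n (%k. u (%p. indicator (?A i) p * h k p))"
      by (rule rms_gaussian_triangle)
    finally show ?thesis using rms_gaussian_le_sum[of n "%k. u (%p. indicator (?A i) p * h k p)"] by linarith
  qed
  have "s \<noteq> \<top>" using x by auto
  then obtain s' where s': "s = ennreal s'" "s' \<ge> 0" by (cases s) auto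
  have le_s: "gaussian_rms n (%k. restrict_operator u (cone_at x \<inter> cone_at (X i)) (h k)) <= s'" for i
  proof -
    have "ennreal (gaussian_rms n (%k. restrict_operator u (cone_at x \<inter> cone_at (X i)) (h k)))
       <= gam (restrict_operator u (cone_at x \<inter> cone_at (X i)))" by (rule gamma_norm_upper[OF h])
    also have "... <= gam (restrict_operator u (cone_at (X i)))" by (intro gamma_norm_restrict_mono u) auto
    also have "... <= ennreal s'" using X(2)[of i] by (simp add: square_function_def s')
    finally show ?thesis using s' by simp
  qed
  have "(%i. s' + (\<Sum>k<n. norm (u (%p. indicator (?A i) p * h k p)))) \<longlonglongrightarrow> s' + (\<Sum>k<n. 0)"
    by (intro tendsto_intros lim) auto
  moreover have "gaussian_rms n (%k. ?u (h k)) <= s' + (\<Sum>k<n. norm (u (%p. indicator (?A i) p * h k p)))" for i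
    using le[of i] le_s[of i] by linarith
  ultimately have "gaussian_rms n (%k. ?u (h k)) <= s' + (\<Sum>k<n. 0)"
    by (intro LIMSEQ_le_const) auto
  then have "ennreal (gaussian_rms n (%k. ?u (h k))) <= s" by (simp add: s' ennreal_leI)
  then show False using gt by simp
qed

lemma square_function_measurable:
  assumes "operator_on u" "AE x in \<mu>. sqf u x < \<top>"
  shows "sqf u \<in> borel_measurable \<mu>"
proof -
  have "{x \<in> space \<mu>. s < sqf u x} \<in> sets \<mu>" for s
    using borel_open[OF open_square_function[OF assms, of s]] by simp
  then show ?thesis by (intro borel_measurableI_greater)
qed

end

section \<open>Decomposition along level sets of the square function\<close>

text \<open>A geometric sum of ratio at least 2 is at most twice its largest term. Applied pointwise
  to the levels below a value of the square function, it is the dyadic form of the layer-cake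
  formula.\<close>

lemma geometric_level_sum:
  fixes \<beta> b T :: real
  assumes "b \<ge> 2" "\<beta> > 0" "T \<ge> 0"
  shows "(\<Sum>k<n. if \<beta> * b ^ k < T then \<beta> * b ^ k else 0) <= 2 * T"
proof (induction n)
  case (Suc n)
  have geo: "(\<Sum>k<m. \<beta> * b ^ k) <= \<beta> * b ^ m" for m
  proof (induction m)
    case (Suc m)
    have "\<beta> * b ^ m * 2 <= \<beta> * b ^ m * b" using assms by (intro mult_left_mono) auto
    then show ?case using Suc by (simp add: mult_ac)
  qed (use assms in simp)
  show ?case
  proof (cases "\<beta> * b ^ n < T")
    case True
    have "(\<Sum>k<Suc n. if \<beta> * b ^ k < T then \<beta> * b ^ k else 0) <= (\<Sum>k<Suc n. \<beta> * b ^ k)"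
      using assms by (intro sum_mono) auto
    also have "... <= 2 * (\<beta> * b ^ n)" using geo[of n] by simp
    finally show ?thesis using True by simp
  qed (use Suc in simp)
qed (use assms in simp)

context metric_measure_space begin

lemma square_function_restrict:
  "sqf (restrict_operator u A) x = gam (restrict_operator u (A \<inter> cone_at x))"
  by (simp add: square_function_def restrict_restrict_operator)

lemma square_function_restrict_le:
  "operator_on u ==> A \<in> sets nu ==> sqf (restrict_operator u A) x <= sqf u x"
  unfolding square_function_restrict unfolding square_function_def
  by (intro gamma_norm_restrict_mono) auto

lemma gamma_restrict_empty: "operator_on u ==> gam (restrict_operator u {}) = 0"
  using gamma_norm_restrict_cover[of u "{}" "%_. {}" "{}"] by simp

lemma cone_meets_cylinder:
  "(y, t) \<in> cone_at x ==> (y, t) \<in> cylinder x0 R ==> x \<in> ball x0 (2 * R)"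
  using dist_triangle[of x0 x y] by (auto simp: cone_at_def cylinder_def dist_commute)

lemma square_function_zero_outside:
  assumes u: "operator_on u" and B: "B \<in> sets nu" "B \<subseteq> cylinder x0 R"
    and loc: "!!h. h \<in> L2c \<mu> ==> u (%p. indicator B p * h p) = u h" and x: "x \<notin> ball x0 (2 * R)"
  shows "sqf u x = 0"
proof -
  have "sqf u x = sqf (restrict_operator u B) x"
    unfolding square_function_def
  proof (rule gamma_norm_cong)
    fix h assume "h \<in> L2c \<mu>"
    then show "restrict_operator u (cone_at x) h = restrict_operator (restrict_operator u B) (cone_at x) h"
      unfolding restrict_operator_def using loc[OF D_indicator[OF cone_sets, of h x]] by simp
  qed
  also have "... = gam (restrict_operator u (B \<inter> cone_at x))" by (rule square_function_restrict)
  also have "B \<inter> cone_at x = {}"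
  proof -
    have False if "(y, t) \<in> B" "(y, t) \<in> cone_at x" for y t
      using cone_meets_cylinder[OF that(2)] that(1) B(2) x by blast
    then show ?thesis by auto
  qed
  finally show ?thesis by (simp add: gamma_restrict_empty[OF u])
qed

end

locale cone_covering_space = doubling_space +
  assumes cone_covering: "cone_covering_property \<mu>"
begin

text \<open>Restriction to a cylinder makes the level sets bounded, as the cone covering property
  requires, and ends the decomposition after finitely many levels. The numbers \<open>a k\<close>
  are levels relative to the norm bound \<open>l\<close>, and the last line of the conclusion is the
  scale-invariant quantity that both endpoint estimates use. \<open>C\<close> depends neither on the
  cylinder nor on \<open>u\<close>.\<close>

lemma square_function_decomposition:
  fixes p :: real
  assumes p: "p \<ge> 1"
  obtains C where "C > 0"
    and "!!(u :: ('a, 'x::complex_banach) tent_operator) B x0 R l.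
     \<lbrakk>operator_on u; AE x in \<mu>. sqf u x < \<top>; B \<in> sets nu; B \<subseteq> cylinder x0 R; 0 < R; 0 < l;
      !!h. h \<in> L2c \<mu> ==> u (%p. indicator B p * h p) = u h;
      (\<integral>\<^sup>+x. ennreal_powr (sqf u x) p \<partial>\<mu>) <= ennreal (l powr p)\<rbrakk> \<Longrightarrow>
     \<exists>n A S a. (\<forall>k<n. A k \<in> sets nu) \<and> (\<forall>k<n. \<forall>j<n. k \<noteq> j --> A k \<inter> A j = {}) \<and> (\<Union>k<n. A k) = B \<and>
       (\<forall>k<n. (0::real) < a k) \<and> (\<forall>k<n. S k \<in> sets borel) \<and>
       (\<forall>k<n. \<forall>x. sqf (restrict_operator u (A k)) x <= ennreal (a k * l) * indicator (S k) x) \<and>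
       (\<Sum>k<(n::nat). ennreal (a k powr p) * emeasure \<mu> (S k)) <= ennreal C"
proof -
  obtain \<sigma> :: real and N :: nat where \<sigma>: "0 < \<sigma>" "\<sigma> < 1" and
    cov0: "\<forall>E. open E \<and> bounded E --> (\<forall>x\<in>E. \<exists>F. finite F \<and> card F <= N \<and> F \<subseteq> - E \<and>
        cone_at x - tent (density_enlargement \<mu> \<sigma> E) \<subseteq> (\<Union>z\<in>F. cone_at z))"
    using cone_covering unfolding cone_covering_property_def by (elim exE conjE) (rule that)
  have cov: "\<exists>F. finite F \<and> card F <= N \<and> F \<subseteq> - E \<and>
        cone_at x - tent (density_enlargement \<mu> \<sigma> E) \<subseteq> (\<Union>z\<in>F. cone_at z)"
    if "open E" "bounded E" "x \<in> E" for E x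
    using spec[OF cov0, of E] that by simp
  obtain Cm where Cm: "Cm \<ge> 0" "!!E. open E ==> bounded E ==> emeasure \<mu> (density_enlargement \<mu> \<sigma> E) <= ennreal Cm * emeasure \<mu> E"
    using emeasure_density_enlargement_le[OF \<sigma>(1)] by blast
  define N' where "N' = real (max N 1)"
  have N': "N' \<ge> 1" "N' \<ge> real N" by (auto simp: N'_def)
  define C where "C = (2 * N') powr p * (1 + Cm * 2)"
  have C: "C > 0" using N' Cm by (auto simp: C_def intro!: mult_pos_pos)
  show ?thesis
  proof (rule that[OF C])
    fix u :: "('a, 'x) tent_operator" and B :: "('a \<times> real) set" and x0 R l
    assume u: "operator_on u" and fin: "AE x in \<mu>. sqf u x < \<top>" and B: "B \<in> sets nu" "B \<subseteq> cylinder x0 R"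
      and R: "0 < R" and l: "0 < l" and loc: "!!h. h \<in> L2c \<mu> ==> u (%p. indicator B p * h p) = u h"
      and int: "(\<integral>\<^sup>+x. ennreal_powr (sqf u x) p \<partial>\<mu>) <= ennreal (l powr p)"
    let ?A = "sqf u"
    have meas: "?A \<in> borel_measurable \<mu>" by (rule square_function_measurable[OF u fin])
    define V where "V = measure \<mu> (ball x0 (2 * R))"
    have V: "V > 0" unfolding V_def using R by (intro measure_ball_pos) simp
    \<comment> \<open>The lowest level is scaled so that \<open>\<beta> powr p\<close> times the
      measure of \<open>ball x0 (2 * R)\<close> is 1; this ball contains all vertices whose cones
      meet the cylinder. The lowest piece then adds a term to the final sum that does not grow with
      \<open>R\<close>.\<close>
    define \<beta> where "\<beta> = (1 / V) powr (1 / p)"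
    have \<beta>: "\<beta> > 0" using V by (simp add: \<beta>_def)
    have \<beta>p: "\<beta> powr p = 1 / V" using V p by (simp add: \<beta>_def powr_powr)
    define b where "b = 2 powr p"
    have b: "b \<ge> 2" unfolding b_def using powr_mono[of 1 p 2] p by simp
    have bk: "(\<beta> * 2 ^ k) powr p = \<beta> powr p * b ^ k" for k
      using \<beta> by (simp add: b_def powr_mult powr_realpow[symmetric] powr_powr mult.commute)
    define E where "E k = {x. ennreal (l * (\<beta> * 2 ^ k)) < ?A x}" for k
    have Eopen: "open (E k)" for k unfolding E_def by (rule open_square_function[OF u fin])
    have Esub: "E k \<subseteq> ball x0 (2 * R)" for k
    proof (rule subsetI, rule ccontr)
      fix x assume "x \<in> E k" "x \<notin> ball x0 (2 * R)"
      then show False using square_function_zero_outside[OF u B loc, of x] by (simp add: E_def)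
    qed
    have Ebd: "bounded (E k)" for k using Esub bounded_ball bounded_subset by blast
    have Es: "E k \<in> sets borel" for k using Eopen by simp
    have Emono: "E (Suc k) \<subseteq> E k" for k
    proof -
      have "ennreal (l * (\<beta> * 2 ^ k)) <= ennreal (l * (\<beta> * 2 ^ Suc k))" using l \<beta> by (intro ennreal_leI) auto
      then show ?thesis unfolding E_def by (auto intro: le_less_trans)
    qed
    \<comment> \<open>The layer-cake estimate for the p-th power of the square function; the 2 comes
      from \<open>geometric_level_sum\<close>.\<close>
    have levels: "(\<Sum>k<n. ennreal ((\<beta> * 2 ^ k) powr p) * emeasure \<mu> (E k)) <= ennreal 2" for n
    proof -
      have pt: "(\<Sum>k<n. ennreal ((\<beta> * 2 ^ k) powr p) * indicator (E k) x) <= ennreal (2 / l powr p) * ennreal_powr (?A x) p" for x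
      proof (cases "?A x")
        case (real a)
        have "x \<in> E k \<longleftrightarrow> \<beta> powr p * b ^ k < (a / l) powr p" for k
        proof -
          have "x \<in> E k \<longleftrightarrow> l * (\<beta> * 2 ^ k) < a" using l \<beta> real by (simp add: E_def ennreal_less_iff)
          also have "... \<longleftrightarrow> \<beta> * 2 ^ k < a / l" using l by (simp add: field_simps)
          also have "... \<longleftrightarrow> (\<beta> * 2 ^ k) powr p < (a / l) powr p"
            using powr_less_cancel2[of p "\<beta> * 2 ^ k" "a / l"] powr_less_mono2[of p "\<beta> * 2 ^ k" "a / l"] p \<beta> l real
            by (cases "a = 0") (auto simp: not_less mult_le_0_iff)
          finally show ?thesis by (simp add: bk)
        qed
        then have "(\<Sum>k<n. ennreal ((\<beta> * 2 ^ k) powr p) * indicator (E k) x) =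
          (\<Sum>k<n. ennreal (if \<beta> powr p * b ^ k < (a / l) powr p then \<beta> powr p * b ^ k else 0))"
          by (intro sum.cong refl) (auto simp: bk indicator_def)
        also have "... = ennreal (\<Sum>k<n. if \<beta> powr p * b ^ k < (a / l) powr p then \<beta> powr p * b ^ k else 0)"
          using b by (intro sum_ennreal) auto
        also have "... <= ennreal (2 * (a / l) powr p)"
          using b \<beta> by (intro ennreal_leI geometric_level_sum) auto
        also have "... = ennreal (2 / l powr p) * ennreal_powr (?A x) p"
          using real l by (simp add: ennreal_powr_ennreal powr_divide ennreal_mult[symmetric])
        finally show ?thesis .
      next
        case top
        then show ?thesis using l by (simp add: ennreal_mult_top)
      qed
      have "(\<Sum>k<n. ennreal ((\<beta> * 2 ^ k) powr p) * emeasure \<mu> (E k)) =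
          (\<integral>\<^sup>+x. (\<Sum>k<n. ennreal ((\<beta> * 2 ^ k) powr p) * indicator (E k) x) \<partial>\<mu>)"
      proof -
        have Em: "E k \<in> sets \<mu>" for k by (simp add: Es)
        have "(\<integral>\<^sup>+x. (\<Sum>k<n. ennreal ((\<beta> * 2 ^ k) powr p) * indicator (E k) x) \<partial>\<mu>) =
          (\<Sum>k<n. \<integral>\<^sup>+x. ennreal ((\<beta> * 2 ^ k) powr p) * indicator (E k) x \<partial>\<mu>)"
          by (intro nn_integral_sum borel_measurable_times_ennreal borel_measurable_const borel_measurable_indicator Em)
        then show ?thesis by (simp only: nn_integral_cmult_indicator[OF Em])
      qed
      also have "... <= (\<integral>\<^sup>+x. ennreal (2 / l powr p) * ennreal_powr (?A x) p \<partial>\<mu>)"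
        by (intro nn_integral_mono pt)
      also have "... = ennreal (2 / l powr p) * (\<integral>\<^sup>+x. ennreal_powr (?A x) p \<partial>\<mu>)"
        by (intro nn_integral_cmult ennreal_powr_measurable meas)
      also have "... <= ennreal (2 / l powr p) * ennreal (l powr p)" by (intro mult_left_mono int) auto
      also have "... = ennreal 2" using l by (simp add: ennreal_mult[symmetric])
      finally show ?thesis .
    qed
    define W where "W k = density_enlargement \<mu> \<sigma> (E k)" for k
    have Wopen: "open (W k)" for k unfolding W_def by (intro open_density_enlargement Es)
    have Wle: "emeasure \<mu> (W k) <= ennreal Cm * emeasure \<mu> (E k)" for k
      unfolding W_def by (intro Cm Eopen Ebd)
    have Wmono: "W (Suc k) \<subseteq> W k" for k unfolding W_def by (intro density_enlargement_mono Emono Es)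
    \<comment> \<open>At index 0 the whole half-space replaces the tent, so that \<open>A 0\<close>
      collects everything in \<open>B\<close> outside \<open>tent (W 1)\<close>, however small the
      square function is there.\<close>
    define T where "T k = (if k = 0 then upper_half_space else tent (W k))" for k
    have Ts: "T k \<in> sets nu" for k
      using Wopen sets.top[of nu] by (simp add: T_def space_nu)
    have Tmono: "T (Suc k) \<subseteq> T k" for k
      using Wmono[of k] by (auto simp: T_def tent_def upper_half_space_def)
    have Tanti: "T j \<subseteq> T k" if "k <= j" for j k
      using that by (induction rule: dec_induct) (use Tmono in blast)+
    obtain Dr where Dr: "Dr > 0" "!!x t. t > 0 ==> measure \<mu> (ball x (((R + 1/R) * R) * t)) <= Dr * measure \<mu> (ball x t)"
      using doubling_const[of "(R + 1/R) * R"] by blast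
    \<comment> \<open>By doubling, a lower bound for the volume of every ball whose centre and
      radius form a point of the cylinder.\<close>
    define c where "c = measure \<mu> (ball x0 (1/R)) / Dr"
    have c: "c > 0" using Dr R by (auto simp: c_def intro!: divide_pos_pos measure_ball_pos)
    have ball_ge: "c <= measure \<mu> (ball y t)" if "(y, t) \<in> cylinder x0 R" for y t
    proof -
      have "ball x0 (1/R) \<subseteq> ball y (R + 1/R)"
      proof
        fix z assume "z \<in> ball x0 (1/R)"
        then show "z \<in> ball y (R + 1/R)"
          using that dist_triangle[of y z x0] by (auto simp: cylinder_def dist_commute)
      qed
      then have "measure \<mu> (ball x0 (1/R)) <= measure \<mu> (ball y (R + 1/R))" by (intro measure_mono_ball) auto
      also have "... = measure \<mu> (ball y (((R + 1/R) * R) * (1/R)))" using R by simp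
      also have "... <= Dr * measure \<mu> (ball y (1/R))" using R by (intro Dr) auto
      also have "... <= Dr * measure \<mu> (ball y t)"
        using that Dr by (intro mult_left_mono measure_mono_ball subset_ball) (auto simp: cylinder_def)
      finally show ?thesis using Dr by (simp add: c_def pos_divide_le_eq mult.commute)
    qed
    \<comment> \<open>The enlargement at level \<open>n\<close> has measure at most
      \<open>2 * Cm / (\<beta> * 2 ^ n) powr p\<close>. Once this is below \<open>c\<close>, no ball
      of the cylinder fits into it, and the tent misses \<open>B\<close>.\<close>
    obtain n' where n': "(Cm * 2 + 1) / (c * \<beta> powr p) < b ^ n'" using real_arch_pow[of b] b by auto
    define n where "n = Suc n'"
    have Tn: "T n \<inter> B = {}"
    proof (rule ccontr)
      assume "T n \<inter> B \<noteq> {}"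
      then obtain y t where yt: "(y, t) \<in> T n" "(y, t) \<in> B" by auto
      have "ball y t \<subseteq> W n" using yt(1) by (simp add: T_def n_def tent_def)
      then have "ennreal c <= emeasure \<mu> (W n)"
        using ball_ge[of y t] yt(2) B(2) emeasure_mono[of "ball y t" "W n" \<mu>] Wopen
        by (auto simp: emeasure_ball_eq intro: order_trans[OF ennreal_leI])
      also have "... <= ennreal Cm * emeasure \<mu> (E n)" by (rule Wle)
      finally have 1: "ennreal c <= ennreal Cm * emeasure \<mu> (E n)" .
      have "ennreal ((\<beta> * 2 ^ n) powr p) * emeasure \<mu> (E n) <= (\<Sum>k<Suc n. ennreal ((\<beta> * 2 ^ k) powr p) * emeasure \<mu> (E k))"
        by (rule member_le_sum) auto
      also have "... <= ennreal 2" by (rule levels)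
      finally have 2: "ennreal ((\<beta> * 2 ^ n) powr p) * emeasure \<mu> (E n) <= ennreal 2" .
      have "ennreal ((\<beta> * 2 ^ n) powr p) * ennreal c <= ennreal Cm * (ennreal ((\<beta> * 2 ^ n) powr p) * emeasure \<mu> (E n))"
        using mult_left_mono[OF 1, of "ennreal ((\<beta> * 2 ^ n) powr p)"] by (simp add: mult_ac)
      also have "... <= ennreal Cm * ennreal 2" by (intro mult_left_mono 2) auto
      finally have "(\<beta> * 2 ^ n) powr p * c <= Cm * 2"
        using Cm c by (simp add: ennreal_mult[symmetric] del: ennreal_numeral)
      moreover have "b ^ n' <= b ^ n" using b by (intro power_increasing) (auto simp: n_def)
      ultimately show False
      proof -
        assume a: "(\<beta> * 2 ^ n) powr p * c <= Cm * 2" and bb: "b ^ n' <= b ^ n"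
        have cb: "c * \<beta> powr p > 0" using c \<beta> by simp
        have "Cm * 2 + 1 < b ^ n' * (c * \<beta> powr p)" using n' cb by (simp add: pos_divide_less_eq)
        also have "... <= b ^ n * (c * \<beta> powr p)" using bb cb by (intro mult_right_mono) auto
        finally show False using a by (simp add: bk mult_ac)
      qed
    qed
    define A where "A k = B \<inter> T k - T (Suc k)" for k
    define S where "S k = (if k = 0 then ball x0 (2 * R) else W k)" for k
    \<comment> \<open>The factor 2 accounts for the next level \<open>Suc k\<close>, the factor
      \<open>N'\<close> for the number of covering cones.\<close>
    define a where "a k = (2 * N') * (\<beta> * 2 ^ k)" for k
    have As: "A k \<in> sets nu" for k unfolding A_def using B Ts by auto
    have disj: "A k \<inter> A j = {}" if "k \<noteq> j" for k j
    proof -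
      have "A k \<inter> A j = {}" if "k < j" for k j
        using Tanti[of "Suc k" j] that by (auto simp: A_def)
      then show ?thesis using that by (cases "k < j") (auto simp: Int_commute)
    qed
    have "(\<Union>k<m. A k) = B \<inter> T 0 - T m" for m
    proof (induction m)
      case (Suc m)
      then show ?case using Tmono[of m] Tanti[of 0 m] by (auto simp: A_def lessThan_Suc)
    qed auto
    moreover have "B \<subseteq> T 0" using B sets.sets_into_space[OF B(1)] by (simp add: T_def space_nu)
    ultimately have UN: "(\<Union>k<n. A k) = B" using Tn by blast
    have a0: "0 < a k" for k using N' \<beta> by (simp add: a_def)
    have bound: "sqf (restrict_operator u (A k)) x <= ennreal (a k * l) * indicator (S k) x" for k x
    proof (cases "x \<in> S k")
      case False
      have "A k \<inter> cone_at x = {}"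
      proof (rule ccontr)
        assume "A k \<inter> cone_at x \<noteq> {}"
        then obtain y t where yt: "(y, t) \<in> A k" "(y, t) \<in> cone_at x" by auto
        show False
        proof (cases "k = 0")
          case True
          have "(y, t) \<in> cylinder x0 R" using yt(1) B by (auto simp: A_def)
          then show False using cone_meets_cylinder[OF yt(2)] False by (auto simp: S_def True)
        next
          case k: False
          then have "(y, t) \<in> tent (W k)" using yt(1) by (simp add: A_def T_def)
          then have "x \<in> W k" using yt(2) by (auto simp: tent_def cone_at_def dist_commute subset_iff)
          then show False using False k by (simp add: S_def)
        qed
      qed
      then show ?thesis by (simp add: square_function_restrict gamma_restrict_empty[OF u])
    next
      case True
      have lev: "sqf u z <= ennreal (l * (\<beta> * 2 ^ Suc k))" if "z \<notin> E (Suc k)" for z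
        using that by (simp add: E_def not_less)
      have "sqf (restrict_operator u (A k)) x <= ennreal N' * ennreal (l * (\<beta> * 2 ^ Suc k))"
      proof (cases "x \<in> E (Suc k)")
        case False
        have "sqf (restrict_operator u (A k)) x <= sqf u x"
          by (rule square_function_restrict_le[OF u As])
        also have "... <= 1 * ennreal (l * (\<beta> * 2 ^ Suc k))" using lev[OF False] by simp
        also have "... <= ennreal N' * ennreal (l * (\<beta> * 2 ^ Suc k))" using N' by (intro mult_right_mono) auto
        finally show ?thesis .
      next
        \<comment> \<open>The piece avoids the tent over \<open>W (Suc k)\<close>, so its part in
          \<open>cone_at x\<close> is covered by at most \<open>N\<close> cones with vertices
          outside \<open>E (Suc k)\<close>, where the square function is at most the next
          level.\<close>
        case True
        obtain F where F: "finite F" "card F <= N" "F \<subseteq> - E (Suc k)"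
          "cone_at x - tent (W (Suc k)) \<subseteq> (\<Union>z\<in>F. cone_at z)"
          using cov[OF Eopen Ebd True] unfolding W_def by blast
        have "sqf (restrict_operator u (A k)) x = gam (restrict_operator u (A k \<inter> cone_at x))"
          by (rule square_function_restrict)
        also have "... <= (\<Sum>z\<in>F. gam (restrict_operator u (cone_at z)))"
        proof (rule gamma_norm_restrict_cover[OF u F(1)])
          show "A k \<inter> cone_at x \<in> sets nu" using As by (intro sets.Int) auto
          show "A k \<inter> cone_at x \<subseteq> (\<Union>z\<in>F. cone_at z)" using F(4) by (auto simp: A_def T_def)
        qed simp
        also have "... <= (\<Sum>z\<in>F. ennreal (l * (\<beta> * 2 ^ Suc k)))"
          using F lev by (intro sum_mono) (auto simp: square_function_def)
        also have "... = of_nat (card F) * ennreal (l * (\<beta> * 2 ^ Suc k))" by simp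
        also have "... <= ennreal N' * ennreal (l * (\<beta> * 2 ^ Suc k))"
          using F N' by (intro mult_right_mono) (auto simp: ennreal_of_nat_eq_real_of_nat intro!: ennreal_leI)
        finally show ?thesis .
      qed
      also have "... = ennreal (a k * l)" using N' l \<beta> by (simp add: ennreal_mult[symmetric] a_def mult_ac)
      finally show ?thesis using True by simp
    qed
    have "ennreal (a k powr p) * emeasure \<mu> (S k) <= ennreal ((2 * N') powr p) * ((if k = 0 then 1 else 0) + ennreal Cm * (ennreal ((\<beta> * 2 ^ k) powr p) * emeasure \<mu> (E k)))" for k
    proof -
      have *: "a k powr p = (2 * N') powr p * (\<beta> * 2 ^ k) powr p" unfolding a_def using N' \<beta> by (intro powr_mult)
      have "ennreal ((\<beta> * 2 ^ k) powr p) * emeasure \<mu> (S k) <= (if k = 0 then 1 else 0) + ennreal Cm * (ennreal ((\<beta> * 2 ^ k) powr p) * emeasure \<mu> (E k))"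
      proof (cases "k = 0")
        case True
        have "ennreal (\<beta> powr p) * emeasure \<mu> (ball x0 (2 * R)) = 1"
          using V by (simp add: emeasure_ball_eq \<beta>p V_def[symmetric] ennreal_mult[symmetric])
        then show ?thesis by (simp add: True S_def)
      next
        case False
        have "ennreal ((\<beta> * 2 ^ k) powr p) * emeasure \<mu> (W k) <= ennreal ((\<beta> * 2 ^ k) powr p) * (ennreal Cm * emeasure \<mu> (E k))"
          by (intro mult_left_mono Wle) auto
        then show ?thesis using False by (simp add: S_def mult_ac)
      qed
      then show ?thesis unfolding * by (simp add: ennreal_mult mult.assoc mult_left_mono)
    qed
    then have "(\<Sum>k<n. ennreal (a k powr p) * emeasure \<mu> (S k)) \<le>
       (\<Sum>k<n. ennreal ((2 * N') powr p) * ((if k = 0 then 1 else 0) + ennreal Cm * (ennreal ((\<beta> * 2 ^ k) powr p) * emeasure \<mu> (E k))))"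
      by (intro sum_mono)
    also have "... = ennreal ((2 * N') powr p) * (1 + ennreal Cm * (\<Sum>k<n. ennreal ((\<beta> * 2 ^ k) powr p) * emeasure \<mu> (E k)))"
      by (simp add: sum_distrib_left[symmetric] sum.distrib n_def)
    also have "... <= ennreal ((2 * N') powr p) * (1 + ennreal Cm * ennreal 2)"
      by (intro mult_left_mono add_left_mono levels) auto
    also have "... = ennreal C" using Cm
      by (simp add: C_def ennreal_mult[symmetric] ennreal_1[symmetric] ennreal_plus[symmetric] del: ennreal_1 ennreal_plus ennreal_numeral)
    finally have sum: "(\<Sum>k<n. ennreal (a k powr p) * emeasure \<mu> (S k)) <= ennreal C" .
    show "\<exists>n A S a. (\<forall>k<n. A k \<in> sets nu) \<and> (\<forall>k<n. \<forall>j<n. k \<noteq> j --> A k \<inter> A j = {}) \<and> (\<Union>k<n. A k) = B \<and>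
       (\<forall>k<n. (0::real) < a k) \<and> (\<forall>k<n. S k \<in> sets borel) \<and>
       (\<forall>k<n. \<forall>x. sqf (restrict_operator u (A k)) x <= ennreal (a k * l) * indicator (S k) x) \<and>
       (\<Sum>k<(n::nat). ennreal (a k powr p) * emeasure \<mu> (S k)) <= ennreal C"
      by (intro exI[of _ n] exI[of _ A] exI[of _ S] exI[of _ a] conjI allI impI UN As a0 bound sum disj)
        (auto simp: S_def Wopen)
  qed
qed

end

section \<open>Strong measurability\<close>

text \<open>A two-sided distance estimate written with sums, since subtraction of extended
  nonnegative reals is truncated. Finiteness of \<open>a\<close> lets the argument pass to real
  numbers, where \<open>b m\<close> is finite as soon as \<open>e m < 1\<close>.\<close>

lemma ennreal_tendsto_perturb:
  fixes a :: ennreal and b e :: "nat => ennreal"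
  assumes "a < \<top>" and le: "!!m. b m <= a + e m" "!!m. a <= b m + e m" and e: "e \<longlonglongrightarrow> 0"
  shows "b \<longlonglongrightarrow> a"
proof -
  obtain a' where a': "a = ennreal a'" "a' \<ge> 0" using assms(1) by (cases a) auto
  have ev: "\<forall>\<^sub>F m in sequentially. e m < 1" using e by (intro order_tendstoD(2)) auto
  have e0: "(%m. enn2real (e m)) \<longlonglongrightarrow> 0" by (rule tendsto_enn2real) (use e in auto)
  have fin: "b m < \<top>" if "e m < 1" for m
  proof -
    have "e m < \<top>" using that by (rule less_trans) simp
    then have "a + e m < \<top>" using assms(1) by (simp add: ennreal_add_eq_top less_top[symmetric])
    then show ?thesis by (rule le_less_trans[OF le(1)])
  qed
  have "(%m. enn2real (b m) - a') \<longlonglongrightarrow> 0"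
  proof (rule Lim_null_comparison[OF _ e0])
    show "\<forall>\<^sub>F m in sequentially. norm (enn2real (b m) - a') <= enn2real (e m)"
      using ev
    proof eventually_elim
      case (elim m)
      obtain b' where b': "b m = ennreal b'" "b' \<ge> 0" using fin[OF elim] by (cases "b m") auto
      have "e m < \<top>" using elim by (rule less_trans) simp
      then obtain e' where e': "e m = ennreal e'" "e' \<ge> 0" by (cases "e m") auto
      have "b' <= a' + e'" "a' <= b' + e'"
        using le[of m] a' b' e' by (simp_all add: ennreal_plus[symmetric] del: ennreal_plus)
      then show ?case using b' e' by simp
    qed
  qed
  then have "(%m. enn2real (b m)) \<longlonglongrightarrow> a'" by (simp add: LIM_zero_iff)
  then have "(%m. ennreal (enn2real (b m))) \<longlonglongrightarrow> a" unfolding a'(1) by (rule tendsto_ennrealI)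
  then show ?thesis
    by (rule Lim_transform_eventually) (use ev fin in \<open>auto elim!: eventually_mono\<close>)
qed

lemma ennreal_tendsto_0_le:
  fixes f g :: "nat => ennreal"
  assumes "!!n. f n <= g n" "g \<longlonglongrightarrow> 0" shows "f \<longlonglongrightarrow> 0"
  by (rule tendsto_sandwich[OF _ _ tendsto_const assms(2)]) (auto simp: assms(1))

lemma ennreal_suminf_tail_tendsto_0:
  fixes f :: "nat => ennreal"
  assumes "(\<Sum>j. f j) < \<top>"
  shows "(%J. \<Sum>j. f (j + J)) \<longlonglongrightarrow> 0"
proof -
  have fin: "f j < \<top>" for j
    using ennreal_suminf_lessD[OF assms, of j] by simp
  define g where "g j = enn2real (f j)" for j
  have fg: "f j = ennreal (g j)" "g j \<ge> 0" for j using fin[of j] by (auto simp: g_def)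
  have sum: "summable g" using assms fg by (intro summable_suminf_not_top) auto
  have "(\<Sum>j. f (j + J)) = ennreal (suminf g - sum g {..<J})" for J
    using fg sum by (simp add: suminf_ennreal2 suminf_minus_initial_segment summable_ignore_initial_segment)
  moreover have "(%J. ennreal (suminf g - sum g {..<J})) \<longlonglongrightarrow> ennreal (suminf g - suminf g)"
    by (intro tendsto_ennrealI tendsto_diff tendsto_const summable_LIMSEQ sum)
  ultimately show ?thesis by simp
qed

lemma ennreal_suminf_terms_tendsto_0:
  fixes f :: "nat => ennreal"
  assumes "(\<Sum>j. f j) < \<top>"
  shows "f \<longlonglongrightarrow> 0"
proof (rule ennreal_tendsto_0_le[OF _ ennreal_suminf_tail_tendsto_0[OF assms]])
  fix J
  have "(\<Sum>j<1. f (j + J)) <= (\<Sum>j. f (j + J))" by (intro sum_le_suminf) auto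
  then show "f J <= (\<Sum>j. f (j + J))" by simp
qed

section \<open>Limits of radonifying operators\<close>

context L2_domain begin

lemma gamma_space_cong:
  assumes u: "u \<in> gamma_space N D" and eq: "!!h. h \<in> D ==> v h = u h"
  shows "v \<in> gamma_space N D"
proof (rule gamma_spaceI)
  have uop: "L2_operator N D u" by (rule gamma_spaceD[OF u])
  show "L2_operator N D v"
  proof (rule L2_operatorI)
    fix g h assume *: "g \<in> D" "h \<in> D"
    then show "v (g + h) = v g + v h" using operator_plus[OF uop *] D_add[OF *] by (simp only: eq)
  next
    fix c h assume *: "h \<in> D"
    then show "v (%p. c * h p) = c *\<^sub>C v h" using operator_scale[OF uop *] D_scale[OF *] by (simp only: eq)
  next
    fix g h assume *: "g \<in> D" "h \<in> D" "AE p in N. g p = h p"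
    then show "v g = v h" using operator_cong[OF uop *] by (simp only: eq)
  qed
  fix e :: real assume "0 < e"
  then obtain w where w: "finite_rank_operator N w" "gamma_norm N D (u - w) < ennreal e"
    using gamma_space_approx[OF u] by blast
  have "gamma_norm N D (v - w) = gamma_norm N D (u - w)"
    by (rule gamma_norm_cong) (simp add: eq)
  then show "\<exists>w. finite_rank_operator N w \<and> gamma_norm N D (v - w) < ennreal e" using w by auto
qed

lemma gamma_space_closed:
  assumes F: "!!n::nat. F n \<in> gamma_space N D" and u: "L2_operator N D u"
    and lim: "(%n. gamma_norm N D (F n - u)) \<longlonglongrightarrow> 0"
  shows "u \<in> gamma_space N D"
proof (rule gamma_spaceI[OF u])
  fix e :: real assume e: "0 < e"
  have "\<forall>\<^sub>F n in sequentially. gamma_norm N D (F n - u) < ennreal (e / 2)"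
    using lim e by (intro order_tendstoD(2)) auto
  then obtain n where n: "gamma_norm N D (F n - u) < ennreal (e / 2)"
    using eventually_happens'[OF sequentially_bot] by blast
  have "0 < e / 2" using e by simp
  then obtain w where w: "finite_rank_operator N w" "gamma_norm N D (F n - w) < ennreal (e / 2)"
    using gamma_space_approx[OF F] by blast
  have "gamma_norm N D (u - w) <= gamma_norm N D (u - F n) + gamma_norm N D (F n - w)"
    using gamma_norm_add[of "u - F n" "F n - w"] by simp
  also have "... < ennreal (e / 2) + ennreal (e / 2)"
    using n w by (intro add_strict_mono) (auto simp: gamma_norm_diff_commute[of u])
  also have "... = ennreal e" using e by (simp add: ennreal_plus[symmetric] del: ennreal_plus)
  finally show "\<exists>w. finite_rank_operator N w \<and> gamma_norm N D (u - w) < ennreal e" using w by blast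
qed

lemma gamma_norm_tendsto:
  assumes u: "gamma_norm N D u < \<top>" and lim: "(%n::nat. gamma_norm N D (F n - u)) \<longlonglongrightarrow> 0"
  shows "(%n. gamma_norm N D (F n)) \<longlonglongrightarrow> gamma_norm N D u"
proof (rule ennreal_tendsto_perturb[OF u _ _ lim])
  show "gamma_norm N D (F n) <= gamma_norm N D u + gamma_norm N D (F n - u)" for n
    using gamma_norm_add[of "u" "F n - u"] by simp
  show "gamma_norm N D u <= gamma_norm N D (F n) + gamma_norm N D (F n - u)" for n
    using gamma_norm_add[of "F n" "u - F n"] by (simp add: gamma_norm_diff_commute[of u])
qed

end

section \<open>Closure properties of strongly measurable functions\<close>

context metric_measure_space begin

abbreviation gsm :: "('m => ('m, 'x::complex_banach) tent_operator) => bool" where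
  "gsm \<equiv> gamma_strongly_measurable \<mu> (half_space_measure \<mu>) (L2c \<mu>)"

abbreviation gspace :: "('m, 'x::complex_banach) tent_operator set" where
  "gspace \<equiv> gamma_space (half_space_measure \<mu>) (L2c \<mu>)"

lemma gsm_AE: "gsm F ==> AE x in \<mu>. F x \<in> gspace"
  by (simp add: gamma_strongly_measurable_def)

lemma gsm_finite: "gsm F ==> AE x in \<mu>. gam (F x) < \<top>"
proof -
  assume "gsm F"
  from gsm_AE[OF this] show ?thesis by eventually_elim (rule gamma_space_finite)
qed

lemma gsmE:
  assumes "gsm F"
  obtains s where "!!n::nat. simple_function \<mu> (s n)" "!!n x. s n x \<in> gspace"
    "AE x in \<mu>. (%n. gam (s n x - F x)) \<longlonglongrightarrow> 0"
proof -
  obtain s where s: "\<forall>n. simple_function \<mu> (s n) \<and> range (s n) \<subseteq> gspace" "AE x in \<mu>. (%n. gam (s n x - F x)) \<longlonglongrightarrow> 0"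
    using assms unfolding gamma_strongly_measurable_def by blast
  show ?thesis by (rule that[of s]) (use s in auto)
qed

lemma gsmI:
  assumes "AE x in \<mu>. F x \<in> gspace" "!!n::nat. simple_function \<mu> (s n)" "!!n x. s n x \<in> gspace"
    "AE x in \<mu>. (%n. gam (s n x - F x)) \<longlonglongrightarrow> 0"
  shows "gsm F"
  using assms unfolding gamma_strongly_measurable_def by blast

lemma gsm_cong:
  assumes F: "gsm F" and eq: "!!x h. h \<in> L2c \<mu> ==> G x h = F x h"
  shows "gsm G"
proof -
  obtain s where s: "!!n::nat. simple_function \<mu> (s n)" "!!n x. s n x \<in> gspace"
    "AE x in \<mu>. (%n. gam (s n x - F x)) \<longlonglongrightarrow> 0" using gsmE[OF F] by blast
  have "gam (s n x - G x) = gam (s n x - F x)" for n x by (rule gamma_norm_cong) (simp add: eq)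
  moreover have "AE x in \<mu>. G x \<in> gspace"
    using gsm_AE[OF F] by eventually_elim (rule gamma_space_cong, auto simp: eq)
  ultimately show ?thesis using s by (intro gsmI[of G s]) auto
qed

lemma gsm_add:
  assumes F: "gsm F" and G: "gsm G" shows "gsm (%x. F x + G x)"
proof -
  obtain s where s: "!!n::nat. simple_function \<mu> (s n)" "!!n x. s n x \<in> gspace"
    "AE x in \<mu>. (%n. gam (s n x - F x)) \<longlonglongrightarrow> 0" using gsmE[OF F] by blast
  obtain t where t: "!!n::nat. simple_function \<mu> (t n)" "!!n x. t n x \<in> gspace"
    "AE x in \<mu>. (%n. gam (t n x - G x)) \<longlonglongrightarrow> 0" using gsmE[OF G] by blast
  show ?thesis
  proof (rule gsmI[where s="%n x. s n x + t n x"])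
    show "AE x in \<mu>. F x + G x \<in> gspace"
      using gsm_AE[OF F] gsm_AE[OF G] by eventually_elim (rule gamma_space_add)
    show "simple_function \<mu> (%x. s n x + t n x)" for n
      by (intro simple_function_compose2[where h="(+)"] s t)
    show "s n x + t n x \<in> gspace" for n x by (intro gamma_space_add s t)
    show "AE x in \<mu>. (%n. gam (s n x + t n x - (F x + G x))) \<longlonglongrightarrow> 0"
      using s(3) t(3)
    proof eventually_elim
      case (elim x)
      have "(%n. gam (s n x - F x) + gam (t n x - G x)) \<longlonglongrightarrow> 0 + 0" by (intro tendsto_add elim)
      then have l: "(%n. gam (s n x - F x) + gam (t n x - G x)) \<longlonglongrightarrow> 0" by simp
      have "gam (s n x + t n x - (F x + G x)) <= gam (s n x - F x) + gam (t n x - G x)" for n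
        using gamma_norm_add[of "s n x - F x" "t n x - G x"] by (simp add: algebra_simps)
      then show ?case by (rule ennreal_tendsto_0_le[OF _ l])
    qed
  qed
qed

lemma gsm_scaleC:
  assumes F: "gsm F" shows "gsm (%x. c *\<^sub>C F x)"
proof -
  obtain s where s: "!!n::nat. simple_function \<mu> (s n)" "!!n x. s n x \<in> gspace"
    "AE x in \<mu>. (%n. gam (s n x - F x)) \<longlonglongrightarrow> 0" using gsmE[OF F] by blast
  show ?thesis
  proof (rule gsmI[where s="%n x. c *\<^sub>C s n x"])
    show "AE x in \<mu>. c *\<^sub>C F x \<in> gspace"
      using gsm_AE[OF F] by eventually_elim (rule gamma_space_scaleC)
    show "simple_function \<mu> (%x. c *\<^sub>C s n x)" for n
      by (intro simple_function_compose1[where g="(*\<^sub>C) c"] s)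
    show "c *\<^sub>C s n x \<in> gspace" for n x by (intro gamma_space_scaleC s)
    show "AE x in \<mu>. (%n. gam (c *\<^sub>C s n x - c *\<^sub>C F x)) \<longlonglongrightarrow> 0"
      using s(3)
    proof eventually_elim
      case (elim x)
      have "(%n. ennreal (cmod c) * gam (s n x - F x)) \<longlonglongrightarrow> ennreal (cmod c) * 0"
        by (intro ennreal_tendsto_cmult elim) auto
      then show ?case by (simp add: scaleC_diff_right[symmetric] gamma_norm_scaleC)
    qed
  qed
qed

lemma gsm_zero: "gsm (%x. 0)"
proof (rule gsmI[where s="%n x. 0"])
  show "AE x in \<mu>. (%n. gam (0 - 0)) \<longlonglongrightarrow> 0"
    unfolding diff_0_right gamma_norm_zero by (intro AE_I2 tendsto_const)
qed (intro AE_I2 gamma_space_zero simple_function_const)+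

lemma gsm_sum:
  "(!!k. k \<in> K ==> gsm (F k)) ==> gsm (%x. \<Sum>k\<in>K. F k x)"
proof (induction K rule: infinite_finite_induct)
  case (insert k K)
  then show ?case unfolding sum.insert[OF insert.hyps] by (intro gsm_add) auto
next
  case (infinite K)
  show ?case unfolding sum.infinite[OF infinite(1)] by (rule gsm_zero)
next
  case empty
  show ?case unfolding sum.empty by (rule gsm_zero)
qed

lemma gsm_restrict:
  assumes F: "gsm F" and A: "A \<in> sets nu" shows "gsm (%x. restrict_operator (F x) A)"
proof -
  obtain s where s: "!!n::nat. simple_function \<mu> (s n)" "!!n x. s n x \<in> gspace"
    "AE x in \<mu>. (%n. gam (s n x - F x)) \<longlonglongrightarrow> 0" using gsmE[OF F] by blast
  show ?thesis
  proof (rule gsmI[where s="%n x. restrict_operator (s n x) A"])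
    show "AE x in \<mu>. restrict_operator (F x) A \<in> gspace"
      using gsm_AE[OF F] by eventually_elim (rule gamma_space_restrict[OF _ A])
    show "simple_function \<mu> (%x. restrict_operator (s n x) A)" for n
      by (intro simple_function_compose1[where g="%u. restrict_operator u A"] s)
    show "restrict_operator (s n x) A \<in> gspace" for n x by (intro gamma_space_restrict s A)
    show "AE x in \<mu>. (%n. gam (restrict_operator (s n x) A - restrict_operator (F x) A)) \<longlonglongrightarrow> 0"
      using s(3) gsm_AE[OF F]
    proof eventually_elim
      case (elim x)
      have "gam (restrict_operator (s n x) A - restrict_operator (F x) A) <= gam (s n x - F x)" for n
        unfolding restrict_operator_diff[symmetric]
        by (intro gamma_norm_restrict_le gamma_spaceD gamma_space_diff s elim A)
      then show ?case by (rule ennreal_tendsto_0_le[OF _ elim(1)])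
    qed
  qed
qed

text \<open>\<open>F\<close> is only an almost everywhere limit, so its distance to \<open>t\<close>
  is measurable up to a null set; \<open>g\<close> is the lower limit of the simple functions that
  an approximating sequence provides.\<close>

lemma gsm_dist_measurable:
  assumes F: "gsm F" and t: "simple_function \<mu> t" "!!x. t x \<in> gspace"
  obtains g where "g \<in> borel_measurable \<mu>" "AE x in \<mu>. g x = gam (t x - F x)"
proof -
  obtain s where s: "!!n::nat. simple_function \<mu> (s n)" "!!n x. s n x \<in> gspace"
    "AE x in \<mu>. (%n. gam (s n x - F x)) \<longlonglongrightarrow> 0" using gsmE[OF F] by blast
  define g where "g x = liminf (%m. gam (t x - s m x))" for x
  have "simple_function \<mu> (%x. gam (t x - s m x))" for m
    by (intro simple_function_compose2[where h="%u v. gam (u - v)"] s t)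
  then have "g \<in> borel_measurable \<mu>"
    unfolding g_def by (intro borel_measurable_liminf borel_measurable_simple_function)
  moreover have "AE x in \<mu>. g x = gam (t x - F x)"
    using s(3) gsm_AE[OF F]
  proof eventually_elim
    case (elim x)
    have "(%m. gam ((t x - s m x) - (t x - F x))) \<longlonglongrightarrow> 0"
      using elim(1) gamma_norm_diff_commute[of "F x"] by simp
    then have "(%m. gam (t x - s m x)) \<longlonglongrightarrow> gam (t x - F x)"
      by (intro gamma_norm_tendsto gamma_space_finite gamma_space_diff t elim)
    then show ?case unfolding g_def by (intro lim_imp_Liminf) auto
  qed
  ultimately show ?thesis using that by blast
qed

text \<open>The diagonal sequence is chosen so that the distances, truncated at 1 and weighted to make
  \<open>\<mu>\<close> finite, have summable integrals.\<close>

lemma gsm_limit: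
  assumes F: "!!J::nat. gsm (F J)" and op: "!!x. operator_on (G x)"
    and lim: "AE x in \<mu>. (%J. gam (F J x - G x)) \<longlonglongrightarrow> 0"
  shows "gsm G"
proof -
  have "\<exists>s. (\<forall>n::nat. simple_function \<mu> (s n)) \<and> (\<forall>n x. s n x \<in> gspace) \<and> (AE x in \<mu>. (%n. gam (s n x - F J x)) \<longlonglongrightarrow> 0)" for J
    by (rule gsmE[OF F[of J]]) blast
  then have "\<forall>J. \<exists>s. (\<forall>n::nat. simple_function \<mu> (s n)) \<and> (\<forall>n x. s n x \<in> gspace) \<and> (AE x in \<mu>. (%n. gam (s n x - F J x)) \<longlonglongrightarrow> 0)"
    by (rule allI)
  from choice[OF this] obtain s where s: "!!J n::nat. simple_function \<mu> (s J n)" "!!J n x. s J n x \<in> gspace"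
    "!!J. AE x in \<mu>. (%n. gam (s J n x - F J x)) \<longlonglongrightarrow> 0" by blast
  have "\<exists>g. g \<in> borel_measurable \<mu> \<and> (AE x in \<mu>. g x = gam (s J n x - F J x))" for J n
    by (rule gsm_dist_measurable[OF F[of J] s(1)[of J n] s(2)]) blast
  then have "\<forall>J. \<exists>g. \<forall>n. g n \<in> borel_measurable \<mu> \<and> (AE x in \<mu>. g n x = gam (s J n x - F J x))"
    by (intro allI choice) blast
  from choice[OF this] obtain g where g [measurable]: "!!J n. g J n \<in> borel_measurable \<mu>"
    and g_eq: "!!J n. AE x in \<mu>. g J n x = gam (s J n x - F J x)" by blast
  obtain w :: "'m => real" where w [measurable]: "w \<in> borel_measurable \<mu>" "!!x. 0 < w x" and wi: "integrable \<mu> w"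
    using obtain_positive_integrable_function by metis
  have wfin: "(\<integral>\<^sup>+x. ennreal (w x) \<partial>\<mu>) < \<top>"
    using wi w(2) by (simp add: nn_integral_eq_integral less_imp_le)
  define b where "b J n x = min 1 (g J n x) * ennreal (w x)" for J n x
  have [measurable]: "b J n \<in> borel_measurable \<mu>" for J n unfolding b_def by measurable
  have g_all: "AE x in \<mu>. \<forall>n. g J n x = gam (s J n x - F J x)" for J
    using g_eq by (simp add: AE_all_countable)
  have "(%n. \<integral>\<^sup>+x. b J n x \<partial>\<mu>) \<longlonglongrightarrow> (\<integral>\<^sup>+x. 0 \<partial>\<mu>)" for J
  proof (rule nn_integral_dominated_convergence[where w="%x. ennreal (w x)"])
    show "AE x in \<mu>. b J n x <= ennreal (w x)" for n
      by (intro AE_I2) (auto simp: b_def intro: order_trans[OF mult_right_mono[of _ 1]])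
    show "AE x in \<mu>. (%n. b J n x) \<longlonglongrightarrow> 0"
      using s(3)[of J] g_all[of J]
    proof eventually_elim
      case (elim x)
      have "(%n. ennreal (w x) * g J n x) \<longlonglongrightarrow> ennreal (w x) * 0"
        using elim by (intro ennreal_tendsto_cmult) auto
      then have "(%n. ennreal (w x) * g J n x) \<longlonglongrightarrow> 0" by simp
      moreover have "b J n x <= ennreal (w x) * g J n x" for n
        unfolding b_def by (subst mult.commute) (intro mult_left_mono min.cobounded2, simp)
      ultimately show ?case by (rule ennreal_tendsto_0_le[rotated])
    qed
  qed (use wfin in auto)
  then have "\<exists>n. (\<integral>\<^sup>+x. b J n x \<partial>\<mu>) < ennreal ((1/2)^J)" for J
  proof -
    have "\<forall>\<^sub>F n in sequentially. (\<integral>\<^sup>+x. b J n x \<partial>\<mu>) < ennreal ((1/2)^J)"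
      using \<open>(%n. \<integral>\<^sup>+x. b J n x \<partial>\<mu>) \<longlonglongrightarrow> (\<integral>\<^sup>+x. 0 \<partial>\<mu>)\<close> by (intro order_tendstoD(2)) auto
    then show ?thesis using eventually_happens'[OF sequentially_bot] by blast
  qed
  then obtain n where n: "!!J. (\<integral>\<^sup>+x. b J (n J) x \<partial>\<mu>) < ennreal ((1/2)^J)" by metis
  have "(\<integral>\<^sup>+x. (\<Sum>J. b J (n J) x) \<partial>\<mu>) = (\<Sum>J. \<integral>\<^sup>+x. b J (n J) x \<partial>\<mu>)"
    by (rule nn_integral_suminf) measurable
  also have "... <= (\<Sum>J. ennreal ((1/2)^J))" by (intro suminf_le less_imp_le n) auto
  also have "... = ennreal (\<Sum>J. (1/2)^J)" by (intro suminf_ennreal2 summable_geometric) auto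
  finally have "(\<integral>\<^sup>+x. (\<Sum>J. b J (n J) x) \<partial>\<mu>) \<noteq> \<infinity>" by (auto simp: top_unique)
  then have "AE x in \<mu>. (\<Sum>J. b J (n J) x) \<noteq> \<infinity>" by (intro nn_integral_PInf_AE) measurable
  then have small: "AE x in \<mu>. (%J. g J (n J) x) \<longlonglongrightarrow> 0"
  proof eventually_elim
    case (elim x)
    then have b0: "(%J. b J (n J) x) \<longlonglongrightarrow> 0" by (intro ennreal_suminf_terms_tendsto_0) (simp add: less_top)
    have "(%J. ennreal (1 / w x) * b J (n J) x) \<longlonglongrightarrow> ennreal (1 / w x) * 0"
      by (intro ennreal_tendsto_cmult b0) auto
    moreover have "ennreal (1 / w x) * b J (n J) x = min 1 (g J (n J) x)" for J
    proof -
      have "ennreal (1 / w x) * b J (n J) x = (ennreal (1 / w x) * ennreal (w x)) * min 1 (g J (n J) x)"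
        by (simp only: b_def mult_ac)
      also have "ennreal (1 / w x) * ennreal (w x) = 1"
        using w(2)[of x] by (simp add: ennreal_mult[symmetric] less_imp_le)
      finally show ?thesis by simp
    qed
    ultimately have m0: "(%J. min 1 (g J (n J) x)) \<longlonglongrightarrow> 0" by simp
    then have "\<forall>\<^sub>F J in sequentially. min 1 (g J (n J) x) < 1" by (intro order_tendstoD(2)) auto
    then have "\<forall>\<^sub>F J in sequentially. min 1 (g J (n J) x) = g J (n J) x" by eventually_elim (auto simp: min_def)
    then show ?case using m0 by (rule Lim_transform_eventually[rotated])
  qed
  show ?thesis
  proof (rule gsmI[where s="%J. s J (n J)"])
    have "AE x in \<mu>. \<forall>J. F J x \<in> gspace" using gsm_AE[OF F] by (simp add: AE_all_countable)
    then show "AE x in \<mu>. G x \<in> gspace"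
      using lim
    proof eventually_elim
      case (elim x)
      show ?case by (rule gamma_space_closed[OF spec[OF elim(1)] op elim(2)])
    qed
    have "AE x in \<mu>. \<forall>J. g J (n J) x = gam (s J (n J) x - F J x)" using g_eq by (simp add: AE_all_countable)
    then show "AE x in \<mu>. (%J. gam (s J (n J) x - G x)) \<longlonglongrightarrow> 0"
      using small lim
    proof eventually_elim
      case (elim x)
      have "(%J. gam (s J (n J) x - F J x) + gam (F J x - G x)) \<longlonglongrightarrow> 0 + 0"
        using elim by (intro tendsto_add) auto
      then have l: "(%J. gam (s J (n J) x - F J x) + gam (F J x - G x)) \<longlonglongrightarrow> 0" by simp
      have "gam (s J (n J) x - G x) <= gam (s J (n J) x - F J x) + gam (F J x - G x)" for J
        using gamma_norm_add[of "s J (n J) x - F J x" "F J x - G x"] by simp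
      then show ?case by (rule ennreal_tendsto_0_le[OF _ l])
    qed
  qed (use s in auto)
qed

section \<open>Locally finite sums of operators\<close>

text \<open>Every function in the domain is seen by finitely many of the operators, so
  \<open>opsum\<close> is a finite sum at each function and linear before anything is known about
  convergence in norm. Operators restricted to the shells of an exhaustion form such a
  family.\<close>

definition locally_finite :: "(nat => ('m, 'x::complex_banach) tent_operator) => bool" where
  "locally_finite V \<longleftrightarrow> (\<forall>h\<in>L2c \<mu>. \<exists>J. \<forall>j\<ge>J. V j h = 0)"

definition opsum :: "(nat => ('m, 'x::complex_banach) tent_operator) => ('m, 'x) tent_operator" where
  "opsum V h = (if h \<in> L2c \<mu> then (\<Sum>j. V j h) else 0)"

lemma opsum_outside: "h \<notin> L2c \<mu> ==> opsum V h = 0"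
  by (simp add: opsum_def)

lemma opsum_eq_sum:
  "h \<in> L2c \<mu> ==> (!!j. j \<ge> J ==> V j h = 0) ==> opsum V h = (\<Sum>j<J. V j h)"
  unfolding opsum_def by (simp, rule suminf_finite) auto

lemma locally_finite_summable:
  assumes "locally_finite V" "h \<in> L2c \<mu>" shows "summable (%j. V j h)"
proof -
  obtain J where "\<forall>j\<ge>J. V j h = 0" using assms by (auto simp: locally_finite_def)
  then show ?thesis by (intro summable_finite[of "{..<J}"]) (auto simp: not_less)
qed

lemma summable_scaleC: "summable f ==> summable (%j. c *\<^sub>C f j)" "summable f ==> (\<Sum>j. c *\<^sub>C f j) = c *\<^sub>C (\<Sum>j. f j)"
  for f :: "nat => 'x::complex_banach"
proof -
  have "bounded_linear (%x::'x. c *\<^sub>C x)"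
    by (rule bounded_linear_intro[where K="cmod c"])
      (simp_all add: scaleC_add_right scaleR_scaleC_commute norm_scaleC mult.commute)
  then interpret bounded_linear "%x::'x. c *\<^sub>C x" .
  show "summable f ==> summable (%j. c *\<^sub>C f j)" by (rule summable)
  show "summable f ==> (\<Sum>j. c *\<^sub>C f j) = c *\<^sub>C (\<Sum>j. f j)" by (rule suminf[symmetric])
qed

lemma operator_opsum:
  assumes V: "!!j. operator_on (V j)" and lf: "locally_finite V"
  shows "operator_on (opsum V)"
proof (rule L2_operatorI)
  fix g h assume *: "g \<in> L2c \<mu>" "h \<in> L2c \<mu>"
  then show "opsum V (g + h) = opsum V g + opsum V h"
    using locally_finite_summable[OF lf]
    by (simp only: opsum_def D_add if_True operator_plus[OF V *] suminf_add)
next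
  fix c h assume *: "h \<in> L2c \<mu>"
  then show "opsum V (%p. c * h p) = c *\<^sub>C opsum V h"
    using locally_finite_summable[OF lf *]
    by (simp only: opsum_def D_scale if_True operator_scale[OF V *] summable_scaleC)
next
  fix g h assume *: "g \<in> L2c \<mu>" "h \<in> L2c \<mu>" "AE p in nu. g p = h p"
  show "opsum V g = opsum V h"
    unfolding opsum_def if_P[OF *(1)] if_P[OF *(2)] operator_cong[OF V *] by (rule refl)
qed

lemma opsum_diff:
  assumes "locally_finite V" "locally_finite W"
  shows "opsum V - opsum W = opsum (%j. V j - W j)"
proof
  fix h show "(opsum V - opsum W) h = opsum (%j. V j - W j) h"
    using suminf_diff[OF locally_finite_summable[OF assms(1)] locally_finite_summable[OF assms(2)]]
    by (simp add: opsum_def)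
qed

lemma opsum_scaleC:
  assumes "locally_finite V" shows "c *\<^sub>C opsum V = opsum (%j. c *\<^sub>C V j)"
proof
  fix h show "(c *\<^sub>C opsum V) h = opsum (%j. c *\<^sub>C V j) h"
    using summable_scaleC(2)[OF locally_finite_summable[OF assms], of h c]
    by (simp add: opsum_def scaleC_fun_def)
qed

text \<open>An orthonormal system is finite, so on it the series reduces to a finite sum, to which
  the triangle inequality applies; the supremum over all systems inherits the bound by the full
  series.\<close>

lemma gam_opsum_le:
  assumes V: "!!j. operator_on (V j)" and lf: "locally_finite V" and A: "A \<in> sets nu"
  shows "gam (restrict_operator (opsum V) A) <= (\<Sum>j. gam (restrict_operator (V j) A))"
  unfolding gamma_norm_le_iff
proof (intro allI impI)
  fix n h assume on: "orthonormal_system nu (L2c \<mu>) n h"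
  have hD: "(%p. indicator A p * h k p) \<in> L2c \<mu>" if "k < n" for k
    using on that by (auto simp: orthonormal_system_def intro!: D_indicator A)
  have "\<exists>J. \<forall>k<n. \<forall>j\<ge>J. V j (%p. indicator A p * h k p) = 0"
  proof -
    have "\<forall>k. \<exists>J. k < n --> (\<forall>j\<ge>J. V j (%p. indicator A p * h k p) = 0)"
      using lf hD unfolding locally_finite_def by blast
    then obtain f where f: "!!k. k < n ==> \<forall>j\<ge>f k. V j (%p. indicator A p * h k p) = 0" by metis
    have "f k <= Max (f ` {..<n})" if "k < n" for k using that by (intro Max_ge) auto
    then show ?thesis using f by (intro exI[of _ "Max (f ` {..<n})"]) (meson order_trans)
  qed
  then obtain J where J: "!!k j. k < n ==> j \<ge> J ==> V j (%p. indicator A p * h k p) = 0" by blast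
  have sum_apply: "(\<Sum>j<J. restrict_operator (V j) A) g = (\<Sum>j<J. V j (%p. indicator A p * g p))" for g
    by (induction J) (auto simp: restrict_operator_def)
  have "gaussian_rms n (%k. restrict_operator (opsum V) A (h k)) =
    gaussian_rms n (%k. (\<Sum>j<J. restrict_operator (V j) A) (h k))"
  proof (rule rms_random_sum_cong)
    fix k assume k: "k < n"
    show "restrict_operator (opsum V) A (h k) = (\<Sum>j<J. restrict_operator (V j) A) (h k)"
      unfolding sum_apply unfolding restrict_operator_def
      by (rule opsum_eq_sum[OF hD[OF k]]) (rule J[OF k])
  qed
  then have "ennreal (gaussian_rms n (%k. restrict_operator (opsum V) A (h k))) \<le>
      gam (\<Sum>j<J. restrict_operator (V j) A)"
    using gamma_norm_upper[OF on, of "\<Sum>j<J. restrict_operator (V j) A"] by simp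
  also have "... <= (\<Sum>j<J. gam (restrict_operator (V j) A))" by (rule gamma_norm_sum)
  also have "... <= (\<Sum>j. gam (restrict_operator (V j) A))" by (intro sum_le_suminf) auto
  finally show "ennreal (gaussian_rms n (%k. restrict_operator (opsum V) A (h k))) <= ..." .
qed

text \<open>Where the series of square functions converges, the partial sums approach
  \<open>opsum V\<close> on the cone in the radonifying norm, with the tail of the series as error;
  \<open>gsm_limit\<close> concludes.\<close>

lemma gsm_opsum:
  assumes V: "!!j. operator_on (V j)" and lf: "locally_finite V"
    and g: "!!j. gsm (%x. restrict_operator (V j) (cone_at x))"
    and fin: "AE x in \<mu>. (\<Sum>j. sqf (V j) x) < \<top>"
  shows "gsm (%x. restrict_operator (opsum V) (cone_at x))"
proof (rule gsm_limit[where F="%J x. \<Sum>j<J. restrict_operator (V j) (cone_at x)"])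
  show "gsm (%x. \<Sum>j<J. restrict_operator (V j) (cone_at x))" for J by (intro gsm_sum g)
  show "operator_on (restrict_operator (opsum V) (cone_at x))" for x
    by (intro L2_operator_restrict operator_opsum V lf) auto
  show "AE x in \<mu>. (%J. gam ((\<Sum>j<J. restrict_operator (V j) (cone_at x)) - restrict_operator (opsum V) (cone_at x))) \<longlonglongrightarrow> 0"
    using fin
  proof eventually_elim
    case (elim x)
    have le: "gam ((\<Sum>j<J. restrict_operator (V j) (cone_at x)) - restrict_operator (opsum V) (cone_at x)) \<le>
      (\<Sum>j. sqf (V (j + J)) x)" for J
    proof -
      have lf': "locally_finite (%j. V (j + J))"
        using lf unfolding locally_finite_def by (meson trans_le_add1)
      have "gam ((\<Sum>j<J. restrict_operator (V j) (cone_at x)) - restrict_operator (opsum V) (cone_at x)) =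
        gam (restrict_operator (opsum V) (cone_at x) - (\<Sum>j<J. restrict_operator (V j) (cone_at x)))"
        by (rule gamma_norm_diff_commute)
      also have "... = gam (restrict_operator (opsum (%j. V (j + J))) (cone_at x))"
      proof (rule gamma_norm_cong)
        fix h assume "h \<in> L2c \<mu>"
        then have h: "(%p. indicator (cone_at x) p * h p) \<in> L2c \<mu>" by (intro D_indicator) auto
        have sum_apply: "(\<Sum>j<J. restrict_operator (V j) (cone_at x)) h = (\<Sum>j<J. V j (%p. indicator (cone_at x) p * h p))"
          by (induction J) (auto simp: restrict_operator_def)
        show "(restrict_operator (opsum V) (cone_at x) - (\<Sum>j<J. restrict_operator (V j) (cone_at x))) h =
          restrict_operator (opsum (%j. V (j + J))) (cone_at x) h"
          using suminf_minus_initial_segment[OF locally_finite_summable[OF lf h], of J]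
          unfolding fun_diff_def sum_apply unfolding restrict_operator_def opsum_def if_P[OF h] by simp
      qed
      also have "... <= (\<Sum>j. sqf (V (j + J)) x)"
        unfolding square_function_def by (intro gam_opsum_le V lf') auto
      finally show ?thesis .
    qed
    show ?case
      by (rule ennreal_tendsto_0_le[OF le ennreal_suminf_tail_tendsto_0[OF elim]])
  qed
qed

section \<open>Tent spaces\<close>

lemma tent_points_iff:
  "u \<in> points (Tent q) \<longleftrightarrow> operator_on u \<and> (\<forall>h. h \<notin> L2c \<mu> --> u h = 0) \<and>
    gsm (%x. restrict_operator u (cone_at x)) \<and> Lp_norm \<mu> q (sqf u) < \<top>"
  by (simp add: tent_space_def)

lemma tent_norm_def: "norm_on (Tent q) u = enn2real (Lp_norm \<mu> q (sqf u))"
  by (simp add: tent_space_def)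

lemma Lp_norm_le_iff:
  "q > 0 ==> c \<ge> 0 ==> Lp_norm \<mu> q f <= ennreal c \<longleftrightarrow> (\<integral>\<^sup>+x. ennreal_powr (f x) q \<partial>\<mu>) <= ennreal (c powr q)"
  unfolding Lp_norm_def by (subst ennreal_powr_le_iff) (auto simp: ennreal_powr_ennreal)

lemma tent_norm_integral:
  assumes "u \<in> points (Tent q)" "q > 0"
  shows "(\<integral>\<^sup>+x. ennreal_powr (sqf u x) q \<partial>\<mu>) <= ennreal (norm_on (Tent q) u powr q)"
  using assms Lp_norm_le_iff[of q "norm_on (Tent q) u" "sqf u"]
  by (simp add: tent_points_iff tent_norm_def)

lemma tent_norm_le:
  assumes "(\<integral>\<^sup>+x. ennreal_powr (sqf u x) q \<partial>\<mu>) <= ennreal (c powr q)" "q > 0" "c \<ge> 0"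
  shows "norm_on (Tent q) u <= c" "Lp_norm \<mu> q (sqf u) < \<top>"
proof -
  have "Lp_norm \<mu> q (sqf u) <= ennreal c" using assms by (subst Lp_norm_le_iff) auto
  then show "norm_on (Tent q) u <= c" "Lp_norm \<mu> q (sqf u) < \<top>"
    using assms(3) by (auto simp: tent_norm_def enn2real_leI less_top[symmetric] top_unique)
qed

lemma tent_norm_nonneg [simp]: "0 <= norm_on (Tent q) u"
  by (simp add: tent_norm_def)

lemma gsm_square_finite:
  "gsm (%x. restrict_operator u (cone_at x)) ==> AE x in \<mu>. sqf u x < \<top>"
  unfolding square_function_def by (rule gsm_finite)

text \<open>The form in which absolutely convergent series are summed in a tent space: local
  finiteness supplies the limit operator, Minkowski's inequality its norm.\<close>

lemma opsum_tent:
  assumes q: "q \<ge> 1" and V: "!!j. operator_on (V j)" and lf: "locally_finite V"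
    and g: "!!j. gsm (%x. restrict_operator (V j) (cone_at x))"
    and G: "!!j. G j \<ge> 0" "summable G"
    and le: "!!j. (\<integral>\<^sup>+x. ennreal_powr (sqf (V j) x) q \<partial>\<mu>) <= ennreal (G j powr q)"
  shows "opsum V \<in> points (Tent q)" "norm_on (Tent q) (opsum V) <= (\<Sum>j. G j)"
proof -
  have m [measurable]: "sqf (V j) \<in> borel_measurable \<mu>" for j
    by (intro square_function_measurable V gsm_square_finite g)
  have int: "(\<integral>\<^sup>+x. ennreal_powr (\<Sum>j. sqf (V j) x) q \<partial>\<mu>) <= ennreal ((\<Sum>j. G j) powr q)"
    by (rule Minkowski_suminf[OF m G q le])
  then have "(\<integral>\<^sup>+x. ennreal_powr (\<Sum>j. sqf (V j) x) q \<partial>\<mu>) \<noteq> \<infinity>" by (auto simp: top_unique)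
  then have "AE x in \<mu>. ennreal_powr (\<Sum>j. sqf (V j) x) q \<noteq> \<infinity>"
    by (rule nn_integral_PInf_AE[rotated]) measurable
  then have fin: "AE x in \<mu>. (\<Sum>j. sqf (V j) x) < \<top>"
    by eventually_elim (metis ennreal_powr_top infinity_ennreal_def less_top)
  have "(\<integral>\<^sup>+x. ennreal_powr (sqf (opsum V) x) q \<partial>\<mu>) <= (\<integral>\<^sup>+x. ennreal_powr (\<Sum>j. sqf (V j) x) q \<partial>\<mu>)"
    using q unfolding square_function_def by (intro nn_integral_mono ennreal_powr_mono gam_opsum_le V lf) auto
  then have le': "(\<integral>\<^sup>+x. ennreal_powr (sqf (opsum V) x) q \<partial>\<mu>) <= ennreal ((\<Sum>j. G j) powr q)"
    using int by (rule order_trans)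
  show "opsum V \<in> points (Tent q)"
    unfolding tent_points_iff
    using tent_norm_le(2)[OF le'] q G operator_opsum[OF V lf] gsm_opsum[OF V lf g fin]
    by (auto simp: opsum_outside suminf_nonneg)
  show "norm_on (Tent q) (opsum V) <= (\<Sum>j. G j)"
    using tent_norm_le(1)[OF le'] q G by (simp add: suminf_nonneg)
qed

end

section \<open>Multipliers on a family of pieces\<close>

lemma sum_fun_apply: "(\<Sum>k\<in>K. F k) h = (\<Sum>k\<in>K. F k h)"
  for F :: "'k => 'h => 'x::comm_monoid_add"
  by (induction K rule: infinite_finite_induct) auto

lemma restrict_operator_sum: "restrict_operator (\<Sum>k\<in>K. F k) A = (\<Sum>k\<in>K. restrict_operator (F k) A)"
  for F :: "'k => ('a => complex) => 'x::comm_monoid_add"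
  by (rule ext) (simp add: restrict_operator_def sum_fun_apply)

lemma restrict_operator_scaleC: "restrict_operator (c *\<^sub>C u) A = c *\<^sub>C restrict_operator u A"
  by (simp add: restrict_operator_def scaleC_fun_def)

lemma sum_space_norm_le:
  fixes A B :: "'v::complex_vector normed_subspace"
  assumes "a \<in> points A" "b \<in> points B" "!!v. 0 <= norm_on A v" "!!v. 0 <= norm_on B v"
  shows "norm_on (sum_space A B) (a + b) <= norm_on A a + norm_on B b"
proof -
  have "bdd_below {norm_on A a' + norm_on B b' | a' b'. a' \<in> points A \<and> b' \<in> points B \<and> a + b = a' + b'}"
    using assms(3,4) by (intro bdd_belowI[of _ 0]) auto
  then show ?thesis
    unfolding sum_space_def using assms(1,2) by (simp, intro cInf_lower) blast+
qed

lemma sum_space_norm_nonneg: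
  fixes A B :: "'v::complex_vector normed_subspace"
  assumes "v \<in> points (sum_space A B)" "!!v. 0 <= norm_on A v" "!!v. 0 <= norm_on B v"
  shows "0 <= norm_on (sum_space A B) v"
  using assms(1) unfolding sum_space_def by (auto intro!: cInf_greatest simp: assms)

text \<open>Cauchy's estimate on circles of radius \<rho> about the points of the \<rho>-ball; these
  circles stay inside the ball of radius 3 \<rho>. The resulting bound is proportional to
  \<open>B\<close>, which permits a uniform domination of difference quotients over all
  pieces.\<close>

lemma holomorphic_Lipschitz:
  fixes g :: "complex => complex"
  assumes hol: "g holomorphic_on UNIV" and \<rho>: "\<rho> > 0"
    and bd: "!!x. dist z x < 3 * \<rho> ==> cmod (g x) <= B"
  shows "cmod (deriv g z) <= B / \<rho>" "dist z w < \<rho> ==> cmod (g w - g z) <= B / \<rho> * cmod (w - z)"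
proof -
  have d: "cmod (deriv g x) <= B / \<rho>" if "dist z x < \<rho>" for x
  proof -
    have "cmod ((deriv ^^ 1) g x) <= fact 1 * B / \<rho> ^ 1"
    proof (rule Cauchy_inequality)
      show "g holomorphic_on ball x \<rho>" using hol by (rule holomorphic_on_subset) simp
      show "continuous_on (cball x \<rho>) g"
        using hol by (intro continuous_on_subset[OF holomorphic_on_imp_continuous_on]) auto
      fix y assume "cmod (x - y) = \<rho>"
      then show "cmod (g y) <= B"
        using that \<rho> dist_triangle[of z y x] by (intro bd) (auto simp: dist_norm)
    qed (use \<rho> in auto)
    then show ?thesis by simp
  qed
  show "cmod (deriv g z) <= B / \<rho>" by (rule d) (use \<rho> in simp)
  assume w: "dist z w < \<rho>"
  show "cmod (g w - g z) <= B / \<rho> * cmod (w - z)"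
  proof (rule field_differentiable_bound[where S="ball z \<rho>"])
    show "(g has_field_derivative deriv g x) (at x within ball z \<rho>)" if "x \<in> ball z \<rho>" for x
      by (rule has_field_derivative_at_within, rule holomorphic_derivI[OF hol open_UNIV UNIV_I])
    show "cmod (deriv g x) <= B / \<rho>" if "x \<in> ball z \<rho>" for x using that by (intro d) simp
  qed (use w \<rho> in auto)
qed

context metric_measure_space begin

lemma square_function_scaled_sum_le:
  "sqf (\<Sum>k<n. b k *\<^sub>C restrict_operator u (A k)) x \<le>
    (\<Sum>k<n. ennreal (cmod (b k)) * sqf (restrict_operator u (A k)) x)"
  unfolding square_function_def restrict_operator_sum restrict_operator_scaleC
  by (rule order_trans[OF gamma_norm_sum]) (simp add: gamma_norm_scaleC)

end

text \<open>Index \<open>j\<close> runs through the shells of an exhaustion, to which the geometric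
  scales \<open>L / 2 ^ j\<close> are assigned, and \<open>k\<close> through the level pieces of one
  shell. \<open>levels\<close> bounds the endpoint norms of a shell by its scale with constants
  common to all shells, and \<open>exhaust\<close> recovers \<open>u\<close> as a locally finite
  sum. The type inequality enters with its constant already chosen.\<close>

locale tent_pieces = metric_measure_space \<mu>
  for \<mu> :: "'m::metric_space measure" +
  fixes u :: "('m, 'x::complex_banach) tent_operator"
    and A :: "nat => nat => ('m \<times> real) set" and S :: "nat => nat => 'm set"
    and a :: "nat => nat => real" and n :: "nat => nat" and L p r C Ct :: real
  assumes u: "operator_on u" and u_outside: "!!h. h \<notin> L2c \<mu> ==> u h = 0"
    and u_gsm: "gsm (%x. restrict_operator u (cone_at x))"
    and A_sets: "!!j k. k < n j ==> A j k \<in> sets nu"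
    and A_disj: "!!j k k'. k < n j ==> k' < n j ==> k \<noteq> k' ==> A j k \<inter> A j k' = {}"
    and a_pos: "!!j k. k < n j ==> 0 < a j k"
    and S_sets: "!!j k. k < n j ==> S j k \<in> sets borel"
    and sq_le: "!!j k x. k < n j ==>
      sqf (restrict_operator u (A j k)) x <= ennreal (a j k * (L / 2 ^ j)) * indicator (S j k) x"
    and levels: "!!j. (\<Sum>k<n j. ennreal (a j k powr p) * emeasure \<mu> (S j k)) <= ennreal C"
    and exhaust: "!!h. h \<in> L2c \<mu> ==> \<exists>J. u h = (\<Sum>j<J. \<Sum>k<n j. restrict_operator u (A j k) h) \<and>
      (\<forall>j\<ge>J. \<forall>k<n j. restrict_operator u (A j k) h = 0)"
    and L_pos: "0 < L" and p_ge: "1 <= p" and r_ge: "1 <= r" and C_pos: "0 < C" and Ct_pos: "0 < Ct"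
    and type: "!!K B (v :: nat => ('m, 'x) tent_operator) G. \<lbrakk>!!k. k < K ==> B k \<in> sets (half_space_measure \<mu>);
       !!k l. k < K ==> l < K ==> k \<noteq> l ==> B k \<inter> B l = {};
       !!k. k < K ==> L2_operator (half_space_measure \<mu>) (L2c \<mu>) (v k);
       !!k h. k < K ==> h \<in> L2c \<mu> ==> v k (%p. indicator (B k) p * h p) = v k h;
       !!k. k < K ==> G k \<ge> 0; !!k. k < K ==> gamma_norm (half_space_measure \<mu>) (L2c \<mu>) (v k) <= ennreal (G k)\<rbrakk>
       \<Longrightarrow> gamma_norm (half_space_measure \<mu>) (L2c \<mu>) (\<Sum>k<K. v k) <= ennreal (Ct * (\<Sum>k<K. G k powr r) powr (1 / r))"
begin

definition part :: "(nat => nat => complex) => nat => ('m, 'x) tent_operator" where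
  "part b j = (\<Sum>k<n j. b j k *\<^sub>C restrict_operator u (A j k))"

definition multiplied :: "(nat => nat => complex) => ('m, 'x) tent_operator" where
  "multiplied b = opsum (part b)"

lemma part_apply: "part b j h = (\<Sum>k<n j. b j k *\<^sub>C restrict_operator u (A j k) h)"
  by (simp add: part_def sum_fun_apply scaleC_fun_def)

lemma operator_part: "operator_on (part b j)"
proof -
  have "operator_on (\<Sum>k\<in>K. b j k *\<^sub>C restrict_operator u (A j k))" if "K \<subseteq> {..<n j}" "finite K" for K
    using that(2,1)
  proof (induction K rule: finite_induct)
    case empty
    show ?case unfolding sum.empty by (rule gamma_spaceD[OF gamma_space_zero])
  next
    case (insert k K)
    show ?case unfolding sum.insert[OF insert.hyps]
      using insert by (intro L2_operator_add L2_operator_scaleC L2_operator_restrict u A_sets) auto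
  qed
  then show ?thesis unfolding part_def by blast
qed

lemma locally_finite_part: "locally_finite (part b)"
  unfolding locally_finite_def
proof
  fix h assume "h \<in> L2c \<mu>"
  then obtain J where "\<forall>j\<ge>J. \<forall>k<n j. restrict_operator u (A j k) h = 0" using exhaust by blast
  then have "\<forall>j\<ge>J. part b j h = 0" by (simp add: part_apply)
  then show "\<exists>J. \<forall>j\<ge>J. part b j h = 0" by blast
qed

lemma gsm_part: "gsm (%x. restrict_operator (part b j) (cone_at x))"
proof -
  have "gsm (%x. b j k *\<^sub>C restrict_operator (restrict_operator u (cone_at x)) (A j k))" if "k < n j" for k
    using that by (intro gsm_scaleC gsm_restrict u_gsm A_sets)
  then have "gsm (%x. \<Sum>k<n j. b j k *\<^sub>C restrict_operator (restrict_operator u (cone_at x)) (A j k))"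
    by (intro gsm_sum) auto
  moreover have "(%x. restrict_operator (part b j) (cone_at x)) =
    (%x. \<Sum>k<n j. b j k *\<^sub>C restrict_operator (restrict_operator u (cone_at x)) (A j k))"
    unfolding part_def restrict_operator_sum restrict_operator_scaleC restrict_restrict_operator
    by (simp only: Int_commute)
  ultimately show ?thesis by simp
qed

text \<open>Linearity in the coefficients reduces continuity, differentiability and decay of the
  operator-valued functions below to the same questions for scalar coefficients.\<close>

lemma multiplied_diff: "multiplied b - multiplied b' = multiplied (%j k. b j k - b' j k)"
proof -
  have "part b j - part b' j = part (%j k. b j k - b' j k) j" for j
  proof
    fix h
    have "(c - d) *\<^sub>C x = c *\<^sub>C x - d *\<^sub>C x" for c d and x :: 'x
      using scaleC_add_left[of c "- d" x] by (simp add: scaleC_minus)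
    then show "(part b j - part b' j) h = part (%j k. b j k - b' j k) j h"
      by (simp add: part_apply sum_subtractf)
  qed
  then show ?thesis
    unfolding multiplied_def opsum_diff[OF locally_finite_part locally_finite_part] by simp
qed

lemma multiplied_scaleC: "c *\<^sub>C multiplied b = multiplied (%j k. c * b j k)"
proof -
  have "c *\<^sub>C part b j = part (%j k. c * b j k) j" for j
    by (rule ext) (simp add: scaleC_fun_def[of c "part b j"] part_apply scaleC_sum_right scaleC_scaleC)
  then show ?thesis unfolding multiplied_def opsum_scaleC[OF locally_finite_part] by simp
qed

lemma multiplied_add: "multiplied b + multiplied b' = multiplied (%j k. b j k + b' j k)"
  using multiplied_diff[of b "%j k. - b' j k"] multiplied_scaleC[of "-1" b']
  by (simp add: scaleC_minus scaleC_one) (metis (no_types, lifting) add.commute diff_minus_eq_add)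

lemma multiplied_one: "multiplied (%j k. 1) = u"
proof
  fix h
  show "multiplied (%j k. 1) h = u h"
  proof (cases "h \<in> L2c \<mu>")
    case True
    then obtain J where J: "u h = (\<Sum>j<J. \<Sum>k<n j. restrict_operator u (A j k) h)"
      "\<forall>j\<ge>J. \<forall>k<n j. restrict_operator u (A j k) h = 0" using exhaust by blast
    have "opsum (part (%j k. 1)) h = (\<Sum>j<J. part (%j k. 1) j h)"
      using J(2) True by (intro opsum_eq_sum) (simp_all add: part_apply)
    then show ?thesis by (simp add: multiplied_def part_apply J(1) scaleC_one)
  qed (simp add: multiplied_def opsum_outside u_outside)
qed

text \<open>The endpoint \<open>Re z = 0\<close>, where the triangle inequality is enough: a
  coefficient of size a^(p-1) times a square function of size a gives a^p on \<open>S j k\<close>,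
  and \<open>levels\<close> controls the sum of the integrals.\<close>

lemma part_L1:
  assumes b: "!!k. k < n j ==> cmod (b j k) <= \<beta> * a j k powr (p - 1)" and \<beta>: "\<beta> \<ge> 0"
  shows "(\<integral>\<^sup>+x. ennreal_powr (sqf (part b j) x) 1 \<partial>\<mu>) <= ennreal ((C * L * (\<beta> / 2 ^ j)) powr 1)"
proof -
  let ?l = "L / 2 ^ j"
  have l: "?l \<ge> 0" using L_pos by simp
  have pt: "sqf (part b j) x <= (\<Sum>k<n j. ennreal (\<beta> * ?l * a j k powr p) * indicator (S j k) x)" for x
  proof -
    have "sqf (part b j) x <= (\<Sum>k<n j. ennreal (cmod (b j k)) * sqf (restrict_operator u (A j k)) x)"
      unfolding part_def by (rule square_function_scaled_sum_le)
    also have "... <= (\<Sum>k<n j. ennreal (\<beta> * a j k powr (p - 1)) * (ennreal (a j k * ?l) * indicator (S j k) x))"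
      by (intro sum_mono mult_mono ennreal_leI b sq_le) auto
    also have "... = (\<Sum>k<n j. ennreal (\<beta> * ?l * a j k powr p) * indicator (S j k) x)"
    proof (intro sum.cong refl)
      fix k assume "k \<in> {..<n j}"
      then have "a j k powr p = a j k powr (p - 1) * a j k" using a_pos[of k j] by (simp add: powr_diff)
      then have "(\<beta> * a j k powr (p - 1)) * (a j k * ?l) = \<beta> * ?l * a j k powr p" by simp
      moreover have "ennreal (\<beta> * a j k powr (p - 1)) * ennreal (a j k * ?l) =
          ennreal ((\<beta> * a j k powr (p - 1)) * (a j k * ?l))"
        using \<beta> l a_pos[of k j] \<open>k \<in> {..<n j}\<close> by (intro ennreal_mult[symmetric] mult_nonneg_nonneg) auto
      ultimately show "ennreal (\<beta> * a j k powr (p - 1)) * (ennreal (a j k * ?l) * indicator (S j k) x) =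
          ennreal (\<beta> * ?l * a j k powr p) * indicator (S j k) x"
        by (simp only: mult.assoc[symmetric])
    qed
    finally show ?thesis .
  qed
  have Sm: "k < n j ==> S j k \<in> sets \<mu>" for k using S_sets by simp
  have "(\<integral>\<^sup>+x. sqf (part b j) x \<partial>\<mu>) \<le>
      (\<integral>\<^sup>+x. (\<Sum>k<n j. ennreal (\<beta> * ?l * a j k powr p) * indicator (S j k) x) \<partial>\<mu>)"
    by (intro nn_integral_mono pt)
  also have "... = (\<Sum>k<n j. \<integral>\<^sup>+x. ennreal (\<beta> * ?l * a j k powr p) * indicator (S j k) x \<partial>\<mu>)"
    by (intro nn_integral_sum borel_measurable_times_ennreal borel_measurable_const borel_measurable_indicator Sm) auto
  also have "... = (\<Sum>k<n j. ennreal (\<beta> * ?l * a j k powr p) * emeasure \<mu> (S j k))"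
    by (intro sum.cong refl nn_integral_cmult_indicator Sm) auto
  also have "... = ennreal (\<beta> * ?l) * (\<Sum>k<n j. ennreal (a j k powr p) * emeasure \<mu> (S j k))"
    unfolding sum_distrib_left
  proof (intro sum.cong refl)
    fix k
    have "ennreal (\<beta> * ?l * a j k powr p) = ennreal (\<beta> * ?l) * ennreal (a j k powr p)"
      using \<beta> l by (intro ennreal_mult mult_nonneg_nonneg) auto
    then show "ennreal (\<beta> * ?l * a j k powr p) * emeasure \<mu> (S j k) = ennreal (\<beta> * ?l) * (ennreal (a j k powr p) * emeasure \<mu> (S j k))"
      by (simp only: mult.assoc)
  qed
  also have "... <= ennreal (\<beta> * ?l) * ennreal C" by (intro mult_left_mono levels) auto
  also have "... = ennreal ((C * L * (\<beta> / 2 ^ j)) powr 1)"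
  proof -
    have "ennreal (\<beta> * ?l) * ennreal C = ennreal (\<beta> * ?l * C)"
      using \<beta> l C_pos by (intro ennreal_mult[symmetric] mult_nonneg_nonneg) auto
    also have "\<beta> * ?l * C = C * L * (\<beta> / 2 ^ j)" by simp
    also have "... = (C * L * (\<beta> / 2 ^ j)) powr 1" using \<beta> C_pos L_pos by simp
    finally show ?thesis .
  qed
  finally show ?thesis by simp
qed

text \<open>The endpoint \<open>Re z = 1\<close>. The pieces of one shell are disjoint, so type
  gives an r-sum at each vertex in place of the triangle inequality. The exponent p/r - 1 turns the
  r-th power of each term into a multiple of a^p, again summable by \<open>levels\<close>.\<close>

lemma part_Lr:
  assumes b: "!!k. k < n j ==> cmod (b j k) <= \<beta> * a j k powr (p / r - 1)" and \<beta>: "\<beta> \<ge> 0"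
  shows "(\<integral>\<^sup>+x. ennreal_powr (sqf (part b j) x) r \<partial>\<mu>) <= ennreal ((Ct * C powr (1 / r) * L * (\<beta> / 2 ^ j)) powr r)"
proof -
  let ?l = "L / 2 ^ j"
  have l: "?l \<ge> 0" using L_pos by simp
  have pt: "ennreal_powr (sqf (part b j) x) r \<le>
      (\<Sum>k<n j. ennreal ((Ct * (\<beta> * ?l)) powr r * a j k powr p) * indicator (S j k) x)" for x
  proof -
    define G where "G k = \<beta> * ?l * a j k powr (p / r) * indicator (S j k) x" for k
    have sq: "sqf (part b j) x <= ennreal (Ct * (\<Sum>k<n j. G k powr r) powr (1 / r))"
      unfolding square_function_def part_def restrict_operator_sum restrict_operator_scaleC
    proof (rule type[where B="A j"])
      fix k assume k: "k < n j"
      show "A j k \<in> sets nu" by (rule A_sets[OF k])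
      show "operator_on (b j k *\<^sub>C restrict_operator (restrict_operator u (A j k)) (cone_at x))"
        by (intro L2_operator_scaleC L2_operator_restrict u A_sets k) auto
      show "0 <= G k" unfolding G_def by (intro mult_nonneg_nonneg \<beta> l powr_ge_zero) (simp add: indicator_def)
      show "(b j k *\<^sub>C restrict_operator (restrict_operator u (A j k)) (cone_at x)) (%p. indicator (A j k) p * h p) =
        (b j k *\<^sub>C restrict_operator (restrict_operator u (A j k)) (cone_at x)) h" for h
      proof -
        have "(%p. indicator (A j k \<inter> cone_at x) p * (indicator (A j k) p * h p)) = (%p. indicator (A j k \<inter> cone_at x) p * h p)"
          by (auto simp: indicator_def fun_eq_iff)
        then show ?thesis
          unfolding scaleC_fun_def restrict_restrict_operator unfolding restrict_operator_def by (simp only:)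
      qed
      have "gam (b j k *\<^sub>C restrict_operator (restrict_operator u (A j k)) (cone_at x)) =
          ennreal (cmod (b j k)) * sqf (restrict_operator u (A j k)) x"
        by (simp add: gamma_norm_scaleC square_function_def)
      also have "... <= ennreal (\<beta> * a j k powr (p / r - 1)) * (ennreal (a j k * ?l) * indicator (S j k) x)"
        by (intro mult_mono ennreal_leI b sq_le k) auto
      also have "... = ennreal (G k)"
      proof -
        have "a j k powr (p / r) = a j k powr (p / r - 1) * a j k" using a_pos[OF k] by (simp add: powr_diff)
        then have e1: "(\<beta> * a j k powr (p / r - 1)) * (a j k * ?l) = \<beta> * ?l * a j k powr (p / r)" by simp
        have e2: "ennreal (\<beta> * a j k powr (p / r - 1)) * ennreal (a j k * ?l) =
            ennreal ((\<beta> * a j k powr (p / r - 1)) * (a j k * ?l))"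
          using \<beta> l a_pos[OF k] by (intro ennreal_mult[symmetric] mult_nonneg_nonneg) auto
        show ?thesis
        proof (cases "x \<in> S j k")
          case True
          then show ?thesis unfolding G_def by (simp only: indicator_simps mult_1_right e2 e1)
        next
          case False
          then show ?thesis unfolding G_def by simp
        qed
      qed
      finally show "gam (b j k *\<^sub>C restrict_operator (restrict_operator u (A j k)) (cone_at x)) <= ennreal (G k)" .
    qed (use A_disj in blast)
    have "ennreal_powr (sqf (part b j) x) r <= ennreal_powr (ennreal (Ct * (\<Sum>k<n j. G k powr r) powr (1 / r))) r"
      using r_ge by (intro ennreal_powr_mono sq) auto
    also have "... = ennreal (Ct powr r * (\<Sum>k<n j. G k powr r))"
      using r_ge Ct_pos by (simp add: ennreal_powr_ennreal powr_mult powr_powr sum_nonneg)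
    also have "(\<Sum>k<n j. G k powr r) = (\<Sum>k<n j. (\<beta> * ?l) powr r * a j k powr p * indicator (S j k) x)"
    proof (intro sum.cong refl)
      fix k
      have "(a j k powr (p / r)) powr r = a j k powr p" using r_ge by (simp add: powr_powr)
      then show "G k powr r = (\<beta> * ?l) powr r * a j k powr p * indicator (S j k) x"
        using powr_mult[of "\<beta> * ?l" "a j k powr (p / r)" r] \<beta> l
        by (cases "x \<in> S j k") (simp_all add: G_def)
    qed
    also have "ennreal (Ct powr r * (\<Sum>k<n j. (\<beta> * ?l) powr r * a j k powr p * indicator (S j k) x)) =
       (\<Sum>k<n j. ennreal ((Ct * (\<beta> * ?l)) powr r * a j k powr p) * indicator (S j k) x)"
    proof -
      have "Ct powr r * (\<Sum>k<n j. (\<beta> * ?l) powr r * a j k powr p * indicator (S j k) x) =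
        (\<Sum>k<n j. (Ct * (\<beta> * ?l)) powr r * a j k powr p * indicator (S j k) x)"
        unfolding sum_distrib_left powr_mult[of Ct "\<beta> * ?l" r]
        by (intro sum.cong refl) (simp only: mult.assoc)
      moreover have "ennreal (\<Sum>k<n j. (Ct * (\<beta> * ?l)) powr r * a j k powr p * indicator (S j k) x) =
        (\<Sum>k<n j. ennreal ((Ct * (\<beta> * ?l)) powr r * a j k powr p * indicator (S j k) x))"
        by (rule sum_ennreal[symmetric]) simp
      moreover have "ennreal (c * indicator (S j k) x) = ennreal c * indicator (S j k) x" for c k
        by (simp add: indicator_def)
      ultimately show ?thesis by simp
    qed
    finally show ?thesis .
  qed
  have Sm: "k < n j ==> S j k \<in> sets \<mu>" for k using S_sets by simp
  have "(\<integral>\<^sup>+x. ennreal_powr (sqf (part b j) x) r \<partial>\<mu>) \<le>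
      (\<integral>\<^sup>+x. (\<Sum>k<n j. ennreal ((Ct * (\<beta> * ?l)) powr r * a j k powr p) * indicator (S j k) x) \<partial>\<mu>)"
    by (intro nn_integral_mono pt)
  also have "... = (\<Sum>k<n j. \<integral>\<^sup>+x. ennreal ((Ct * (\<beta> * ?l)) powr r * a j k powr p) * indicator (S j k) x \<partial>\<mu>)"
    by (intro nn_integral_sum borel_measurable_times_ennreal borel_measurable_const borel_measurable_indicator Sm) auto
  also have "... = (\<Sum>k<n j. ennreal ((Ct * (\<beta> * ?l)) powr r * a j k powr p) * emeasure \<mu> (S j k))"
    by (intro sum.cong refl nn_integral_cmult_indicator Sm) auto
  also have "... = ennreal ((Ct * (\<beta> * ?l)) powr r) * (\<Sum>k<n j. ennreal (a j k powr p) * emeasure \<mu> (S j k))"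
    unfolding sum_distrib_left
  proof (intro sum.cong refl)
    fix k
    have "ennreal ((Ct * (\<beta> * ?l)) powr r * a j k powr p) = ennreal ((Ct * (\<beta> * ?l)) powr r) * ennreal (a j k powr p)"
      by (intro ennreal_mult) auto
    then show "ennreal ((Ct * (\<beta> * ?l)) powr r * a j k powr p) * emeasure \<mu> (S j k) =
        ennreal ((Ct * (\<beta> * ?l)) powr r) * (ennreal (a j k powr p) * emeasure \<mu> (S j k))"
      by (simp only: mult.assoc)
  qed
  also have "... <= ennreal ((Ct * (\<beta> * ?l)) powr r) * ennreal C" by (intro mult_left_mono levels) auto
  also have "... = ennreal ((Ct * C powr (1 / r) * L * (\<beta> / 2 ^ j)) powr r)"
  proof -
    have "(Ct * C powr (1 / r) * L * (\<beta> / 2 ^ j)) = (Ct * (\<beta> * ?l)) * C powr (1 / r)" by simp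
    also have "... powr r = (Ct * (\<beta> * ?l)) powr r * C"
      using Ct_pos \<beta> l C_pos r_ge by (subst powr_mult) (auto simp: powr_powr)
    finally show ?thesis using C_pos by (simp add: ennreal_mult)
  qed
  finally show ?thesis .
qed

lemma multiplied_T1:
  assumes b: "!!j k. k < n j ==> cmod (b j k) <= \<beta> j * a j k powr (p - 1)"
    and \<beta>: "!!j. \<beta> j \<ge> 0" "summable (%j. \<beta> j / 2 ^ j)"
  shows "multiplied b \<in> points (Tent 1)"
    "norm_on (Tent 1) (multiplied b) <= C * L * (\<Sum>j. \<beta> j / 2 ^ j)"
proof -
  have G: "0 <= C * L * (\<beta> j / 2 ^ j)" for j using \<beta>(1)[of j] C_pos L_pos by simp
  note * = opsum_tent[of 1 "part b" "%j. C * L * (\<beta> j / 2 ^ j)", OF order_refl operator_part locally_finite_part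
    gsm_part G summable_mult[OF \<beta>(2)] part_L1[OF b \<beta>(1)]]
  show "multiplied b \<in> points (Tent 1)" unfolding multiplied_def by (rule *(1))
  show "norm_on (Tent 1) (multiplied b) <= C * L * (\<Sum>j. \<beta> j / 2 ^ j)"
    unfolding multiplied_def suminf_mult[OF \<beta>(2), symmetric] by (rule *(2))
qed

lemma multiplied_Tr:
  assumes b: "!!j k. k < n j ==> cmod (b j k) <= \<beta> j * a j k powr (p / r - 1)"
    and \<beta>: "!!j. \<beta> j \<ge> 0" "summable (%j. \<beta> j / 2 ^ j)"
  shows "multiplied b \<in> points (Tent r)"
    "norm_on (Tent r) (multiplied b) <= Ct * C powr (1 / r) * L * (\<Sum>j. \<beta> j / 2 ^ j)"
proof -
  have G: "0 <= Ct * C powr (1 / r) * L * (\<beta> j / 2 ^ j)" for j using \<beta>(1)[of j] Ct_pos L_pos by simp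
  note * = opsum_tent[of r "part b" "%j. Ct * C powr (1 / r) * L * (\<beta> j / 2 ^ j)", OF r_ge operator_part locally_finite_part
    gsm_part G summable_mult[OF \<beta>(2)] part_Lr[OF b \<beta>(1)]]
  show "multiplied b \<in> points (Tent r)" unfolding multiplied_def by (rule *(1))
  show "norm_on (Tent r) (multiplied b) <= Ct * C powr (1 / r) * L * (\<Sum>j. \<beta> j / 2 ^ j)"
    unfolding multiplied_def suminf_mult[OF \<beta>(2), symmetric] by (rule *(2))
qed

text \<open>The larger of the two endpoint weights; it dominates the powers with any exponent
  between theirs and so is the bound for coefficients inside the strip.\<close>

definition weight :: "real => real" where
  "weight t = max (t powr (p - 1)) (t powr (p / r - 1))"

text \<open>Each piece goes to the summand of the larger weight, so both parts obey an endpoint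
  estimate with the same factors \<open>\<beta>\<close>.\<close>

lemma multiplied_sum:
  assumes b: "!!j k. k < n j ==> cmod (b j k) <= \<beta> j * weight (a j k)"
    and \<beta>: "!!j. \<beta> j \<ge> 0" "summable (%j. \<beta> j / 2 ^ j)"
  shows "multiplied b \<in> points (sum_space (Tent 1) (Tent r))"
    "norm_on (sum_space (Tent 1) (Tent r)) (multiplied b) \<le>
      (C + Ct * C powr (1 / r)) * L * (\<Sum>j. \<beta> j / 2 ^ j)"
proof -
  define b1 where "b1 j k = (if a j k powr (p / r - 1) <= a j k powr (p - 1) then b j k else 0)" for j k
  define b2 where "b2 j k = (if a j k powr (p / r - 1) <= a j k powr (p - 1) then 0 else b j k)" for j k
  have 1: "cmod (b1 j k) <= \<beta> j * a j k powr (p - 1)" if "k < n j" for j k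
    using b[OF that] \<beta>(1)[of j] by (auto simp: b1_def weight_def max_def)
  have 2: "cmod (b2 j k) <= \<beta> j * a j k powr (p / r - 1)" if "k < n j" for j k
    using b[OF that] \<beta>(1)[of j] by (auto simp: b2_def weight_def max_def)
  have "multiplied b1 + multiplied b2 = multiplied b"
    unfolding multiplied_add by (intro arg_cong[where f=multiplied] ext) (simp add: b1_def b2_def)
  then have eq: "multiplied b = multiplied b1 + multiplied b2" ..
  note m1 = multiplied_T1[OF 1 \<beta>] and m2 = multiplied_Tr[OF 2 \<beta>]
  show "multiplied b \<in> points (sum_space (Tent 1) (Tent r))"
    unfolding eq sum_space_def using m1(1) m2(1) by auto
  have "norm_on (sum_space (Tent 1) (Tent r)) (multiplied b) \<le>
      norm_on (Tent 1) (multiplied b1) + norm_on (Tent r) (multiplied b2)"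
    unfolding eq by (intro sum_space_norm_le m1 m2 tent_norm_nonneg)
  also have "... <= (C + Ct * C powr (1 / r)) * L * (\<Sum>j. \<beta> j / 2 ^ j)"
    using m1(2) m2(2) by (simp add: algebra_simps)
  finally show "norm_on (sum_space (Tent 1) (Tent r)) (multiplied b) \<le>
      (C + Ct * C powr (1 / r)) * L * (\<Sum>j. \<beta> j / 2 ^ j)" .
qed

text \<open>An instance of Tannery's theorem.\<close>

lemma multiplied_tendsto_0:
  fixes b :: "'t => nat => nat => complex" and W :: "nat => nat => real"
  assumes nrm: "!!b \<beta>. \<lbrakk>!!j k. k < n j ==> cmod (b j k) <= \<beta> j * W j k; !!j. \<beta> j \<ge> 0; summable (%j. \<beta> j / 2 ^ j)\<rbrakk>
      \<Longrightarrow> nrm (multiplied b) <= D * (\<Sum>j. \<beta> j / 2 ^ j)"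
    and pos: "!!b \<beta>. \<lbrakk>!!j k. k < n j ==> cmod (b j k) <= \<beta> j * W j k; !!j. \<beta> j \<ge> 0; summable (%j. \<beta> j / 2 ^ j)\<rbrakk>
      \<Longrightarrow> 0 <= nrm (multiplied b)"
    and W: "!!j k. k < n j ==> W j k > 0" and K: "K \<ge> 0"
    and bd: "\<forall>\<^sub>F w in F. \<forall>j k. k < n j --> cmod (b w j k) <= K * W j k"
    and lim: "!!j k. k < n j ==> ((%w. b w j k) \<longlongrightarrow> 0) F"
  shows "((%w. nrm (multiplied (b w))) \<longlongrightarrow> 0) F"
proof (cases "F = bot")
  case False
  \<comment> \<open>The sum over the finitely many pieces of shell \<open>j\<close> dominates each
    quotient of coefficient by weight and tends to 0; truncation at \<open>K\<close> makes
    \<open>K / 2 ^ j\<close> a summable majorant that does not depend on \<open>w\<close>.\<close>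
  define \<beta> where "\<beta> w j = min K (\<Sum>k<n j. cmod (b w j k) / W j k)" for w j
  have W': "0 <= W j k" if "k < n j" for j k using W[OF that] by simp
  have \<beta>0: "\<beta> w j \<ge> 0" for w j
    using K W' by (auto simp: \<beta>_def intro!: sum_nonneg divide_nonneg_nonneg)
  have geo: "summable (%j. K * (1/2)^j)" by (intro summable_mult summable_geometric) simp
  have \<beta>s: "\<beta> w j / 2 ^ j <= K * (1/2)^j" for w j
  proof -
    have "\<beta> w j / 2 ^ j <= K / 2 ^ j" by (intro divide_right_mono) (auto simp: \<beta>_def)
    then show ?thesis by (simp add: power_one_over)
  qed
  have summ: "summable (%j. \<beta> w j / 2 ^ j)" for w
    by (rule summable_comparison_test'[OF geo, of 0]) (use \<beta>s \<beta>0 in auto)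
  have b\<beta>: "cmod (b w j k) <= \<beta> w j * W j k" if "k < n j" "cmod (b w j k) <= K * W j k" for w j k
  proof -
    have "cmod (b w j k) / W j k <= (\<Sum>k<n j. cmod (b w j k) / W j k)"
      using that W' by (intro member_le_sum) (auto intro!: divide_nonneg_nonneg)
    moreover have "cmod (b w j k) / W j k <= K" using that W[OF that(1)] by (simp add: pos_divide_le_eq)
    ultimately have "cmod (b w j k) / W j k <= \<beta> w j" by (simp add: \<beta>_def)
    then show ?thesis using W[OF that(1)] by (simp add: pos_divide_le_eq)
  qed
  have "((%w. \<Sum>j. \<beta> w j / 2 ^ j) \<longlongrightarrow> (\<Sum>j. (0::real))) F"
  proof (rule tannerys_theorem[where M="%j. K * (1/2)^j", THEN conjunct2, THEN conjunct2])
    fix j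
    have "((%w. min K (\<Sum>k<n j. cmod (b w j k) / W j k) / 2 ^ j) \<longlongrightarrow> min K (\<Sum>k<n j. cmod 0 / W j k) / 2 ^ j) F"
      using W by (intro tendsto_intros lim) (auto simp: less_imp_neq[symmetric])
    then show "((%w. \<beta> w j / 2 ^ j) \<longlongrightarrow> 0) F" using K by (simp add: \<beta>_def)
  next
    show "\<forall>\<^sub>F (j, w) in at_top \<times>\<^sub>F F. norm (\<beta> w j / 2 ^ j) <= K * (1/2)^j"
      using \<beta>s \<beta>0 by (intro always_eventually) auto
  qed (use False geo in auto)
  then have "((%w. D * (\<Sum>j. \<beta> w j / 2 ^ j)) \<longlongrightarrow> D * 0) F" by (intro tendsto_intros) simp
  then have l: "((%w. D * (\<Sum>j. \<beta> w j / 2 ^ j)) \<longlongrightarrow> 0) F" by simp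
  show ?thesis
  proof (rule tendsto_sandwich[OF _ _ tendsto_const l])
    show "\<forall>\<^sub>F w in F. 0 <= nrm (multiplied (b w))"
      using bd by eventually_elim (rule pos[OF _ \<beta>0 summ], rule b\<beta>, auto)
    show "\<forall>\<^sub>F w in F. nrm (multiplied (b w)) <= D * (\<Sum>j. \<beta> w j / 2 ^ j)"
      using bd by eventually_elim (rule nrm[OF _ \<beta>0 summ], rule b\<beta>, auto)
  qed
qed simp

end

section \<open>The Calderon function of a tent space element\<close>

text \<open>The Gaussian factor exp(z^2 - \<theta>^2) produces the decay along the boundary lines
  that \<open>calderon_functions\<close> asks for and equals 1 at \<theta>. The argument
  \<open>t\<close> receives the levels \<open>a j k\<close>.\<close>

definition calderon_coefficient :: "real => real => real => complex => real => complex" where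
  "calderon_coefficient p r \<theta> z t =
     exp (z\<^sup>2 - of_real (\<theta>\<^sup>2) + (of_real p * (1 - z + z / of_real r) - 1) * of_real (ln t))"

lemma calderon_coefficient_norm:
  assumes "t > 0"
  shows "cmod (calderon_coefficient p r \<theta> z t) =
    exp ((Re z)\<^sup>2 - (Im z)\<^sup>2 - \<theta>\<^sup>2) * t powr (p * (1 - Re z + Re z / r) - 1)"
proof -
  have "Re (z\<^sup>2 - of_real (\<theta>\<^sup>2) + (of_real p * (1 - z + z / of_real r) - 1) * of_real (ln t)) =
     ((Re z)\<^sup>2 - (Im z)\<^sup>2 - \<theta>\<^sup>2) + (p * (1 - Re z + Re z / r) - 1) * ln t"
    by (simp add: power2_eq_square)
  then show ?thesis
    using assms by (simp add: calderon_coefficient_def powr_def mult_exp_exp)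
qed

lemma calderon_coefficient_holomorphic: "(%z. calderon_coefficient p r \<theta> z t) holomorphic_on UNIV"
  unfolding calderon_coefficient_def by (cases "r = 0") (auto intro!: holomorphic_intros)

context tent_pieces begin

lemma weight_pos: "t > 0 ==> weight t > 0"
  by (simp add: weight_def less_max_iff_disj)

text \<open>In the strip the exponent of \<open>t\<close> runs between p/r - 1 and p - 1, so one
  endpoint weight dominates, according to whether \<open>t\<close> is at least 1. The Gaussian
  factor is at most \<open>exp 1\<close> there.\<close>

lemma calderon_coefficient_strip:
  assumes t: "t > 0" and z: "0 <= Re z" "Re z <= 1"
  shows "cmod (calderon_coefficient p r \<theta> z t) <= exp 1 * weight t"
proof -
  let ?e = "p * (1 - Re z + Re z / r) - 1"
  have "(Re z)\<^sup>2 <= 1" using z by (simp add: power_le_one)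
  then have 1: "exp ((Re z)\<^sup>2 - (Im z)\<^sup>2 - \<theta>\<^sup>2) <= exp 1"
    by (simp add: add_increasing2 diff_le_eq)
  have "Re z / r <= Re z" using z r_ge mult_left_mono[of 1 r "Re z"] by (simp add: divide_le_eq)
  then have e1: "?e <= p - 1" using mult_left_mono[of "1 - Re z + Re z / r" 1 p] p_ge by simp
  have "(1 - Re z) * (1 - 1 / r) \<ge> 0" using z r_ge by (intro mult_nonneg_nonneg) auto
  then have "1 / r <= 1 - Re z + Re z / r" by (simp add: algebra_simps diff_divide_distrib)
  then have e2: "p / r - 1 <= ?e" using mult_left_mono[of "1 / r" "1 - Re z + Re z / r" p] p_ge by simp
  have "t powr ?e <= weight t"
  proof (cases "t \<ge> 1")
    case True
    then show ?thesis using powr_mono[OF e1 True] by (simp add: weight_def)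
  next
    case False
    then show ?thesis using powr_mono'[OF e2, of t] t by (simp add: weight_def)
  qed
  then show ?thesis unfolding calderon_coefficient_norm[OF t] using 1 by (intro mult_mono) auto
qed

lemma calderon_coefficient_left:
  "t > 0 ==> cmod (calderon_coefficient p r \<theta> (Complex 0 s) t) = exp (- s\<^sup>2 - \<theta>\<^sup>2) * t powr (p - 1)"
  by (simp add: calderon_coefficient_norm)

lemma calderon_coefficient_right:
  "t > 0 ==> cmod (calderon_coefficient p r \<theta> (Complex 1 s) t) = exp (1 - s\<^sup>2 - \<theta>\<^sup>2) * t powr (p / r - 1)"
  by (simp add: calderon_coefficient_norm)

definition calderon_function :: "real => complex => ('m, 'x) tent_operator" where
  "calderon_function \<theta> z = multiplied (%j k. calderon_coefficient p r \<theta> z (a j k))"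

lemma geometric_const: "summable (%j. c / 2 ^ j)" "(\<Sum>j. c / 2 ^ j) = 2 * c" for c :: real
proof -
  have e: "(%j. c / 2 ^ j) = (%j. c * (1/2)^j)" by (simp add: power_divide)
  show "summable (%j. c / 2 ^ j)" unfolding e by (intro summable_mult summable_geometric) simp
  show "(\<Sum>j. c / 2 ^ j) = 2 * c"
    unfolding e by (subst suminf_mult) (auto simp: suminf_geometric)
qed

lemma tendsto_T1:
  assumes "K \<ge> 0" "\<forall>\<^sub>F w in F. \<forall>j k. k < n j --> cmod (b w j k) <= K * a j k powr (p - 1)"
    "!!j k. k < n j ==> ((%w. b w j k) \<longlongrightarrow> 0) F"
  shows "((%w. norm_on (Tent 1) (multiplied (b w))) \<longlongrightarrow> 0) F"
  using assms
  by (intro multiplied_tendsto_0[where W="%j k. a j k powr (p - 1)" and D="C * L"] multiplied_T1(2) tent_norm_nonneg)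
    (auto dest: a_pos)

lemma tendsto_Tr:
  assumes "K \<ge> 0" "\<forall>\<^sub>F w in F. \<forall>j k. k < n j --> cmod (b w j k) <= K * a j k powr (p / r - 1)"
    "!!j k. k < n j ==> ((%w. b w j k) \<longlongrightarrow> 0) F"
  shows "((%w. norm_on (Tent r) (multiplied (b w))) \<longlongrightarrow> 0) F"
  using assms
  by (intro multiplied_tendsto_0[where W="%j k. a j k powr (p / r - 1)" and D="Ct * C powr (1 / r) * L"] multiplied_Tr(2) tent_norm_nonneg)
    (auto dest: a_pos)

lemma tendsto_sum:
  assumes "K \<ge> 0" "\<forall>\<^sub>F w in F. \<forall>j k. k < n j --> cmod (b w j k) <= K * weight (a j k)"
    "!!j k. k < n j ==> ((%w. b w j k) \<longlongrightarrow> 0) F"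
  shows "((%w. norm_on (sum_space (Tent 1) (Tent r)) (multiplied (b w))) \<longlongrightarrow> 0) F"
proof (rule multiplied_tendsto_0[where W="%j k. weight (a j k)" and D="(C + Ct * C powr (1 / r)) * L"])
  show "0 < weight (a j k)" if "k < n j" for j k using a_pos[OF that] by (rule weight_pos)
  show "norm_on (sum_space (Tent 1) (Tent r)) (multiplied b) <= (C + Ct * C powr (1 / r)) * L * (\<Sum>j. \<beta> j / 2 ^ j)"
    if "!!j k. k < n j ==> cmod (b j k) <= \<beta> j * weight (a j k)" "!!j. \<beta> j \<ge> 0" "summable (%j. \<beta> j / 2 ^ j)" for b \<beta>
    using multiplied_sum(2)[OF that] .
  show "0 <= norm_on (sum_space (Tent 1) (Tent r)) (multiplied b)"
    if "!!j k. k < n j ==> cmod (b j k) <= \<beta> j * weight (a j k)" "!!j. \<beta> j \<ge> 0" "summable (%j. \<beta> j / 2 ^ j)" for b \<beta>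
    by (intro sum_space_norm_nonneg multiplied_sum(1)[OF that] tent_norm_nonneg)
qed (use assms in auto)

lemma strip_sum:
  assumes z: "0 <= Re z" "Re z <= 1"
  shows "calderon_function \<theta> z \<in> points (sum_space (Tent 1) (Tent r))"
    "norm_on (sum_space (Tent 1) (Tent r)) (calderon_function \<theta> z) \<le>
      (C + Ct * C powr (1 / r)) * L * (2 * exp 1)"
proof -
  note * = multiplied_sum[of "%j k. calderon_coefficient p r \<theta> z (a j k)" "%_. exp 1", OF calderon_coefficient_strip[OF a_pos z]
    _ geometric_const(1), unfolded geometric_const(2)]
  show "calderon_function \<theta> z \<in> points (sum_space (Tent 1) (Tent r))"
    unfolding calderon_function_def by (rule *(1)) auto
  show "norm_on (sum_space (Tent 1) (Tent r)) (calderon_function \<theta> z) <= (C + Ct * C powr (1 / r)) * L * (2 * exp 1)"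
    unfolding calderon_function_def by (rule *(2)) auto
qed

lemma left_T1:
  "calderon_function \<theta> (Complex 0 s) \<in> points (Tent 1)"
  "norm_on (Tent 1) (calderon_function \<theta> (Complex 0 s)) <= C * L * (2 * exp 1)"
proof -
  have b: "cmod (calderon_coefficient p r \<theta> (Complex 0 s) (a j k)) <= exp 1 * a j k powr (p - 1)" if "k < n j" for j k
    unfolding calderon_coefficient_left[OF a_pos[OF that]] by (intro mult_right_mono) (auto simp: add_nonneg_nonneg intro: order_trans[of _ 0])
  note * = multiplied_T1[OF b _ geometric_const(1), unfolded geometric_const(2)]
  show "calderon_function \<theta> (Complex 0 s) \<in> points (Tent 1)"
    unfolding calderon_function_def by (rule *(1)) auto
  show "norm_on (Tent 1) (calderon_function \<theta> (Complex 0 s)) <= C * L * (2 * exp 1)"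
    unfolding calderon_function_def by (rule *(2)) auto
qed

lemma right_Tr:
  "calderon_function \<theta> (Complex 1 s) \<in> points (Tent r)"
  "norm_on (Tent r) (calderon_function \<theta> (Complex 1 s)) <= Ct * C powr (1 / r) * L * (2 * exp 1)"
proof -
  have b: "cmod (calderon_coefficient p r \<theta> (Complex 1 s) (a j k)) <= exp 1 * a j k powr (p / r - 1)" if "k < n j" for j k
    unfolding calderon_coefficient_right[OF a_pos[OF that]] by (intro mult_right_mono) (auto simp: add_nonneg_nonneg)
  note * = multiplied_Tr[OF b _ geometric_const(1), unfolded geometric_const(2)]
  show "calderon_function \<theta> (Complex 1 s) \<in> points (Tent r)"
    unfolding calderon_function_def by (rule *(1)) auto
  show "norm_on (Tent r) (calderon_function \<theta> (Complex 1 s)) <= Ct * C powr (1 / r) * L * (2 * exp 1)"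
    unfolding calderon_function_def by (rule *(2)) auto
qed

lemma coefficient_continuous: "continuous_on UNIV (%z. calderon_coefficient p r \<theta> z t)"
  using calderon_coefficient_holomorphic by (rule holomorphic_on_imp_continuous_on)

lemma exp_neg_square_tendsto_0: "((%s::real. exp (c - s\<^sup>2 - d)) \<longlongrightarrow> (0::real)) at_infinity"
proof -
  have "filterlim (%s::real. c - s\<^sup>2 - d) at_bot at_infinity"
    unfolding filterlim_at_bot
  proof
    fix Z :: real
    have "c - s\<^sup>2 - d <= Z" if "norm s \<ge> \<bar>c - d - Z\<bar> + 1" for s :: real
    proof -
      have "\<bar>c - d - Z\<bar> * 1 <= (\<bar>c - d - Z\<bar> + 1) * (\<bar>c - d - Z\<bar> + 1)" by (intro mult_mono) auto
      also have "... <= \<bar>s\<bar> * \<bar>s\<bar>" using that by (intro mult_mono) auto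
      also have "... = s\<^sup>2" by (simp add: power2_eq_square)
      finally have "\<bar>c - d - Z\<bar> <= s\<^sup>2" by simp
      then have "c - d - Z <= s\<^sup>2" by (rule order_trans[OF abs_ge_self])
      then show ?thesis by (simp add: algebra_simps)
    qed
    then show "\<forall>\<^sub>F s in at_infinity. c - s\<^sup>2 - d <= Z" unfolding eventually_at_infinity by blast
  qed
  then show ?thesis using exp_at_bot filterlim_compose by blast
qed

text \<open>By linearity in the coefficients, the limit conditions concern scalar functions that
  converge for each single piece and are dominated by a fixed multiple of the respective weight;
  \<open>multiplied_tendsto_0\<close> turns this into convergence in norm.\<close>

lemma calderon_function_mem:
  "calderon_function \<theta> \<in> calderon_functions (Tent 1) (Tent r)"
proof -
  let ?c = "calderon_coefficient p r \<theta>"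
  let ?S = "sum_space (Tent 1 :: ('m, 'x) tent_operator normed_subspace) (Tent r)"
  have diff: "calderon_function \<theta> w - calderon_function \<theta> z = multiplied (%j k. ?c w (a j k) - ?c z (a j k))" for w z
    unfolding calderon_function_def multiplied_diff ..
  have lim: "((%w. ?c w t - ?c z t) \<longlongrightarrow> 0) (at z within X)" for z t X
  proof -
    have "((%w. ?c w t - ?c z t) \<longlongrightarrow> ?c z t - ?c z t) (at z within X)"
      using coefficient_continuous[unfolded continuous_on_eq_continuous_within, rule_format, of z]
      by (intro tendsto_intros) (auto simp: continuous_within intro: tendsto_within_subset)
    then show ?thesis by simp
  qed
  have cont: "continuous_in ?S {z. 0 <= Re z \<and> Re z <= 1} (calderon_function \<theta>)"
    unfolding continuous_in_def
  proof (intro conjI ballI)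
    show "calderon_function \<theta> ` {z. 0 <= Re z \<and> Re z <= 1} \<subseteq> points ?S" using strip_sum(1) by auto
    fix z :: complex assume z: "z \<in> {z. 0 <= Re z \<and> Re z <= 1}"
    show "((%w. norm_on ?S (calderon_function \<theta> w - calderon_function \<theta> z)) \<longlongrightarrow> 0) (at z within {z. 0 <= Re z \<and> Re z <= 1})"
      unfolding diff
    proof (rule tendsto_sum[where K="2 * exp 1"])
      show "\<forall>\<^sub>F w in at z within {z. 0 <= Re z \<and> Re z <= 1}. \<forall>j k. k < n j --> cmod (?c w (a j k) - ?c z (a j k)) <= 2 * exp 1 * weight (a j k)"
        unfolding eventually_at_filter
      proof (intro always_eventually allI impI)
        fix w j k assume "w \<in> {z. 0 <= Re z \<and> Re z <= 1}" "k < n j"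
        then show "cmod (?c w (a j k) - ?c z (a j k)) <= 2 * exp 1 * weight (a j k)"
          using calderon_coefficient_strip[OF a_pos[OF \<open>k < n j\<close>], of w \<theta>] calderon_coefficient_strip[OF a_pos[OF \<open>k < n j\<close>], of z \<theta>] z
            norm_triangle_ineq4[of "?c w (a j k)" "?c z (a j k)"] by simp
      qed
    qed (auto intro: lim)
  qed
  have hol: "holomorphic_in ?S {z. 0 < Re z \<and> Re z < 1} (calderon_function \<theta>)"
    unfolding holomorphic_in_def
  proof (intro conjI ballI)
    show "calderon_function \<theta> ` {z. 0 < Re z \<and> Re z < 1} \<subseteq> points ?S" using strip_sum(1) by auto
    fix z :: complex assume "z \<in> {z. 0 < Re z \<and> Re z < 1}"
    then have z: "0 < Re z" "Re z < 1" by auto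
    \<comment> \<open>A third of the distance to the boundary, because
      \<open>holomorphic_Lipschitz\<close> looks at the ball of radius 3 \<rho>.\<close>
    define \<rho> where "\<rho> = min (Re z) (1 - Re z) / 3"
    have \<rho>: "\<rho> > 0" using z by (simp add: \<rho>_def)
    have strip: "0 <= Re x \<and> Re x <= 1" if "dist z x < 3 * \<rho>" for x
    proof -
      have "\<bar>Re z - Re x\<bar> <= dist z x" using abs_Re_le_cmod[of "z - x"] by (simp add: dist_norm)
      then show ?thesis using that by (auto simp: \<rho>_def)
    qed
    define d where "d t = deriv (%z. ?c z t) z" for t
    note Lip = holomorphic_Lipschitz[OF calderon_coefficient_holomorphic \<rho>]
    have bd: "cmod (?c x (a j k)) <= exp 1 * weight (a j k)" if "k < n j" "dist z x < 3 * \<rho>" for x j k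
      using calderon_coefficient_strip[OF a_pos[OF that(1)]] strip[OF that(2)] by blast
    have d_le: "cmod (d (a j k)) <= exp 1 / \<rho> * weight (a j k)" if "k < n j" for j k
      using Lip(1)[OF bd[OF that]] by (simp add: d_def)
    have q_le: "cmod (inverse (w - z) * (?c w (a j k) - ?c z (a j k)) - d (a j k)) <= 2 * exp 1 / \<rho> * weight (a j k)"
      if "k < n j" "dist z w < \<rho>" for w j k
    proof -
      have "cmod (inverse (w - z) * (?c w (a j k) - ?c z (a j k))) <= exp 1 / \<rho> * weight (a j k)"
      proof (cases "w = z")
        case True
        then show ?thesis using \<rho> weight_pos[OF a_pos[OF that(1)]] by (simp add: less_imp_le)
      next
        case False
        have "cmod (?c w (a j k) - ?c z (a j k)) <= exp 1 * weight (a j k) / \<rho> * cmod (w - z)"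
          by (rule Lip(2)[OF bd[OF that(1)] that(2)])
        then have "cmod (?c w (a j k) - ?c z (a j k)) / cmod (w - z) <= exp 1 * weight (a j k) / \<rho>"
          using False by (subst pos_divide_le_eq) auto
        moreover have "cmod (inverse (w - z) * (?c w (a j k) - ?c z (a j k))) = cmod (?c w (a j k) - ?c z (a j k)) / cmod (w - z)"
          unfolding norm_mult norm_inverse by (simp only: divide_inverse mult.commute)
        ultimately show ?thesis by simp
      qed
      then show ?thesis
        using d_le[OF that(1)] norm_triangle_ineq4[of "inverse (w - z) * (?c w (a j k) - ?c z (a j k))" "d (a j k)"]
        by simp
    qed
    have "multiplied (%j k. d (a j k)) \<in> points ?S"
      by (rule multiplied_sum(1)[OF d_le _ geometric_const(1)]) (use \<rho> in simp_all)
    moreover have "((%w. norm_on ?S (inverse (w - z) *\<^sub>C (calderon_function \<theta> w - calderon_function \<theta> z) - multiplied (%j k. d (a j k))))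
        \<longlongrightarrow> 0) (at z within {z. 0 < Re z \<and> Re z < 1})"
      unfolding diff multiplied_scaleC multiplied_diff
    proof (rule tendsto_sum[where K="2 * exp 1 / \<rho>"])
      show "\<forall>\<^sub>F w in at z within {z. 0 < Re z \<and> Re z < 1}. \<forall>j k. k < n j \<longrightarrow>
          cmod (inverse (w - z) * (?c w (a j k) - ?c z (a j k)) - d (a j k)) <= 2 * exp 1 / \<rho> * weight (a j k)"
        unfolding eventually_at using q_le \<rho> by (intro exI[of _ \<rho>]) (auto simp: dist_commute)
      fix j k
      have "((%z. ?c z (a j k)) has_field_derivative d (a j k)) (at z within {z. 0 < Re z \<and> Re z < 1})"
        unfolding d_def by (rule has_field_derivative_at_within, rule holomorphic_derivI[OF calderon_coefficient_holomorphic open_UNIV UNIV_I])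
      then have "((%w. (?c w (a j k) - ?c z (a j k)) / (w - z) - d (a j k)) \<longlongrightarrow> d (a j k) - d (a j k)) (at z within {z. 0 < Re z \<and> Re z < 1})"
        unfolding has_field_derivative_iff by (intro tendsto_intros)
      then show "((%w. inverse (w - z) * (?c w (a j k) - ?c z (a j k)) - d (a j k)) \<longlongrightarrow> 0) (at z within {z. 0 < Re z \<and> Re z < 1})"
        by (simp add: divide_inverse mult.commute)
    qed (use \<rho> in simp)
    ultimately show "\<exists>d\<in>points ?S. ((%w. norm_on ?S (inverse (w - z) *\<^sub>C (calderon_function \<theta> w - calderon_function \<theta> z) - d))
        \<longlongrightarrow> 0) (at z within {z. 0 < Re z \<and> Re z < 1})" by blast
  qed
  have vert: "((%s. ?c (Complex x s) t - ?c (Complex x s0) t) \<longlongrightarrow> 0) (at s0)" for x s0 t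
  proof -
    have "((%s. ?c (Complex x s) t) \<longlongrightarrow> ?c (Complex x s0) t) (at s0)"
    proof (rule tendsto_compose[of "%z. ?c z t"])
      show "((%z. ?c z t) \<longlongrightarrow> ?c (Complex x s0) t) (at (Complex x s0))"
        using coefficient_continuous[unfolded continuous_on_eq_continuous_within, rule_format, of "Complex x s0"]
        by (simp add: continuous_within)
      show "(Complex x \<longlongrightarrow> Complex x s0) (at s0)" by (intro tendsto_intros)
    qed
    then show ?thesis by (simp add: LIM_zero)
  qed
  have exp_le: "exp (c - s\<^sup>2 - \<theta>\<^sup>2) <= exp 1" if "c <= 1" for c s :: real
    using that by (simp add: add_increasing2 diff_le_eq)
  have left_le: "cmod (?c (Complex 0 s) (a j k)) <= exp 1 * a j k powr (p - 1)" if "k < n j" for s j k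
    unfolding calderon_coefficient_left[OF a_pos[OF that]] using exp_le[of 0 s] by (intro mult_right_mono) auto
  have right_le: "cmod (?c (Complex 1 s) (a j k)) <= exp 1 * a j k powr (p / r - 1)" if "k < n j" for s j k
    unfolding calderon_coefficient_right[OF a_pos[OF that]] using exp_le[of 1 s] by (intro mult_right_mono) auto
  have cont0: "continuous_in (Tent 1) UNIV (%s::real. calderon_function \<theta> (Complex 0 s))"
    unfolding continuous_in_def diff
  proof (intro conjI ballI)
    fix s0 :: real
    show "((%s. norm_on (Tent 1) (multiplied (%j k. ?c (Complex 0 s) (a j k) - ?c (Complex 0 s0) (a j k)))) \<longlongrightarrow> 0) (at s0)"
    proof (rule tendsto_T1[where K="2 * exp 1"])
      show "\<forall>\<^sub>F s in at s0. \<forall>j k. k < n j --> cmod (?c (Complex 0 s) (a j k) - ?c (Complex 0 s0) (a j k)) <= 2 * exp 1 * a j k powr (p - 1)"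
      proof (intro always_eventually allI impI)
        fix s j k assume "k < n j"
        then show "cmod (?c (Complex 0 s) (a j k) - ?c (Complex 0 s0) (a j k)) <= 2 * exp 1 * a j k powr (p - 1)"
          using left_le[of k j s] left_le[of k j s0] norm_triangle_ineq4[of "?c (Complex 0 s) (a j k)" "?c (Complex 0 s0) (a j k)"] by simp
      qed
    qed (auto intro: vert)
  qed (use left_T1(1) in auto)
  have cont1: "continuous_in (Tent r) UNIV (%s::real. calderon_function \<theta> (Complex 1 s))"
    unfolding continuous_in_def diff
  proof (intro conjI ballI)
    fix s0 :: real
    show "((%s. norm_on (Tent r) (multiplied (%j k. ?c (Complex 1 s) (a j k) - ?c (Complex 1 s0) (a j k)))) \<longlongrightarrow> 0) (at s0)"
    proof (rule tendsto_Tr[where K="2 * exp 1"])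
      show "\<forall>\<^sub>F s in at s0. \<forall>j k. k < n j --> cmod (?c (Complex 1 s) (a j k) - ?c (Complex 1 s0) (a j k)) <= 2 * exp 1 * a j k powr (p / r - 1)"
      proof (intro always_eventually allI impI)
        fix s j k assume "k < n j"
        then show "cmod (?c (Complex 1 s) (a j k) - ?c (Complex 1 s0) (a j k)) <= 2 * exp 1 * a j k powr (p / r - 1)"
          using right_le[of k j s] right_le[of k j s0] norm_triangle_ineq4[of "?c (Complex 1 s) (a j k)" "?c (Complex 1 s0) (a j k)"] by simp
      qed
    qed (auto intro: vert)
  qed (use right_Tr(1) in auto)
  have decay0: "((%s. norm_on (Tent 1) (calderon_function \<theta> (Complex 0 s))) \<longlongrightarrow> 0) at_infinity"
    unfolding calderon_function_def
  proof (rule tendsto_T1[where K="exp 1"])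
    fix j k assume k: "k < n j"
    have "((%s. exp (0 - s\<^sup>2 - \<theta>\<^sup>2) * a j k powr (p - 1)) \<longlongrightarrow> 0 * a j k powr (p - 1)) at_infinity"
      by (intro tendsto_mult tendsto_const exp_neg_square_tendsto_0)
    then show "((%s. ?c (Complex 0 s) (a j k)) \<longlongrightarrow> 0) at_infinity"
      by (subst tendsto_norm_zero_iff[symmetric]) (simp add: calderon_coefficient_left[OF a_pos[OF k]])
  qed (use left_le in auto)
  have decay1: "((%s. norm_on (Tent r) (calderon_function \<theta> (Complex 1 s))) \<longlongrightarrow> 0) at_infinity"
    unfolding calderon_function_def
  proof (rule tendsto_Tr[where K="exp 1"])
    fix j k assume k: "k < n j"
    have "((%s. exp (1 - s\<^sup>2 - \<theta>\<^sup>2) * a j k powr (p / r - 1)) \<longlongrightarrow> 0 * a j k powr (p / r - 1)) at_infinity"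
      by (intro tendsto_mult tendsto_const exp_neg_square_tendsto_0)
    then show "((%s. ?c (Complex 1 s) (a j k)) \<longlongrightarrow> 0) at_infinity"
      by (subst tendsto_norm_zero_iff[symmetric]) (simp add: calderon_coefficient_right[OF a_pos[OF k]])
  qed (use right_le in auto)
  show ?thesis
    unfolding calderon_functions_def
    using cont hol cont0 cont1 decay0 decay1 strip_sum(2) by blast
qed

text \<open>The relation between \<open>p\<close> and \<theta> says that p (1 - \<theta> +
  \<theta>/r) = 1, so every coefficient is 1 at \<theta>.\<close>

lemma calderon_function_at:
  assumes "1 / p = 1 - \<theta> * (1 - 1 / r)"
  shows "calderon_function \<theta> (of_real \<theta>) = u"
proof -
  have "p * (1 - \<theta> + \<theta> / r) = 1" using assms p_ge by (simp add: algebra_simps field_simps)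
  then have "of_real p * (1 - of_real \<theta> + of_real \<theta> / of_real r) = (1 :: complex)"
    by (metis of_real_1 of_real_add of_real_diff of_real_divide of_real_mult)
  then have "calderon_coefficient p r \<theta> (of_real \<theta>) t = 1" for t
    by (simp add: calderon_coefficient_def)
  then show ?thesis by (simp add: calderon_function_def multiplied_one)
qed

lemma calderon_function_norm:
  "calderon_norm (Tent 1) (Tent r) (calderon_function \<theta>) <= (C + Ct * C powr (1 / r)) * (2 * exp 1) * L"
proof -
  have 0: "0 <= C * L * (2 * exp 1)" "0 <= Ct * C powr (1 / r) * L * (2 * exp 1)"
    using C_pos Ct_pos L_pos by auto
  have "(SUP t. norm_on (Tent 1) (calderon_function \<theta> (Complex 0 t))) <= C * L * (2 * exp 1)"
    by (intro cSUP_least left_T1(2)) auto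
  moreover have "(SUP t. norm_on (Tent r) (calderon_function \<theta> (Complex 1 t))) <= Ct * C powr (1 / r) * L * (2 * exp 1)"
    by (intro cSUP_least right_Tr(2)) auto
  moreover have "(C + Ct * C powr (1 / r)) * (2 * exp 1) * L = C * L * (2 * exp 1) + Ct * C powr (1 / r) * L * (2 * exp 1)"
    by (simp add: algebra_simps)
  ultimately show ?thesis unfolding calderon_norm_def using 0 by linarith
qed

end

section \<open>Truncation to cylinders and Calderon functions with prescribed value\<close>

lemma ennreal_powr_tendsto_0:
  fixes X :: "nat => ennreal"
  assumes "X \<longlonglongrightarrow> 0" "q > 0"
  shows "(%n. ennreal_powr (X n) q) \<longlonglongrightarrow> 0"
proof (rule order_tendstoI)
  fix a :: ennreal assume "0 < a"
  then obtain e where e: "0 < e" "e < a" using dense by blast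
  have "0 < ennreal_powr e (1 / q)" using e ennreal_powr_eq_0_iff[of e "1/q"] by (simp add: zero_less_iff_neq_zero)
  then have "\<forall>\<^sub>F n in sequentially. X n < ennreal_powr e (1 / q)" by (rule order_tendstoD(2)[OF assms(1)])
  then show "\<forall>\<^sub>F n in sequentially. ennreal_powr (X n) q < a"
  proof eventually_elim
    case (elim n)
    then have "ennreal_powr (X n) q <= e" using assms(2) by (subst ennreal_powr_le_iff) auto
    then show ?case using e by simp
  qed
qed simp

lemma (in L2_domain) restrict_operator_UN:
  fixes n :: nat
  assumes u: "L2_operator N D u" and h: "h \<in> D"
    and A: "!!k. k < n ==> A k \<in> sets N" "!!k k'. k < n ==> k' < n ==> k \<noteq> k' ==> A k \<inter> A k' = {}"
  shows "restrict_operator u (\<Union>k<n. A k) h = (\<Sum>k<n. restrict_operator u (A k) h)"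
  using A
proof (induction n)
  case 0
  then show ?case using operator_zero[OF u] by (simp add: restrict_operator_def)
next
  case (Suc n)
  have "restrict_operator u ((\<Union>k<n. A k) \<union> A n) h = restrict_operator u (\<Union>k<n. A k) h + restrict_operator u (A n) h"
  proof (rule restrict_operator_split[OF u _ _ _ h])
    show "(\<Union>k<n. A k) \<in> sets N" using Suc.prems by (intro sets.finite_UN) auto
    show "A n \<in> sets N" using Suc.prems by auto
    have "A k \<inter> A n = {}" if "k < n" for k using Suc.prems(2)[of k n] that by simp
    then show "(\<Union>k<n. A k) \<inter> A n = {}" by blast
  qed
  then show ?case using Suc by (simp add: lessThan_Suc Un_commute add.commute)
qed

context cone_covering_space begin

text \<open>Dominated convergence with the square function of \<open>u\<close> as majorant.
  Convergence at almost every vertex is \<open>gamma_norm_restrict_tendsto_0\<close> for the cone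
  restriction, which strong measurability places in \<open>gamma_space\<close>.\<close>

lemma tent_truncation_tendsto_0:
  fixes u :: "('a, 'x::complex_banach) tent_operator"
  assumes u: "u \<in> points (Tent q)" and q: "q > 0"
  shows "(%n. \<integral>\<^sup>+x. ennreal_powr (sqf (restrict_operator u (upper_half_space - cylinder x0 (real (Suc n)))) x) q \<partial>\<mu>) \<longlonglongrightarrow> 0"
proof -
  have uop: "operator_on u" and g: "gsm (%x. restrict_operator u (cone_at x))"
    using u by (simp_all add: tent_points_iff)
  have fin: "AE x in \<mu>. sqf u x < \<top>" by (rule gsm_square_finite[OF g])
  define E where "E n = upper_half_space - cylinder x0 (real (Suc n))" for n
  have Es: "E n \<in> sets nu" for n
    unfolding E_def using sets.compl_sets[OF cylinder_sets[of "real (Suc n)" x0]] by (simp add: space_nu)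
  have le: "sqf (restrict_operator u (E n)) x <= sqf u x" for n x
    by (rule square_function_restrict_le[OF uop Es])
  have [measurable]: "sqf u \<in> borel_measurable \<mu>" by (rule square_function_measurable[OF uop fin])
  have [measurable]: "sqf (restrict_operator u (E n)) \<in> borel_measurable \<mu>" for n
  proof (rule square_function_measurable[OF L2_operator_restrict[OF uop Es]])
    show "AE x in \<mu>. sqf (restrict_operator u (E n)) x < \<top>"
      using fin by eventually_elim (rule le_less_trans[OF le])
  qed
  have "(%n. \<integral>\<^sup>+x. ennreal_powr (sqf (restrict_operator u (E n)) x) q \<partial>\<mu>) \<longlonglongrightarrow> (\<integral>\<^sup>+x. 0 \<partial>\<mu>)"
  proof (rule nn_integral_dominated_convergence[where w="%x. ennreal_powr (sqf u x) q"])
    show "AE x in \<mu>. ennreal_powr (sqf (restrict_operator u (E n)) x) q <= ennreal_powr (sqf u x) q" for n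
      using q by (intro AE_I2 ennreal_powr_mono le) auto
    show "(\<integral>\<^sup>+x. ennreal_powr (sqf u x) q \<partial>\<mu>) < \<infinity>"
      using tent_norm_integral[OF u q] by (simp add: le_less_trans)
    show "AE x in \<mu>. (%n. ennreal_powr (sqf (restrict_operator u (E n)) x) q) \<longlonglongrightarrow> 0"
      using gsm_AE[OF g]
    proof eventually_elim
      case (elim x)
      have "(%n. gam (restrict_operator (restrict_operator u (cone_at x)) (E n))) \<longlonglongrightarrow> 0"
      proof (rule gamma_norm_restrict_tendsto_0[OF elim Es])
        fix p :: "'a \<times> real" assume p: "p \<in> space nu"
        obtain R0 where R0: "R0 > 0" "\<forall>R\<ge>R0. {p} \<subseteq> cylinder x0 R"
          using compact_subset_cylinder[of "{p}" x0] p by (auto simp: space_nu)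
        obtain n0 :: nat where n0: "R0 < real n0" using reals_Archimedean2 by blast
        have "p \<notin> E n" if "n \<ge> n0" for n
        proof -
          have "R0 <= real (Suc n)" using n0 that by simp
          then show ?thesis using R0 by (auto simp: E_def)
        qed
        then show "\<forall>\<^sub>F n in sequentially. p \<notin> E n" by (auto simp: eventually_sequentially)
      qed
      then have "(%n. sqf (restrict_operator u (E n)) x) \<longlonglongrightarrow> 0"
        by (simp only: square_function_restrict restrict_restrict_operator Int_commute)
      then show ?case by (rule ennreal_powr_tendsto_0[OF _ q])
    qed
  qed measurable
  then show ?thesis by (simp add: E_def)
qed

text \<open>The level decomposition handles operators supported in a cylinder. A general
  \<open>u\<close> is therefore cut into shells with norms at most \<open>L / 2 ^ j\<close>, fast
  enough for the estimates of the shells to be summed. \<open>L\<close> is any positive bound of the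
  norm, so that the scale is positive also for \<open>u = 0\<close>.\<close>

lemma tent_calderon_extension:
  fixes r p \<theta> :: real
  assumes ty: "has_type TYPE('x::complex_banach) r" and r: "1 < r" "r <= 2" and \<theta>: "0 < \<theta>" "\<theta> < 1"
    and p: "1 / p = 1 - \<theta> * (1 - 1 / r)" "1 <= p"
  obtains K where "K > 0" "!!(u :: ('a, 'x) tent_operator) L. \<lbrakk>u \<in> points (Tent p); 0 < L; norm_on (Tent p) u <= L\<rbrakk> \<Longrightarrow>
    \<exists>f\<in>calderon_functions (Tent 1) (Tent r). f (of_real \<theta>) = u \<and>
      calderon_norm (Tent 1) (Tent r) f <= K * L"
proof (rule square_function_decomposition[OF p(2), where 'x='x])
  fix C :: real
  assume C: "C > 0" and
    dec: "!!(u :: ('a, 'x) tent_operator) B x0 R l.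
     \<lbrakk>operator_on u; AE x in \<mu>. sqf u x < \<top>; B \<in> sets nu; B \<subseteq> cylinder x0 R; 0 < R; 0 < l;
      !!h. h \<in> L2c \<mu> ==> u (%p. indicator B p * h p) = u h;
      (\<integral>\<^sup>+x. ennreal_powr (sqf u x) p \<partial>\<mu>) <= ennreal (l powr p)\<rbrakk> \<Longrightarrow>
     \<exists>n A S a. (\<forall>k<n. A k \<in> sets nu) \<and> (\<forall>k<n. \<forall>j<n. k \<noteq> j --> A k \<inter> A j = {}) \<and> (\<Union>k<n. A k) = B \<and>
       (\<forall>k<n. (0::real) < a k) \<and> (\<forall>k<n. S k \<in> sets borel) \<and>
       (\<forall>k<n. \<forall>x. sqf (restrict_operator u (A k)) x <= ennreal (a k * l) * indicator (S k) x) \<and>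
       (\<Sum>k<(n::nat). ennreal (a k powr p) * emeasure \<mu> (S k)) <= ennreal C"
  show thesis
  proof (rule gamma_norm_type[OF ty less_imp_le[OF r(1)] r(2)])
  fix Ct :: real
  assume Ct: "Ct > 0" and
    type: "!!K A (v :: nat => ('a, 'x) tent_operator) G. \<lbrakk>!!k. k < K ==> A k \<in> sets nu;
       !!k l. k < K ==> l < K ==> k \<noteq> l ==> A k \<inter> A l = {};
       !!k. k < K ==> L2_operator nu (L2c \<mu>) (v k);
       !!k h. k < K ==> h \<in> L2c \<mu> ==> v k (%p. indicator (A k) p * h p) = v k h;
       !!k. k < K ==> G k \<ge> 0; !!k. k < K ==> gamma_norm nu (L2c \<mu>) (v k) <= ennreal (G k)\<rbrakk>
       \<Longrightarrow> gamma_norm nu (L2c \<mu>) (\<Sum>k<K. v k) <= ennreal (Ct * (\<Sum>k<K. G k powr r) powr (1 / r))"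
  define K where "K = (C + Ct * C powr (1 / r)) * (2 * exp 1)"
  have K: "K > 0" unfolding K_def using C Ct by (intro mult_pos_pos add_pos_nonneg) auto
  have "\<exists>f\<in>calderon_functions (Tent 1) (Tent r). f (of_real \<theta>) = u \<and>
      calderon_norm (Tent 1) (Tent r) f <= K * L"
    if u: "u \<in> points (Tent p)" and L: "0 < L" "norm_on (Tent p) u <= L"
    for u :: "('a, 'x) tent_operator" and L
  proof -
    have p0: "p > 0" using p(2) by simp
    have uop: "operator_on u" and u0: "!!h. h \<notin> L2c \<mu> ==> u h = 0" and g: "gsm (%x. restrict_operator u (cone_at x))"
      using u by (simp_all add: tent_points_iff)
    have fin: "AE x in \<mu>. sqf u x < \<top>" by (rule gsm_square_finite[OF g])
    have uL: "(\<integral>\<^sup>+x. ennreal_powr (sqf u x) p \<partial>\<mu>) <= ennreal (L powr p)"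
      using tent_norm_integral[OF u p0] by (rule order_trans) (use L p0 in \<open>intro ennreal_leI powr_mono2, auto\<close>)
    define x0 :: 'a where "x0 = undefined"
    let ?E = "%n. upper_half_space - cylinder x0 (real (Suc n))"
    have "\<exists>n0. \<forall>n\<ge>n0. (\<integral>\<^sup>+x. ennreal_powr (sqf (restrict_operator u (?E n)) x) p \<partial>\<mu>) <= ennreal ((L / 2 ^ Suc j) powr p)" for j
    proof -
      have "\<forall>\<^sub>F n in sequentially. (\<integral>\<^sup>+x. ennreal_powr (sqf (restrict_operator u (?E n)) x) p \<partial>\<mu>) < ennreal ((L / 2 ^ Suc j) powr p)"
        by (rule order_tendstoD(2)[OF tent_truncation_tendsto_0[OF u p0]]) (use L in simp)
      then show ?thesis unfolding eventually_sequentially by (meson less_imp_le)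
    qed
    then obtain N0 where N0: "!!j n. n \<ge> N0 j ==> (\<integral>\<^sup>+x. ennreal_powr (sqf (restrict_operator u (?E n)) x) p \<partial>\<mu>) <= ennreal ((L / 2 ^ Suc j) powr p)"
      by metis
    \<comment> \<open>The partial sums make the indices monotone and at least \<open>N0 j\<close>;
      the summand \<open>j\<close> makes the radii tend to infinity.\<close>
    define m where "m j = j + (\<Sum>i\<le>j. N0 i)" for j
    define R where "R j = real (Suc (m j))" for j
    have mN: "N0 j <= m j" for j unfolding m_def by (intro trans_le_add2 member_le_sum) auto
    have Rpos: "R j > 0" for j by (simp add: R_def)
    have Rmono: "R i <= R j" if "i <= j" for i j
      using that by (induction rule: dec_induct) (auto simp: R_def m_def)
    have Rj: "real j <= R j" for j
    proof -
      have "j <= Suc (m j)" by (simp add: m_def)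
      then show ?thesis unfolding R_def by (rule of_nat_mono)
    qed
    define Q where "Q j = cylinder x0 (R j)" for j
    have Qs: "Q j \<in> sets nu" for j using Rpos by (simp add: Q_def)
    have Qmono: "Q i \<subseteq> Q j" if "i <= j" for i j
      unfolding Q_def by (intro cylinder_mono Rpos Rmono that)
    define B where "B j = (if j = 0 then Q 0 else Q j - Q (j - 1))" for j
    have Bs: "B j \<in> sets nu" for j using Qs by (auto simp: B_def)
    have BQ: "B j \<subseteq> Q j" for j by (auto simp: B_def)
    have B_int: "(\<integral>\<^sup>+x. ennreal_powr (sqf (restrict_operator u (B j)) x) p \<partial>\<mu>) <= ennreal ((L / 2 ^ j) powr p)" for j
    proof (cases j)
      \<comment> \<open>Shell 0 is charged with the full norm. Shell \<open>Suc i\<close> lies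
        outside the cylinder of radius \<open>R i\<close> and inherits the tail bound
        \<open>L / 2 ^ Suc i\<close> from the choice of \<open>m i\<close>.\<close>
      case 0
      have "(\<integral>\<^sup>+x. ennreal_powr (sqf (restrict_operator u (B j)) x) p \<partial>\<mu>) <= (\<integral>\<^sup>+x. ennreal_powr (sqf u x) p \<partial>\<mu>)"
        using p0 by (intro nn_integral_mono ennreal_powr_mono square_function_restrict_le uop Bs) auto
      then show ?thesis using uL 0 by simp
    next
      case (Suc i)
      have sub: "B j \<subseteq> ?E (m i)"
        using sets.sets_into_space[OF Bs[of j]] by (auto simp: Suc B_def Q_def R_def space_nu)
      have Es: "?E (m i) \<in> sets nu"
        using sets.compl_sets[OF cylinder_sets[of "real (Suc (m i))" x0]] by (simp add: space_nu)
      have "sqf (restrict_operator u (B j)) x <= sqf (restrict_operator u (?E (m i))) x" for x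
        unfolding square_function_restrict using sub Bs Es by (intro gamma_norm_restrict_mono uop sets.Int) auto
      then have "(\<integral>\<^sup>+x. ennreal_powr (sqf (restrict_operator u (B j)) x) p \<partial>\<mu>) \<le>
        (\<integral>\<^sup>+x. ennreal_powr (sqf (restrict_operator u (?E (m i))) x) p \<partial>\<mu>)"
        using p0 by (intro nn_integral_mono ennreal_powr_mono) auto
      also have "... <= ennreal ((L / 2 ^ Suc i) powr p)" by (rule N0[OF mN])
      finally show ?thesis by (simp only: Suc)
    qed
    \<comment> \<open>The decomposition of shell \<open>j\<close> as one predicate, so that its four
      witnesses can be chosen for all \<open>j\<close> at once.\<close>
    define PP where "PP j n A S a \<longleftrightarrow> (\<forall>k<n. A k \<in> sets nu) \<and> (\<forall>k<n. \<forall>j<n. k \<noteq> j --> A k \<inter> A j = {}) \<and> (\<Union>k<n. A k) = B j \<and>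
       (\<forall>k<n. (0::real) < a k) \<and> (\<forall>k<n. S k \<in> sets borel) \<and>
       (\<forall>k<n. \<forall>x. sqf (restrict_operator (restrict_operator u (B j)) (A k)) x <= ennreal (a k * (L / 2 ^ j)) * indicator (S k) x) \<and>
       (\<Sum>k<(n::nat). ennreal (a k powr p) * emeasure \<mu> (S k)) <= ennreal C" for j n A S a
    have "\<exists>n A S a. PP j n A S a" for j
      unfolding PP_def
    proof (rule dec[OF L2_operator_restrict[OF uop Bs] _ Bs _ Rpos])
      show "AE x in \<mu>. sqf (restrict_operator u (B j)) x < \<top>"
        using fin by eventually_elim (rule le_less_trans[OF square_function_restrict_le[OF uop Bs]])
      show "B j \<subseteq> cylinder x0 (R j)" using BQ by (simp add: Q_def)
      show "0 < L / 2 ^ j" using L by simp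
      show "restrict_operator u (B j) (%p. indicator (B j) p * h p) = restrict_operator u (B j) h" for h
        unfolding restrict_operator_def by (intro arg_cong[where f=u]) (auto simp: indicator_def)
    qed (rule B_int)
    then have "\<exists>n A S a. \<forall>j. PP j (n j) (A j) (S j) (a j)" by metis
    then obtain n A S a where PP: "!!j. PP j (n j) (A j) (S j) (a j)" by blast
    have As: "A j k \<in> sets nu" if "k < n j" for j k using PP[of j] that unfolding PP_def by blast
    have Ad: "A j k \<inter> A j k' = {}" if "k < n j" "k' < n j" "k \<noteq> k'" for j k k' using PP[of j] that unfolding PP_def by blast
    have AU: "(\<Union>k<n j. A j k) = B j" for j using PP[of j] unfolding PP_def by blast
    have uB: "restrict_operator u (B j) h = (\<Sum>k<n j. restrict_operator u (A j k) h)" if "h \<in> L2c \<mu>" for j h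
      unfolding AU[symmetric] by (rule restrict_operator_UN[OF uop that As Ad])
    have uQ: "restrict_operator u (Q J) h = (\<Sum>j<Suc J. restrict_operator u (B j) h)" if h: "h \<in> L2c \<mu>" for J h
    proof (induction J)
      case (Suc J)
      have "Q (Suc J) = Q J \<union> B (Suc J)" using Qmono[of J "Suc J"] by (auto simp: B_def)
      then show ?case
        using restrict_operator_split[OF uop Qs Bs _ h, of J "Suc J"] Suc by (simp add: B_def)
    qed (simp add: B_def)
    interpret pieces: tent_pieces \<mu> u A S a n L p r C Ct
    proof
      show "operator_on u" by (rule uop)
      show "u h = 0" if "h \<notin> L2c \<mu>" for h by (rule u0[OF that])
      show "gsm (%x. restrict_operator u (cone_at x))" by (rule g)
      show "A j k \<in> sets nu" if "k < n j" for j k by (rule As[OF that])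
      show "A j k \<inter> A j k' = {}" if "k < n j" "k' < n j" "k \<noteq> k'" for j k k' by (rule Ad[OF that])
      show "0 < a j k" if "k < n j" for j k using PP[of j] that unfolding PP_def by blast
      show "S j k \<in> sets borel" if "k < n j" for j k using PP[of j] that unfolding PP_def by blast
      show "sqf (restrict_operator u (A j k)) x <= ennreal (a j k * (L / 2 ^ j)) * indicator (S j k) x"
        if "k < n j" for j k x
      proof -
        have "sqf (restrict_operator (restrict_operator u (B j)) (A j k)) x <= ennreal (a j k * (L / 2 ^ j)) * indicator (S j k) x"
          using PP[of j] that unfolding PP_def by blast
        moreover have "B j \<inter> A j k = A j k" using AU[of j] that by blast
        ultimately show ?thesis by (simp only: restrict_restrict_operator)
      qed
      show "(\<Sum>k<n j. ennreal (a j k powr p) * emeasure \<mu> (S j k)) <= ennreal C" for j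
        using PP[of j] unfolding PP_def by blast
      show "\<exists>J. u h = (\<Sum>j<J. \<Sum>k<n j. restrict_operator u (A j k) h) \<and> (\<forall>j\<ge>J. \<forall>k<n j. restrict_operator u (A j k) h = 0)"
        if h: "h \<in> L2c \<mu>" for h
      proof -
        obtain H where H: "compact H" "H \<subseteq> upper_half_space" "AE p in nu. p \<notin> H --> h p = 0"
          using h by (auto simp: L2c_def)
        obtain R0 where R0: "\<forall>R\<ge>R0. H \<subseteq> cylinder x0 R" using compact_subset_cylinder[OF H(1,2), of x0] by blast
        obtain J :: nat where J: "R0 < real J" using reals_Archimedean2 by blast
        have HQ: "H \<subseteq> Q j" if "j \<ge> J" for j
        proof -
          have "R0 <= R j" using J Rj[of j] that by (meson less_imp_le of_nat_mono order_trans)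
          then show ?thesis using R0 by (simp add: Q_def)
        qed
        have "u h = restrict_operator u (Q J) h"
          unfolding restrict_operator_def
        proof (rule operator_cong[OF uop h D_indicator[OF Qs h]])
          show "AE p in nu. h p = indicator (Q J) p * h p"
            using H(3) by eventually_elim (use HQ[of J] in \<open>auto simp: indicator_def\<close>)
        qed
        also have "... = (\<Sum>j<Suc J. \<Sum>k<n j. restrict_operator u (A j k) h)" by (simp only: uQ[OF h] uB[OF h])
        finally have 1: "u h = (\<Sum>j<Suc J. \<Sum>k<n j. restrict_operator u (A j k) h)" .
        \<comment> \<open>Up to a null set \<open>h\<close> lives in \<open>H\<close>, which is
          contained in \<open>Q (j - 1)\<close>, the set that was removed to form
          \<open>B j\<close>.\<close>
        have 2: "restrict_operator u (A j k) h = 0" if "j \<ge> Suc J" "k < n j" for j k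
        proof -
          have "A j k \<subseteq> B j" using AU[of j] that by blast
          moreover have "H \<subseteq> Q (j - 1)" using that by (intro HQ) simp
          then have "B j \<inter> H = {}" using that by (auto simp: B_def)
          ultimately have dis: "A j k \<inter> H = {}" by blast
          have "AE p in nu. indicator (A j k) p * h p = 0"
            using H(3) by eventually_elim (use dis in \<open>auto simp: indicator_def\<close>)
          then have "u (%p. indicator (A j k) p * h p) = u (%p. 0)"
            by (intro operator_cong[OF uop] D_indicator As that h D_zero)
          then show ?thesis by (simp add: restrict_operator_def operator_zero[OF uop])
        qed
        show ?thesis using 1 2 by blast
      qed
    qed (use L p r C Ct in simp_all, rule type, assumption+)
    show ?thesis
      using pieces.calderon_function_mem[of \<theta>] pieces.calderon_function_at[OF p(1)] pieces.calderon_function_norm[of \<theta>]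
      unfolding K_def by blast
  qed
  then show thesis using that[of K] K by blast
  qed
qed

end

section \<open>Norming functionals\<close>

text \<open>A minimal sublinear functional is linear; minimal ones exist below any given one by Zorn's
  lemma.\<close>

locale seminormed_subspace =
  fixes W :: "'v::complex_vector set" and q :: "'v => real"
  assumes W_zero: "0 \<in> W" and W_add: "x \<in> W ==> y \<in> W ==> x + y \<in> W"
    and W_scale: "x \<in> W ==> c *\<^sub>C x \<in> W"
    and q_add: "x \<in> W ==> y \<in> W ==> q (x + y) <= q x + q y"
    and q_scale: "x \<in> W ==> q (c *\<^sub>C x) = cmod c * q x"
begin

definition sublin :: "('v => real) => bool" where
  "sublin f \<longleftrightarrow> (\<forall>x. x \<notin> W --> f x = 0) \<and> (\<forall>x\<in>W. \<forall>y\<in>W. f (x + y) <= f x + f y) \<and>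
    (\<forall>t>0. \<forall>x\<in>W. f (of_real t *\<^sub>C x) <= t * f x) \<and> f 0 <= 0"

lemma sublinD:
  assumes "sublin f"
  shows "x \<notin> W ==> f x = 0" "x \<in> W ==> y \<in> W ==> f (x + y) <= f x + f y"
    "t > 0 ==> x \<in> W ==> f (of_real t *\<^sub>C x) <= t * f x" "f 0 = 0"
proof -
  show "x \<notin> W ==> f x = 0" "x \<in> W ==> y \<in> W ==> f (x + y) <= f x + f y"
    "t > 0 ==> x \<in> W ==> f (of_real t *\<^sub>C x) <= t * f x" using assms unfolding sublin_def by blast+
  have "f (0 + 0) <= f 0 + f 0" "f 0 <= 0" using assms W_zero unfolding sublin_def by blast+
  then show "f 0 = 0" by simp
qed

lemma W_minus: "x \<in> W ==> - x \<in> W"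
  using W_scale[of x "-1"] by (simp add: scaleC_minus scaleC_one)

lemma sublin_lower:
  assumes "sublin f" "x \<in> W" shows "- f (- x) <= f x"
  using sublinD(2)[OF assms(1,2) W_minus[OF assms(2)]] sublinD(4)[OF assms(1)] by simp

text \<open>\<open>sublin\<close> asks for an inequality only; applying it with \<open>1 / t\<close>
  gives the reverse one.\<close>

lemma sublin_homogeneous:
  assumes f: "sublin f" and t: "t > 0" and x: "x \<in> W"
  shows "f (of_real t *\<^sub>C x) = t * f x"
proof (rule antisym)
  show "f (of_real t *\<^sub>C x) <= t * f x" by (rule sublinD(3)[OF f t x])
  have "f (of_real (1/t) *\<^sub>C of_real t *\<^sub>C x) <= (1/t) * f (of_real t *\<^sub>C x)"
    using t by (intro sublinD(3)[OF f] W_scale x) simp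
  moreover have "of_real (1/t) *\<^sub>C of_real t *\<^sub>C x = x"
    using t by (simp add: scaleC_scaleC of_real_mult[symmetric] scaleC_one del: of_real_mult of_real_divide)
  ultimately show "t * f x <= f (of_real t *\<^sub>C x)" using t by (simp add: field_simps)
qed

text \<open>A sublinear functional below \<open>f\<close> whose value at \<open>- y\<close> is at
  most \<open>- f y\<close>. A minimal functional equals its lowering along every \<open>y\<close>
  in \<open>W\<close>, hence satisfies \<open>f (- y) = - f y\<close>, and subadditivity then
  becomes additivity.\<close>

definition lowered :: "('v => real) => 'v => 'v => real" where
  "lowered f y x = (if x \<in> W then INF t\<in>{0..}. f (x + of_real t *\<^sub>C y) - t * f y else 0)"

lemma lowered:
  assumes f: "sublin f" and y: "y \<in> W"
  shows "sublin (lowered f y)" "x \<in> W ==> lowered f y x <= f x" "lowered f y (- y) <= - f y"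
proof -
  have ty: "of_real t *\<^sub>C y \<in> W" for t by (rule W_scale[OF y])
  have tf: "t * f y = f (of_real t *\<^sub>C y)" if "t \<ge> 0" for t
    using sublin_homogeneous[OF f _ y, of t] sublinD(4)[OF f] that by (cases "t = 0") auto
  have bdd: "bdd_below ((%t. f (x + of_real t *\<^sub>C y) - t * f y) ` {0..})" if x: "x \<in> W" for x
  proof (rule bdd_belowI2[where m="- f (- x)"])
    fix t :: real assume t: "t \<in> {0..}"
    have "f ((x + of_real t *\<^sub>C y) + (- x)) <= f (x + of_real t *\<^sub>C y) + f (- x)"
      by (intro sublinD(2)[OF f] W_add x ty W_minus)
    then show "- f (- x) <= f (x + of_real t *\<^sub>C y) - t * f y" using t by (simp add: tf)
  qed
  have up: "lowered f y x <= f (x + of_real t *\<^sub>C y) - t * f y" if "x \<in> W" "t \<ge> 0" for x t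
    unfolding lowered_def if_P[OF that(1)] by (intro cINF_lower bdd) (use that in auto)
  have ex: "\<exists>t\<ge>0. f (x + of_real t *\<^sub>C y) - t * f y < lowered f y x + e" if x: "x \<in> W" and e: "e > 0" for x e
  proof -
    have "(INF t\<in>{0..}. f (x + of_real t *\<^sub>C y) - t * f y) < lowered f y x + e"
      using e by (simp add: lowered_def x)
    then show ?thesis using cInf_less_iff[OF _ bdd[OF x]] by auto
  qed
  show le: "lowered f y x <= f x" if "x \<in> W" for x using up[OF that, of 0] by simp
  show "lowered f y (- y) <= - f y"
    using up[OF W_minus[OF y], of 1] sublinD(4)[OF f] by (simp add: scaleC_one)
  show "sublin (lowered f y)"
    unfolding sublin_def
  proof (intro conjI allI ballI impI)
    show "lowered f y x = 0" if "x \<notin> W" for x using that by (simp add: lowered_def)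
    show "lowered f y 0 <= 0" using le[OF W_zero] sublinD(4)[OF f] by simp
  next
    fix x z assume xz: "x \<in> W" "z \<in> W"
    show "lowered f y (x + z) <= lowered f y x + lowered f y z"
    proof (rule field_le_epsilon)
      fix e :: real assume "e > 0"
      then obtain s t where s: "s \<ge> 0" "f (x + of_real s *\<^sub>C y) - s * f y < lowered f y x + e / 2"
        and t: "t \<ge> 0" "f (z + of_real t *\<^sub>C y) - t * f y < lowered f y z + e / 2"
        using ex[OF xz(1), of "e/2"] ex[OF xz(2), of "e/2"] by auto
      have "lowered f y (x + z) <= f ((x + z) + of_real (s + t) *\<^sub>C y) - (s + t) * f y"
        using s t by (intro up W_add xz) auto
      also have "(x + z) + of_real (s + t) *\<^sub>C y = (x + of_real s *\<^sub>C y) + (z + of_real t *\<^sub>C y)"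
        by (simp add: scaleC_add_left algebra_simps)
      also have "f ... <= f (x + of_real s *\<^sub>C y) + f (z + of_real t *\<^sub>C y)"
        by (intro sublinD(2)[OF f] W_add xz ty)
      finally show "lowered f y (x + z) <= lowered f y x + lowered f y z + e"
        using s t by (simp add: algebra_simps)
    qed
  next
    fix s x assume s: "(0::real) < s" and x: "x \<in> W"
    show "lowered f y (of_real s *\<^sub>C x) <= s * lowered f y x"
    proof (rule field_le_epsilon)
      fix e :: real assume "e > 0"
      then obtain t where t: "t \<ge> 0" "f (x + of_real t *\<^sub>C y) - t * f y < lowered f y x + e / s"
        using ex[OF x, of "e/s"] s by auto
      have "lowered f y (of_real s *\<^sub>C x) <= f (of_real s *\<^sub>C x + of_real (s * t) *\<^sub>C y) - (s * t) * f y"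
        using s t by (intro up W_scale x) auto
      also have "of_real s *\<^sub>C x + of_real (s * t) *\<^sub>C y = of_real s *\<^sub>C (x + of_real t *\<^sub>C y)"
        by (simp add: scaleC_add_right scaleC_scaleC)
      also have "f ... <= s * f (x + of_real t *\<^sub>C y)" by (intro sublinD(3)[OF f s] W_add x ty)
      finally have "lowered f y (of_real s *\<^sub>C x) <= s * (f (x + of_real t *\<^sub>C y) - t * f y)"
        by (simp add: algebra_simps)
      also have "... <= s * (lowered f y x + e / s)" using s t by (intro mult_left_mono) auto
      also have "... = s * lowered f y x + e" using s by (simp add: distrib_left)
      finally show "lowered f y (of_real s *\<^sub>C x) <= s * lowered f y x + e" .
    qed
  qed
qed

text \<open>A chain has its pointwise infimum as a lower bound. The infimum is finite because a
  sublinear functional below \<open>f\<close> is at least \<open>- f (- x)\<close> at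
  \<open>x\<close>, and subadditive because of two members of a chain the smaller one is nearly
  optimal at both points.\<close>

lemma minimal_sublin:
  assumes f: "sublin f"
  obtains g where "sublin g" "!!x. x \<in> W ==> g x <= f x" "!!h. sublin h ==> (!!x. x \<in> W ==> h x <= g x) ==> h = g"
proof -
  define Z where "Z = {g. sublin g \<and> (\<forall>x\<in>W. g x <= f x)}"
  define R where "R = {(g, h). g \<in> Z \<and> h \<in> Z \<and> (\<forall>x\<in>W. h x <= g x)}"
  have Field: "Field R = Z" by (auto simp: R_def Field_def)
  have off: "g x = 0" if "g \<in> Z" "x \<notin> W" for g x using that sublinD(1) by (auto simp: Z_def)
  have anti: "g = h" if "g \<in> Z" "h \<in> Z" "\<forall>x\<in>W. h x <= g x" "\<forall>x\<in>W. g x <= h x" for g h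
  proof
    fix x show "g x = h x" using that off[of g x] off[of h x] by (cases "x \<in> W") (auto intro: antisym)
  qed
  have po: "Partial_order R"
    unfolding partial_order_on_def preorder_on_def Field
  proof (intro conjI)
    show "refl_on Z R" by (auto simp: refl_on_def R_def)
    show "trans R" unfolding trans_def R_def by (auto intro: order_trans)
    show "antisym R" unfolding antisym_def R_def using anti by auto
    show "R \<subseteq> Z \<times> Z" by (auto simp: R_def)
  qed
  have "\<exists>u\<in>Field R. \<forall>a\<in>C. (a, u) \<in> R" if C: "C \<in> Chains R" for C
  proof (cases "C = {}")
    case True
    then show ?thesis using f by (auto simp: Field Z_def)
  next
    case False
    have CZ: "g \<in> Z" if "g \<in> C" for g using C that by (auto simp: Chains_def R_def)
    have tot: "(\<forall>x\<in>W. h x <= g x) \<or> (\<forall>x\<in>W. g x <= h x)" if "g \<in> C" "h \<in> C" for g h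
      using C that by (auto simp: Chains_def R_def)
    define m where "m x = (if x \<in> W then INF g\<in>C. g x else 0)" for x
    have bdd: "bdd_below ((%g. g x) ` C)" if x: "x \<in> W" for x
    proof (rule bdd_belowI2[where m="- f (- x)"])
      fix g assume "g \<in> C"
      then have g: "sublin g" "g (- x) <= f (- x)" using CZ W_minus[OF x] by (auto simp: Z_def)
      then show "- f (- x) <= g x" using sublin_lower[OF g(1) x] by simp
    qed
    have up: "m x <= g x" if "x \<in> W" "g \<in> C" for x g
      unfolding m_def if_P[OF that(1)] by (intro cINF_lower bdd that)
    have ex: "\<exists>g\<in>C. g x < m x + e" if x: "x \<in> W" and e: "e > 0" for x e
    proof -
      have "(INF g\<in>C. g x) < m x + e" using e by (simp add: m_def x)
      then show ?thesis using cInf_less_iff[OF _ bdd[OF x]] False by auto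
    qed
    obtain g0 where g0: "g0 \<in> C" using False by blast
    have "sublin m"
      unfolding sublin_def
    proof (intro conjI allI ballI impI)
      show "m x = 0" if "x \<notin> W" for x using that by (simp add: m_def)
      show "m 0 <= 0" using up[OF W_zero g0] sublinD(4)[of g0] CZ[OF g0] by (simp add: Z_def)
    next
      fix x z assume xz: "x \<in> W" "z \<in> W"
      show "m (x + z) <= m x + m z"
      proof (rule field_le_epsilon)
        fix e :: real assume "e > 0"
        then obtain g h where g: "g \<in> C" "g x < m x + e/2" and h: "h \<in> C" "h z < m z + e/2"
          using ex[OF xz(1), of "e/2"] ex[OF xz(2), of "e/2"] by auto
        obtain k where k: "k \<in> C" "k x <= g x" "k z <= h z"
          using tot[OF g(1) h(1)] g(1) h(1) xz by blast
        have "m (x + z) <= k (x + z)" by (intro up W_add xz k)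
        also have "... <= k x + k z" using CZ[OF k(1)] by (intro sublinD(2) xz) (simp add: Z_def)
        finally show "m (x + z) <= m x + m z + e" using g h k by simp
      qed
    next
      fix s x assume s: "(0::real) < s" and x: "x \<in> W"
      show "m (of_real s *\<^sub>C x) <= s * m x"
      proof (rule field_le_epsilon)
        fix e :: real assume "e > 0"
        then obtain g where g: "g \<in> C" "g x < m x + e / s" using ex[OF x, of "e/s"] s by auto
        have "m (of_real s *\<^sub>C x) <= g (of_real s *\<^sub>C x)" by (intro up W_scale x g)
        also have "... <= s * g x" using CZ[OF g(1)] by (intro sublinD(3) s x) (simp add: Z_def)
        also have "... <= s * (m x + e / s)" using s g by (intro mult_left_mono) auto
        also have "... = s * m x + e" using s by (simp add: distrib_left)
        finally show "m (of_real s *\<^sub>C x) <= s * m x + e" .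
      qed
    qed
    moreover have "m x <= f x" if "x \<in> W" for x
      using up[OF that g0] CZ[OF g0] that by (auto simp: Z_def intro: order_trans)
    ultimately have "m \<in> Z" by (simp add: Z_def)
    moreover from this have "m \<in> Field R" by (simp add: Field)
    ultimately show ?thesis using up CZ by (intro bexI[of _ m]) (auto simp: R_def)
  qed
  then obtain g where g: "g \<in> Z" and min: "!!h. h \<in> Z ==> (g, h) \<in> R ==> h = g"
    using Zorns_po_lemma[OF po] unfolding Field by blast
  show ?thesis
  proof (rule that[of g])
    show "sublin g" "!!x. x \<in> W ==> g x <= f x" using g by (auto simp: Z_def)
    fix h assume h: "sublin h" "!!x. x \<in> W ==> h x <= g x"
    then have "h \<in> Z" using g by (auto simp: Z_def intro: order_trans)
    then show "h = g" using g h by (intro min) (auto simp: R_def)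
  qed
qed

text \<open>The minimal functional \<open>g\<close> is taken below \<open>q\<close> already lowered
  along \<open>v\<close>, which forces \<open>g v = q v\<close>. Its complexification, with real
  part \<open>g x\<close> and imaginary part \<open>- g (\<i> *\<^sub>C x)\<close>, is complex
  linear, and multiplying \<open>x\<close> by a unimodular scalar bounds its modulus by
  \<open>q\<close>.\<close>

theorem norming_functional:
  assumes v: "v \<in> W"
  obtains \<phi> :: "'v => complex" where "!!x y. x \<in> W ==> y \<in> W ==> \<phi> (x + y) = \<phi> x + \<phi> y"
    "!!c x. x \<in> W ==> \<phi> (c *\<^sub>C x) = c * \<phi> x" "!!x. x \<in> W ==> cmod (\<phi> x) <= q x" "cmod (\<phi> v) = q v"
proof -
  define q0 where "q0 x = (if x \<in> W then q x else 0)" for x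
  have q0: "sublin q0"
    unfolding sublin_def q0_def using q_add q_scale W_add W_scale q_scale[OF W_zero, of 0] W_zero
    by (auto simp: norm_of_real)
  obtain g where g: "sublin g" and gl: "!!x. x \<in> W ==> g x <= lowered q0 v x"
    and min: "!!h. sublin h ==> (!!x. x \<in> W ==> h x <= g x) ==> h = g"
    using minimal_sublin[OF lowered(1)[OF q0 v]] by blast
  have gq: "g x <= q x" if "x \<in> W" for x
    using gl[OF that] lowered(2)[OF q0 v that] that by (simp add: q0_def)
  have neg: "g (- y) = - g y" if y: "y \<in> W" for y
  proof -
    have "lowered g y = g" by (intro min lowered[OF g y])
    then have "g (- y) <= - g y" using lowered(3)[OF g y] by simp
    then show ?thesis using sublin_lower[OF g y] by simp
  qed
  have add: "g (x + y) = g x + g y" if xy: "x \<in> W" "y \<in> W" for x y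
  proof -
    have "g ((x + y) + (- y)) <= g (x + y) + g (- y)" by (intro sublinD(2)[OF g] W_add W_minus xy)
    then show ?thesis using sublinD(2)[OF g xy] neg[OF xy(2)] by simp
  qed
  have hom: "g (of_real t *\<^sub>C x) = t * g x" if x: "x \<in> W" for t x
  proof -
    consider "t > 0" | "t = 0" | "t < 0" by linarith
    then show ?thesis
    proof cases
      case 3
      have "g (- (of_real (- t) *\<^sub>C x)) = - ((- t) * g x)"
        using neg[OF W_scale[OF x, of "of_real (- t)"]] sublin_homogeneous[OF g _ x, of "- t"] 3 by simp
      then show ?thesis by (simp add: scaleC_minus)
    qed (use sublin_homogeneous[OF g _ x, of t] sublinD(4)[OF g] in auto)
  qed
  have gv: "q v <= g v"
  proof -
    have "g (- v) <= - q0 v" using gl[OF W_minus[OF v]] lowered(3)[OF q0 v] by simp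
    then show ?thesis using neg[OF v] v by (simp add: q0_def)
  qed
  define \<phi> where "\<phi> x = Complex (g x) (- g (\<i> *\<^sub>C x))" for x
  have \<phi>_add: "\<phi> (x + y) = \<phi> x + \<phi> y" if "x \<in> W" "y \<in> W" for x y
    using that by (simp add: \<phi>_def add W_scale scaleC_add_right complex_eq_iff)
  have \<phi>_scale: "\<phi> (c *\<^sub>C x) = c * \<phi> x" if x: "x \<in> W" for c x
  proof -
    have e: "c *\<^sub>C x = of_real (Re c) *\<^sub>C x + of_real (Im c) *\<^sub>C \<i> *\<^sub>C x"
      by (simp add: scaleC_scaleC scaleC_add_left[symmetric]) (metis complex_eq mult.commute)
    have "\<i> *\<^sub>C c *\<^sub>C x = of_real (Re c) *\<^sub>C \<i> *\<^sub>C x + of_real (- Im c) *\<^sub>C x"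
      by (simp add: scaleC_scaleC scaleC_add_left[symmetric]) (simp add: complex_eq_iff arg_cong2[where f=scaleC])
    then have "g (\<i> *\<^sub>C c *\<^sub>C x) = Re c * g (\<i> *\<^sub>C x) + (- Im c) * g x"
      by (simp only: add[OF W_scale[OF W_scale[OF x]] W_scale[OF x]] hom[OF W_scale[OF x]] hom[OF x])
    moreover have "g (c *\<^sub>C x) = Re c * g x + Im c * g (\<i> *\<^sub>C x)"
      unfolding e by (simp only: add[OF W_scale[OF x] W_scale[OF W_scale[OF x]]] hom[OF W_scale[OF x]] hom[OF x])
    ultimately show ?thesis by (simp add: \<phi>_def complex_eq_iff algebra_simps)
  qed
  have \<phi>_le: "cmod (\<phi> x) <= q x" if x: "x \<in> W" for x
  proof (cases "\<phi> x = 0")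
    case True
    have "0 <= q x"
    proof -
      have "q (x + (-1) *\<^sub>C x) <= q x + q ((-1) *\<^sub>C x)" by (intro q_add x W_scale)
      moreover have "x + (-1) *\<^sub>C x = 0 *\<^sub>C x" by (simp add: scaleC_minus scaleC_one)
      ultimately show ?thesis using q_scale[OF x, of "-1"] q_scale[OF x, of 0] by simp
    qed
    then show ?thesis using True by simp
  next
    case False
    define c where "c = cnj (\<phi> x) / of_real (cmod (\<phi> x))"
    have c1: "cmod c = 1" using False by (simp add: c_def norm_divide)
    have "c * \<phi> x = of_real (cmod (\<phi> x))"
    proof -
      have "c * \<phi> x = (\<phi> x * cnj (\<phi> x)) / of_real (cmod (\<phi> x))" by (simp add: c_def)
      also have "... = of_real ((cmod (\<phi> x))\<^sup>2) / of_real (cmod (\<phi> x))" by (simp only: complex_norm_square)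
      also have "... = of_real (cmod (\<phi> x))" using False by (simp add: power2_eq_square)
      finally show ?thesis .
    qed
    then have "cmod (\<phi> x) = Re (\<phi> (c *\<^sub>C x))" by (simp add: \<phi>_scale[OF x])
    also have "... = g (c *\<^sub>C x)" by (simp add: \<phi>_def)
    also have "... <= q (c *\<^sub>C x)" by (intro gq W_scale x)
    also have "... = q x" by (simp add: q_scale[OF x] c1)
    finally show ?thesis .
  qed
  have "q v <= Re (\<phi> v)" using gv by (simp add: \<phi>_def)
  also have "... <= cmod (\<phi> v)" by (rule complex_Re_le_cmod)
  finally have "cmod (\<phi> v) = q v" using \<phi>_le[OF v] by simp
  then show ?thesis using that[of \<phi>] \<phi>_add \<phi>_scale \<phi>_le by blast
qed

end

section \<open>The maximum principle on a strip\<close>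

text \<open>The factor exp(e (z^2 - 1)) has modulus at most 1 in the strip and decays along it, so
  on the horizontal sides of a long rectangle it beats the a priori bound \<open>M\<close>. The
  maximum principle applies on the rectangle, and then \<open>e\<close> tends to 0.\<close>

lemma strip_maximum_principle:
  fixes H :: "complex => complex"
  assumes cont: "continuous_on {z. 0 <= Re z \<and> Re z <= 1} H"
    and hol: "H holomorphic_on {z. 0 < Re z \<and> Re z < 1}"
    and bdd: "!!z. 0 <= Re z ==> Re z <= 1 ==> cmod (H z) <= M"
    and left: "!!t. cmod (H (Complex 0 t)) <= B" and right: "!!t. cmod (H (Complex 1 t)) <= B"
    and B: "0 < B" and \<theta>: "0 < \<theta>" "\<theta> < 1"
  shows "cmod (H (of_real \<theta>)) <= B"
proof -
  have eps: "cmod (H (of_real \<theta>)) * exp (e * (\<theta>\<^sup>2 - 1)) <= B" if e: "e > 0" for e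
  proof -
    define E where "E z = exp (of_real e * (z\<^sup>2 - 1))" for z :: complex
    have E: "cmod (E z) = exp (e * ((Re z)\<^sup>2 - (Im z)\<^sup>2 - 1))" for z
      by (simp add: E_def power2_eq_square)
    have E_le: "cmod (E z) <= exp (- (e * (Im z)\<^sup>2))" if "0 <= Re z" "Re z <= 1" for z
    proof -
      have "(Re z)\<^sup>2 <= 1" using that by (simp add: power_le_one)
      then have "e * ((Re z)\<^sup>2 - (Im z)\<^sup>2 - 1) <= e * (- (Im z)\<^sup>2)" using e by (intro mult_left_mono) auto
      then show ?thesis unfolding E by simp
    qed
    have E_le1: "cmod (E z) <= 1" if "0 <= Re z" "Re z <= 1" for z
    proof -
      have "0 <= e * (Im z)\<^sup>2" using e by simp
      then show ?thesis by (intro order_trans[OF E_le[OF that]]) simp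
    qed
    have M0: "0 <= M" using order_trans[OF norm_ge_zero bdd[of 0]] by simp
    \<comment> \<open>Chosen so that \<open>M / B <= e * T\<close>, from which the inequality 1 + x
      <= exp x gives the bound on the horizontal sides.\<close>
    define T where "T = 1 + M / (B * e)"
    have T: "T \<ge> 1" using M0 B e by (simp add: T_def)
    have top: "M * exp (- (e * T\<^sup>2)) <= B"
    proof -
      have "e * T <= e * T\<^sup>2" using T e by (intro mult_left_mono) (auto simp: power2_eq_square)
      moreover have "M / B <= e * T" using B e by (simp add: T_def field_simps)
      moreover have "1 + e * T\<^sup>2 <= exp (e * T\<^sup>2)" by (rule exp_ge_add_one_self)
      ultimately have "M / B <= exp (e * T\<^sup>2)" by linarith
      then have "M <= B * exp (e * T\<^sup>2)" using B by (simp add: pos_divide_le_eq mult.commute)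
      then show ?thesis by (simp add: exp_minus field_simps)
    qed
    define S where "S = box (Complex 0 (- T)) (Complex 1 T)"
    have mem: "z \<in> S \<longleftrightarrow> 0 < Re z \<and> Re z < 1 \<and> - T < Im z \<and> Im z < T" for z
      by (simp add: S_def in_box_complex_iff)
    have cl: "closure S = cbox (Complex 0 (- T)) (Complex 1 T)"
      unfolding S_def using T by (intro closure_box) (auto simp: mem[unfolded S_def] intro!: exI[of _ "Complex (1/2) 0"] simp: ex_in_conv[symmetric])
    have clmem: "z \<in> closure S \<longleftrightarrow> 0 <= Re z \<and> Re z <= 1 \<and> - T <= Im z \<and> Im z <= T" for z
      by (simp add: cl in_cbox_complex_iff)
    have "cmod (H (of_real \<theta>) * E (of_real \<theta>)) <= B"
    proof (rule maximum_modulus_frontier[where S=S and f="%z. H z * E z"])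
      have "open S" by (simp add: S_def open_box)
      then have int: "interior S = S" by (rule interior_open)
      have "H holomorphic_on S" by (rule holomorphic_on_subset[OF hol]) (auto simp: mem)
      moreover have "E holomorphic_on S" unfolding E_def by (intro holomorphic_intros)
      ultimately show "(%z. H z * E z) holomorphic_on interior S" unfolding int by (intro holomorphic_on_mult)
      have "continuous_on (closure S) H" by (rule continuous_on_subset[OF cont]) (auto simp: clmem)
      moreover have "continuous_on (closure S) E" unfolding E_def by (intro continuous_intros)
      ultimately show "continuous_on (closure S) (%z. H z * E z)" by (intro continuous_on_mult)
      show "bounded S" by (simp add: S_def bounded_box)
      show "of_real \<theta> \<in> S" using \<theta> T by (simp add: mem)
      fix z assume "z \<in> frontier S"
      then have zc: "z \<in> closure S" "z \<notin> S" by (auto simp: frontier_def int)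
      then have strip: "0 <= Re z" "Re z <= 1" by (auto simp: clmem)
      have "Re z = 0 \<or> Re z = 1 \<or> Im z = T \<or> Im z = - T" using zc unfolding clmem mem by linarith
      then have "Re z = 0 \<or> Re z = 1 \<or> (Im z)\<^sup>2 = T\<^sup>2" by (metis power2_minus)
      then consider "Re z = 0" | "Re z = 1" | "(Im z)\<^sup>2 = T\<^sup>2" by blast
      then show "cmod (H z * E z) <= B"
      proof cases
        case 1
        then have "cmod (H z) <= B" using left[of "Im z"] by (metis complex_surj)
        then show ?thesis unfolding norm_mult using E_le1[OF strip] B mult_mono[of "cmod (H z)" B "cmod (E z)" 1] by simp
      next
        case 2
        then have "cmod (H z) <= B" using right[of "Im z"] by (metis complex_surj)
        then show ?thesis unfolding norm_mult using E_le1[OF strip] B mult_mono[of "cmod (H z)" B "cmod (E z)" 1] by simp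
      next
        case 3
        have "cmod (H z) * cmod (E z) <= M * exp (- (e * (Im z)\<^sup>2))"
          using M0 by (intro mult_mono bdd E_le strip) auto
        then show ?thesis unfolding norm_mult 3 using top by simp
      qed
    qed
    moreover have "cmod (E (of_real \<theta>)) = exp (e * (\<theta>\<^sup>2 - 1))" unfolding E by simp
    ultimately show ?thesis by (simp add: norm_mult)
  qed
  have "((%e. cmod (H (of_real \<theta>)) * exp (e * (\<theta>\<^sup>2 - 1))) \<longlongrightarrow> cmod (H (of_real \<theta>)) * exp (0 * (\<theta>\<^sup>2 - 1))) (at_right 0)"
    by (intro tendsto_intros)
  then have "cmod (H (of_real \<theta>)) * exp (0 * (\<theta>\<^sup>2 - 1)) <= B"
    by (rule tendsto_upperbound) (auto simp: eventually_at_right_less intro!: eventually_at_rightI[of 0 1] eps)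
  then show ?thesis by simp
qed

section \<open>The couple of tent spaces\<close>

text \<open>\<open>calderon_norm\<close> is built from suprema of real numbers, which are
  informative only for bounded families; continuity and decay at infinity provide the bound.
  Triangle inequality and symmetry are assumptions because a \<open>normed_subspace\<close> carries
  no axioms.\<close>

lemma boundary_norm_bdd_above:
  fixes g :: "real => 'v::complex_vector"
  assumes cont: "continuous_in A UNIV g" and lim: "((%t. norm_on A (g t)) \<longlongrightarrow> 0) at_infinity"
    and tri: "!!u v. u \<in> points A ==> v \<in> points A ==> norm_on A u <= norm_on A v + norm_on A (u - v)"
    and sym: "!!u v. norm_on A (u - v) = norm_on A (v - u)"
  shows "bdd_above (range (%t. norm_on A (g t)))"
proof -
  have pts: "g t \<in> points A" for t using cont by (auto simp: continuous_in_def)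
  have "continuous_on UNIV (%t. norm_on A (g t))"
    unfolding continuous_on_def
  proof (rule ballI)
    fix t :: real
    have "((%s. norm_on A (g s - g t)) \<longlongrightarrow> 0) (at t)" using cont by (simp add: continuous_in_def)
    then have "((%s. norm_on A (g s) - norm_on A (g t)) \<longlongrightarrow> 0) (at t)"
    proof (rule Lim_null_comparison[rotated], intro always_eventually allI)
      show "norm (norm_on A (g s) - norm_on A (g t)) <= norm_on A (g s - g t)" for s
        using tri[OF pts pts, of s t] tri[OF pts pts, of t s] sym[of "g s" "g t"] by (simp add: abs_le_iff)
    qed
    then show "((%s. norm_on A (g s)) \<longlongrightarrow> norm_on A (g t)) (at t within UNIV)" by (simp add: LIM_zero_iff)
  qed
  moreover from lim have "\<forall>\<^sub>F t in at_infinity. norm_on A (g t) < 1" by (intro order_tendstoD(2)) auto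
  then obtain R where R: "!!t. norm t \<ge> R ==> norm_on A (g t) < 1" by (auto simp: eventually_at_infinity)
  ultimately have "compact ((%t. norm_on A (g t)) ` {- R..R})"
    by (intro compact_continuous_image) (auto intro: continuous_on_subset)
  from bounded_imp_bdd_above[OF compact_imp_bounded[OF this]]
  obtain M where M: "!!t. t \<in> {- R..R} ==> norm_on A (g t) <= M"
    unfolding bdd_above_def by blast
  have "norm_on A (g t) <= max 1 M" for t
  proof (cases "t \<in> {- R..R}")
    case True then show ?thesis using M by (simp add: le_max_iff_disj)
  next
    case False
    then have "norm t \<ge> R" by auto
    then show ?thesis using R[of t] by simp
  qed
  then show ?thesis by (intro bdd_aboveI[of _ "max 1 M"]) auto
qed

context metric_measure_space begin

lemma square_function_add: "sqf (u + v) x <= sqf u x + sqf v x"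
proof -
  have "restrict_operator (u + v) (cone_at x) = restrict_operator u (cone_at x) + restrict_operator v (cone_at x)"
    by (rule ext) (simp add: restrict_operator_def)
  then show ?thesis unfolding square_function_def by (simp only: gamma_norm_add)
qed

lemma square_function_scaleC: "sqf (c *\<^sub>C u) x = ennreal (cmod c) * sqf u x"
  unfolding square_function_def restrict_operator_scaleC by (rule gamma_norm_scaleC)

abbreviation cone_gsm :: "('m, 'x::complex_banach) tent_operator => bool" where
  "cone_gsm u \<equiv> gsm (%x. restrict_operator u (cone_at x))"

lemma cone_gsm_add: "cone_gsm u ==> cone_gsm v ==> cone_gsm (u + v)"
proof -
  assume "cone_gsm u" "cone_gsm v"
  then have "gsm (%x. restrict_operator u (cone_at x) + restrict_operator v (cone_at x))" by (rule gsm_add)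
  then show ?thesis by (rule gsm_cong) (simp add: restrict_operator_def)
qed

lemma cone_gsm_scaleC: "cone_gsm u ==> cone_gsm (c *\<^sub>C u)"
  unfolding restrict_operator_scaleC by (rule gsm_scaleC)

lemma square_function_integral_add:
  assumes u: "u \<in> points (Tent q)" and v: "v \<in> points (Tent q)" and q: "1 <= q"
  shows "(\<integral>\<^sup>+x. ennreal_powr (sqf (u + v) x) q \<partial>\<mu>)
    <= ennreal ((norm_on (Tent q) u + norm_on (Tent q) v) powr q)"
proof -
  define w where "w k = (if k then u else v)" for k
  have w: "w k \<in> points (Tent q)" for k using u v by (simp add: w_def)
  have "(\<integral>\<^sup>+x. ennreal_powr (\<Sum>k\<in>UNIV. sqf (w k) x) q \<partial>\<mu>)
    <= ennreal ((\<Sum>k\<in>UNIV. norm_on (Tent q) (w k)) powr q)"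
  proof (rule Minkowski_sum)
    show "sqf (w k) \<in> borel_measurable \<mu>" for k
      using w[of k] unfolding tent_points_iff by (intro square_function_measurable gsm_square_finite) auto
    show "(\<integral>\<^sup>+x. ennreal_powr (sqf (w k) x) q \<partial>\<mu>) <= ennreal (norm_on (Tent q) (w k) powr q)" for k
      using q by (intro tent_norm_integral w) auto
  qed (use q in auto)
  moreover have "(\<integral>\<^sup>+x. ennreal_powr (sqf (u + v) x) q \<partial>\<mu>) \<le>
      (\<integral>\<^sup>+x. ennreal_powr (\<Sum>k\<in>UNIV. sqf (w k) x) q \<partial>\<mu>)"
    using square_function_add[of u v] q
    by (intro nn_integral_mono ennreal_powr_mono) (auto simp: w_def UNIV_bool add.commute)
  ultimately show ?thesis by (simp add: w_def UNIV_bool add.commute)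
qed

lemma tent_space_add:
  assumes u: "u \<in> points (Tent q)" and v: "v \<in> points (Tent q)" and q: "1 <= q"
  shows "u + v \<in> points (Tent q)"
    "norm_on (Tent q) (u + v) <= norm_on (Tent q) u + norm_on (Tent q) v"
proof -
  have q0: "q > 0" and n: "0 <= norm_on (Tent q) u + norm_on (Tent q) v" using q by auto
  note * = tent_norm_le[OF square_function_integral_add[OF assms] q0 n]
  show "norm_on (Tent q) (u + v) <= norm_on (Tent q) u + norm_on (Tent q) v" by (rule *)
  have "operator_on (u + v)" using u v unfolding tent_points_iff by (intro L2_operator_add) auto
  moreover have "cone_gsm (u + v)" using u v unfolding tent_points_iff by (intro cone_gsm_add) auto
  ultimately show "u + v \<in> points (Tent q)" using u v *(2) unfolding tent_points_iff by auto
qed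

lemma tent_space_scaleC:
  assumes u: "u \<in> points (Tent q)" and q: "0 < q"
  shows "c *\<^sub>C u \<in> points (Tent q)"
proof -
  have [measurable]: "sqf u \<in> borel_measurable \<mu>"
    using u unfolding tent_points_iff by (intro square_function_measurable gsm_square_finite) auto
  have "(\<integral>\<^sup>+x. ennreal_powr (sqf (c *\<^sub>C u) x) q \<partial>\<mu>) =
    ennreal (cmod c powr q) * (\<integral>\<^sup>+x. ennreal_powr (sqf u x) q \<partial>\<mu>)"
    using q by (simp add: square_function_scaleC ennreal_powr_mult nn_integral_cmult)
  also have "... <= ennreal (cmod c powr q) * ennreal (norm_on (Tent q) u powr q)"
    by (intro mult_left_mono tent_norm_integral u q) simp
  also have "... = ennreal ((cmod c * norm_on (Tent q) u) powr q)"
    by (simp add: ennreal_mult[symmetric] powr_mult)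
  finally have "Lp_norm \<mu> q (sqf (c *\<^sub>C u)) < \<top>" using q by (intro tent_norm_le) auto
  moreover have "operator_on (c *\<^sub>C u)" using u unfolding tent_points_iff by (intro L2_operator_scaleC) auto
  moreover have "cone_gsm (c *\<^sub>C u)" using u unfolding tent_points_iff by (intro cone_gsm_scaleC) auto
  ultimately show ?thesis using u unfolding tent_points_iff by (auto simp: scaleC_fun_def)
qed

lemma tent_space_diff:
  assumes "u \<in> points (Tent q)" "v \<in> points (Tent q)" "1 <= q"
  shows "u - v \<in> points (Tent q)"
  using tent_space_add(1)[OF assms(1) tent_space_scaleC[OF assms(2), of "-1"] assms(3)] assms(3)
  by (simp add: scaleC_minus scaleC_one)

lemma tent_norm_diff_commute: "norm_on (Tent q) (u - v) = norm_on (Tent q) (v - u)"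
proof -
  have "sqf (u - v) = sqf (v - u)"
    unfolding square_function_def restrict_operator_diff by (intro ext gamma_norm_diff_commute)
  then show ?thesis by (simp add: tent_norm_def)
qed

abbreviation tent_sum :: "real => ('m, 'x::complex_banach) tent_operator normed_subspace" where
  "tent_sum r \<equiv> sum_space (Tent 1) (Tent r)"

lemma tent_sum_points:
  "v \<in> points (tent_sum r) \<longleftrightarrow> (\<exists>a\<in>points (Tent 1). \<exists>b\<in>points (Tent r). v = a + b)"
  by (auto simp: sum_space_def)

lemma tent_sum_diff:
  assumes "u \<in> points (tent_sum r)" "v \<in> points (tent_sum r)" "1 <= r"
  shows "u - v \<in> points (tent_sum r)"
proof -
  obtain a b a' b' where *: "a \<in> points (Tent 1)" "b \<in> points (Tent r)" "u = a + b"
    "a' \<in> points (Tent 1)" "b' \<in> points (Tent r)" "v = a' + b'"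
    using assms(1,2) unfolding tent_sum_points by blast
  then have "u - v = (a - a') + (b - b')" by simp
  then show ?thesis unfolding tent_sum_points using assms(3) *
    by (intro bexI[of _ "a - a'"] bexI[of _ "b - b'"] tent_space_diff) auto
qed

lemma tent_sum_scaleC:
  assumes "u \<in> points (tent_sum r)" "1 <= r"
  shows "c *\<^sub>C u \<in> points (tent_sum r)"
proof -
  obtain a b where *: "a \<in> points (Tent 1)" "b \<in> points (Tent r)" "u = a + b"
    using assms(1) unfolding tent_sum_points by blast
  then have "c *\<^sub>C u = c *\<^sub>C a + c *\<^sub>C b" by (simp only: scaleC_add_right)
  then show ?thesis unfolding tent_sum_points using assms(2) *
    by (intro bexI[of _ "c *\<^sub>C a"] bexI[of _ "c *\<^sub>C b"] tent_space_scaleC) auto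
qed

lemma tent_sum_cone_gsm:
  assumes "u \<in> points (tent_sum r)" shows "cone_gsm u" "operator_on u" "\<forall>h. h \<notin> L2c \<mu> --> u h = 0"
proof -
  obtain a b where *: "a \<in> points (Tent 1)" "b \<in> points (Tent r)" and u: "u = a + b"
    using assms(1) unfolding tent_sum_points by blast
  show "cone_gsm u" unfolding u using * unfolding tent_points_iff by (intro cone_gsm_add) auto
  show "operator_on u" unfolding u using * unfolding tent_points_iff by (intro L2_operator_add) auto
  show "\<forall>h. h \<notin> L2c \<mu> --> u h = 0" unfolding u using * unfolding tent_points_iff by auto
qed

lemma calderon_boundary:
  fixes f :: "complex => ('m, 'x::complex_banach) tent_operator"
  assumes f: "f \<in> calderon_functions (Tent 1) (Tent r)" and r: "1 <= r"
  shows "f (Complex 0 t) \<in> points (Tent 1)" "f (Complex 1 t) \<in> points (Tent r)"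
    "norm_on (Tent 1) (f (Complex 0 t)) <= calderon_norm (Tent 1) (Tent r) f"
    "norm_on (Tent r) (f (Complex 1 t)) <= calderon_norm (Tent 1) (Tent r) f"
proof -
  have c: "continuous_in (Tent 1) (UNIV :: real set) (%t. f (Complex 0 t))"
    "continuous_in (Tent r) (UNIV :: real set) (%t. f (Complex 1 t))"
    and l: "((%t. norm_on (Tent 1) (f (Complex 0 t))) \<longlongrightarrow> 0) at_infinity"
    "((%t. norm_on (Tent r) (f (Complex 1 t))) \<longlongrightarrow> 0) at_infinity"
    using f by (auto simp: calderon_functions_def)
  show "f (Complex 0 t) \<in> points (Tent 1)" "f (Complex 1 t) \<in> points (Tent r)"
    using c by (auto simp: continuous_in_def)
  have tri: "norm_on (Tent q) u <= norm_on (Tent q) v + norm_on (Tent q) (u - v)"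
    if "u \<in> points (Tent q)" "v \<in> points (Tent q)" "1 <= q"
    for q :: real and u v :: "('m, 'x) tent_operator"
    using tent_space_add(2)[OF that(2) tent_space_diff[OF that] that(3)] by simp
  have "bdd_above (range (%t. norm_on (Tent 1) (f (Complex 0 t))))"
    by (rule boundary_norm_bdd_above[OF c(1) l(1) _ tent_norm_diff_commute], rule tri) auto
  then have "norm_on (Tent 1) (f (Complex 0 t)) <= (SUP t. norm_on (Tent 1) (f (Complex 0 t)))"
    by (intro cSUP_upper) auto
  then show "norm_on (Tent 1) (f (Complex 0 t)) <= calderon_norm (Tent 1) (Tent r) f"
    by (simp add: calderon_norm_def)
  have "bdd_above (range (%t. norm_on (Tent r) (f (Complex 1 t))))"
    by (rule boundary_norm_bdd_above[OF c(2) l(2) _ tent_norm_diff_commute], rule tri) (use r in auto)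
  then have "norm_on (Tent r) (f (Complex 1 t)) <= (SUP t. norm_on (Tent r) (f (Complex 1 t)))"
    by (intro cSUP_upper) auto
  then show "norm_on (Tent r) (f (Complex 1 t)) <= calderon_norm (Tent 1) (Tent r) f"
    by (simp add: calderon_norm_def)
qed

end

section \<open>Pairing with norming functionals\<close>

context metric_measure_space begin

text \<open>Membership of \<open>v\<close> is the premise of an implication, so that a functional
  can be selected for every \<open>v\<close> without side condition. The properties are asked for on
  \<open>gspace\<close>, where the norm is finite and \<open>norming_functional\<close>
  applies.\<close>

lemma norming_functional_exists:
  fixes v :: "('m, 'x::complex_banach) tent_operator"
  shows "\<exists>\<phi>. v \<in> gspace --> (\<forall>x\<in>gspace. \<forall>y\<in>gspace. \<phi> (x + y) = \<phi> x + \<phi> y) \<and>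
    (\<forall>c. \<forall>x\<in>gspace. \<phi> (c *\<^sub>C x) = c * \<phi> x) \<and> (\<forall>x\<in>gspace. ennreal (cmod (\<phi> x)) <= gam x) \<and>
    ennreal (cmod (\<phi> v)) = gam v"
proof (cases "v \<in> gspace")
  case True
  interpret seminormed_subspace "gspace :: ('m, 'x) tent_operator set" "%u. enn2real (gam u)"
  proof
    fix x y :: "('m, 'x) tent_operator" and c
    assume x: "x \<in> gspace"
    show "c *\<^sub>C x \<in> gspace" by (rule gamma_space_scaleC[OF x])
    show "enn2real (gam (c *\<^sub>C x)) = cmod c * enn2real (gam x)"
      by (simp add: gamma_norm_scaleC enn2real_mult)
    assume y: "y \<in> gspace"
    show "x + y \<in> gspace" by (rule gamma_space_add[OF x y])
    have "enn2real (gam (x + y)) <= enn2real (gam x + gam y)"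
      using gamma_space_finite[OF x] gamma_space_finite[OF y]
      by (intro enn2real_mono gamma_norm_add) (simp add: ennreal_add_less_top)
    then show "enn2real (gam (x + y)) <= enn2real (gam x) + enn2real (gam y)"
      using gamma_space_finite[OF x] gamma_space_finite[OF y] by (simp add: enn2real_plus)
  qed (rule gamma_space_zero)
  have fin: "gam x = ennreal (enn2real (gam x))" if "x \<in> gspace" for x :: "('m, 'x) tent_operator"
    using gamma_space_finite[OF that] by simp
  obtain \<phi> where \<phi>: "!!x y. x \<in> gspace ==> y \<in> gspace ==> \<phi> (x + y) = \<phi> x + \<phi> y"
    "!!c x. x \<in> gspace ==> \<phi> (c *\<^sub>C x) = c * \<phi> x" "!!x. x \<in> gspace ==> cmod (\<phi> x) <= enn2real (gam x)"
    "cmod (\<phi> v) = enn2real (gam v)"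
    using norming_functional[OF True] by blast
  have "ennreal (cmod (\<phi> x)) <= gam x" if "x \<in> gspace" for x
    by (subst fin[OF that]) (intro ennreal_leI \<phi> that)
  moreover have "ennreal (cmod (\<phi> v)) = gam v" by (subst fin[OF True]) (simp only: \<phi>)
  ultimately show ?thesis using \<phi>(1,2) by (intro exI[of _ \<phi>]) blast
qed simp

text \<open>The functional depends on the operator alone; along a simple function it takes finitely
  many values, which settles its measurability.\<close>

definition norming :: "('m, 'x::complex_banach) tent_operator => ('m, 'x) tent_operator => complex" where
  "norming v = (SOME \<phi>. v \<in> gspace --> (\<forall>x\<in>gspace. \<forall>y\<in>gspace. \<phi> (x + y) = \<phi> x + \<phi> y) \<and>
    (\<forall>c. \<forall>x\<in>gspace. \<phi> (c *\<^sub>C x) = c * \<phi> x) \<and> (\<forall>x\<in>gspace. ennreal (cmod (\<phi> x)) <= gam x) \<and>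
    ennreal (cmod (\<phi> v)) = gam v)"

lemma norming:
  assumes "v \<in> gspace"
  shows "x \<in> gspace ==> y \<in> gspace ==> norming v (x + y) = norming v x + norming v y"
    "x \<in> gspace ==> norming v (c *\<^sub>C x) = c * norming v x"
    "x \<in> gspace ==> ennreal (cmod (norming v x)) <= gam x"
    "ennreal (cmod (norming v v)) = gam v"
  using someI_ex[OF norming_functional_exists[of v], folded norming_def] assms by blast+

lemma norming_diff:
  assumes "v \<in> gspace" "x \<in> gspace" "y \<in> gspace"
  shows "norming v (x - y) = norming v x - norming v y"
  using norming(1)[OF assms(1) gamma_space_diff[OF assms(2,3)] assms(3)] by simp

text \<open>\<open>s\<close> and the approximants of \<open>F\<close> are simple, so the
  approximating scalar functions are simple whatever functionals were selected. Their limit is the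
  pairing wherever the approximation converges.\<close>

lemma pairing_measurable:
  assumes F: "gsm F" and s: "simple_function \<mu> s" "!!x. s x \<in> gspace"
  shows "\<exists>g. g \<in> borel_measurable \<mu> \<and> (AE x in \<mu>. g x = norming (s x) (F x))"
proof -
  obtain t where t: "!!n::nat. simple_function \<mu> (t n)" "!!n x. t n x \<in> gspace"
    "AE x in \<mu>. (%n. gam (t n x - F x)) \<longlonglongrightarrow> 0" using gsmE[OF F] by blast
  define g where "g x = lim (%n. norming (s x) (t n x))" for x
  have "g \<in> borel_measurable \<mu>"
    unfolding g_def
    by (intro borel_measurable_lim_metric borel_measurable_simple_function
      simple_function_compose2[where h=norming] s t)
  moreover have "AE x in \<mu>. g x = norming (s x) (F x)"
    using t(3) gsm_AE[OF F]
  proof eventually_elim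
    case (elim x)
    have "(%n. enn2real (gam (t n x - F x))) \<longlonglongrightarrow> 0"
      by (rule tendsto_enn2real) (use elim in auto)
    then have "(%n. norming (s x) (t n x) - norming (s x) (F x)) \<longlonglongrightarrow> 0"
    proof (rule Lim_null_comparison[rotated], intro always_eventually allI)
      fix n
      have d: "t n x - F x \<in> gspace" by (intro gamma_space_diff t elim)
      have "ennreal (cmod (norming (s x) (t n x - F x))) <= gam (t n x - F x)" by (rule norming(3)[OF s(2) d])
      then have "cmod (norming (s x) (t n x - F x)) <= enn2real (gam (t n x - F x))"
        using gamma_space_finite[OF d] by (metis enn2real_mono enn2real_ennreal norm_ge_zero)
      then show "cmod (norming (s x) (t n x) - norming (s x) (F x)) <= enn2real (gam (t n x - F x))"
        by (simp only: norming_diff[OF s(2) t(2) elim(2)])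
    qed
    then show ?case unfolding g_def by (intro limI) (simp add: LIM_zero_iff)
  qed
  ultimately show ?thesis by blast
qed

end

text \<open>The simple function \<open>s\<close> fixes one functional on \<open>gspace\<close> at
  every vertex. In the application \<open>s\<close> approximates the cone restrictions of the
  operator to be estimated, so that the functionals nearly norm them.\<close>

locale tent_pairing = metric_measure_space \<mu>
  for \<mu> :: "'m::metric_space measure" +
  fixes s :: "'m => ('m, 'x::complex_banach) tent_operator"
  assumes s_simple: "simple_function \<mu> s" and s_gspace: "!!x. s x \<in> gspace"
begin

text \<open>A measurable representative of the scalar function that the functionals extract from the
  cone restrictions of \<open>v\<close>; measurability is obtained after a change on a null
  set.\<close>

definition rep :: "('m, 'x) tent_operator => 'm => complex" where
  "rep v = (SOME g. g \<in> borel_measurable \<mu> \<and>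
    (AE x in \<mu>. g x = norming (s x) (restrict_operator v (cone_at x))))"

lemma rep:
  assumes "cone_gsm v"
  shows "rep v \<in> borel_measurable \<mu>" "AE x in \<mu>. rep v x = norming (s x) (restrict_operator v (cone_at x))"
  using someI_ex[OF pairing_measurable[OF assms s_simple s_gspace], folded rep_def] by blast+

lemma rep_le:
  assumes "cone_gsm v" shows "AE x in \<mu>. ennreal (cmod (rep v x)) <= sqf v x"
  using rep(2)[OF assms] gsm_AE[OF assms]
proof eventually_elim
  case (elim x)
  show ?case unfolding square_function_def elim(1) by (rule norming(3)[OF s_gspace elim(2)])
qed

lemma rep_add:
  assumes "cone_gsm u" "cone_gsm v" shows "AE x in \<mu>. rep (u + v) x = rep u x + rep v x"
  using rep(2)[OF assms(1)] rep(2)[OF assms(2)] rep(2)[OF cone_gsm_add[OF assms]] gsm_AE[OF assms(1)] gsm_AE[OF assms(2)]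
proof eventually_elim
  case (elim x)
  have "restrict_operator (u + v) (cone_at x) = restrict_operator u (cone_at x) + restrict_operator v (cone_at x)"
    by (rule ext) (simp add: restrict_operator_def)
  then show ?case unfolding elim(1-3) by (simp only: norming(1)[OF s_gspace elim(4,5)])
qed

lemma rep_scaleC:
  assumes "cone_gsm v" shows "AE x in \<mu>. rep (c *\<^sub>C v) x = c * rep v x"
  using rep(2)[OF assms] rep(2)[OF cone_gsm_scaleC[OF assms, of c]] gsm_AE[OF assms]
proof eventually_elim
  case (elim x)
  show ?case unfolding elim(1,2) restrict_operator_scaleC by (rule norming(2)[OF s_gspace elim(3)])
qed

definition pairing :: "('m => complex) => ('m, 'x) tent_operator => complex" where
  "pairing \<omega> v = (\<integral>x. \<omega> x * rep v x \<partial>\<mu>)"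

lemma pairing_le:
  assumes v: "cone_gsm v" and \<omega> [measurable]: "\<omega> \<in> borel_measurable \<mu>" and c: "c \<ge> 0"
    and le: "(\<integral>\<^sup>+x. ennreal (cmod (\<omega> x)) * sqf v x \<partial>\<mu>) <= ennreal c"
  shows "integrable \<mu> (%x. \<omega> x * rep v x)" "cmod (pairing \<omega> v) <= c"
proof -
  have [measurable]: "rep v \<in> borel_measurable \<mu>" by (rule rep[OF v])
  have "(\<integral>\<^sup>+x. ennreal (cmod (\<omega> x * rep v x)) \<partial>\<mu>) <= (\<integral>\<^sup>+x. ennreal (cmod (\<omega> x)) * sqf v x \<partial>\<mu>)"
    using rep_le[OF v]
    by (intro nn_integral_mono_AE, eventually_elim) (simp add: norm_mult ennreal_mult mult_left_mono)
  also note le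
  finally have *: "(\<integral>\<^sup>+x. ennreal (cmod (\<omega> x * rep v x)) \<partial>\<mu>) <= ennreal c" .
  show int: "integrable \<mu> (%x. \<omega> x * rep v x)"
    by (rule integrableI_bounded) (use * in \<open>auto intro: le_less_trans\<close>)
  have "ennreal (cmod (pairing \<omega> v)) <= ennreal c"
    unfolding pairing_def using integral_norm_bound_ennreal[OF int] * by (rule order_trans)
  then show "cmod (pairing \<omega> v) <= c" using c by simp
qed

lemma pairing_T1:
  assumes v: "v \<in> points (Tent 1)" and \<omega>: "\<omega> \<in> borel_measurable \<mu>" "!!x. cmod (\<omega> x) <= 1"
  shows "integrable \<mu> (%x. \<omega> x * rep v x)" "cmod (pairing \<omega> v) <= norm_on (Tent 1) v"
proof -
  have "(\<integral>\<^sup>+x. ennreal (cmod (\<omega> x)) * sqf v x \<partial>\<mu>) <= (\<integral>\<^sup>+x. 1 * sqf v x \<partial>\<mu>)"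
    using \<omega>(2) by (intro nn_integral_mono mult_right_mono) auto
  also have "... <= ennreal (norm_on (Tent 1) v)"
    using tent_norm_integral[OF v] by simp
  finally have le: "(\<integral>\<^sup>+x. ennreal (cmod (\<omega> x)) * sqf v x \<partial>\<mu>) <= ennreal (norm_on (Tent 1) v)" .
  have "cone_gsm v" using v unfolding tent_points_iff by blast
  from pairing_le[OF this \<omega>(1) tent_norm_nonneg le]
  show "integrable \<mu> (%x. \<omega> x * rep v x)" "cmod (pairing \<omega> v) <= norm_on (Tent 1) v" .
qed

text \<open>Hoelder's inequality derived from Young's. The scaling uses numbers \<open>M\<close>
  above the norm rather than the norm itself, which may be 0; the bound by the norm follows since
  \<open>M\<close> is arbitrary.\<close>

lemma pairing_Tr:
  assumes v: "v \<in> points (Tent r)" and r: "1 < r" and \<omega> [measurable]: "\<omega> \<in> borel_measurable \<mu>"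
    and le1: "(\<integral>\<^sup>+x. ennreal (cmod (\<omega> x) powr (r / (r - 1))) \<partial>\<mu>) <= 1"
  shows "integrable \<mu> (%x. \<omega> x * rep v x)" "cmod (pairing \<omega> v) <= norm_on (Tent r) v"
proof -
  let ?n = "norm_on (Tent r) v" and ?r' = "r / (r - 1)"
  have r': "1 < ?r'" "1 / ?r' + 1 / r = 1" using r by (simp_all add: field_simps)
  have vc: "cone_gsm v" using v unfolding tent_points_iff by blast
  have [measurable]: "sqf v \<in> borel_measurable \<mu>"
    using v unfolding tent_points_iff by (intro square_function_measurable gsm_square_finite) auto
  have main: "(\<integral>\<^sup>+x. ennreal (cmod (\<omega> x)) * sqf v x \<partial>\<mu>) <= ennreal M" if M: "M > ?n" for M
  proof -
    have M0: "M > 0" using M tent_norm_nonneg[of r v] by linarith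
    \<comment> \<open>Young's inequality is applied to \<open>cmod (\<omega> x)\<close> and the
      square function divided by \<open>M\<close>, then multiplied by \<open>M\<close>; with these
      constants the two integrals contribute at most M/r' + M/r = M.\<close>
    define a where "a = M / ?r'"
    define b where "b = M / (r * M powr r)"
    have ab: "0 <= a" "0 <= b" using M0 r by (auto simp: a_def b_def)
    have "(\<integral>\<^sup>+x. ennreal (cmod (\<omega> x)) * sqf v x \<partial>\<mu>) \<le>
      (\<integral>\<^sup>+x. ennreal a * ennreal (cmod (\<omega> x) powr ?r') + ennreal b * ennreal_powr (sqf v x) r \<partial>\<mu>)"
    proof (rule nn_integral_mono_AE)
      show "AE x in \<mu>. ennreal (cmod (\<omega> x)) * sqf v x \<le>
        ennreal a * ennreal (cmod (\<omega> x) powr ?r') + ennreal b * ennreal_powr (sqf v x) r"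
        using gsm_square_finite[OF vc]
      proof eventually_elim
        case (elim x)
        then obtain y where y: "sqf v x = ennreal y" "0 <= y" by (cases "sqf v x") auto
        have "cmod (\<omega> x) * (y / M) <= cmod (\<omega> x) powr ?r' / ?r' + (y / M) powr r / r"
          using y M0 by (intro Youngs_inequality r' r) auto
        then have "M * (cmod (\<omega> x) * (y / M)) <= M * (cmod (\<omega> x) powr ?r' / ?r' + (y / M) powr r / r)"
          using M0 by (intro mult_left_mono) auto
        also have "... = a * cmod (\<omega> x) powr ?r' + b * y powr r"
          using M0 y by (simp add: a_def b_def powr_divide distrib_left mult_ac)
        also have "M * (cmod (\<omega> x) * (y / M)) = cmod (\<omega> x) * y" using M0 by simp
        finally have "ennreal (cmod (\<omega> x) * y) <= ennreal (a * cmod (\<omega> x) powr ?r' + b * y powr r)" by (rule ennreal_leI)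
        then show ?case unfolding y(1) using ab y(2)
          by (simp add: ennreal_powr_ennreal ennreal_mult ennreal_plus del: times_divide_eq_right)
      qed
    qed
    also have "... = ennreal a * (\<integral>\<^sup>+x. ennreal (cmod (\<omega> x) powr ?r') \<partial>\<mu>) +
      ennreal b * (\<integral>\<^sup>+x. ennreal_powr (sqf v x) r \<partial>\<mu>)"
      by (subst nn_integral_add) (auto simp: nn_integral_cmult)
    also have "... <= ennreal a * 1 + ennreal b * ennreal (M powr r)"
    proof (intro add_mono mult_left_mono le1 order_trans[OF tent_norm_integral[OF v]] ennreal_leI powr_mono2)
    qed (use r M in auto)
    also have "... = ennreal (a + b * M powr r)" using ab by (simp add: ennreal_mult ennreal_plus)
    also have "a + b * M powr r = M * (1 / ?r' + 1 / r)" using M0 by (simp add: a_def b_def distrib_left)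
    finally show ?thesis unfolding r' by simp
  qed
  have *: "integrable \<mu> (%x. \<omega> x * rep v x)" "cmod (pairing \<omega> v) <= M" if "M > ?n" for M
    using pairing_le[OF vc \<omega> _ main[OF that]] that tent_norm_nonneg[of r v] by auto
  show "integrable \<mu> (%x. \<omega> x * rep v x)" by (rule *(1)[of "?n + 1"]) simp
  show "cmod (pairing \<omega> v) <= ?n" by (rule dense_ge) (rule *(2))
qed

lemma pairing_scaleC:
  assumes v: "cone_gsm v" and [measurable]: "\<omega> \<in> borel_measurable \<mu>"
  shows "pairing \<omega> (c *\<^sub>C v) = c * pairing \<omega> v"
proof -
  have [measurable]: "rep v \<in> borel_measurable \<mu>" "rep (c *\<^sub>C v) \<in> borel_measurable \<mu>"
    by (intro rep v cone_gsm_scaleC)+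
  have "pairing \<omega> (c *\<^sub>C v) = (\<integral>x. c * (\<omega> x * rep v x) \<partial>\<mu>)"
    unfolding pairing_def using rep_scaleC[OF v, of c]
    by (intro integral_cong_AE) (auto elim!: eventually_mono)
  then show ?thesis by (simp add: pairing_def)
qed

lemma pairing_add:
  assumes u: "cone_gsm u" and v: "cone_gsm v" and [measurable]: "\<omega> \<in> borel_measurable \<mu>"
    and i: "integrable \<mu> (%x. \<omega> x * rep u x)" "integrable \<mu> (%x. \<omega> x * rep v x)"
  shows "pairing \<omega> (u + v) = pairing \<omega> u + pairing \<omega> v" "integrable \<mu> (%x. \<omega> x * rep (u + v) x)"
proof -
  have [measurable]: "rep u \<in> borel_measurable \<mu>" "rep v \<in> borel_measurable \<mu>" "rep (u + v) \<in> borel_measurable \<mu>"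
    by (intro rep u v cone_gsm_add)+
  have eq: "AE x in \<mu>. \<omega> x * rep (u + v) x = \<omega> x * rep u x + \<omega> x * rep v x"
    using rep_add[OF u v] by eventually_elim (simp add: distrib_left)
  have "pairing \<omega> (u + v) = (\<integral>x. \<omega> x * rep u x + \<omega> x * rep v x \<partial>\<mu>)"
    unfolding pairing_def by (intro integral_cong_AE eq) auto
  then show "pairing \<omega> (u + v) = pairing \<omega> u + pairing \<omega> v" using i by (simp add: pairing_def)
  have "integrable \<mu> (%x. \<omega> x * rep u x + \<omega> x * rep v x)" using i by simp
  then show "integrable \<mu> (%x. \<omega> x * rep (u + v) x)"
    by (subst integrable_cong_AE[OF _ _ eq]) auto
qed

lemma pairing_weight_sum:
  assumes "!!k. k \<in> K ==> integrable \<mu> (%x. \<omega> k x * rep v x)"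
  shows "pairing (%x. \<Sum>k\<in>K. c k * \<omega> k x) v = (\<Sum>k\<in>K. c k * pairing (\<omega> k) v)"
proof -
  have "pairing (%x. \<Sum>k\<in>K. c k * \<omega> k x) v = (\<integral>x. (\<Sum>k\<in>K. c k * (\<omega> k x * rep v x)) \<partial>\<mu>)"
    unfolding pairing_def by (simp only: sum_distrib_right mult.assoc)
  also have "... = (\<Sum>k\<in>K. \<integral>x. c k * (\<omega> k x * rep v x) \<partial>\<mu>)"
    by (intro Bochner_Integration.integral_sum integrable_mult_right assms)
  finally show ?thesis by (simp add: pairing_def)
qed

text \<open>Boundedness makes the pairing continuous on \<open>Tent 1\<close>; together with the
  finite measure of the support it makes it continuous on \<open>Tent r\<close>.\<close>

definition weight :: "('m => complex) => bool" where
  "weight \<omega> \<longleftrightarrow> \<omega> \<in> borel_measurable \<mu> \<and> (\<forall>x. cmod (\<omega> x) <= 1) \<and> emeasure \<mu> {x \<in> space \<mu>. \<omega> x \<noteq> 0} < \<top>"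

text \<open>A functional bounded on both spaces is bounded on their sum, by the infimum over all
  decompositions. On \<open>Tent r\<close> the weight must first be normalised in the dual
  exponent.\<close>

lemma pairing_tent_sum:
  assumes \<omega>: "weight \<omega>" and r: "1 < r"
  obtains C where "C > 0" "!!v. v \<in> points (tent_sum r) ==> integrable \<mu> (%x. \<omega> x * rep v x)"
    "!!v. v \<in> points (tent_sum r) ==> cmod (pairing \<omega> v) <= C * norm_on (tent_sum r) v"
proof -
  have \<omega>m [measurable]: "\<omega> \<in> borel_measurable \<mu>" and \<omega>1: "!!x. cmod (\<omega> x) <= 1"
    and fin: "emeasure \<mu> {x \<in> space \<mu>. \<omega> x \<noteq> 0} < \<top>" using \<omega> unfolding weight_def by blast+
  define D where "D = {x \<in> space \<mu>. \<omega> x \<noteq> 0}"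
  have D [measurable]: "D \<in> sets \<mu>" unfolding D_def by measurable
  define m where "m = measure \<mu> D"
  have em: "emeasure \<mu> D = ennreal m"
    using fin unfolding m_def D_def[symmetric] by (simp add: emeasure_eq_ennreal_measure less_top)
  \<comment> \<open>The power r/(r-1) of \<open>c\<close> is 1/(m+1), so the scaled weight has norm
    at most 1 in the dual exponent; \<open>m + 1\<close> instead of \<open>m\<close> admits a null
    support.\<close>
  define c where "c = (m + 1) powr (- (r - 1) / r)"
  have m: "0 <= m" by (simp add: m_def)
  then have c: "c > 0" by (simp add: c_def)
  have cp: "c powr (r / (r - 1)) = 1 / (m + 1)"
  proof -
    have "- (r - 1) / r * (r / (r - 1)) = -1" using r by (simp add: field_simps)
    then have "c powr (r / (r - 1)) = (m + 1) powr - 1" by (simp only: c_def powr_powr)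
    also have "... = 1 / (m + 1)" using m by (simp add: powr_minus_divide)
    finally show ?thesis .
  qed
  have le1: "(\<integral>\<^sup>+x. ennreal (cmod (of_real c * \<omega> x) powr (r / (r - 1))) \<partial>\<mu>) <= 1"
  proof -
    have "ennreal (cmod (of_real c * \<omega> x) powr (r / (r - 1))) \<le>
        ennreal (1 / (m + 1)) * indicator D x" if "x \<in> space \<mu>" for x
    proof (cases "\<omega> x = 0")
      case False
      have "cmod (of_real c * \<omega> x) <= c" using \<omega>1[of x] c by (simp add: norm_mult mult_left_le)
      then have "cmod (of_real c * \<omega> x) powr (r / (r - 1)) <= c powr (r / (r - 1))"
        using r by (intro powr_mono2) auto
      moreover have "x \<in> D" using False that by (simp add: D_def)
      ultimately show ?thesis unfolding cp by (simp add: ennreal_leI)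
    qed simp
    then have "(\<integral>\<^sup>+x. ennreal (cmod (of_real c * \<omega> x) powr (r / (r - 1))) \<partial>\<mu>) \<le>
        (\<integral>\<^sup>+x. ennreal (1 / (m + 1)) * indicator D x \<partial>\<mu>)"
      by (rule nn_integral_mono)
    also have "... = ennreal (1 / (m + 1)) * ennreal m"
      unfolding nn_integral_cmult_indicator[OF D] em by (rule refl)
    also have "... = ennreal (1 / (m + 1) * m)" using m by (simp add: ennreal_mult[symmetric])
    also have "... <= ennreal 1" using m by (intro ennreal_leI) (simp add: field_simps)
    finally show ?thesis by simp
  qed
  have Tr: "integrable \<mu> (%x. \<omega> x * rep b x)" "cmod (pairing \<omega> b) <= 1 / c * norm_on (Tent r) b"
    if b: "b \<in> points (Tent r)" for b
  proof -
    have i: "integrable \<mu> (%x. (of_real c * \<omega> x) * rep b x)"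
      and l: "cmod (pairing (%x. of_real c * \<omega> x) b) <= norm_on (Tent r) b"
      by (rule pairing_Tr[OF b r _ le1]; measurable)+
    have "integrable \<mu> (%x. of_real (1 / c) * ((of_real c * \<omega> x) * rep b x))" by (rule integrable_mult_right[OF i])
    moreover have "(%x. of_real (1 / c) * ((of_real c * \<omega> x) * rep b x)) = (%x. \<omega> x * rep b x)"
      using c by (simp add: fun_eq_iff)
    ultimately show "integrable \<mu> (%x. \<omega> x * rep b x)" by simp
    have "pairing (%x. of_real c * \<omega> x) b = of_real c * pairing \<omega> b" by (simp add: pairing_def mult.assoc)
    then show "cmod (pairing \<omega> b) <= 1 / c * norm_on (Tent r) b"
      using l c by (simp add: norm_mult field_simps)
  qed
  define C where "C = max 1 (1 / c)"
  have C: "C > 0" "1 <= C" "1 / c <= C" by (auto simp: C_def)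
  have dec: "integrable \<mu> (%x. \<omega> x * rep (a + b) x)"
    "cmod (pairing \<omega> (a + b)) <= C * (norm_on (Tent 1) a + norm_on (Tent r) b)"
    if a: "a \<in> points (Tent 1)" and b: "b \<in> points (Tent r)" for a b
  proof -
    have cg: "cone_gsm a" "cone_gsm b" using a b unfolding tent_points_iff by blast+
    note * = pairing_add[OF cg \<omega>m pairing_T1(1)[OF a \<omega>m \<omega>1] Tr(1)[OF b]]
    show "integrable \<mu> (%x. \<omega> x * rep (a + b) x)" by (rule *)
    have "cmod (pairing \<omega> (a + b)) <= cmod (pairing \<omega> a) + cmod (pairing \<omega> b)"
      unfolding *(1) by (rule norm_triangle_ineq)
    also have "... <= 1 * norm_on (Tent 1) a + 1 / c * norm_on (Tent r) b"
      using pairing_T1(2)[OF a \<omega>m \<omega>1] Tr(2)[OF b] by simp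
    also have "... <= C * norm_on (Tent 1) a + C * norm_on (Tent r) b"
      by (intro add_mono mult_right_mono C tent_norm_nonneg)
    finally show "cmod (pairing \<omega> (a + b)) <= C * (norm_on (Tent 1) a + norm_on (Tent r) b)"
      by (simp only: distrib_left)
  qed
  show ?thesis
  proof (rule that[OF C(1)])
    fix v :: "('m, 'x) tent_operator" assume v: "v \<in> points (tent_sum r)"
    then obtain a b where ab: "a \<in> points (Tent 1)" "b \<in> points (Tent r)" "v = a + b"
      unfolding tent_sum_points by blast
    show "integrable \<mu> (%x. \<omega> x * rep v x)" unfolding ab(3) by (rule dec[OF ab(1,2)])
    have "cmod (pairing \<omega> v) / C <= norm_on (tent_sum r) v"
      unfolding sum_space_def normed_subspace.simps
    proof (rule cInf_greatest)
      show "{norm_on (Tent 1) a + norm_on (Tent r) b |a b.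
        a \<in> points (Tent 1) \<and> b \<in> points (Tent r) \<and> v = a + b} \<noteq> {}" using ab by blast
      fix y assume "y \<in> {norm_on (Tent 1) a + norm_on (Tent r) b |a b.
        a \<in> points (Tent 1) \<and> b \<in> points (Tent r) \<and> v = a + b}"
      then obtain a b where "a \<in> points (Tent 1)" "b \<in> points (Tent r)" "v = a + b"
        "y = norm_on (Tent 1) a + norm_on (Tent r) b" by blast
      then show "cmod (pairing \<omega> v) / C <= y" using dec(2)[of a b] C(1) by (simp add: field_simps)
    qed
    then show "cmod (pairing \<omega> v) <= C * norm_on (tent_sum r) v" using C(1) by (simp add: field_simps)
  qed
qed

lemma pairing_tent_sum_integrable:
  assumes \<omega>: "weight \<omega>" and r: "1 < r" and v: "v \<in> points (tent_sum r)"
  shows "integrable \<mu> (%x. \<omega> x * rep v x)"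
proof (rule pairing_tent_sum[OF \<omega> r])
  fix C :: real
  assume "!!v. v \<in> points (tent_sum r) ==> integrable \<mu> (%x. \<omega> x * rep v x)"
  from this[OF v] show ?thesis .
qed

lemma pairing_tent_sum_diff:
  assumes \<omega>: "weight \<omega>" and r: "1 < r" and u: "u \<in> points (tent_sum r)" and v: "v \<in> points (tent_sum r)"
  shows "pairing \<omega> (u - v) = pairing \<omega> u - pairing \<omega> v"
proof -
  have \<omega>m: "\<omega> \<in> borel_measurable \<mu>" using \<omega> by (simp add: weight_def)
  have d: "u - v \<in> points (tent_sum r)" using r by (intro tent_sum_diff u v) simp
  have "pairing \<omega> ((u - v) + v) = pairing \<omega> (u - v) + pairing \<omega> v"
    by (intro pairing_add tent_sum_cone_gsm(1)[OF d] tent_sum_cone_gsm(1)[OF v] \<omega>m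
      pairing_tent_sum_integrable[OF \<omega> r] d v)
  then show ?thesis by simp
qed

text \<open>The pairing is linear and bounded on the sum space, so the vector-valued conditions of
  \<open>calderon_functions\<close> pass to a scalar function.\<close>

lemma pairing_calderon:
  assumes \<omega>: "weight \<omega>" and r: "1 < r" and f: "f \<in> calderon_functions (Tent 1) (Tent r)"
  shows "continuous_on {z. 0 <= Re z \<and> Re z <= 1} (%z. pairing \<omega> (f z))"
    "(%z. pairing \<omega> (f z)) holomorphic_on {z. 0 < Re z \<and> Re z < 1}"
    "\<exists>M. \<forall>z. 0 <= Re z \<and> Re z <= 1 --> cmod (pairing \<omega> (f z)) <= M"
proof -
  have \<omega>m: "\<omega> \<in> borel_measurable \<mu>" using \<omega> by (simp add: weight_def)
  have r1: "1 <= r" using r by simp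
  have "\<exists>C>0. \<forall>v\<in>points (tent_sum r). cmod (pairing \<omega> v) <= C * norm_on (tent_sum r) v"
    by (rule pairing_tent_sum[OF \<omega> r]) blast
  then obtain C where C: "C > 0" "!!v. v \<in> points (tent_sum r) ==> cmod (pairing \<omega> v) <= C * norm_on (tent_sum r) v"
    by blast
  let ?S = "{z. 0 <= Re z \<and> Re z <= 1}" and ?I = "{z. 0 < Re z \<and> Re z < 1}"
  have cont: "continuous_in (tent_sum r) ?S f" and hol: "holomorphic_in (tent_sum r) ?I f"
    and bdd: "\<exists>M. \<forall>z. 0 <= Re z \<and> Re z <= 1 --> norm_on (tent_sum r) (f z) <= M"
    using f unfolding calderon_functions_def by blast+
  have pts: "f z \<in> points (tent_sum r)" if "z \<in> ?S" for z using cont that unfolding continuous_in_def by blast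
  show "continuous_on ?S (%z. pairing \<omega> (f z))"
    unfolding continuous_on_def
  proof (rule ballI)
    fix z assume z: "z \<in> ?S"
    have "((%w. norm_on (tent_sum r) (f w - f z)) \<longlongrightarrow> 0) (at z within ?S)"
      using cont z unfolding continuous_in_def by blast
    then have "((%w. C * norm_on (tent_sum r) (f w - f z)) \<longlongrightarrow> 0) (at z within ?S)"
      by (rule tendsto_mult_right_zero)
    then have "((%w. pairing \<omega> (f w) - pairing \<omega> (f z)) \<longlongrightarrow> 0) (at z within ?S)"
    proof (rule Lim_null_comparison[rotated])
      show "\<forall>\<^sub>F w in at z within ?S. norm (pairing \<omega> (f w) - pairing \<omega> (f z)) <= C * norm_on (tent_sum r) (f w - f z)"
        unfolding eventually_at_filter
      proof (intro always_eventually allI impI)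
        fix w assume "w \<in> ?S"
        show "norm (pairing \<omega> (f w) - pairing \<omega> (f z)) <= C * norm_on (tent_sum r) (f w - f z)"
          unfolding pairing_tent_sum_diff[OF \<omega> r pts[OF \<open>w \<in> ?S\<close>] pts[OF z], symmetric]
          by (intro C(2) tent_sum_diff pts z \<open>w \<in> ?S\<close> r1)
      qed
    qed
    then show "((%w. pairing \<omega> (f w)) \<longlongrightarrow> pairing \<omega> (f z)) (at z within ?S)" by (simp add: LIM_zero_iff)
  qed
  show "(%z. pairing \<omega> (f z)) holomorphic_on ?I"
    unfolding holomorphic_on_def field_differentiable_def
  proof (rule ballI)
    fix z assume z: "z \<in> ?I"
    have zS: "z \<in> ?S" using z by auto
    obtain d where d: "d \<in> points (tent_sum r)"
      "((%w. norm_on (tent_sum r) (inverse (w - z) *\<^sub>C (f w - f z) - d)) \<longlongrightarrow> 0) (at z within ?I)"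
      using hol z unfolding holomorphic_in_def by blast
    have "((%w. C * norm_on (tent_sum r) (inverse (w - z) *\<^sub>C (f w - f z) - d)) \<longlongrightarrow> 0) (at z within ?I)"
      by (rule tendsto_mult_right_zero[OF d(2)])
    then have "((%w. (pairing \<omega> (f w) - pairing \<omega> (f z)) / (w - z) - pairing \<omega> d) \<longlongrightarrow> 0) (at z within ?I)"
    proof (rule Lim_null_comparison[rotated])
      show "\<forall>\<^sub>F w in at z within ?I. norm ((pairing \<omega> (f w) - pairing \<omega> (f z)) / (w - z) - pairing \<omega> d)
          <= C * norm_on (tent_sum r) (inverse (w - z) *\<^sub>C (f w - f z) - d)"
        unfolding eventually_at_filter
      proof (intro always_eventually allI impI)
        fix w assume "w \<in> ?I"
        then have wS: "w \<in> ?S" by auto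
        have D: "f w - f z \<in> points (tent_sum r)" by (intro tent_sum_diff pts zS wS r1)
        have Q: "inverse (w - z) *\<^sub>C (f w - f z) \<in> points (tent_sum r)" by (intro tent_sum_scaleC D r1)
        have "(pairing \<omega> (f w) - pairing \<omega> (f z)) / (w - z) - pairing \<omega> d =
          pairing \<omega> (inverse (w - z) *\<^sub>C (f w - f z) - d)"
          unfolding pairing_tent_sum_diff[OF \<omega> r Q d(1)] pairing_scaleC[OF tent_sum_cone_gsm(1)[OF D] \<omega>m]
            pairing_tent_sum_diff[OF \<omega> r pts[OF wS] pts[OF zS]]
          by (simp add: divide_inverse mult.commute)
        then show "norm ((pairing \<omega> (f w) - pairing \<omega> (f z)) / (w - z) - pairing \<omega> d)
          <= C * norm_on (tent_sum r) (inverse (w - z) *\<^sub>C (f w - f z) - d)"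
          using C(2)[OF tent_sum_diff[OF Q d(1) r1]] by simp
      qed
    qed
    then have "((%w. (pairing \<omega> (f w) - pairing \<omega> (f z)) / (w - z)) \<longlongrightarrow> pairing \<omega> d) (at z within ?I)"
      by (simp add: LIM_zero_iff)
    then show "\<exists>D. ((%z. pairing \<omega> (f z)) has_field_derivative D) (at z within ?I)"
      unfolding has_field_derivative_iff by blast
  qed
  obtain M where M: "!!z. 0 <= Re z \<and> Re z <= 1 ==> norm_on (tent_sum r) (f z) <= M" using bdd by blast
  show "\<exists>M. \<forall>z. 0 <= Re z \<and> Re z <= 1 --> cmod (pairing \<omega> (f z)) <= M"
  proof (intro exI allI impI)
    fix z assume z: "0 <= Re z \<and> Re z <= 1"
    have "cmod (pairing \<omega> (f z)) <= C * norm_on (tent_sum r) (f z)" by (rule C(2), rule pts) (use z in simp)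
    also have "... <= C * M" using C(1) M[OF z] by (intro mult_left_mono) auto
    finally show "cmod (pairing \<omega> (f z)) <= C * M" .
  qed
qed

end

lemma nn_integral_le_of_limit:
  fixes f :: "nat => 'a => ennreal"
  assumes [measurable]: "!!n. f n \<in> borel_measurable M" and lim: "AE x in M. (%n. f n x) \<longlonglongrightarrow> g x"
    and le: "!!n. (\<integral>\<^sup>+x. f n x \<partial>M) <= c"
  shows "(\<integral>\<^sup>+x. g x \<partial>M) <= c"
proof -
  have "(\<integral>\<^sup>+x. g x \<partial>M) = (\<integral>\<^sup>+x. liminf (%n. f n x) \<partial>M)"
    using lim by (intro nn_integral_cong_AE, eventually_elim) (simp add: lim_imp_Liminf)
  also have "... <= liminf (%n. \<integral>\<^sup>+x. f n x \<partial>M)" by (rule nn_integral_liminf) measurable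
  also have "... <= liminf (%n::nat. c)" by (intro Liminf_mono always_eventually allI le)
  also have "... = c" by (rule Liminf_const) simp
  finally show ?thesis .
qed

context tent_pairing begin

text \<open>With \<open>S = (\<Sum>k\<in>K. b k powr p * measure \<mu> (B k))\<close> and \<open>q = 1 - 1 / r\<close>, the function
  \<open>H z = (\<Sum>k\<in>K. (b k powr p / S) powr (q * z) * pairing (\<omega> k) (f z))\<close> is bounded by \<open>N\<close> on the two
  boundary lines, because there the combined weight has norm at most 1 in \<open>L\<^sup>\<infinity>\<close> and in the dual of
  \<open>L\<^sup>r\<close>, respectively; at \<open>\<theta>\<close> it is at least \<open>S powr (1 / p)\<close>.\<close>

lemma level_sum_le:
  fixes p :: real
  assumes f: "f \<in> calderon_functions (Tent 1) (Tent r)" and r: "1 < r"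
    and \<theta>: "0 < \<theta>" "\<theta> < 1" and p: "1 / p = 1 - \<theta> * (1 - 1 / r)"
    and N: "0 < N" "calderon_norm (Tent 1) (Tent r) f <= N"
    and K: "finite K" and B: "!!k. k \<in> K ==> B k \<in> sets \<mu>" "!!k. k \<in> K ==> emeasure \<mu> (B k) < \<top>"
    and disj: "!!j k. j \<in> K ==> k \<in> K ==> j \<noteq> k ==> B j \<inter> B k = {}"
    and b: "!!k. k \<in> K ==> b k > 0" "!!k x. k \<in> K ==> x \<in> B k ==> b k <= cmod (rep (f (of_real \<theta>)) x)"
  shows "(\<Sum>k\<in>K. b k powr p * measure \<mu> (B k)) <= N powr p"
proof -
  define G where "G = f (of_real \<theta>)"
  define S where "S = (\<Sum>k\<in>K. b k powr p * measure \<mu> (B k))"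
  define q where "q = 1 - 1 / r"
  have q: "0 < q" "q < 1" using r by (auto simp: q_def)
  have "0 < 1 / p" unfolding p using \<theta> q mult_strict_mono[of \<theta> 1 q 1] by (simp add: q_def)
  then have p0: "p > 0" by simp
  have S0: "0 <= S" unfolding S_def by (intro sum_nonneg) auto
  show ?thesis
  proof (cases "S = 0")
    case True
    then show ?thesis by (simp add: S_def)
  next
    case False
    with S0 have S: "S > 0" by simp
    \<comment> \<open>The conjugate phase of \<open>rep G\<close> on \<open>B k\<close>, so that
      pairing it with \<open>G\<close> integrates the modulus of \<open>rep G\<close> over
      \<open>B k\<close>. Where \<open>rep G\<close> vanishes, division by zero gives 0.\<close>
    define \<omega> where "\<omega> k x = indicator (B k) x * (cnj (rep G x) / of_real (cmod (rep G x)))" for k x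
    \<comment> \<open>The logarithm of (b k^p / S)^q; the power with exponent q z thus becomes an
      exponential, entire in \<open>z\<close>.\<close>
    define \<alpha> where "\<alpha> k = q * (p * ln (b k) - ln S)" for k
    define \<Omega> where "\<Omega> z x = (\<Sum>k\<in>K. exp (z * of_real (\<alpha> k)) * \<omega> k x)" for z x
    define H where "H z = (\<Sum>k\<in>K. exp (z * of_real (\<alpha> k)) * pairing (\<omega> k) (f z))" for z
    have r1: "1 <= r" using r by simp
    have pts: "f z \<in> points (tent_sum r)" if "0 <= Re z" "Re z <= 1" for z
      using f that unfolding calderon_functions_def continuous_in_def by blast
    have Gp: "G \<in> points (tent_sum r)" unfolding G_def by (rule pts) (use \<theta> in auto)
    have [measurable]: "rep G \<in> borel_measurable \<mu>" by (intro rep tent_sum_cone_gsm(1)[OF Gp])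
    have \<omega>_meas: "\<omega> k \<in> borel_measurable \<mu>" if "k \<in> K" for k
    proof -
      note B(1)[OF that, measurable]
      show ?thesis unfolding \<omega>_def by measurable
    qed
    have \<omega>1: "cmod (\<omega> k x) <= 1" for k x by (auto simp: \<omega>_def norm_mult norm_divide indicator_def)
    have \<omega>0: "x \<notin> B k ==> \<omega> k x = 0" for k x by (simp add: \<omega>_def)
    have weight: "weight (\<omega> k)" if k: "k \<in> K" for k
    proof -
      have "emeasure \<mu> {x \<in> space \<mu>. \<omega> k x \<noteq> 0} <= emeasure \<mu> (B k)"
        using \<omega>0 B(1)[OF k] by (intro emeasure_mono) auto
      then show ?thesis using \<omega>_meas[OF k] \<omega>1 B(2)[OF k] unfolding weight_def by (auto intro: le_less_trans)
    qed
    have int: "integrable \<mu> (%x. \<omega> k x * rep v x)" if "k \<in> K" "v \<in> points (tent_sum r)" for k v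
      by (rule pairing_tent_sum_integrable[OF weight[OF that(1)] r that(2)])
    have H_eq: "H z = pairing (\<Omega> z) (f z)" if "0 <= Re z" "Re z <= 1" for z
      unfolding H_def \<Omega>_def by (rule pairing_weight_sum[symmetric]) (intro int pts that)
    have \<Omega>_meas: "\<Omega> z \<in> borel_measurable \<mu>" for z
      unfolding \<Omega>_def by (intro borel_measurable_sum borel_measurable_times borel_measurable_const \<omega>_meas)
    have \<Omega>_in: "\<Omega> z x = exp (z * of_real (\<alpha> j)) * \<omega> j x" if j: "j \<in> K" "x \<in> B j" for z x j
    proof -
      have "\<omega> k x = 0" if "k \<in> K - {j}" for k using disj[of j k] that j by (intro \<omega>0) auto
      then show ?thesis unfolding \<Omega>_def by (subst sum.remove[OF K j(1)]) simp
    qed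
    have \<Omega>_out: "\<Omega> z x = 0" if "x \<notin> (\<Union>k\<in>K. B k)" for z x
      unfolding \<Omega>_def using that \<omega>0 by (intro sum.neutral) auto
    have expn: "cmod (exp (z * of_real (\<alpha> k))) = exp (Re z * \<alpha> k)" for z k by (simp add: norm_exp_eq_Re)
    have left: "cmod (H (Complex 0 t)) <= N" for t
    proof -
      have "cmod (\<Omega> (Complex 0 t) x) <= 1" for x
      proof (cases "x \<in> (\<Union>k\<in>K. B k)")
        case True
        then obtain j where "j \<in> K" "x \<in> B j" by blast
        then show ?thesis using \<omega>1 by (simp add: \<Omega>_in norm_mult expn)
      qed (simp add: \<Omega>_out)
      then have "cmod (pairing (\<Omega> (Complex 0 t)) (f (Complex 0 t))) <= norm_on (Tent 1) (f (Complex 0 t))"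
        by (intro pairing_T1 calderon_boundary(1)[OF f r1] \<Omega>_meas)
      also have "... <= N" by (rule order_trans[OF calderon_boundary(3)[OF f r1] N(2)])
      finally show ?thesis by (simp add: H_eq)
    qed
    have right: "cmod (H (Complex 1 t)) <= N" for t
    proof -
      let ?r = "r / (r - 1)"
      \<comment> \<open>The exponent \<open>?r\<close> is conjugate to \<open>r\<close> and
        \<open>q\<close> is its reciprocal. Hence the power \<open>?r\<close> of the weight is at
        most \<open>b k powr p / S\<close> on \<open>B k\<close>, and these numbers times the
        measures sum to 1 by the definition of \<open>S\<close>.\<close>
      have qr: "q * ?r = 1" using r by (simp add: q_def field_simps)
      have e: "exp (\<alpha> k) powr ?r = b k powr p / S" if "k \<in> K" for k
      proof -
        have "\<alpha> k * ?r = (q * ?r) * (p * ln (b k) - ln S)" by (simp only: \<alpha>_def mult_ac)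
        then have "\<alpha> k * ?r = p * ln (b k) - ln S" unfolding qr by simp
        moreover have "exp (\<alpha> k) powr ?r = exp (\<alpha> k * ?r)" by (simp add: powr_def mult.commute)
        ultimately show ?thesis using b(1)[OF that] S by (simp add: exp_diff powr_def)
      qed
      have pt: "ennreal (cmod (\<Omega> (Complex 1 t) x) powr ?r) <= (\<Sum>k\<in>K. ennreal (b k powr p / S) * indicator (B k) x)" for x
      proof (cases "x \<in> (\<Union>k\<in>K. B k)")
        case True
        then obtain j where j: "j \<in> K" "x \<in> B j" by blast
        have "cmod (\<Omega> (Complex 1 t) x) <= exp (\<alpha> j)"
          using \<omega>1[of j x] by (simp add: \<Omega>_in[OF j] norm_mult expn)
        then have "cmod (\<Omega> (Complex 1 t) x) powr ?r <= b j powr p / S"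
          unfolding e[OF j(1), symmetric] using r by (intro powr_mono2) auto
        then have "ennreal (cmod (\<Omega> (Complex 1 t) x) powr ?r) <= ennreal (b j powr p / S) * indicator (B j) x"
          using j by (simp add: ennreal_leI)
        also have "... <= (\<Sum>k\<in>K. ennreal (b k powr p / S) * indicator (B k) x)"
          by (rule member_le_sum[OF j(1) _ K]) simp
        finally show ?thesis .
      qed (simp add: \<Omega>_out)
      have "(\<integral>\<^sup>+x. ennreal (cmod (\<Omega> (Complex 1 t) x) powr ?r) \<partial>\<mu>) \<le>
        (\<integral>\<^sup>+x. (\<Sum>k\<in>K. ennreal (b k powr p / S) * indicator (B k) x) \<partial>\<mu>)"
        by (intro nn_integral_mono pt)
      also have "... = (\<Sum>k\<in>K. \<integral>\<^sup>+x. ennreal (b k powr p / S) * indicator (B k) x \<partial>\<mu>)"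
        by (rule nn_integral_sum) (use B(1) in measurable)
      also have "... = (\<Sum>k\<in>K. ennreal (b k powr p / S * measure \<mu> (B k)))"
      proof (rule sum.cong[OF refl])
        fix k assume k: "k \<in> K"
        show "(\<integral>\<^sup>+x. ennreal (b k powr p / S) * indicator (B k) x \<partial>\<mu>) = ennreal (b k powr p / S * measure \<mu> (B k))"
          using B[OF k] S
          by (simp add: nn_integral_cmult_indicator emeasure_eq_ennreal_measure less_top ennreal_mult
              del: times_divide_eq_left)
      qed
      also have "... = ennreal (\<Sum>k\<in>K. b k powr p / S * measure \<mu> (B k))"
        using S by (intro sum_ennreal) auto
      also have "(\<Sum>k\<in>K. b k powr p / S * measure \<mu> (B k)) = 1"
        using S unfolding times_divide_eq_left sum_divide_distrib[symmetric] S_def[symmetric] by simp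
      finally have "cmod (pairing (\<Omega> (Complex 1 t)) (f (Complex 1 t))) <= norm_on (Tent r) (f (Complex 1 t))"
        by (intro pairing_Tr calderon_boundary(2)[OF f r1] \<Omega>_meas r) simp
      also have "... <= N" by (rule order_trans[OF calderon_boundary(4)[OF f r1] N(2)])
      finally show ?thesis by (simp add: H_eq)
    qed
    have "\<forall>k\<in>K. \<exists>M. \<forall>z. 0 <= Re z \<and> Re z <= 1 --> cmod (pairing (\<omega> k) (f z)) <= M"
      by (intro ballI pairing_calderon(3)[OF _ r f] weight)
    from bchoice[OF this] obtain M where M: "!!k z. k \<in> K ==> 0 <= Re z ==> Re z <= 1 ==> cmod (pairing (\<omega> k) (f z)) <= M k"
      by blast
    have bdd: "cmod (H z) <= (\<Sum>k\<in>K. exp \<bar>\<alpha> k\<bar> * M k)" if z: "0 <= Re z" "Re z <= 1" for z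
      unfolding H_def
    proof (rule order_trans[OF norm_sum], rule sum_mono)
      fix k assume k: "k \<in> K"
      have "Re z * \<alpha> k <= \<bar>Re z * \<alpha> k\<bar>" by simp
      also have "... <= 1 * \<bar>\<alpha> k\<bar>" unfolding abs_mult using z by (intro mult_right_mono) auto
      finally show "cmod (exp (z * of_real (\<alpha> k)) * pairing (\<omega> k) (f z)) <= exp \<bar>\<alpha> k\<bar> * M k"
        unfolding norm_mult expn by (intro mult_mono M k z) auto
    qed
    have "cmod (H (of_real \<theta>)) <= N"
    proof (rule strip_maximum_principle[OF _ _ bdd left right N(1) \<theta>])
      show "continuous_on {z. 0 <= Re z \<and> Re z <= 1} H"
        unfolding H_def by (intro continuous_on_sum continuous_on_mult pairing_calderon(1)[OF _ r f] weight continuous_intros)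
      show "H holomorphic_on {z. 0 < Re z \<and> Re z < 1}"
        unfolding H_def by (intro holomorphic_on_sum holomorphic_on_mult pairing_calderon(2)[OF _ r f] weight holomorphic_intros)
    qed
    moreover have "S powr (1 / p) <= cmod (H (of_real \<theta>))"
    proof -
      define I where "I k = (\<integral>x. indicator (B k) x * cmod (rep G x) \<partial>\<mu>)" for k
      have \<omega>G: "\<omega> k x * rep G x = of_real (indicator (B k) x * cmod (rep G x))" for k x
      proof (cases "rep G x = 0")
        case False
        have "cnj (rep G x) * rep G x = of_real (cmod (rep G x)) * of_real (cmod (rep G x))"
          using complex_norm_square[of "rep G x"] by (simp add: power2_eq_square mult.commute)
        then have "cnj (rep G x) / of_real (cmod (rep G x)) * rep G x = of_real (cmod (rep G x))"
          using False by (simp add: field_simps)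
        then show ?thesis by (simp add: \<omega>_def indicator_def mult.assoc)
      qed simp
      have I: "pairing (\<omega> k) G = of_real (I k)" for k
        unfolding pairing_def \<omega>G I_def by (rule integral_complex_of_real)
      have I_ge: "b k * measure \<mu> (B k) <= I k" if k: "k \<in> K" for k
      proof -
        have "integrable \<mu> (%x. norm (\<omega> k x * rep G x))" by (intro integrable_norm int k Gp)
        then have i: "integrable \<mu> (%x. indicator (B k) x * cmod (rep G x))" unfolding \<omega>G by (simp add: norm_mult)
        have "b k * measure \<mu> (B k) = (\<integral>x. b k * indicator (B k) x \<partial>\<mu>)" using B[OF k] by simp
        also have "... <= I k" unfolding I_def
        proof (rule integral_mono[OF _ i])
          show "integrable \<mu> (%x. b k * indicator (B k) x)"
            using B[OF k] by (intro integrable_mult_right integrable_real_indicator) auto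
          show "b k * indicator (B k) x <= indicator (B k) x * cmod (rep G x)" for x
            using b(2)[OF k, of x] by (simp add: indicator_def G_def)
        qed
        finally show ?thesis .
      qed
      \<comment> \<open>Since \<theta> q = 1 - 1/p, the factor at \<theta> is (b k^p / S)^(1 - 1/p),
        which turns one factor \<open>b k\<close> into its p-th power.\<close>
      have e: "exp (\<theta> * \<alpha> k) * b k = S powr (1 / p - 1) * b k powr p" if "k \<in> K" for k
      proof -
        have t: "\<theta> * q = 1 - 1 / p" using p by (simp add: q_def)
        have "\<theta> * \<alpha> k = (\<theta> * q) * (p * ln (b k) - ln S)" by (simp only: \<alpha>_def mult_ac)
        also have "... = p * ln (b k) - ln (b k) + (1 / p - 1) * ln S"
          unfolding t using p0 by (simp add: field_simps)
        finally show ?thesis using b(1)[OF that] S by (simp add: powr_def exp_add exp_diff)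
      qed
      have "S powr (1 / p) = S powr (1 / p - 1) * S" using S by (simp add: powr_diff)
      also have "... = (\<Sum>k\<in>K. S powr (1 / p - 1) * (b k powr p * measure \<mu> (B k)))"
        by (subst (2) S_def) (rule sum_distrib_left)
      also have "... = (\<Sum>k\<in>K. exp (\<theta> * \<alpha> k) * (b k * measure \<mu> (B k)))"
        by (intro sum.cong refl) (simp add: mult.assoc[symmetric] e)
      also have "... <= (\<Sum>k\<in>K. exp (\<theta> * \<alpha> k) * I k)" by (intro sum_mono mult_left_mono I_ge) auto
      also have "... <= cmod (of_real (\<Sum>k\<in>K. exp (\<theta> * \<alpha> k) * I k))" unfolding norm_of_real by simp
      also have "of_real (\<Sum>k\<in>K. exp (\<theta> * \<alpha> k) * I k) = H (of_real \<theta>)"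
        unfolding H_def G_def[symmetric] I by (simp add: exp_of_real[symmetric])
      finally show ?thesis .
    qed
    ultimately have "S powr (1 / p) <= N" by simp
    then have "(S powr (1 / p)) powr p <= N powr p" using p0 by (intro powr_mono2) auto
    then show ?thesis using S p0 by (simp add: powr_powr S_def)
  qed
qed

text \<open>Dyadic level sets inside balls form finite families of sets of finite measure, the
  setting of \<open>level_sum_le\<close>, whose sum is finite before anything is known about
  integrability. Rounding to powers of 2 costs the factor 2, and Fatou's lemma removes the
  truncation.\<close>

lemma rep_integral_le:
  fixes p :: real
  assumes f: "f \<in> calderon_functions (Tent 1) (Tent r)" and r: "1 < r"
    and \<theta>: "0 < \<theta>" "\<theta> < 1" and p: "1 / p = 1 - \<theta> * (1 - 1 / r)" "0 < p"
    and N: "0 < N" "calderon_norm (Tent 1) (Tent r) f <= N"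
    and G: "cone_gsm (f (of_real \<theta>))"
  shows "(\<integral>\<^sup>+x. ennreal (cmod (rep (f (of_real \<theta>)) x) powr p) \<partial>\<mu>) <= ennreal ((2 * N) powr p)"
proof -
  let ?g = "rep (f (of_real \<theta>))"
  have gm [measurable]: "?g \<in> borel_measurable \<mu>" by (rule rep[OF G])
  obtain x0 :: 'm where True by blast
  \<comment> \<open>The index is shifted by \<open>m\<close> so that the levels with
    \<open>k < 2 * m\<close> cover the range from 2^(-m) to 2^m.\<close>
  define b where "b m k = 2 powr (real k - real m)" for m k :: nat
  define B where "B m k = {x \<in> ball x0 (real m). b m k <= cmod (?g x) \<and> cmod (?g x) < b m (Suc k)}" for m k
  have b0: "b m k > 0" and bS: "b m (Suc k) = 2 * b m k" for m k
    by (simp_all add: b_def powr_diff powr_add)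
  have b_mono: "b m j <= b m k" if "j <= k" for m j k
    unfolding b_def using that by (intro powr_mono) auto
  have ball: "ball x0 t \<in> sets \<mu>" for t by (simp add: sets_mu)
  have B_sets [measurable]: "B m k \<in> sets \<mu>" for m k
  proof -
    have "B m k = ball x0 (real m) \<inter> {x \<in> space \<mu>. b m k <= cmod (?g x) \<and> cmod (?g x) < b m (Suc k)}"
      by (auto simp: B_def space_mu)
    also have "... \<in> sets \<mu>" using ball by measurable
    finally show ?thesis .
  qed
  have B_fin: "emeasure \<mu> (B m k) < \<top>" for m k
  proof -
    have "emeasure \<mu> (B m k) <= emeasure \<mu> (ball x0 (real m))" by (intro emeasure_mono ball) (auto simp: B_def)
    also have "... < \<top>" using emeasure_bounded[of "ball x0 (real m)"] by simp
    finally show ?thesis .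
  qed
  have disj: "B m j \<inter> B m k = {}" if "j < k" for m j k
    using b_mono[of "Suc j" k m] that by (auto simp: B_def)
  have disj': "B m j \<inter> B m k = {}" if "j \<noteq> k" for m j k
    using disj[of j k m] disj[of k j m] that by (cases "j < k") auto
  define h where "h m x = (\<Sum>k<2*m. ennreal (cmod (?g x) powr p) * indicator (B m k) x)" for m x
  show ?thesis
  proof (rule nn_integral_le_of_limit[where f=h])
    show "h m \<in> borel_measurable \<mu>" for m unfolding h_def by measurable
    show "(\<integral>\<^sup>+x. h m x \<partial>\<mu>) <= ennreal ((2 * N) powr p)" for m
    proof -
      have "(\<integral>\<^sup>+x. h m x \<partial>\<mu>) = (\<Sum>k<2*m. \<integral>\<^sup>+x. ennreal (cmod (?g x) powr p) * indicator (B m k) x \<partial>\<mu>)"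
        unfolding h_def by (rule nn_integral_sum) measurable
      also have "... <= (\<Sum>k<2*m. ennreal (2 powr p * (b m k powr p * measure \<mu> (B m k))))"
      proof (rule sum_mono)
        fix k
        have "(\<integral>\<^sup>+x. ennreal (cmod (?g x) powr p) * indicator (B m k) x \<partial>\<mu>) \<le>
          (\<integral>\<^sup>+x. ennreal ((2 * b m k) powr p) * indicator (B m k) x \<partial>\<mu>)"
          using p(2) bS
          by (intro nn_integral_mono) (auto simp: indicator_def B_def intro!: ennreal_leI powr_mono2)
        also have "... = ennreal ((2 * b m k) powr p) * emeasure \<mu> (B m k)"
          by (rule nn_integral_cmult_indicator) measurable
        also have "emeasure \<mu> (B m k) = ennreal (measure \<mu> (B m k))"
          using B_fin by (simp add: emeasure_eq_ennreal_measure less_top)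
        also have "ennreal ((2 * b m k) powr p) * ennreal (measure \<mu> (B m k)) =
          ennreal (2 powr p * (b m k powr p * measure \<mu> (B m k)))"
          by (simp add: ennreal_mult[symmetric] powr_mult less_imp_le[OF b0] mult.assoc)
        finally show "(\<integral>\<^sup>+x. ennreal (cmod (?g x) powr p) * indicator (B m k) x \<partial>\<mu>) \<le>
          ennreal (2 powr p * (b m k powr p * measure \<mu> (B m k)))" .
      qed
      also have "... = ennreal (2 powr p * (\<Sum>k<2*m. b m k powr p * measure \<mu> (B m k)))"
        by (simp add: sum_ennreal sum_distrib_left)
      also have "... <= ennreal (2 powr p * N powr p)"
      proof (intro ennreal_leI mult_left_mono level_sum_le[OF f r \<theta> p(1) N])
        show "b m k <= cmod (?g x)" if "x \<in> B m k" for k x using that by (simp add: B_def)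
      qed (rule finite_lessThan B_sets B_fin b0 powr_ge_zero | rule disj', assumption)+
      also have "2 powr p * N powr p = (2 * N) powr p" using N(1) by (simp add: powr_mult)
      finally show ?thesis .
    qed
    show "AE x in \<mu>. (%m. h m x) \<longlonglongrightarrow> ennreal (cmod (?g x) powr p)"
    proof (rule AE_I2)
      fix x
      show "(%m. h m x) \<longlonglongrightarrow> ennreal (cmod (?g x) powr p)"
      proof (cases "?g x = 0")
        case True
        then show ?thesis by (simp add: h_def)
      next
        case False
        define l where "l = log 2 (cmod (?g x))"
        have g: "cmod (?g x) = 2 powr l" using False by (simp add: l_def)
        obtain m0 :: nat where m0: "max (dist x0 x) \<bar>l\<bar> < real m0" using reals_Archimedean2 by blast
        \<comment> \<open>From \<open>m0\<close> on, \<open>x\<close> lies in the ball and in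
          exactly one level set of the range, so \<open>h m x\<close> already has its final
          value.\<close>
        have "h m x = ennreal (cmod (?g x) powr p)" if "m0 <= m" for m
        proof -
          have m: "dist x0 x < real m" "\<bar>l\<bar> < real m" using m0 that by auto
          define k where "k = nat \<lfloor>l + real m\<rfloor>"
          have k: "real k <= l + real m" "l + real m < real k + 1"
            using m(2) unfolding k_def by linarith+
          have k2: "k < 2 * m" using k m(2) by linarith
          have xk: "x \<in> B m k"
            using m k unfolding B_def b_def by (auto simp: g powr_less_cancel_iff)
          have "h m x = (\<Sum>j<2*m. if j = k then ennreal (cmod (?g x) powr p) else 0)"
            unfolding h_def
          proof (rule sum.cong[OF refl])
            fix j
            show "ennreal (cmod (?g x) powr p) * indicator (B m j) x = (if j = k then ennreal (cmod (?g x) powr p) else 0)"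
              using xk disj'[of j k m] by (auto simp: indicator_def)
          qed
          then show ?thesis using k2 by simp
        qed
        then show ?thesis by (intro tendsto_eventually eventually_sequentiallyI[of m0])
      qed
    qed
  qed
qed

end

section \<open>Values of Calderon functions at \<theta>\<close>

context metric_measure_space begin

text \<open>Functionals that norm the approximants \<open>s n x\<close> nearly norm the cone
  restriction itself, so the scalar functions tend to the square function in modulus, and Fatou's
  lemma passes the bound of \<open>rep_integral_le\<close> to the limit. That bound is the same for
  all \<open>n\<close>, since all functionals have norm at most 1.\<close>

lemma calderon_value_tent:
  fixes f :: "complex => ('m, 'x::complex_banach) tent_operator" and p :: real
  assumes f: "f \<in> calderon_functions (Tent 1) (Tent r)" and r: "1 < r"
    and \<theta>: "0 < \<theta>" "\<theta> < 1" and p: "1 / p = 1 - \<theta> * (1 - 1 / r)" "0 < p"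
    and N: "0 < N" "calderon_norm (Tent 1) (Tent r) f <= N"
  shows "f (of_real \<theta>) \<in> points (Tent p)" "norm_on (Tent p) (f (of_real \<theta>)) <= 2 * N"
proof -
  let ?G = "f (of_real \<theta>)"
  have "?G \<in> points (tent_sum r)"
    using f \<theta> unfolding calderon_functions_def continuous_in_def by (auto simp: image_subset_iff)
  note G = tent_sum_cone_gsm[OF this]
  let ?F = "%x. restrict_operator ?G (cone_at x)"
  obtain s where s: "!!n::nat. simple_function \<mu> (s n)" "!!n x. s n x \<in> gspace"
    "AE x in \<mu>. (%n. gam (s n x - ?F x)) \<longlonglongrightarrow> 0" using gsmE[OF G(1)] by blast
  have tp: "tent_pairing \<mu> (s n)" for n
    using s by (intro tent_pairing.intro tent_pairing_axioms.intro metric_measure_space_axioms)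
  define g where "g n = tent_pairing.rep \<mu> (s n) ?G" for n
  have gm [measurable]: "g n \<in> borel_measurable \<mu>" for n
    unfolding g_def by (rule tent_pairing.rep[OF tp G(1)])
  have "AE x in \<mu>. g n x = norming (s n x) (?F x)" for n
    unfolding g_def by (rule tent_pairing.rep[OF tp G(1)])
  then have g_eq: "AE x in \<mu>. \<forall>n. g n x = norming (s n x) (?F x)" by (simp add: AE_all_countable)
  have "(\<integral>\<^sup>+x. ennreal_powr (sqf ?G x) p \<partial>\<mu>) <= ennreal ((2 * N) powr p)"
  proof (rule nn_integral_le_of_limit)
    show "(%x. ennreal (cmod (g n x) powr p)) \<in> borel_measurable \<mu>" for n by measurable
    show "(\<integral>\<^sup>+x. ennreal (cmod (g n x) powr p) \<partial>\<mu>) <= ennreal ((2 * N) powr p)" for n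
      unfolding g_def by (rule tent_pairing.rep_integral_le[OF tp f r \<theta> p N G(1)])
    show "AE x in \<mu>. (%n. ennreal (cmod (g n x) powr p)) \<longlonglongrightarrow> ennreal_powr (sqf ?G x) p"
      using g_eq s(3) gsm_AE[OF G(1)]
    proof eventually_elim
      case (elim x)
      have fin: "gam (?F x) < \<top>" by (rule gamma_space_finite[OF elim(3)])
      \<comment> \<open>The distance counts twice: once for evaluating the functional at
        \<open>?F x\<close> instead of \<open>s n x\<close>, once for comparing the norms of the
        two.\<close>
      have "(%n. 2 * gam (s n x - ?F x)) \<longlonglongrightarrow> 2 * 0" by (intro ennreal_tendsto_cmult elim) simp
      then have e0: "(%n. 2 * gam (s n x - ?F x)) \<longlonglongrightarrow> 0" by simp
      have lim: "(%n. ennreal (cmod (g n x))) \<longlonglongrightarrow> gam (?F x)"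
      proof (rule ennreal_tendsto_perturb[OF fin _ _ e0])
        fix n
        have "ennreal (cmod (g n x)) <= gam (?F x)" using elim(1) norming(3)[OF s(2) elim(3)] by simp
        also have "... <= gam (?F x) + 2 * gam (s n x - ?F x)" by simp
        finally show "ennreal (cmod (g n x)) <= gam (?F x) + 2 * gam (s n x - ?F x)" .
        have d: "s n x - ?F x \<in> gspace" by (intro gamma_space_diff s elim)
        have "norming (s n x) (s n x) = norming (s n x) (s n x - ?F x) + g n x"
          using norming_diff[OF s(2) s(2) elim(3), of n x n x] elim(1) by simp
        then have "cmod (norming (s n x) (s n x)) <= cmod (norming (s n x) (s n x - ?F x)) + cmod (g n x)"
          by (simp only: norm_triangle_ineq)
        then have "ennreal (cmod (norming (s n x) (s n x))) \<le>
            ennreal (cmod (norming (s n x) (s n x - ?F x))) + ennreal (cmod (g n x))"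
          by (simp add: ennreal_plus[symmetric] ennreal_leI del: ennreal_plus)
        also have "... <= gam (s n x - ?F x) + ennreal (cmod (g n x))"
          by (intro add_right_mono norming(3)[OF s(2) d])
        finally have "gam (s n x) <= gam (s n x - ?F x) + ennreal (cmod (g n x))"
          by (simp only: norming(4)[OF s(2)])
        moreover have "gam (?F x) <= gam (s n x) + gam (s n x - ?F x)"
          using gamma_norm_diff[of "s n x" "s n x - ?F x"] by simp
        ultimately have "gam (?F x) <= gam (s n x - ?F x) + ennreal (cmod (g n x)) + gam (s n x - ?F x)"
          by (meson add_right_mono order_trans)
        then show "gam (?F x) <= ennreal (cmod (g n x)) + 2 * gam (s n x - ?F x)"
          by (simp add: mult_2 ac_simps)
      qed
      have "(%n. enn2real (ennreal (cmod (g n x)))) \<longlonglongrightarrow> enn2real (gam (?F x))"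
        by (rule tendsto_enn2real) (use lim fin in auto)
      then have "(%n. cmod (g n x)) \<longlonglongrightarrow> enn2real (gam (?F x))" by simp
      then have "(%n. cmod (g n x) powr p) \<longlonglongrightarrow> enn2real (gam (?F x)) powr p"
        using p(2) by (intro tendsto_powr' tendsto_const) auto
      then have "(%n. ennreal (cmod (g n x) powr p)) \<longlonglongrightarrow> ennreal (enn2real (gam (?F x)) powr p)"
        by (rule tendsto_ennrealI)
      then show ?case using less_imp_neq[OF fin] by (simp add: ennreal_powr_def square_function_def)
    qed
  qed
  from tent_norm_le[OF this p(2)] N(1) G
  show "?G \<in> points (Tent p)" "norm_on (Tent p) ?G <= 2 * N"
    unfolding tent_points_iff by auto
qed

end

section \<open>Equality of the interpolation space with the tent space and equivalence of the
  norms\<close>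

theorem theorem6:
  fixes \<mu> :: "'m::complete_space measure" and r \<theta> p :: real
  assumes "metric_measure \<mu>" and "doubling \<mu>" and "cone_covering_property \<mu>"
    and "1 < r" and "r \<le> 2" and "has_type TYPE('x::complex_banach) r"
    and "0 < \<theta>" and "\<theta> < 1" and "1 / p = 1 - \<theta> * (1 - 1 / r)"
  shows "equal_with_equivalent_norms
           (complex_interpolation
             (tent_space \<mu> 1 :: (('m \<times> real \<Rightarrow> complex) \<Rightarrow> 'x) normed_subspace)
             (tent_space \<mu> r) \<theta>)
           (tent_space \<mu> p)"
proof -
  interpret cone_covering_space \<mu>
    by (standard; fact assms)
  note r = assms(4,5) and ty = assms(6) and \<theta> = assms(7,8) and p = assms(9)
  have q: "0 < 1 - 1 / r" "1 - 1 / r < 1" using r by auto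
  have "\<theta> * (1 - 1 / r) < 1" using mult_strict_mono[of \<theta> 1 "1 - 1 / r" 1] \<theta> q by simp
  moreover have "0 <= \<theta> * (1 - 1 / r)" using \<theta> q by (intro mult_nonneg_nonneg) auto
  ultimately have "0 < 1 / p" "1 / p <= 1" unfolding p by simp_all
  then have p0: "0 < p" and p1: "1 <= p" by (auto simp: divide_le_eq split: if_splits)
  let ?F = "calderon_functions (tent_space \<mu> 1) (tent_space \<mu> r) :: (complex => ('m \<times> real => complex) => 'x) set"
    and ?n = "calderon_norm (tent_space \<mu> 1) (tent_space \<mu> r) :: (complex => ('m \<times> real => complex) => 'x) => real"
    and ?T = "tent_space \<mu> p :: (('m \<times> real => complex) => 'x) normed_subspace"
  let ?I = "complex_interpolation (tent_space \<mu> 1 :: (('m \<times> real => complex) => 'x) normed_subspace) (tent_space \<mu> r) \<theta>"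
  have n0: "0 <= ?n f" if "f \<in> ?F" for f
    using calderon_boundary(3)[OF that, of 0] r(1) by (intro order_trans[OF tent_norm_nonneg]) simp
  have val: "f (of_real \<theta>) \<in> points ?T" "norm_on ?T (f (of_real \<theta>)) <= 2 * ?n f" if f: "f \<in> ?F" for f
  proof -
    \<comment> \<open>The estimates ask for \<open>N > 0\<close>; every \<open>N\<close> above the
      Calderon norm is admissible even if that norm is 0, and \<open>dense_ge\<close> returns to the
      norm itself.\<close>
    have *: "f (of_real \<theta>) \<in> points ?T" "norm_on ?T (f (of_real \<theta>)) <= 2 * N" if "N > ?n f" for N
      using calderon_value_tent[OF f r(1) \<theta> p p0, of N] that n0[OF f] by auto
    show "f (of_real \<theta>) \<in> points ?T" by (rule *(1)[of "?n f + 1"]) simp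
    have "norm_on ?T (f (of_real \<theta>)) / 2 <= ?n f"
    proof (rule dense_ge)
      fix N assume "?n f < N"
      from *(2)[OF this] show "norm_on ?T (f (of_real \<theta>)) / 2 <= N" by simp
    qed
    then show "norm_on ?T (f (of_real \<theta>)) <= 2 * ?n f" by simp
  qed
  obtain K where K: "K > 0" "!!(u :: ('m \<times> real => complex) => 'x) L. \<lbrakk>u \<in> points (tent_space \<mu> p); 0 < L; norm_on (tent_space \<mu> p) u <= L\<rbrakk> \<Longrightarrow>
    \<exists>f\<in>?F. f (of_real \<theta>) = u \<and> ?n f <= K * L"
    using tent_calderon_extension[OF ty r \<theta> p p1] by blast
  \<comment> \<open>A strict upper bound \<open>L\<close> of the norm is positive also when the norm
    vanishes, as \<open>K(2)\<close> demands.\<close>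
  have ex: "\<exists>f\<in>?F. f (of_real \<theta>) = u \<and> ?n f <= K * L" if "u \<in> points ?T" "norm_on ?T u < L" for u L
    using that by (intro K(2) le_less_trans[OF tent_norm_nonneg]) auto
  have pts: "points ?I = points ?T"
  proof
    show "points ?I \<subseteq> points ?T" unfolding complex_interpolation_def using val(1) by auto
    show "points ?T \<subseteq> points ?I"
    proof
      fix u assume "u \<in> points ?T"
      then obtain f where "f \<in> ?F" "f (of_real \<theta>) = u" using ex[of u "norm_on ?T u + 1"] by auto
      then show "u \<in> points ?I" unfolding complex_interpolation_def by auto
    qed
  qed
  have norms: "1 / 2 * norm_on ?T v <= norm_on ?I v \<and> norm_on ?I v <= K * norm_on ?T v" if v: "v \<in> points ?T" for v
  proof
    let ?S = "{?n f |f. f \<in> ?F \<and> f (of_real \<theta>) = v}"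
    have I: "norm_on ?I v = Inf ?S" by (simp add: complex_interpolation_def)
    obtain f0 where "f0 \<in> ?F" "f0 (of_real \<theta>) = v" using ex[OF v, of "norm_on ?T v + 1"] by auto
    then have ne: "?S \<noteq> {}" by blast
    show "1 / 2 * norm_on ?T v <= norm_on ?I v"
      unfolding I
    proof (rule cInf_greatest[OF ne])
      fix y assume "y \<in> ?S"
      then obtain f where "f \<in> ?F" "f (of_real \<theta>) = v" "y = ?n f" by blast
      then show "1 / 2 * norm_on ?T v <= y" using val(2)[of f] by simp
    qed
    have bdd: "bdd_below ?S" using n0 by (intro bdd_belowI[of _ 0]) auto
    have "norm_on ?I v / K <= norm_on ?T v"
    proof (rule dense_ge)
      fix L assume "norm_on ?T v < L"
      then obtain f where f: "f \<in> ?F" "f (of_real \<theta>) = v" "?n f <= K * L" using ex[OF v] by blast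
      have "Inf ?S <= ?n f" using f by (intro cInf_lower bdd) blast
      then show "norm_on ?I v / K <= L" unfolding I using f(3) K(1) by (simp add: pos_divide_le_eq mult.commute)
    qed
    then show "norm_on ?I v <= K * norm_on ?T v" using K(1) by (simp add: pos_divide_le_eq mult.commute)
  qed
  show ?thesis
    unfolding equal_with_equivalent_norms_def pts
    using norms K(1) by (intro conjI refl exI[of _ "1/2"] exI[of _ K]) auto
qed

end
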